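(* Let $f\colon \mathcal{M}\to\mathcal{M}$ be conal, that is, $f$ is injective and maps $\mathcal{M}_z^+$ onto $\mathcal{M}_{f(z)}^+$ for all $z\in\mathcal{M}$ (no continuity or surjectivity is assumed). Then $f$ extends to an element of $\mathrm{Co}(G(\Omega))^{(-\alpha)}$. In particular, $f$ extends to a birational function on $V^c$.
   Context: Jordan algebra. $V=\mathbb{R}^{n}$ with coordinates $x=(x_0,x_1,\dots,x_{n-1})$ and product $z=xy$ given by $z_0=x_0y_0+\dots+x_{n-1}y_{n-1}$, $z_j=x_0y_j+x_jy_0$ for $1\le j\le n-1$; the unit is $e=(1,0,\dots,0)$. Put $\Delta(x)=x_0^2-x_1^2-\dots-x_{n-1}^2$ and $\Omega=\{x\in V: \Delta(x)>0,\ x_0>0\}$. Let $j\colon x\mapsto x^{-1}$ be Jordan inversion, so $j(x)=\Delta(x)^{-1}(x_0,-x_1,\dots,-x_{n-1})$. Let $N_+=\{\tau_v:v\in V\}$, $\tau_v(x)=x+v$, and $N_-=j\circ N_+\circ j$. Groups. $\mathrm{Str}(V)=\{g\in \mathrm{GL}(V): j\circ g\circ j\in \mathrm{GL}(V)\}$ and $G(\Omega)=\{g\in\mathrm{GL}(V): g(\Omega)=\Omega\}=\mathbb{R}_+\times \mathrm{O}(1,n-1)^+$. The conformal group $\mathrm{Co}(V)$ is the group of rational maps generated by $N_+$, $\mathrm{Str}(V)$ and $j$. The causal group $\mathrm{Co}(G(\Omega))$ is the subgroup generated by $N_+$, $G(\Omega)$ and $-j$. The conformal compactification is $V^c=\mathrm{Co}(V)/(\mathrm{Str}(V)\ltimes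 N_-)$, on which $\mathrm{Co}(V)$ acts; $V$ is an open dense subset of $V^c$ via $v\mapsto \tau_v\cdot o$, where $o$ is the base point. $V^c$ carries the flat $\mathrm{Co}(G(\Omega))$-invariant causal structure (field of closed convex cones in the tangent spaces) given by $-\overline{\Omega}\subseteq T_xV^c=V$ at points $x\in V$. The space $\mathcal{M}$. Let $\alpha(x_0,x_1,\dots,x_{n-1})=(x_0,-x_1,\dots,-x_{n-1})$. For a group $L$ of transformations, $L^{(-\alpha)}=\{g\in L: (-\alpha)\circ g\circ(-\alpha)=g\}$. Let $G$ be the identity component of $\mathrm{Co}(V)^{(-\alpha)}$ and $\mathcal{M}=G\cdot e\subset V^c$, an open orbit. Then $G\simeq \mathrm{SO}_0(1,n)$ and $\mathcal{M}\simeq \mathrm{SO}_0(1,n)/\mathrm{SO}_0(1,n-1)$. $\mathcal{M}$ inherits its causal structure from $V^c$. Order. A causal curve is a continuous, piecewise differentiable curve $\gamma\colon[a,b]\to\mathcal{M}$ whose (right) derivative $\gamma'(t)$ lies in the cone of the causal structure at $\gamma(t)$ (that is, $\gamma'(t)\in-\overline\Omega$ when $\gamma(t)\in V$) for all $t\in(a,b)$. Write $x\le y$ if there is a causal curve in $\mathcal{M}$ from $x$ to $y$; this is a partial order. Put $\mathcal{M}_z^+=\{x\in\mathcal{M}: x\ge z\}$.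
   Formalization: The formal theorem assumes n ≥ 3; for n = 1 (any increasing bijection of (0,∞)) and n = 2 (maps induced by arbitrary orientation-preserving circle homeomorphisms) there are conal maps that do not extend to Co(G(Ω)), so the claim is false there. *)

theory Defs
  imports "HOL-Analysis.Analysis" "HOL-Algebra.Left_Coset" "HOL-Algebra.Elementary_Groups"
begin

section \<open>The Jordan algebra\<close>

text \<open>
  The index type \<open>'n\<close> of the coordinates has \<open>n\<close> elements. The class \<^class>\<open>zero\<close> only serves to
  distinguish one coordinate \<open>x $ 0\<close>; all other indices are the spatial ones.
\<close>

type_synonym 'n V = "(real, 'n) vec"

definition jmult :: "'n::{finite,zero} V \<Rightarrow> 'n V \<Rightarrow> 'n V" where
  "jmult x y = (\<chi> i. if i = 0 then (\<Sum>k\<in>UNIV. x $ k * y $ k) else x $ 0 * y $ i + x $ i * y $ 0)"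

definition junit :: "'n::{finite,zero} V" where
  "junit = (\<chi> i. if i = 0 then 1 else 0)"

definition jdet :: "'n::{finite,zero} V \<Rightarrow> real" where
  "jdet x = (x $ 0)\<^sup>2 - (\<Sum>i\<in>UNIV - {0}. (x $ i)\<^sup>2)"

definition Omega :: "('n::{finite,zero} V) set" where
  "Omega = {x. jdet x > 0 \<and> x $ 0 > 0}"

definition alpha :: "'n::{finite,zero} V \<Rightarrow> 'n V" where
  "alpha x = (\<chi> i. if i = 0 then x $ 0 else - x $ i)"

text \<open>Jordan inversion, with the irrelevant value 0 where \<open>jdet x = 0\<close>.\<close>

definition jinv :: "'n::{finite,zero} V \<Rightarrow> 'n V" where
  "jinv x = (1 / jdet x) *\<^sub>R alpha x"

lemma jmult_junit: "jmult junit x = x" "jmult x junit = x"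
  by (simp_all add: jmult_def junit_def vec_eq_iff if_distrib if_distribR cong: if_cong)

lemma jmult_commute: "jmult x y = jmult y x"
  by (simp add: jmult_def vec_eq_iff mult.commute add.commute)

lemma jmult_alpha: "jmult x (alpha x) = jdet x *\<^sub>R junit"
proof -
  have "(\<Sum>k\<in>UNIV. x $ k * alpha x $ k) = jdet x"
    by (subst sum.remove[of _ 0])
       (simp_all add: alpha_def jdet_def power2_eq_square sum_negf)
  then show ?thesis
    by (simp add: jmult_def vec_eq_iff junit_def) (simp add: alpha_def)
qed

lemma jmult_jinv:
  assumes "jdet x \<noteq> 0"
  shows "jmult x (jinv x) = junit"
proof -
  have "jmult x (jinv x) = (1 / jdet x) *\<^sub>R jmult x (alpha x)"
    by (simp add: jmult_def jinv_def vec_eq_iff sum_divide_distrib add_divide_distrib algebra_simps)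
  with assms show ?thesis
    by (simp add: jmult_alpha)
qed


section \<open>Birational maps of the vector space\<close>

text \<open>
  A rational map is represented by a total function that is a quotient of polynomials off the zero
  set of a nonzero polynomial. Two representatives are the same rational map if they agree off such
  a set, and a rational map is an equivalence class of representatives.
\<close>

type_synonym 'n ratmap = "('n V \<Rightarrow> 'n V) set"

definition rational_fun :: "('n::finite V \<Rightarrow> 'n V) \<Rightarrow> bool" where
  "rational_fun f \<longleftrightarrow>
     (\<exists>P q. polynomial_function P \<and> real_polynomial_function q \<and> (\<exists>x. q x \<noteq> 0) \<and>
            (\<forall>x. q x \<noteq> 0 \<longrightarrow> f x = (1 / q x) *\<^sub>R P x))"

definition rat_eq :: "('n::finite V \<Rightarrow> 'n V) \<Rightarrow> ('n V \<Rightarrow> 'n V) \<Rightarrow> bool" where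
  "rat_eq f g \<longleftrightarrow>
     (\<exists>q. real_polynomial_function q \<and> (\<exists>x. q x \<noteq> 0) \<and> (\<forall>x. q x \<noteq> 0 \<longrightarrow> f x = g x))"

definition birational_fun :: "('n::finite V \<Rightarrow> 'n V) \<Rightarrow> bool" where
  "birational_fun f \<longleftrightarrow>
     rational_fun f \<and> (\<exists>g. rational_fun g \<and> rat_eq (f \<circ> g) id \<and> rat_eq (g \<circ> f) id)"

definition ratcls :: "('n::finite V \<Rightarrow> 'n V) \<Rightarrow> 'n ratmap" where
  "ratcls f = {h. rat_eq h f}"

definition Bir :: "'n::finite ratmap monoid" where
  "Bir = \<lparr> carrier = {ratcls f |f. birational_fun f},
           monoid.mult = (\<lambda>A B. {h. \<exists>f\<in>A. \<exists>g\<in>B. rat_eq h (f \<circ> g)}),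
           one = ratcls id \<rparr>"


section \<open>The conformal and the causal group\<close>

definition GL :: "('n::finite V \<Rightarrow> 'n V) set" where
  "GL = {g. linear g \<and> bij g}"

definition transl :: "'n::finite V \<Rightarrow> 'n ratmap" where
  "transl v = ratcls (\<lambda>x. x + v)"

definition Nplus :: "'n::finite ratmap set" where
  "Nplus = range transl"

definition Jinv :: "'n::{finite,zero} ratmap" where
  "Jinv = ratcls jinv"

definition Nminus :: "'n::{finite,zero} ratmap set" where
  "Nminus = {Jinv \<otimes>\<^bsub>Bir\<^esub> T \<otimes>\<^bsub>Bir\<^esub> Jinv |T. T \<in> Nplus}"

definition Str :: "'n::{finite,zero} ratmap set" where
  "Str = {ratcls g |g. g \<in> GL \<and> (\<exists>h\<in>GL. rat_eq (jinv \<circ> g \<circ> jinv) h)}"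

definition GOmega :: "'n::{finite,zero} ratmap set" where
  "GOmega = {ratcls g |g. g \<in> GL \<and> g ` Omega = Omega}"

definition Co :: "'n::{finite,zero} ratmap monoid" where
  "Co = subgroup_generated Bir (Nplus \<union> Str \<union> {Jinv})"

definition CoG :: "'n::{finite,zero} ratmap set" where
  "CoG = generate Bir (Nplus \<union> GOmega \<union> {ratcls (\<lambda>x. - jinv x)})"

definition neg_alpha_fixed :: "'n::{finite,zero} ratmap set \<Rightarrow> 'n ratmap set" where
  "neg_alpha_fixed L =
     {g \<in> L. ratcls (\<lambda>x. - alpha x) \<otimes>\<^bsub>Bir\<^esub> g \<otimes>\<^bsub>Bir\<^esub> ratcls (\<lambda>x. - alpha x) = g}"


section \<open>The conformal compactification\<close>

type_synonym 'n vcpoint = "'n ratmap set"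

text \<open>The stabilizer of the base point is the internal semidirect product of \<open>Str\<close> and \<open>Nminus\<close>.\<close>

definition base :: "'n::{finite,zero} vcpoint" where
  "base = Str <#>\<^bsub>Bir\<^esub> Nminus"

definition Vc :: "'n::{finite,zero} vcpoint set" where
  "Vc = lcosets\<^bsub>Co\<^esub> base"

definition act :: "'n::{finite,zero} ratmap \<Rightarrow> 'n vcpoint \<Rightarrow> 'n vcpoint" where
  "act g p = g <#\<^bsub>Co\<^esub> p"

definition emb :: "'n::{finite,zero} V \<Rightarrow> 'n vcpoint" where
  "emb v = act (transl v) base"

text \<open>
  The translates \<open>g \<cdot> V\<close> of the embedded vector space, for \<open>g\<close> in \<^const>\<open>Co\<close>, form the atlas of the
  manifold \<^const>\<open>Vc\<close>: \<open>vcpar g\<close> is a parametrization and \<open>vcchart g\<close> its inverse on \<open>g \<cdot> V\<close>.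
\<close>

definition vcpar :: "'n::{finite,zero} ratmap \<Rightarrow> 'n V \<Rightarrow> 'n vcpoint" where
  "vcpar g v = act g (emb v)"

definition vcchart :: "'n::{finite,zero} ratmap \<Rightarrow> 'n vcpoint \<Rightarrow> 'n V" where
  "vcchart g = inv_into UNIV (vcpar g)"

definition Vc_top :: "'n::{finite,zero} vcpoint topology" where
  "Vc_top = topology (\<lambda>U. U \<subseteq> Vc \<and> (\<forall>g\<in>carrier Co. open (vcpar g -` U)))"

lemma openin_Vc_top:
  fixes U :: "'n::{finite,zero} vcpoint set"
  shows "openin Vc_top U \<longleftrightarrow> U \<subseteq> Vc \<and> (\<forall>g\<in>carrier Co. open (vcpar g -` U))"
proof -
  have "istopology (\<lambda>U :: 'n vcpoint set. U \<subseteq> Vc \<and> (\<forall>g\<in>carrier Co. open (vcpar g -` U)))"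
    unfolding istopology_def by (auto simp: vimage_Union)
  then show ?thesis
    by (simp only: Vc_top_def topology_inverse')
qed

text \<open>
  The Lie group topology of \<^const>\<open>Co\<close>, realized as the compact-open topology of its action on the
  compact space \<^const>\<open>Vc\<close>.
\<close>

definition Co_top :: "'n::{finite,zero} ratmap topology" where
  "Co_top = topology_generated_by
     {{g \<in> carrier Co. act g ` K \<subseteq> U} |K U. compactin Vc_top K \<and> openin Vc_top U}"


section \<open>The causal symmetric space and its order\<close>

definition Ggrp :: "'n::{finite,zero} ratmap set" where
  "Ggrp = connected_component_of_set
            (subtopology Co_top (neg_alpha_fixed (carrier Co))) \<one>\<^bsub>Co\<^esub>"

definition MM :: "'n::{finite,zero} vcpoint set" where
  "MM = (\<lambda>g. act g (emb junit)) ` Ggrp"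

text \<open>
  Derivatives of curves are taken in charts. \<open>S\<close> is the set of parameters within which the
  derivative is taken.
\<close>

definition vc_differentiable :: "(real \<Rightarrow> 'n::{finite,zero} vcpoint) \<Rightarrow> real \<Rightarrow> real set \<Rightarrow> bool" where
  "vc_differentiable \<gamma> t S \<longleftrightarrow>
     (\<exists>g\<in>carrier Co. \<gamma> t \<in> range (vcpar g) \<and>
        (\<lambda>s. vcchart g (\<gamma> s)) differentiable (at t within S))"

text \<open>
  Each interval \<open>{c..d}\<close> without points of the finite set \<open>D\<close> in its interior is contained in one of the
  pieces, and the curve is differentiable on it, one-sidedly at the end points.
\<close>

definition piecewise_diff_curve :: "(real \<Rightarrow> 'n::{finite,zero} vcpoint) \<Rightarrow> real \<Rightarrow> real \<Rightarrow> bool" where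
  "piecewise_diff_curve \<gamma> a b \<longleftrightarrow>
     (\<exists>D. finite D \<and>
        (\<forall>c d. a \<le> c \<and> c < d \<and> d \<le> b \<and> D \<inter> {c<..<d} = {} \<longrightarrow>
           (\<forall>t\<in>{c..d}. vc_differentiable \<gamma> t {c..d})))"

text \<open>
  The flat invariant causal structure is \<open>- closure Omega\<close> in every chart belonging to an element of
  \<^const>\<open>CoG\<close>, and these charts cover \<^const>\<open>Vc\<close>.
\<close>

definition right_deriv_in_cone :: "(real \<Rightarrow> 'n::{finite,zero} vcpoint) \<Rightarrow> real \<Rightarrow> bool" where
  "right_deriv_in_cone \<gamma> t \<longleftrightarrow>
     (\<exists>g\<in>CoG. \<gamma> t \<in> range (vcpar g) \<and>
        (\<exists>w\<in>uminus ` closure Omega.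
           ((\<lambda>s. vcchart g (\<gamma> s)) has_vector_derivative w) (at_right t)))"

definition causal_curve :: "(real \<Rightarrow> 'n::{finite,zero} vcpoint) \<Rightarrow> real \<Rightarrow> real \<Rightarrow> bool" where
  "causal_curve \<gamma> a b \<longleftrightarrow>
     a < b \<and> \<gamma> ` {a..b} \<subseteq> MM \<and> continuous_map (top_of_set {a..b}) Vc_top \<gamma> \<and>
     piecewise_diff_curve \<gamma> a b \<and> (\<forall>t\<in>{a<..<b}. right_deriv_in_cone \<gamma> t)"

definition causal_le :: "'n::{finite,zero} vcpoint \<Rightarrow> 'n vcpoint \<Rightarrow> bool" where
  "causal_le x y \<longleftrightarrow> (\<exists>\<gamma> a b. causal_curve \<gamma> a b \<and> \<gamma> a = x \<and> \<gamma> b = y)"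

definition future :: "'n::{finite,zero} vcpoint \<Rightarrow> 'n vcpoint set" where
  "future z = {x \<in> MM. causal_le z x}"

definition conal :: "('n::{finite,zero} vcpoint \<Rightarrow> 'n vcpoint) \<Rightarrow> bool" where
  "conal f \<longleftrightarrow> f ` MM \<subseteq> MM \<and> inj_on f MM \<and> (\<forall>z\<in>MM. f ` future z = future (f z))"


section \<open>Birational functions on the compactification\<close>

definition Vc_zariski_open :: "'n::{finite,zero} vcpoint set \<Rightarrow> bool" where
  "Vc_zariski_open U \<longleftrightarrow>
     U \<subseteq> Vc \<and>
     (\<forall>g\<in>carrier Co. \<exists>Q. (\<forall>q\<in>Q. real_polynomial_function q) \<and>
        vcpar g -` U = {v. \<exists>q\<in>Q. q v \<noteq> 0})"

definition Vc_regular_on :: "'n::{finite,zero} vcpoint set \<Rightarrow> ('n vcpoint \<Rightarrow> 'n vcpoint) \<Rightarrow> bool" where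
  "Vc_regular_on U F \<longleftrightarrow>
     (\<forall>p\<in>U. \<exists>g\<in>carrier Co. \<exists>h\<in>carrier Co. \<exists>v P q.
        p = vcpar g v \<and> polynomial_function P \<and> real_polynomial_function q \<and> q v \<noteq> 0 \<and>
        (\<forall>w. q w \<noteq> 0 \<and> vcpar g w \<in> U \<longrightarrow> F (vcpar g w) = vcpar h ((1 / q w) *\<^sub>R P w)))"

text \<open>
  \<open>F\<close> is a rational function on \<^const>\<open>Vc\<close>, defined on the Zariski open set \<open>U\<close>, that restricts to an
  isomorphism between nonempty Zariski open sets.
\<close>

definition Vc_birational :: "'n::{finite,zero} vcpoint set \<Rightarrow> ('n vcpoint \<Rightarrow> 'n vcpoint) \<Rightarrow> bool" where
  "Vc_birational U F \<longleftrightarrow>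
     Vc_zariski_open U \<and> F ` U \<subseteq> Vc \<and> Vc_regular_on U F \<and>
     (\<exists>U' W F'. U' \<subseteq> U \<and> Vc_zariski_open U' \<and> U' \<noteq> {} \<and> Vc_zariski_open W \<and>
        Vc_regular_on W F' \<and> F ` U' = W \<and> F' ` W = U' \<and> (\<forall>x\<in>U'. F' (F x) = x))"

end

theory Submission
  imports Defs
begin

text \<open>
  The map \<open>v \<mapsto> (1, v, jdet v)\<close> identifies \<^const>\<open>Vc\<close> with the projective null quadric of the form
  \<open>jdet v - s * r\<close> in the variables \<open>(s, v, r)\<close>, and the conformal group with the projective conformal
  group of this form. \<^const>\<open>MM\<close> is the part of the quadric where \<open>v $ 0 \<noteq> 0\<close>. Normalised by \<open>v $ 0 = 1\<close>
  it is de Sitter space, and its causal order is the restriction of the order of the surrounding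
  Minkowski space.

  Two comparable points differ by a null vector iff the order interval between them is a chain. Hence
  a conal map sends null rays onto null rays. Parallel null rays have parallel images, which gives a
  bijection of the sphere of null directions. A point of de Sitter space is a spherical cap in this
  sphere, and these caps are preserved. After composition with an inversion the bijection fixes
  infinity. Then it maps half-spaces to half-spaces and a ball with diameter \<open>[p, q]\<close> to the ball whose
  diameter joins the images of \<open>p\<close> and \<open>q\<close>. By Thales' theorem right angles are preserved, which forces a
  Euclidean similarity. A point of de Sitter space is determined up to sign by the null directions
  orthogonal to it, so the similarity determines the conal map. The similarity extends to a translation
  composed with an element of \<^const>\<open>GOmega\<close>, and the inversion to \<open>- jinv\<close> composed with a translation.
\<close>

section \<open>The order of de Sitter space\<close>

text \<open>Conality makes \<open>f\<close> onto only above points of its image. Hence every passage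
  from the image back to the source runs upwards from some \<open>f X\<close>: order intervals and
  future null rays can be pulled back, but a null direction of the target only after it is known to
  be orthogonal to some \<open>f X\<close>. This is why surjectivity on null directions comes after
  \<open>f (- X) = - f X\<close>: one of these two images has a future that catches rays of the
  wanted direction. Parallelism becomes an order property through common upper bounds: on parallel
  rays whose normals are not opposite any two points have one, on rays of different directions far
  points have none. A third normal bridges a pair of opposite ones; it exists because
  \<open>n \<ge> 3\<close>. Real homogeneity has to come from a comparison of lengths, since
  additivity alone admits wild solutions. On the conformal side the obstacle is orientation: the
  cone is given in all charts of \<open>CoG\<close>, so \<open>CoG\<close> must be seen to keep
  future and past apart.\<close>

text \<open>
  \<open>s\<close> and \<open>u\<close> are null coordinates, so \<open>(s, v, u)\<close> is a point of de Sitter space iff \<open>v \<bullet> v - s * u = 1\<close>.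
  The null directions form the one-point compactification of the space of the \<open>v\<close>, with \<open>None\<close> at infinity.
\<close>

definition lf :: "real \<times> 'e::real_inner \<times> real \<Rightarrow> real \<times> 'e \<times> real \<Rightarrow> real" where
  "lf X Y = fst X * snd (snd Y) + snd (snd X) * fst Y - 2 * (fst (snd X) \<bullet> fst (snd Y))"

definition future_cone :: "(real \<times> 'e::real_inner \<times> real) set" where
  "future_cone = {(s, v, u). 0 \<le> s \<and> 0 \<le> u \<and> v \<bullet> v \<le> s * u}"

definition de_sitter :: "'e::real_inner set \<Rightarrow> (real \<times> 'e \<times> real) set" where
  "de_sitter E = {X. fst (snd X) \<in> E \<and> lf X X = - 2}"

definition null_vec :: "'e::real_inner option \<Rightarrow> real \<times> 'e \<times> real" where
  "null_vec k = (case k of None \<Rightarrow> (0, 0, 1) | Some p \<Rightarrow> (1, p, p \<bullet> p))"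

definition null_dirs :: "'e set \<Rightarrow> 'e option set" where
  "null_dirs E = insert None (Some ` E)"

definition future_le :: "real \<times> 'e::real_inner \<times> real \<Rightarrow> real \<times> 'e \<times> real \<Rightarrow> bool" where
  "future_le X Y \<longleftrightarrow> Y - X \<in> future_cone"

section \<open>The Lorentz form and its light cone\<close>

lemma lf_Pair [simp]: "lf (s, v, u) (s', v', u') = s * u' + u * s' - 2 * (v \<bullet> v')"
  by (simp add: lf_def)

lemma null_vec_simps [simp]: "null_vec None = (0, 0, 1)" "null_vec (Some p) = (1, p, p \<bullet> p)"
  by (simp_all add: null_vec_def)

lemma inner_self_le_0: "v \<bullet> v \<le> 0 \<Longrightarrow> v = 0"
  by (metis inner_gt_zero_iff not_less)

lemma lf_commute: "lf X Y = lf Y X"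
  by (simp add: lf_def inner_commute)

lemma lf_add_left: "lf (X + Y) Z = lf X Z + lf Y Z"
  and lf_add_right: "lf Z (X + Y) = lf Z X + lf Z Y"
  and lf_diff_left: "lf (X - Y) Z = lf X Z - lf Y Z"
  and lf_diff_right: "lf Z (X - Y) = lf Z X - lf Z Y"
  and lf_scale_left: "lf (c *\<^sub>R X) Z = c * lf X Z"
  and lf_scale_right: "lf Z (c *\<^sub>R X) = c * lf Z X"
  and lf_minus_left: "lf (- X) Z = - lf X Z"
  and lf_minus_right: "lf Z (- X) = - lf Z X"
  by (simp_all add: lf_def inner_simps algebra_simps)

lemmas lf_simps = lf_add_left lf_add_right lf_diff_left lf_diff_right lf_scale_left lf_scale_right
  lf_minus_left lf_minus_right

lemma lf_quad: "lf (A + t *\<^sub>R B) (A + t *\<^sub>R B) = lf A A + 2 * t * lf A B + t * t * lf B B"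
  using lf_commute[of B A] by (simp add: lf_simps algebra_simps)

lemma future_cone_Pair [simp]: "(s, v, u) \<in> future_cone \<longleftrightarrow> 0 \<le> s \<and> 0 \<le> u \<and> v \<bullet> v \<le> s * u"
  by (simp add: future_cone_def)

text \<open>Reversed Cauchy-Schwarz inequality: the ordinary one bounds the spatial part, and
  \<open>(s * u' + u * s')\<^sup>2\<close> exceeds \<open>4 * ((s * u) * (s' * u'))\<close> by the
  square of \<open>s * u' - u * s'\<close>.\<close>

lemma lf_future_cone_nonneg:
  assumes "X \<in> future_cone" "Y \<in> future_cone"
  shows "0 \<le> lf X Y"
proof -
  obtain s v u where X: "X = (s, v, u)" by (cases X)
  obtain s' v' u' where Y: "Y = (s', v', u')" by (cases Y)
  have a: "0 \<le> s" "0 \<le> u" "v \<bullet> v \<le> s * u" "0 \<le> s'" "0 \<le> u'" "v' \<bullet> v' \<le> s' * u'"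
    using assms by (auto simp: X Y)
  have "(2 * (v \<bullet> v'))\<^sup>2 \<le> 4 * ((v \<bullet> v) * (v' \<bullet> v'))"
    using Cauchy_Schwarz_ineq[of v v'] by (simp add: power2_eq_square)
  also have "\<dots> \<le> 4 * ((s * u) * (s' * u'))"
    using a by (intro mult_left_mono mult_mono) auto
  also have "\<dots> \<le> (s * u' + u * s')\<^sup>2"
    using zero_le_square[of "s * u' - u * s'"] by (simp add: power2_eq_square algebra_simps)
  finally have "2 * (v \<bullet> v') \<le> s * u' + u * s'"
    by (rule power2_le_imp_le) (use a in auto)
  then show ?thesis
    by (simp add: X Y)
qed

lemma future_cone_cases:
  assumes "0 \<le> lf X X"
  shows "X \<in> future_cone \<or> - X \<in> future_cone"
proof -
  obtain s v u where X: "X = (s, v, u)" by (cases X)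
  have a: "v \<bullet> v \<le> s * u" using assms by (simp add: X)
  then have su: "0 \<le> s * u" using inner_ge_zero[of v] by linarith
  have vz: "v \<bullet> v \<le> 0" if "s = 0 \<or> u = 0" using a that by auto
  show ?thesis
  proof (cases "0 \<le> s \<and> 0 \<le> u")
    case True then show ?thesis using a by (simp add: X)
  next
    case False
    then have "s \<le> 0 \<and> u \<le> 0" using su by (auto simp: zero_le_mult_iff)
    then show ?thesis using a by (simp add: X)
  qed
qed

lemma future_cone_add:
  assumes "X \<in> future_cone" "Y \<in> future_cone"
  shows "X + Y \<in> future_cone"
proof -
  obtain s v u where X: "X = (s, v, u)" by (cases X)
  obtain s' v' u' where Y: "Y = (s', v', u')" by (cases Y)
  have "0 \<le> lf X Y" using lf_future_cone_nonneg[OF assms] .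
  then show ?thesis using assms by (simp add: X Y inner_simps algebra_simps inner_commute)
qed

lemma future_cone_scale: "X \<in> future_cone \<Longrightarrow> 0 \<le> c \<Longrightarrow> c *\<^sub>R X \<in> future_cone"
  using mult_left_mono[of _ _ "c * c"] by (cases X) (force simp: algebra_simps)

lemma future_cone_0 [simp]: "0 \<in> future_cone"
  by (simp add: zero_prod_def)

lemma lf_self_nonneg: "X \<in> future_cone \<Longrightarrow> 0 \<le> lf X X"
  by (rule lf_future_cone_nonneg)

lemma future_cone_antisym:
  assumes "X \<in> future_cone" "- X \<in> future_cone"
  shows "X = 0"
proof -
  obtain s v u where X: "X = (s, v, u)" by (cases X)
  have "s = 0" "u = 0" "v \<bullet> v \<le> 0" using assms by (auto simp: X)
  then show ?thesis
    using inner_self_le_0[of v] by (simp add: X zero_prod_def)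
qed

text \<open>The standard membership test below: a nonnegative square leaves only the two halves of
  the cone, and one positive product with a future vector excludes the past half.\<close>

lemma future_cone_sign:
  assumes "0 \<le> lf X X" "0 < lf X L" "L \<in> future_cone"
  shows "X \<in> future_cone"
  using future_cone_cases[OF assms(1)] lf_future_cone_nonneg[OF _ assms(3), of "- X"] assms(2)
  by (auto simp: lf_simps)

lemma null_vec_future_cone [simp]: "null_vec k \<in> future_cone" and lf_null_vec_self [simp]: "lf (null_vec k) (null_vec k) = 0"
  and null_vec_nz [simp]: "null_vec k \<noteq> 0"
  by (cases k; simp add: zero_prod_def)+

lemma lf_null_vec_pos:
  assumes "k \<noteq> k'"
  shows "0 < lf (null_vec k) (null_vec k')"
proof -
  have *: "0 < q \<bullet> q + p \<bullet> p - 2 * (p \<bullet> q)" if "p \<noteq> q" for p q :: 'a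
  proof -
    have "0 < (p - q) \<bullet> (p - q)" using that by simp
    then show ?thesis by (simp add: inner_simps inner_commute)
  qed
  show ?thesis using assms *
    by (cases k; cases k') auto
qed

text \<open>For a finite direction \<open>p\<close>, the product with \<open>null_vec k\<close>
  multiplied by \<open>s\<close> bounds the square of \<open>v - s *\<^sub>R p\<close> from above,
  so its vanishing forces \<open>v = s *\<^sub>R p\<close>.\<close>

lemma future_cone_orthogonal_null_vec:
  assumes "A \<in> future_cone" "lf A (null_vec k) = 0"
  obtains t where "0 \<le> t" "A = t *\<^sub>R null_vec k"
proof -
  obtain s v u where X: "A = (s, v, u)" by (cases A)
  have a: "0 \<le> s" "0 \<le> u" "v \<bullet> v \<le> s * u" using assms by (auto simp: X)
  show thesis
  proof (cases k)
    case None
    then have "s = 0" using assms by (simp add: X)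
    then have "v = 0" using a inner_self_le_0[of v] by simp
    then show thesis using that[of u] a \<open>s = 0\<close> by (simp add: X None)
  next
    case (Some p)
    have e: "s * (p \<bullet> p) + u - 2 * (v \<bullet> p) = 0" using assms by (simp add: X Some)
    have "(v - s *\<^sub>R p) \<bullet> (v - s *\<^sub>R p) = v \<bullet> v - 2 * s * (v \<bullet> p) + s * (s * (p \<bullet> p))"
      by (simp add: inner_simps inner_commute algebra_simps)
    also have "\<dots> \<le> s * u - 2 * s * (v \<bullet> p) + s * (s * (p \<bullet> p))" using a by simp
    also have "\<dots> = s * (s * (p \<bullet> p) + u - 2 * (v \<bullet> p))" by (simp add: algebra_simps)
    also have "\<dots> = 0" by (simp add: e)
    finally have "(v - s *\<^sub>R p) \<bullet> (v - s *\<^sub>R p) = 0"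
      using inner_ge_zero[of "v - s *\<^sub>R p"] by linarith
    then have v: "v = s *\<^sub>R p" by simp
    then have "u = s * (p \<bullet> p)" using e by simp
    then show thesis using that[of s] a v by (simp add: X Some)
  qed
qed

lemma future_cone_null:
  assumes "A \<in> future_cone" "lf A A = 0" "A \<noteq> 0" "fst (snd A) \<in> E" "subspace E"
  obtains k t where "k \<in> null_dirs E" "0 < t" "A = t *\<^sub>R null_vec k"
proof -
  obtain s v u where X: "A = (s, v, u)" by (cases A)
  have a: "0 \<le> s" "0 \<le> u" "v \<bullet> v = s * u" "v \<in> E" using assms by (auto simp: X)
  show thesis
  proof (cases "s = 0")
    case True
    then have "v = 0" using a by simp
    moreover have "u \<noteq> 0" using assms(3) True calculation by (auto simp: X zero_prod_def)
    ultimately show thesis using that[of None u] True a by (simp add: X null_dirs_def)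
  next
    case False
    have "A = s *\<^sub>R null_vec (Some (v /\<^sub>R s))"
      using False a by (simp add: X field_simps power2_eq_square)
    moreover have "v /\<^sub>R s \<in> E" using a assms(5) by (simp add: subspace_scale)
    ultimately show thesis using that[of "Some (v /\<^sub>R s)" s] a False by (simp add: null_dirs_def)
  qed
qed

text \<open>Null vectors span the extreme rays of the cone: both summands have nonnegative product
  with \<open>null_vec k\<close>, and these products add up to zero.\<close>

lemma future_cone_null_summand:
  assumes "A \<in> future_cone" "B \<in> future_cone" "A + B = t *\<^sub>R null_vec k"
  obtains r where "0 \<le> r" "r \<le> t" "A = r *\<^sub>R null_vec k"
proof -
  have "lf (A + B) (null_vec k) = 0" by (simp add: assms(3) lf_simps)
  moreover have "0 \<le> lf A (null_vec k)" "0 \<le> lf B (null_vec k)"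
    using assms by (auto intro: lf_future_cone_nonneg)
  ultimately have z: "lf A (null_vec k) = 0" "lf B (null_vec k) = 0" by (auto simp: lf_simps)
  obtain r where r: "0 \<le> r" "A = r *\<^sub>R null_vec k" using future_cone_orthogonal_null_vec[OF assms(1) z(1)] .
  obtain q where q: "0 \<le> q" "B = q *\<^sub>R null_vec k" using future_cone_orthogonal_null_vec[OF assms(2) z(2)] .
  have "(r + q - t) *\<^sub>R null_vec k = 0" using assms(3) by (simp add: r q algebra_simps)
  then have "r + q = t" using null_vec_nz[of k] by simp
  then show thesis using that r q by auto
qed

section \<open>Null rays and order intervals\<close>

lemma future_le_refl [simp]: "future_le X X" by (simp add: future_le_def)

lemma future_le_antisym: "future_le X Y \<Longrightarrow> future_le Y X \<Longrightarrow> X = Y"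
  using future_cone_antisym[of "Y - X"] by (simp add: future_le_def)

lemma de_sitter_norm: "X \<in> de_sitter E \<Longrightarrow> lf X X = - 2"
  by (simp add: de_sitter_def)

lemma de_sitter_uminus: "subspace E \<Longrightarrow> X \<in> de_sitter E \<Longrightarrow> - X \<in> de_sitter E"
  by (simp add: de_sitter_def lf_simps subspace_neg)

lemma null_vec_snd_mem: "subspace E \<Longrightarrow> k \<in> null_dirs E \<Longrightarrow> fst (snd (null_vec k)) \<in> E"
  by (auto simp: null_dirs_def subspace_0)

text \<open>The ruling lines of the quadric: both the linear and the quadratic term in
  \<open>t\<close> vanish.\<close>

lemma de_sitter_ray:
  assumes "subspace E" "X \<in> de_sitter E" "k \<in> null_dirs E" "lf X (null_vec k) = 0"
  shows "X + t *\<^sub>R null_vec k \<in> de_sitter E"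
  using assms null_vec_snd_mem[OF assms(1,3)] lf_commute[of "null_vec k" X]
  by (simp add: de_sitter_def lf_simps subspace_add subspace_scale)

lemma future_le_ray: "0 \<le> t \<Longrightarrow> future_le X (X + t *\<^sub>R null_vec k)"
  by (simp add: future_le_def future_cone_scale)

lemma lf_de_sitter_diff:
  assumes "X \<in> de_sitter E" "Y \<in> de_sitter E"
  shows "lf (Y - X) (Y - X) = - 4 - 2 * lf X Y"
  using assms lf_commute[of X Y] by (simp add: de_sitter_def lf_simps)

text \<open>On de Sitter space the square of \<open>Y - X\<close> equals
  \<open>- 2 * lf X (Y - X)\<close>. A null difference is therefore orthogonal to \<open>X\<close>,
  and the two points lie on a ruling line.\<close>

lemma de_sitter_null_diff:
  assumes "subspace E" "X \<in> de_sitter E" "Y \<in> de_sitter E" "future_le X Y" "lf (Y - X) (Y - X) = 0" "X \<noteq> Y"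
  obtains k t where "k \<in> null_dirs E" "0 < t" "Y = X + t *\<^sub>R null_vec k" "lf X (null_vec k) = 0"
proof -
  have "fst (snd (Y - X)) \<in> E" using assms by (simp add: de_sitter_def subspace_diff)
  then obtain k t where k: "k \<in> null_dirs E" "0 < t" "Y - X = t *\<^sub>R null_vec k"
    using future_cone_null[of "Y - X" E] assms by (auto simp: future_le_def)
  have "lf X (Y - X) = 0"
    using lf_de_sitter_diff[OF assms(2,3)] assms by (simp add: lf_simps de_sitter_norm)
  then have "lf X (null_vec k) = 0" using k by (simp add: lf_simps)
  moreover have "Y = X + t *\<^sub>R null_vec k" using k(3) by (metis add.commute diff_add_cancel)
  ultimately show thesis using that k by blast
qed

text \<open>Formulated by the order alone, so that maps respecting the order and its intervals
  transport it.\<close>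

definition chain_interval :: "'e::real_inner set \<Rightarrow> real \<times> 'e \<times> real \<Rightarrow> real \<times> 'e \<times> real \<Rightarrow> bool" where
  "chain_interval E X Y \<longleftrightarrow> (\<forall>Z\<in>de_sitter E. \<forall>Z'\<in>de_sitter E. future_le X Z \<and> future_le Z Y \<and> future_le X Z' \<and> future_le Z' Y \<longrightarrow> future_le Z Z' \<or> future_le Z' Z)"

text \<open>The space of finite null directions is a subspace \<open>E\<close> of a larger type,
  because in the application it is the hyperplane \<open>E0\<close> of the Jordan algebra. The two
  orthogonal vectors say that its dimension is at least two.\<close>

locale orth_space =
  fixes E :: "'e::real_inner set"
  assumes subE: "subspace E"
    and two: "\<exists>a\<in>E. \<exists>b\<in>E. a \<noteq> 0 \<and> b \<noteq> 0 \<and> a \<bullet> b = 0"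
begin

text \<open>Unless \<open>b\<close> is already orthogonal to \<open>w\<close>, the combination
  \<open>(b \<bullet> w) *\<^sub>R a - (a \<bullet> w) *\<^sub>R b\<close> is.\<close>

lemma unit_orth:
  assumes "w \<in> E"
  obtains m where "m \<in> E" "m \<bullet> m = 1" "m \<bullet> w = 0"
proof -
  obtain a b where ab: "a \<in> E" "b \<in> E" "a \<noteq> 0" "b \<noteq> 0" "a \<bullet> b = 0" using two by blast
  obtain c where c: "c \<in> E" "c \<noteq> 0" "c \<bullet> w = 0"
  proof (cases "b \<bullet> w = 0")
    case True then show ?thesis using that ab by blast
  next
    case False
    define c where "c = (b \<bullet> w) *\<^sub>R a - (a \<bullet> w) *\<^sub>R b"
    have "c \<bullet> a = (b \<bullet> w) * (a \<bullet> a)" using ab by (simp add: c_def inner_simps inner_commute)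
    then have "c \<noteq> 0" using False ab by auto
    moreover have "c \<bullet> w = 0" by (simp add: c_def inner_simps)
    moreover have "c \<in> E" using ab subE by (simp add: c_def subspace_diff subspace_scale)
    ultimately show ?thesis using that by blast
  qed
  have "(c /\<^sub>R norm c) \<in> E" using c subE by (simp add: subspace_scale)
  moreover have "(c /\<^sub>R norm c) \<bullet> (c /\<^sub>R norm c) = 1" using c by (simp add: dot_square_norm power2_eq_square)
  moreover have "(c /\<^sub>R norm c) \<bullet> w = 0" using c by simp
  ultimately show thesis using that by blast
qed

text \<open>The directions orthogonal to \<open>X\<close> form the boundary of its cap: the sphere
  with centre \<open>(1 / s) *\<^sub>R v\<close> and radius \<open>1 / \<bar>s\<bar>\<close>, or a
  hyperplane together with infinity if \<open>s = 0\<close>. Two points of it are picked.\<close>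

lemma de_sitter_two_null:
  assumes "X \<in> de_sitter E"
  obtains k k' where "k \<in> null_dirs E" "k' \<in> null_dirs E" "k \<noteq> k'" "lf X (null_vec k) = 0" "lf X (null_vec k') = 0"
proof -
  obtain s v u where X: "X = (s, v, u)" by (cases X)
  have a: "v \<in> E" "v \<bullet> v = 1 + s * u" using assms by (auto simp: X de_sitter_def)
  show thesis
  proof (cases "s = 0")
    case True
    have "lf X (null_vec (Some ((u / 2) *\<^sub>R v))) = 0" using a True by (simp add: X)
    moreover have "Some ((u / 2) *\<^sub>R v) \<in> null_dirs E" using a subE by (simp add: null_dirs_def subspace_scale)
    ultimately show thesis using that[of None "Some ((u / 2) *\<^sub>R v)"] True by (simp add: X null_dirs_def)
  next
    case False
    obtain m where m: "m \<in> E" "m \<bullet> m = 1" "m \<bullet> v = 0" using unit_orth[OF a(1)] .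
    have *: "lf X (null_vec (Some ((1 / s) *\<^sub>R (v + c *\<^sub>R m)))) = 0" if "c * c = 1" for c
    proof -
      have "(v + c *\<^sub>R m) \<bullet> (v + c *\<^sub>R m) = v \<bullet> v + c * c"
        using m by (simp add: inner_simps inner_commute)
      then have "lf X (null_vec (Some ((1 / s) *\<^sub>R (v + c *\<^sub>R m)))) =
        s * ((1 / s) * ((1 / s) * (v \<bullet> v + c * c))) + u - 2 * (1 / s) * (v \<bullet> v)"
        using m by (simp add: X inner_simps inner_commute)
      also have "\<dots> = 0" using False that a by (simp add: field_simps)
      finally show ?thesis .
    qed
    have "m \<noteq> 0" using m by auto
    then have "(1 / s) *\<^sub>R (v + m) \<noteq> (1 / s) *\<^sub>R (v + (-1) *\<^sub>R m)"
      using False by (auto simp: eq_neg_iff_add_eq_0 scaleR_2 [symmetric])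
    then show thesis
      using that[of "Some ((1 / s) *\<^sub>R (v + 1 *\<^sub>R m))" "Some ((1 / s) *\<^sub>R (v + (-1) *\<^sub>R m))"]
        *[of 1] *[of "-1"] a m subE by (simp add: null_dirs_def subspace_scale subspace_add subspace_neg subspace_diff)
  qed
qed

text \<open>A null difference spans an extreme ray, so all points of the interval lie on one line.
  If the difference is timelike, two null rays of different directions leave \<open>X\<close> inside
  the interval, and their points are spacelike to each other.\<close>

lemma chain_interval_iff:
  assumes X: "X \<in> de_sitter E" and Y: "Y \<in> de_sitter E" and le: "future_le X Y"
  shows "chain_interval E X Y \<longleftrightarrow> lf (Y - X) (Y - X) = 0"
proof
  assume n: "lf (Y - X) (Y - X) = 0"
  show "chain_interval E X Y"
  proof (cases "X = Y")
    case True then show ?thesis using future_le_antisym unfolding chain_interval_def by (metis future_le_refl)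
  next
    case False
    obtain k t where k: "k \<in> null_dirs E" "0 < t" "Y = X + t *\<^sub>R null_vec k" "lf X (null_vec k) = 0"
      using de_sitter_null_diff[OF subE X Y le n False] .
    have *: "\<exists>r. Z = X + r *\<^sub>R null_vec k" if le: "future_le X Z" "future_le Z Y" for Z
    proof -
      have "(Z - X) + (Y - Z) = t *\<^sub>R null_vec k" using k by simp
      then obtain r where "Z - X = r *\<^sub>R null_vec k"
        using future_cone_null_summand[of "Z - X" "Y - Z" t k] le unfolding future_le_def by blast
      then show ?thesis by (metis add.commute diff_add_cancel)
    qed
    show ?thesis unfolding chain_interval_def
    proof (intro ballI impI)
      fix Z Z' assume "future_le X Z \<and> future_le Z Y \<and> future_le X Z' \<and> future_le Z' Y"
      then obtain r r' where "Z = X + r *\<^sub>R null_vec k" "Z' = X + r' *\<^sub>R null_vec k" using * by meson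
      then have "Z' - Z = (r' - r) *\<^sub>R null_vec k" "Z - Z' = (r - r') *\<^sub>R null_vec k" by (auto simp: algebra_simps)
      then show "future_le Z Z' \<or> future_le Z' Z"
        unfolding future_le_def using future_cone_scale[OF null_vec_future_cone] by (metis diff_ge_0_iff_ge linear)
    qed
  qed
next
  assume c: "chain_interval E X Y"
  show "lf (Y - X) (Y - X) = 0"
  proof (rule ccontr)
    assume ne: "lf (Y - X) (Y - X) \<noteq> 0"
    define D where "D = Y - X"
    have D: "D \<in> future_cone" using le by (simp add: future_le_def D_def)
    then have pos: "0 < lf D D" using ne lf_self_nonneg[OF D] by (simp add: D_def)
    obtain k k' where k: "k \<in> null_dirs E" "k' \<in> null_dirs E" "k \<noteq> k'" "lf X (null_vec k) = 0" "lf X (null_vec k') = 0"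
      using de_sitter_two_null[OF X] .
    have kp: "0 < lf D (null_vec j)" for j
    proof -
      have "lf D (null_vec j) \<noteq> 0"
      proof
        assume "lf D (null_vec j) = 0"
        then obtain r where "D = r *\<^sub>R null_vec j" using future_cone_orthogonal_null_vec[OF D] by blast
        then show False using pos by (simp add: lf_simps)
      qed
      then show ?thesis using lf_future_cone_nonneg[OF D null_vec_future_cone, of j] by simp
    qed
    \<comment> \<open>\<open>D - t *\<^sub>R null_vec j\<close> becomes null at the parameter
      \<open>lf D D / (2 * lf D (null_vec j))\<close>. Half the smaller of the two values keeps both
      points below \<open>Y\<close>.\<close>
    define t where "t = min (lf D D / (2 * lf D (null_vec k))) (lf D D / (2 * lf D (null_vec k'))) / 2"
    have t: "0 < t" using pos kp by (simp add: t_def)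
    have *: "future_le (X + t *\<^sub>R null_vec j) Y" if j: "t < lf D D / (2 * lf D (null_vec j))" for j
    proof -
      have e: "Y - (X + t *\<^sub>R null_vec j) = D - t *\<^sub>R null_vec j" by (simp add: D_def)
      have "t * (2 * lf D (null_vec j)) < lf D D" using j kp[of j] by (simp add: field_simps)
      then have "0 \<le> lf (D - t *\<^sub>R null_vec j) (D - t *\<^sub>R null_vec j)"
        using lf_commute[of "null_vec j" D] by (simp add: lf_simps)
      moreover have "0 < lf (D - t *\<^sub>R null_vec j) (null_vec j)" using kp by (simp add: lf_simps)
      ultimately have "D - t *\<^sub>R null_vec j \<in> future_cone" using future_cone_sign null_vec_future_cone by blast
      then show ?thesis by (simp add: future_le_def e)
    qed
    have tt: "t < lf D D / (2 * lf D (null_vec k))" "t < lf D D / (2 * lf D (null_vec k'))"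
      using pos kp[of k] kp[of k'] by (simp_all add: t_def min_def field_simps)
    define Z where "Z = X + t *\<^sub>R null_vec k"
    define Z' where "Z' = X + t *\<^sub>R null_vec k'"
    have "Z \<in> de_sitter E" "Z' \<in> de_sitter E" using k X de_sitter_ray[OF subE] by (auto simp: Z_def Z'_def)
    moreover have "future_le X Z" "future_le X Z'" using t by (auto simp: Z_def Z'_def intro: future_le_ray)
    moreover have "future_le Z Y" "future_le Z' Y" using * tt by (auto simp: Z_def Z'_def)
    ultimately have "future_le Z Z' \<or> future_le Z' Z" using c by (auto simp: chain_interval_def)
    then have "0 \<le> lf (Z - Z') (Z - Z')"
      using lf_self_nonneg[of "Z - Z'"] lf_self_nonneg[of "Z' - Z"] by (auto simp: future_le_def lf_simps)
    moreover have "lf (Z - Z') (Z - Z') = - 2 * t * t * lf (null_vec k) (null_vec k')"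
    proof -
      have "Z - Z' = t *\<^sub>R (null_vec k - null_vec k')" by (simp add: Z_def Z'_def algebra_simps)
      then show ?thesis using lf_commute[of "null_vec k'" "null_vec k"] by (simp add: lf_simps)
    qed
    moreover have "0 < t * t * lf (null_vec k) (null_vec k')" using t lf_null_vec_pos[OF k(3)] by simp
    ultimately show False by simp
  qed
qed

section \<open>Caps, normals and common upper bounds\<close>

text \<open>For \<open>X\<close> orthogonal to \<open>null_vec k\<close>, the unit normal at
  \<open>k\<close> of the boundary of the cap where \<open>lf X (null_vec _) < 0\<close>, pointing
  into the cap. It is constant along the ray from \<open>X\<close> in direction \<open>k\<close> and
  so labels the lines of that direction in the quadric.\<close>

definition nrm :: "'e option \<Rightarrow> real \<times> 'e \<times> real \<Rightarrow> 'e" where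
  "nrm k X = (case k of None \<Rightarrow> fst (snd X) | Some p \<Rightarrow> fst (snd X) - fst X *\<^sub>R p)"

lemma nrm_unit:
  assumes "X \<in> de_sitter E" "k \<in> null_dirs E" "lf X (null_vec k) = 0"
  shows "nrm k X \<in> E" "nrm k X \<bullet> nrm k X = 1"
proof -
  obtain s v u where X: "X = (s, v, u)" by (cases X)
  have a: "v \<in> E" "v \<bullet> v = 1 + s * u" using assms by (auto simp: X de_sitter_def)
  show "nrm k X \<in> E" using a assms subE
    by (auto simp: X nrm_def null_dirs_def intro!: subspace_diff subspace_scale)
  show "nrm k X \<bullet> nrm k X = 1"
  proof (cases k)
    case None then show ?thesis using a assms by (simp add: X nrm_def)
  next
    case (Some p)
    have e: "s * (p \<bullet> p) + u - 2 * (v \<bullet> p) = 0" using assms by (simp add: X Some)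
    have "(v - s *\<^sub>R p) \<bullet> (v - s *\<^sub>R p) = v \<bullet> v - s * u + s * (s * (p \<bullet> p) + u - 2 * (v \<bullet> p))"
      by (simp add: inner_simps inner_commute algebra_simps)
    then show ?thesis using a e by (simp add: X Some nrm_def)
  qed
qed

lemma de_sitter_with_nrm:
  assumes "k \<in> null_dirs E" "m \<in> E" "m \<bullet> m = 1"
  obtains X where "X \<in> de_sitter E" "lf X (null_vec k) = 0" "nrm k X = m"
proof (cases k)
  case None
  then show thesis using that[of "(0, m, 0)"] assms by (simp add: de_sitter_def nrm_def)
next
  case (Some p)
  then show thesis using that[of "(0, m, 2 * (m \<bullet> p))"] assms by (simp add: de_sitter_def nrm_def)
qed

lemma perp_exists:
  assumes "k \<in> null_dirs E" "k' \<in> null_dirs E"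
  obtains X where "X \<in> de_sitter E" "lf X (null_vec k) = 0" "lf X (null_vec k') = 0"
proof -
  define w where "w = (case k of None \<Rightarrow> 0 | Some p \<Rightarrow> (case k' of None \<Rightarrow> 0 | Some q \<Rightarrow> p - q))"
  have "w \<in> E" using assms subE
    by (auto simp: w_def null_dirs_def subspace_0 subspace_diff split: option.splits)
  then obtain m where m: "m \<in> E" "m \<bullet> m = 1" "m \<bullet> w = 0" using unit_orth by blast
  define p where "p = (case k of None \<Rightarrow> (case k' of None \<Rightarrow> 0 | Some q \<Rightarrow> q) | Some p \<Rightarrow> p)"
  have "lf (0, m, 2 * (m \<bullet> p)) (null_vec k) = 0" "lf (0, m, 2 * (m \<bullet> p)) (null_vec k') = 0"
    using m by (auto simp: p_def w_def inner_simps split: option.splits)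
  then show thesis using that[of "(0, m, 2 * (m \<bullet> p))"] m by (simp add: de_sitter_def)
qed

text \<open>Two caps whose boundaries pass through \<open>k\<close> with normals that are not
  opposite overlap near \<open>k\<close>. The witness leaves \<open>k\<close> along the sum of the
  normals: far out if \<open>k\<close> is infinity, a short way if \<open>k\<close> is a finite
  point.\<close>

lemma common_cap:
  assumes X: "X \<in> de_sitter E" "lf X (null_vec k) = 0" and Y: "Y \<in> de_sitter E" "lf Y (null_vec k) = 0"
    and k: "k \<in> null_dirs E" and ne: "nrm k X \<noteq> - nrm k Y"
  obtains l where "l \<in> null_dirs E" "lf X (null_vec l) < 0" "lf Y (null_vec l) < 0"
proof -
  obtain s v u where Xe: "X = (s, v, u)" by (cases X)
  obtain s' v' u' where Ye: "Y = (s', v', u')" by (cases Y)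
  define m where "m = nrm k X"
  define m' where "m' = nrm k Y"
  have m: "m \<in> E" "m \<bullet> m = 1" and m': "m' \<in> E" "m' \<bullet> m' = 1"
    using nrm_unit X Y k by (auto simp: m_def m'_def)
  have "0 < (m + m') \<bullet> (m + m')" using ne by (simp add: m_def m'_def add_eq_0_iff2)
  then have mm: "0 < 1 + m \<bullet> m'" using m m' by (simp add: inner_simps inner_commute)
  have wE: "m + m' \<in> E" using m m' subE by (simp add: subspace_add)
  show thesis
  proof (cases k)
    case None
    then have z: "s = 0" "s' = 0" "m = v" "m' = v'"
      using X Y by (auto simp: Xe Ye m_def m'_def nrm_def)
    define t where "t = (\<bar>u\<bar> + \<bar>u'\<bar> + 1) / (1 + m \<bullet> m')"
    have t: "t * (1 + m \<bullet> m') = \<bar>u\<bar> + \<bar>u'\<bar> + 1" using mm by (simp add: t_def)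
    have "lf X (null_vec (Some (t *\<^sub>R (m + m')))) = u - 2 * (t * (1 + m \<bullet> m'))"
      "lf Y (null_vec (Some (t *\<^sub>R (m + m')))) = u' - 2 * (t * (1 + m \<bullet> m'))"
      using m m' by (auto simp: Xe Ye z(3,4)[symmetric] z(1,2) inner_simps inner_commute algebra_simps)
    then show thesis using that[of "Some (t *\<^sub>R (m + m'))"] t wE subE
      by (auto simp: null_dirs_def subspace_scale)
  next
    case (Some p)
    then have pE: "p \<in> E" using k by (auto simp: null_dirs_def)
    have e: "s * (p \<bullet> p) + u - 2 * (v \<bullet> p) = 0" "s' * (p \<bullet> p) + u' - 2 * (v' \<bullet> p) = 0"
      using X Y by (auto simp: Xe Ye Some)
    have me: "m = v - s *\<^sub>R p" "m' = v' - s' *\<^sub>R p"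
      by (auto simp: m_def m'_def Xe Ye nrm_def Some)
    define w where "w = m + m'"
    have ww: "w \<bullet> w = 2 * (1 + m \<bullet> m')" "m \<bullet> w = 1 + m \<bullet> m'" "m' \<bullet> w = 1 + m \<bullet> m'"
      using m m' by (auto simp: w_def inner_simps inner_commute)
    \<comment> \<open>Small enough that \<open>t * s\<close> and \<open>t * s'\<close> stay below 1,
      which makes the factor \<open>t * a - 1\<close> below negative in both uses.\<close>
    define t where "t = 1 / (2 * (\<bar>s\<bar> + \<bar>s'\<bar> + 1))"
    have t: "0 < t" "t * \<bar>s\<bar> < 1" "t * \<bar>s'\<bar> < 1" by (auto simp: t_def field_simps)
    have f: "lf (a, b, c) (null_vec (Some (p + t *\<^sub>R w))) = 2 * t * (1 + m \<bullet> m') * (t * a - 1)"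
      if "a * (p \<bullet> p) + c - 2 * (b \<bullet> p) = 0" "(b - a *\<^sub>R p) \<bullet> w = 1 + m \<bullet> m'" for a b c
    proof -
      have "lf (a, b, c) (null_vec (Some (p + t *\<^sub>R w))) =
        (a * (p \<bullet> p) + c - 2 * (b \<bullet> p)) + t * t * a * (w \<bullet> w) - 2 * t * ((b - a *\<^sub>R p) \<bullet> w)"
        by (simp add: inner_simps inner_commute[of w p] algebra_simps)
      also have "\<dots> = 2 * t * (1 + m \<bullet> m') * (t * a - 1)"
        unfolding that ww by (simp add: algebra_simps)
      finally show ?thesis .
    qed
    have "t * s < 1" "t * s' < 1" using t by (smt (verit) abs_ge_self mult_left_mono)+
    then have "2 * t * (1 + m \<bullet> m') * (t * s - 1) < 0" "2 * t * (1 + m \<bullet> m') * (t * s' - 1) < 0"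
      using t mm by (auto simp: mult_less_0_iff zero_less_mult_iff)
    then have "lf X (null_vec (Some (p + t *\<^sub>R w))) < 0" "lf Y (null_vec (Some (p + t *\<^sub>R w))) < 0"
      using f[of s u v] f[of s' u' v'] e ww me by (auto simp: Xe Ye)
    moreover have "Some (p + t *\<^sub>R w) \<in> null_dirs E"
      using pE wE subE by (simp add: null_dirs_def w_def subspace_add subspace_scale)
    ultimately show thesis using that by blast
  qed
qed

text \<open>If the cap of \<open>X\<close> contains the direction \<open>l\<close>, the square of
  the difference to \<open>X\<close> grows linearly along every ray of direction \<open>l\<close>;
  from \<open>t0\<close> on it is nonnegative.\<close>

lemma ray_reaches:
  assumes X: "X \<in> de_sitter E" and l: "l \<in> null_dirs E" "lf X (null_vec l) < 0" and Z: "Z \<in> de_sitter E" "lf Z (null_vec l) = 0"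
  obtains t0 where "0 \<le> t0" "\<And>t. t0 \<le> t \<Longrightarrow> future_le X (Z + t *\<^sub>R null_vec l)"
proof -
  define c where "c = - lf X (null_vec l)"
  have c: "0 < c" using l by (simp add: c_def)
  define t0 where "t0 = (2 + \<bar>lf X Z\<bar>) / c"
  have "future_le X (Z + t *\<^sub>R null_vec l)" if "t0 \<le> t" for t
  proof -
    have "2 + \<bar>lf X Z\<bar> \<le> t * c" using that c by (simp add: t0_def field_simps)
    moreover have "lf (Z + t *\<^sub>R null_vec l - X) (Z + t *\<^sub>R null_vec l - X) = - 4 - 2 * lf X Z + 2 * (t * c)"
      using lf_de_sitter_diff[OF X de_sitter_ray[OF subE Z(1) l(1) Z(2)], of t] by (simp add: lf_simps c_def)
    ultimately have "0 \<le> lf (Z + t *\<^sub>R null_vec l - X) (Z + t *\<^sub>R null_vec l - X)" by simp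
    moreover have "0 < lf (Z + t *\<^sub>R null_vec l - X) (null_vec l)" using Z c by (simp add: lf_simps c_def)
    ultimately show ?thesis unfolding future_le_def using future_cone_sign null_vec_future_cone by blast
  qed
  moreover have "0 \<le> t0" using c by (simp add: t0_def)
  ultimately show thesis using that by blast
qed

lemma common_upper:
  assumes "X \<in> de_sitter E" "Y \<in> de_sitter E" "l \<in> null_dirs E" "lf X (null_vec l) < 0" "lf Y (null_vec l) < 0"
  obtains Z where "Z \<in> de_sitter E" "future_le X Z" "future_le Y Z"
proof -
  obtain Z where Z: "Z \<in> de_sitter E" "lf Z (null_vec l) = 0" using perp_exists[OF assms(3,3)] .
  obtain t1 where t1: "\<And>t. t1 \<le> t \<Longrightarrow> future_le X (Z + t *\<^sub>R null_vec l)"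
    using ray_reaches[OF assms(1,3,4) Z] by blast
  obtain t2 where t2: "\<And>t. t2 \<le> t \<Longrightarrow> future_le Y (Z + t *\<^sub>R null_vec l)"
    using ray_reaches[OF assms(2,3,5) Z] by blast
  show thesis using that[of "Z + max t1 t2 *\<^sub>R null_vec l"] t1[of "max t1 t2"] t2[of "max t1 t2"]
      de_sitter_ray[OF subE Z(1) assms(3) Z(2)] by simp
qed

text \<open>A common upper bound \<open>Z\<close> would make \<open>2 *\<^sub>R Z\<close> a sum of
  three future vectors, hence causal, while points of de Sitter space are spacelike. The first
  assumption says that \<open>X\<close> lies above the antipode of \<open>Y\<close>.\<close>

lemma no_common_upper:
  assumes "X + Y \<in> future_cone" "Z \<in> de_sitter E" "future_le X Z" "future_le Y Z"
  shows False
proof -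
  have "(X + Y) + ((Z - X) + (Z - Y)) \<in> future_cone"
    by (rule future_cone_add[OF assms(1) future_cone_add]) (use assms in \<open>simp_all add: future_le_def\<close>)
  moreover have "(X + Y) + ((Z - X) + (Z - Y)) = 2 *\<^sub>R Z" by (simp add: scaleR_2)
  ultimately have "0 \<le> lf (2 *\<^sub>R Z) (2 *\<^sub>R Z)" using lf_self_nonneg by metis
  then show False using assms(2) by (simp add: lf_simps de_sitter_norm)
qed

text \<open>Supplies the assumption of \<open>no_common_upper\<close> for rays of different
  directions. In the square of the sum the mixed term \<open>2 * t * (t * c)\<close> outgrows the
  rest; \<open>t\<close> is chosen to beat the coefficients \<open>a\<close>, \<open>b\<close> and
  \<open>d\<close>.\<close>

lemma rays_diverge:
  assumes P: "P \<in> de_sitter E" "lf P (null_vec k) = 0" and R: "R \<in> de_sitter E" "lf R (null_vec l) = 0" and ne: "k \<noteq> l"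
  obtains t where "0 \<le> t" "P + t *\<^sub>R null_vec k + (R + t *\<^sub>R null_vec l) \<in> future_cone"
proof -
  define c where "c = lf (null_vec k) (null_vec l)"
  have c: "0 < c" using lf_null_vec_pos[OF ne] by (simp add: c_def)
  define a where "a = lf (P + R) (P + R)"
  define b where "b = 2 * lf (P + R) (null_vec k + null_vec l)"
  define d where "d = lf R (null_vec k)"
  define t where "t = 1 + (\<bar>a\<bar> + \<bar>b\<bar> + \<bar>d\<bar>) / c"
  have t1: "1 \<le> t" using c by (simp add: t_def)
  have tc: "t * c = c + \<bar>a\<bar> + \<bar>b\<bar> + \<bar>d\<bar>" using c by (simp add: t_def field_simps)
  define S where "S = P + t *\<^sub>R null_vec k + (R + t *\<^sub>R null_vec l)"
  have "S = (P + R) + t *\<^sub>R (null_vec k + null_vec l)" by (simp add: S_def algebra_simps)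
  then have "lf S S = a + 2 * t * lf (P + R) (null_vec k + null_vec l) + t * t * lf (null_vec k + null_vec l) (null_vec k + null_vec l)"
    by (simp add: lf_quad a_def)
  also have "lf (null_vec k + null_vec l) (null_vec k + null_vec l) = 2 * c"
    using lf_commute[of "null_vec l" "null_vec k"] by (simp add: lf_simps c_def)
  finally have SS: "lf S S = a + t * b + 2 * t * (t * c)" by (simp add: b_def)
  have "- \<bar>a\<bar> * t \<le> a" using mult_left_mono[of 1 t "\<bar>a\<bar>"] t1 by simp
  moreover have "- \<bar>b\<bar> * t \<le> t * b" using mult_left_mono[of "- \<bar>b\<bar>" b t] t1
    by (simp add: mult.commute)
  moreover have "t * (\<bar>a\<bar> + \<bar>b\<bar>) \<le> t * (t * c)" using t1 c by (intro mult_left_mono) (auto simp: tc)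
  moreover have "0 \<le> t * (t * c)" using t1 c by simp
  ultimately have "0 \<le> lf S S" unfolding SS by (simp add: algebra_simps)
  moreover have "lf S (null_vec k) = d + t * c"
    using P lf_commute[of "null_vec l" "null_vec k"] by (simp add: S_def lf_simps d_def c_def)
  then have "0 < lf S (null_vec k)" using tc c by simp
  ultimately have "S \<in> future_cone" using future_cone_sign null_vec_future_cone by blast
  then show thesis using that[of t] t1 by (simp add: S_def)
qed

text \<open>For \<open>k \<noteq> l\<close> the difference of the two points has the negative square
  \<open>- 2 * (a * b * lf (null_vec k) (null_vec l))\<close>.\<close>

lemma null_comparable:
  assumes "0 < a" "0 < b" "future_le (X + a *\<^sub>R null_vec k) (X + b *\<^sub>R null_vec l) \<or> future_le (X + b *\<^sub>R null_vec l) (X + a *\<^sub>R null_vec k)"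
  shows "k = l"
proof (rule ccontr)
  assume "k \<noteq> l"
  then have c: "0 < lf (null_vec k) (null_vec l)" by (rule lf_null_vec_pos)
  define D where "D = b *\<^sub>R null_vec l - a *\<^sub>R null_vec k"
  have "D \<in> future_cone \<or> - D \<in> future_cone" using assms(3) by (auto simp: future_le_def D_def)
  then have "0 \<le> lf D D" using lf_self_nonneg[of D] lf_self_nonneg[of "- D"] by (auto simp: lf_simps)
  moreover have "lf D D = - 2 * (a * b * lf (null_vec k) (null_vec l))"
    using lf_commute[of "null_vec l" "null_vec k"] by (simp add: D_def lf_simps algebra_simps)
  ultimately show False using c assms by (simp add: mult_le_0_iff)
qed

text \<open>A sphere determines its centre and radius, a hyperplane its normal and offset. In both
  cases \<open>R\<close> is a multiple of \<open>P\<close>, and the normalisation leaves only the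
  sign.\<close>

lemma null_perp_determines:
  assumes P: "P \<in> de_sitter E" and R: "R \<in> de_sitter E"
    and eq: "\<And>k. k \<in> null_dirs E \<Longrightarrow> lf P (null_vec k) = 0 \<Longrightarrow> lf R (null_vec k) = 0"
  shows "R = P \<or> R = - P"
proof -
  obtain s v u where Pe: "P = (s, v, u)" by (cases P)
  obtain s' v' u' where Re: "R = (s', v', u')" by (cases R)
  have a: "v \<in> E" "v \<bullet> v = 1 + s * u" using P by (auto simp: Pe de_sitter_def)
  have a': "v' \<in> E" "v' \<bullet> v' = 1 + s' * u'" using R by (auto simp: Re de_sitter_def)
  have "\<exists>c. R = c *\<^sub>R P"
  proof (cases "s = 0")
    case True
    then have vv: "v \<bullet> v = 1" using a by simp
    have s': "s' = 0" using eq[of None] True by (simp add: null_dirs_def Pe Re)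
    \<comment> \<open>\<open>w\<close> is the part of \<open>v'\<close> along the hyperplane of
      \<open>P\<close>. Moving in direction \<open>w\<close> stays in the zero set, so
      \<open>v'\<close> must be orthogonal to \<open>w\<close>.\<close>
    define w where "w = v' - (v' \<bullet> v) *\<^sub>R v"
    have w: "w \<in> E" "v \<bullet> w = 0"
      using a a' subE vv by (auto simp: w_def subspace_diff subspace_scale inner_simps inner_commute)
    have q: "u' - 2 * (v' \<bullet> ((u / 2) *\<^sub>R v + t *\<^sub>R w)) = 0" for t
    proof -
      have "Some ((u / 2) *\<^sub>R v + t *\<^sub>R w) \<in> null_dirs E"
        using a w subE by (simp add: null_dirs_def subspace_add subspace_scale)
      moreover have "lf P (null_vec (Some ((u / 2) *\<^sub>R v + t *\<^sub>R w))) = 0"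
        using True vv w by (simp add: Pe inner_simps)
      ultimately have "lf R (null_vec (Some ((u / 2) *\<^sub>R v + t *\<^sub>R w))) = 0" by (rule eq)
      then show ?thesis by (simp add: Re s')
    qed
    have "v' \<bullet> w = 0" using q[of 0] q[of 1] by (simp add: inner_simps)
    then have "w \<bullet> w = 0" using w by (simp add: w_def inner_simps inner_commute)
    then have v': "v' = (v' \<bullet> v) *\<^sub>R v" by (simp add: w_def)
    have "u' = (v' \<bullet> v) * u" using q[of 0] by (simp add: inner_simps)
    then have "R = (v' \<bullet> v) *\<^sub>R P" using v' True s' by (simp add: Pe Re)
    then show ?thesis ..
  next
    case False
    define c where "c = (1 / s) *\<^sub>R v"
    have v: "v = s *\<^sub>R c" using False by (simp add: c_def)
    have cE: "c \<in> E" using a subE by (simp add: c_def subspace_scale)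
    have u: "s * u = s * s * (c \<bullet> c) - 1" using a by (simp add: v)
    have q: "s' * ((c + (1 / s) *\<^sub>R e) \<bullet> (c + (1 / s) *\<^sub>R e)) + u' - 2 * (v' \<bullet> (c + (1 / s) *\<^sub>R e)) = 0"
      if e: "e \<in> E" "e \<bullet> e = 1" for e
    proof -
      have "Some (c + (1 / s) *\<^sub>R e) \<in> null_dirs E"
        using cE e subE by (simp add: null_dirs_def subspace_add subspace_scale)
      moreover have "s * lf P (null_vec (Some (c + (1 / s) *\<^sub>R e))) = 0"
      proof -
        have "s * lf P (null_vec (Some (c + (1 / s) *\<^sub>R e))) =
          (s *\<^sub>R c + e) \<bullet> (s *\<^sub>R c + e) + s * u - 2 * s * (c \<bullet> (s *\<^sub>R c + e))"
          using False by (simp add: Pe v inner_simps inner_commute field_simps)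
        also have "\<dots> = 0" using e u by (simp add: inner_simps inner_commute algebra_simps)
        finally show ?thesis .
      qed
      then have "lf P (null_vec (Some (c + (1 / s) *\<^sub>R e))) = 0" using False by simp
      ultimately have "lf R (null_vec (Some (c + (1 / s) *\<^sub>R e))) = 0" by (rule eq)
      then show ?thesis by (simp add: Re)
    qed
    define w where "w = s' *\<^sub>R c - v'"
    \<comment> \<open>The points of the sphere in the directions \<open>e\<close> and
      \<open>- e\<close> from its centre \<open>c\<close> are both zeros of \<open>R\<close>.
      Subtracting the two equations removes the even terms.\<close>
    have we: "w \<bullet> e = 0" if e: "e \<in> E" "e \<bullet> e = 1" for e
    proof -
      have "- e \<in> E" "(- e) \<bullet> (- e) = 1" using e subE by (auto simp: subspace_neg)
      then have "s' * (c \<bullet> c) - s' * (2 / s) * (c \<bullet> e) + s' / (s * s) + u' - 2 * (v' \<bullet> c) + (2 / s) * (v' \<bullet> e) = 0"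
        using q[of "- e"] e(2) by (simp add: inner_simps inner_commute algebra_simps)
      moreover have "s' * (c \<bullet> c) + s' * (2 / s) * (c \<bullet> e) + s' / (s * s) + u' - 2 * (v' \<bullet> c) - (2 / s) * (v' \<bullet> e) = 0"
        using q[OF e] e(2) by (simp add: inner_simps inner_commute algebra_simps)
      ultimately have "(2 / s) * (v' \<bullet> e) = s' * (2 / s) * (c \<bullet> e)" by linarith
      then show ?thesis using False by (simp add: w_def inner_simps)
    qed
    have wE: "w \<in> E" using cE a' subE by (simp add: w_def subspace_diff subspace_scale)
    have "w = 0"
    proof (rule ccontr)
      assume "w \<noteq> 0"
      then have "w \<bullet> (w /\<^sub>R norm w) = 0"
        by (intro we) (use wE subE in \<open>auto simp: subspace_scale dot_square_norm power2_eq_square\<close>)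
      then show False using \<open>w \<noteq> 0\<close> by simp
    qed
    then have v': "v' = s' *\<^sub>R c" by (simp add: w_def)
    obtain e where e: "e \<in> E" "e \<bullet> e = 1" using unit_orth[OF subspace_0[OF subE]] by blast
    have "u' = s' * (c \<bullet> c) - s' / (s * s)"
      using q[OF e] e v' by (simp add: inner_simps inner_commute algebra_simps)
    moreover have "u = s * (c \<bullet> c) - 1 / s" using u False by (simp add: field_simps)
    ultimately have "u' = (s' / s) * u" using False by (simp add: right_diff_distrib)
    then have "R = (s' / s) *\<^sub>R P" using v v' False by (simp add: Pe Re)
    then show ?thesis ..
  qed
  then obtain c where c: "R = c *\<^sub>R P" ..
  then have "c * c = 1" using de_sitter_norm[OF P] de_sitter_norm[OF R] by (simp add: lf_simps)
  then have "c = 1 \<or> c = - 1" by (simp add: square_eq_1_iff)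
  then show ?thesis using c by auto
qed

end

section \<open>Conal maps of de Sitter space\<close>

locale de_sitter_conal = orth_space E for E :: "'e::real_inner set" +
  fixes f :: "real \<times> 'e \<times> real \<Rightarrow> real \<times> 'e \<times> real"
  assumes maps: "X \<in> de_sitter E \<Longrightarrow> f X \<in> de_sitter E"
    and inj: "inj_on f (de_sitter E)"
    and fut: "X \<in> de_sitter E \<Longrightarrow> f ` {Y \<in> de_sitter E. future_le X Y} = {Y \<in> de_sitter E. future_le (f X) Y}"
begin

section \<open>Images of null rays\<close>

lemma order_iff:
  assumes "X \<in> de_sitter E" "Y \<in> de_sitter E"
  shows "future_le (f X) (f Y) \<longleftrightarrow> future_le X Y"
proof
  assume "future_le (f X) (f Y)"
  then have "f Y \<in> f ` {Y \<in> de_sitter E. future_le X Y}" using fut[OF assms(1)] maps[OF assms(2)] by auto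
  then show "future_le X Y" using inj assms by (auto simp: inj_on_def)
qed (use fut[OF assms(1)] assms in auto)

lemma onto:
  assumes "X \<in> de_sitter E" "Z \<in> de_sitter E" "future_le (f X) Z"
  obtains Y where "Y \<in> de_sitter E" "future_le X Y" "f Y = Z"
proof -
  have "Z \<in> f ` {Y \<in> de_sitter E. future_le X Y}" using fut[OF assms(1)] assms by auto
  then show thesis using that by auto
qed

text \<open>Points between \<open>f X\<close> and \<open>f Y\<close> lie above \<open>f X\<close>,
  where \<open>f\<close> is onto, so the two intervals correspond.\<close>

lemma chain_interval_f:
  assumes X: "X \<in> de_sitter E" and Y: "Y \<in> de_sitter E"
  shows "chain_interval E (f X) (f Y) \<longleftrightarrow> chain_interval E X Y"
proof
  assume l: "chain_interval E (f X) (f Y)"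
  show "chain_interval E X Y" unfolding chain_interval_def
  proof (intro ballI impI)
    fix Z Z' assume "Z \<in> de_sitter E" "Z' \<in> de_sitter E" "future_le X Z \<and> future_le Z Y \<and> future_le X Z' \<and> future_le Z' Y"
    then show "future_le Z Z' \<or> future_le Z' Z"
      using l[unfolded chain_interval_def, rule_format, of "f Z" "f Z'"] maps order_iff X Y by auto
  qed
next
  assume l: "chain_interval E X Y"
  show "chain_interval E (f X) (f Y)" unfolding chain_interval_def
  proof (intro ballI impI)
    fix Z Z' assume z: "Z \<in> de_sitter E" "Z' \<in> de_sitter E"
      "future_le (f X) Z \<and> future_le Z (f Y) \<and> future_le (f X) Z' \<and> future_le Z' (f Y)"
    obtain W where W: "W \<in> de_sitter E" "future_le X W" "f W = Z" using onto[OF X z(1)] z by blast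
    obtain W' where W': "W' \<in> de_sitter E" "future_le X W'" "f W' = Z'" using onto[OF X z(2)] z by blast
    have "future_le W Y" "future_le W' Y" using order_iff W W' Y z by metis+
    then show "future_le Z Z' \<or> future_le Z' Z"
      using l W W' order_iff[of W W'] order_iff[of W' W] by (auto simp: chain_interval_def)
  qed
qed

lemma null_f:
  assumes X: "X \<in> de_sitter E" and Y: "Y \<in> de_sitter E" and le: "future_le X Y"
  shows "lf (f Y - f X) (f Y - f X) = 0 \<longleftrightarrow> lf (Y - X) (Y - X) = 0"
  using chain_interval_iff[OF X Y le] chain_interval_iff[OF maps[OF X] maps[OF Y]] chain_interval_f[OF X Y] order_iff[OF X Y] le
  by simp

text \<open>The two quantified clauses say that the ray from \<open>X\<close> is mapped into and
  onto the ray from \<open>f X\<close>; the parameters may correspond in any way.\<close>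

definition ray_image :: "'e option \<Rightarrow> real \<times> 'e \<times> real \<Rightarrow> 'e option \<Rightarrow> bool" where
  "ray_image k X k' \<longleftrightarrow> k' \<in> null_dirs E \<and> lf (f X) (null_vec k') = 0 \<and>
     (\<forall>t\<ge>0. \<exists>t'\<ge>0. f (X + t *\<^sub>R null_vec k) = f X + t' *\<^sub>R null_vec k') \<and>
     (\<forall>t'\<ge>0. \<exists>t\<ge>0. f (X + t *\<^sub>R null_vec k) = f X + t' *\<^sub>R null_vec k')"

text \<open>Every point of the ray lands on some null ray from \<open>f X\<close>. Points of the ray
  are pairwise comparable, and comparable points on null rays with a common origin share the
  direction, so the direction found at parameter 1 serves for all.\<close>

lemma ray_image_exists:
  assumes X: "X \<in> de_sitter E" and k: "k \<in> null_dirs E" "lf X (null_vec k) = 0"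
  obtains k' where "ray_image k X k'"
proof -
  have ray: "X + t *\<^sub>R null_vec k \<in> de_sitter E" for t using de_sitter_ray[OF subE X k] .
  have one: "\<exists>k' t'. k' \<in> null_dirs E \<and> 0 < t' \<and> f (X + t *\<^sub>R null_vec k) = f X + t' *\<^sub>R null_vec k' \<and> lf (f X) (null_vec k') = 0"
    if t: "0 < t" for t
  proof -
    have le: "future_le X (X + t *\<^sub>R null_vec k)" using t by (intro future_le_ray) simp
    have "X \<noteq> X + t *\<^sub>R null_vec k" using t by simp
    then have "f X \<noteq> f (X + t *\<^sub>R null_vec k)" using inj X ray by (metis inj_onD)
    moreover have "lf (f (X + t *\<^sub>R null_vec k) - f X) (f (X + t *\<^sub>R null_vec k) - f X) = 0"
      using null_f[OF X ray le] by (simp add: lf_simps)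
    moreover have "future_le (f X) (f (X + t *\<^sub>R null_vec k))" using order_iff[OF X ray] le by simp
    ultimately show ?thesis using de_sitter_null_diff[OF subE maps[OF X] maps[OF ray]] by metis
  qed
  obtain k' t1 where k': "k' \<in> null_dirs E" "0 < t1" "f (X + 1 *\<^sub>R null_vec k) = f X + t1 *\<^sub>R null_vec k'" "lf (f X) (null_vec k') = 0"
    using one[of 1] by auto
  have cmp: "future_le (X + a *\<^sub>R null_vec l) (X + b *\<^sub>R null_vec l) \<or> future_le (X + b *\<^sub>R null_vec l) (X + a *\<^sub>R null_vec l)" for X a b l
  proof -
    have "(X + b *\<^sub>R null_vec l) - (X + a *\<^sub>R null_vec l) = (b - a) *\<^sub>R null_vec l"
      "(X + a *\<^sub>R null_vec l) - (X + b *\<^sub>R null_vec l) = (a - b) *\<^sub>R null_vec l" by (auto simp: algebra_simps)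
    then show ?thesis unfolding future_le_def using future_cone_scale[OF null_vec_future_cone] by (metis diff_ge_0_iff_ge linear)
  qed
  have fwd: "\<exists>t'\<ge>0. f (X + t *\<^sub>R null_vec k) = f X + t' *\<^sub>R null_vec k'" if t: "0 \<le> t" for t
  proof (cases "t = 0")
    case True then show ?thesis by (intro exI[of _ 0]) simp
  next
    case False
    then obtain l s where l: "0 < s" "f (X + t *\<^sub>R null_vec k) = f X + s *\<^sub>R null_vec l"
      using one[of t] t by auto
    have "future_le (f (X + t *\<^sub>R null_vec k)) (f (X + 1 *\<^sub>R null_vec k)) \<or> future_le (f (X + 1 *\<^sub>R null_vec k)) (f (X + t *\<^sub>R null_vec k))"
      unfolding order_iff[OF ray ray] by (rule cmp)
    then have "l = k'" using null_comparable[OF l(1) k'(2)] l k' by simp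
    then show ?thesis using l by (intro exI[of _ s]) auto
  qed
  \<comment> \<open>A preimage exists because \<open>f\<close> is onto above \<open>f X\<close>.
    Comparability with the point at parameter 1 puts it on the ray of direction
    \<open>k\<close>.\<close>
  have bwd: "\<exists>t\<ge>0. f (X + t *\<^sub>R null_vec k) = f X + t' *\<^sub>R null_vec k'" if t: "0 \<le> t'" for t'
  proof (cases "t' = 0")
    case True then show ?thesis by (intro exI[of _ 0]) simp
  next
    case False
    define Z where "Z = f X + t' *\<^sub>R null_vec k'"
    have Z: "Z \<in> de_sitter E" "future_le (f X) Z" using de_sitter_ray[OF subE maps[OF X] k'(1,4)] future_le_ray[OF t] by (simp_all add: Z_def)
    obtain Y where Y: "Y \<in> de_sitter E" "future_le X Y" "f Y = Z" using onto[OF X Z] .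
    have "lf (Y - X) (Y - X) = 0" using null_f[OF X Y(1,2)] Y by (simp add: Z_def lf_simps)
    moreover have "X \<noteq> Y" using Y(3) False by (auto simp: Z_def)
    ultimately obtain l s where l: "l \<in> null_dirs E" "0 < s" "Y = X + s *\<^sub>R null_vec l"
      using de_sitter_null_diff[OF subE X Y(1,2)] by metis
    have "future_le (f Y) (f (X + 1 *\<^sub>R null_vec k)) \<or> future_le (f (X + 1 *\<^sub>R null_vec k)) (f Y)"
      unfolding Y(3) Z_def k'(3) by (rule cmp)
    then have "future_le Y (X + 1 *\<^sub>R null_vec k) \<or> future_le (X + 1 *\<^sub>R null_vec k) Y" using order_iff Y ray by blast
    then have "l = k" using null_comparable[OF l(2) zero_less_one, of X l k] l by simp
    then show ?thesis using l Y by (intro exI[of _ s]) (auto simp: Z_def)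
  qed
  show thesis using that[of k'] k' fwd bwd by (auto simp: ray_image_def)
qed

text \<open>Different image directions would give two image points without a common upper bound.
  Their preimages lie on the original rays, where the normals at \<open>k\<close> are unchanged, so
  the caps overlap and a common upper bound exists; its image is a contradiction.\<close>

lemma ray_image_unique_opposite:
  assumes X: "X \<in> de_sitter E" "lf X (null_vec k) = 0" and Y: "Y \<in> de_sitter E" "lf Y (null_vec k) = 0" and k: "k \<in> null_dirs E"
    and rX: "ray_image k X a" and rY: "ray_image k Y b" and ne: "nrm k X \<noteq> - nrm k Y"
  shows "a = b"
proof (rule ccontr)
  assume "a \<noteq> b"
  have fa: "lf (f X) (null_vec a) = 0" and fb: "lf (f Y) (null_vec b) = 0" using rX rY by (auto simp: ray_image_def)
  obtain t where t: "0 \<le> t" "f X + t *\<^sub>R null_vec a + (f Y + t *\<^sub>R null_vec b) \<in> future_cone"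
    using rays_diverge[OF maps[OF X(1)] fa maps[OF Y(1)] fb \<open>a \<noteq> b\<close>] .
  obtain r where r: "f (X + r *\<^sub>R null_vec k) = f X + t *\<^sub>R null_vec a" using rX t by (auto simp: ray_image_def)
  obtain q where q: "f (Y + q *\<^sub>R null_vec k) = f Y + t *\<^sub>R null_vec b" using rY t by (auto simp: ray_image_def)
  have n: "nrm k (Z + c *\<^sub>R null_vec k) = nrm k Z" for Z c
    by (cases k) (auto simp: nrm_def algebra_simps)
  have m: "X + r *\<^sub>R null_vec k \<in> de_sitter E" "Y + q *\<^sub>R null_vec k \<in> de_sitter E"
    using de_sitter_ray[OF subE _ k] X Y by auto
  have z: "lf (X + r *\<^sub>R null_vec k) (null_vec k) = 0" "lf (Y + q *\<^sub>R null_vec k) (null_vec k) = 0" using X Y by (auto simp: lf_simps)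
  obtain l where l: "l \<in> null_dirs E" "lf (X + r *\<^sub>R null_vec k) (null_vec l) < 0" "lf (Y + q *\<^sub>R null_vec k) (null_vec l) < 0"
    using common_cap[OF m(1) z(1) m(2) z(2) k] ne n by metis
  obtain Z where Z: "Z \<in> de_sitter E" "future_le (X + r *\<^sub>R null_vec k) Z" "future_le (Y + q *\<^sub>R null_vec k) Z"
    using common_upper[OF m l] .
  then have "future_le (f X + t *\<^sub>R null_vec a) (f Z)" "future_le (f Y + t *\<^sub>R null_vec b) (f Z)"
    using order_iff m r q by metis+
  then show False using no_common_upper[OF t(2) maps[OF Z(1)]] by blast
qed

text \<open>Rays with opposite normals are compared through a third one whose normal is orthogonal
  to both.\<close>

lemma ray_image_unique:
  assumes X: "X \<in> de_sitter E" "lf X (null_vec k) = 0" and Y: "Y \<in> de_sitter E" "lf Y (null_vec k) = 0" and k: "k \<in> null_dirs E"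
    and rX: "ray_image k X a" and rY: "ray_image k Y b"
  shows "a = b"
proof (cases "nrm k X = - nrm k Y")
  case False
  then show ?thesis using ray_image_unique_opposite assms by blast
next
  case True
  obtain m where m: "m \<in> E" "m \<bullet> m = 1" "m \<bullet> nrm k Y = 0"
    using unit_orth[OF nrm_unit(1)[OF Y(1) k Y(2)]] .
  obtain Z where Z: "Z \<in> de_sitter E" "lf Z (null_vec k) = 0" "nrm k Z = m" using de_sitter_with_nrm[OF k m(1,2)] .
  obtain c where c: "ray_image k Z c" using ray_image_exists[OF Z(1) k Z(2)] .
  have "nrm k X \<noteq> - nrm k Z" "nrm k Z \<noteq> - nrm k Y" using True Z m by auto
  then have "a = c" "c = b"
    using ray_image_unique_opposite[OF X Z(1,2) k rX c] ray_image_unique_opposite[OF Z(1,2) Y k c rY] by auto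
  then show ?thesis by simp
qed

section \<open>The induced bijection of null directions\<close>

definition phi :: "'e option \<Rightarrow> 'e option" where
  "phi k = (SOME k'. \<exists>X\<in>de_sitter E. lf X (null_vec k) = 0 \<and> ray_image k X k')"

lemma ray_image_phi:
  assumes "k \<in> null_dirs E" "X \<in> de_sitter E" "lf X (null_vec k) = 0"
  shows "ray_image k X (phi k)"
proof -
  obtain k' where k': "ray_image k X k'" using ray_image_exists[OF assms(2,1,3)] .
  have "\<exists>X\<in>de_sitter E. lf X (null_vec k) = 0 \<and> ray_image k X (phi k)"
    unfolding phi_def by (rule someI[of _ k']) (use assms k' in auto)
  then obtain Y where "Y \<in> de_sitter E" "lf Y (null_vec k) = 0" "ray_image k Y (phi k)" by blast
  then have "phi k = k'" using ray_image_unique assms k' by blast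
  then show ?thesis using k' by simp
qed

lemma phi_null_dirs: "k \<in> null_dirs E \<Longrightarrow> phi k \<in> null_dirs E"
  using perp_exists[of k k] ray_image_phi[of k] by (metis ray_image_def)

lemma phi_zero: "k \<in> null_dirs E \<Longrightarrow> X \<in> de_sitter E \<Longrightarrow> lf X (null_vec k) = 0 \<Longrightarrow> lf (f X) (null_vec (phi k)) = 0"
  using ray_image_phi by (simp add: ray_image_def)

text \<open>A point \<open>X\<close> orthogonal to both directions starts a ray in each. If both
  rays are mapped onto the same ray, its point at parameter 1 has a preimage on either, and
  injectivity of \<open>f\<close> identifies them.\<close>

lemma phi_inj:
  assumes k: "k \<in> null_dirs E" "l \<in> null_dirs E" and eq: "phi k = phi l"
  shows "k = l"
proof -
  obtain X where X: "X \<in> de_sitter E" "lf X (null_vec k) = 0" "lf X (null_vec l) = 0" using perp_exists[OF k] .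
  have rk: "ray_image k X (phi k)" and rl: "ray_image l X (phi k)" using ray_image_phi[OF k(1) X(1,2)] ray_image_phi[OF k(2) X(1,3)] eq by simp_all
  obtain s where s: "0 \<le> s" "f (X + s *\<^sub>R null_vec k) = f X + 1 *\<^sub>R null_vec (phi k)"
    using rk zero_le_one unfolding ray_image_def by blast
  obtain t where t: "0 \<le> t" "f (X + t *\<^sub>R null_vec l) = f X + 1 *\<^sub>R null_vec (phi k)"
    using rl zero_le_one unfolding ray_image_def by blast
  have "s \<noteq> 0" "t \<noteq> 0" using s t by auto
  then have st: "0 < s" "0 < t" using s t by auto
  have "X + s *\<^sub>R null_vec k = X + t *\<^sub>R null_vec l"
    using inj de_sitter_ray[OF subE X(1) k(1) X(2)] de_sitter_ray[OF subE X(1) k(2) X(3)] s(2) t(2)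
    by (metis inj_onD)
  then show ?thesis using null_comparable[OF st, of X k l] by (metis future_le_refl)
qed

text \<open>The ray from \<open>f X\<close> in direction \<open>k'\<close> lies in the future of
  \<open>f X\<close>, where \<open>f\<close> is onto, so it comes from a null ray starting at
  \<open>X\<close>.\<close>

lemma phi_range_perp:
  assumes X: "X \<in> de_sitter E" and k: "k' \<in> null_dirs E" "lf (f X) (null_vec k') = 0"
  obtains k where "k \<in> null_dirs E" "phi k = k'" "lf X (null_vec k) = 0"
proof -
  define Z where "Z = f X + 1 *\<^sub>R null_vec k'"
  have Z: "Z \<in> de_sitter E" "future_le (f X) Z"
    using de_sitter_ray[OF subE maps[OF X] k, of 1] future_le_ray[of 1 "f X" k'] by (auto simp: Z_def)
  obtain Y where Y: "Y \<in> de_sitter E" "future_le X Y" "f Y = Z" using onto[OF X Z] .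
  have "lf (Y - X) (Y - X) = 0" using null_f[OF X Y(1,2)] Y by (simp add: Z_def lf_simps)
  moreover have "X \<noteq> Y" using Y(3) by (auto simp: Z_def)
  ultimately obtain l s where l: "l \<in> null_dirs E" "0 < s" "Y = X + s *\<^sub>R null_vec l" "lf X (null_vec l) = 0"
    using de_sitter_null_diff[OF subE X Y(1,2)] by metis
  have "ray_image l X (phi l)" using ray_image_phi l X by blast
  then obtain t where t: "0 \<le> t" "f Y = f X + t *\<^sub>R null_vec (phi l)"
    using l by (metis ray_image_def less_imp_le)
  then have e: "f X + t *\<^sub>R null_vec (phi l) = f X + 1 *\<^sub>R null_vec k'" using Y(3) by (simp add: Z_def)
  have "t \<noteq> 0" using e by auto
  then have "phi l = k'" using null_comparable[of t 1 "f X" "phi l" k'] e t by auto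
  then show thesis using that l by blast
qed

text \<open>The sign is visible in the order: a ray of direction \<open>k\<close> enters the future
  of \<open>X\<close>, so its image enters the future of \<open>f X\<close>, which makes the product
  nonpositive. Zero is excluded by injectivity of \<open>phi\<close>.\<close>

lemma phi_neg:
  assumes k: "k \<in> null_dirs E" and X: "X \<in> de_sitter E" and neg: "lf X (null_vec k) < 0"
  shows "lf (f X) (null_vec (phi k)) < 0"
proof -
  obtain Y where Y: "Y \<in> de_sitter E" "lf Y (null_vec k) = 0" using perp_exists[OF k k] .
  obtain t0 where t0: "0 \<le> t0" "\<And>t. t0 \<le> t \<Longrightarrow> future_le X (Y + t *\<^sub>R null_vec k)"
    using ray_reaches[OF X k neg Y] by blast
  have "ray_image k Y (phi k)" using ray_image_phi k Y by blast
  then obtain t' where t': "f (Y + t0 *\<^sub>R null_vec k) = f Y + t' *\<^sub>R null_vec (phi k)"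
    using t0(1) by (auto simp: ray_image_def)
  have "future_le (f X) (f (Y + t0 *\<^sub>R null_vec k))"
    using order_iff X de_sitter_ray[OF subE Y(1) k Y(2)] t0 by simp
  then have "0 \<le> lf (f Y + t' *\<^sub>R null_vec (phi k) - f X) (null_vec (phi k))"
    unfolding t' future_le_def using lf_future_cone_nonneg null_vec_future_cone by blast
  then have le: "lf (f X) (null_vec (phi k)) \<le> 0" using phi_zero[OF k Y] by (simp add: lf_simps)
  have "lf (f X) (null_vec (phi k)) \<noteq> 0"
  proof
    assume "lf (f X) (null_vec (phi k)) = 0"
    then obtain l where "l \<in> null_dirs E" "phi l = phi k" "lf X (null_vec l) = 0"
      using phi_range_perp[OF X phi_null_dirs[OF k]] by blast
    then show False using phi_inj[of l k] k neg by simp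
  qed
  then show ?thesis using le by simp
qed

text \<open>Otherwise the ray of direction \<open>phi k\<close> from \<open>f Y\<close> enters the
  future of \<open>f X\<close>. A point of it there is the image of a point on the ray from
  \<open>Y\<close>, which would have to lie above \<open>X\<close>.\<close>

lemma phi_pos:
  assumes k: "k \<in> null_dirs E" and X: "X \<in> de_sitter E" and pos: "0 < lf X (null_vec k)"
  shows "0 < lf (f X) (null_vec (phi k))"
proof (rule ccontr)
  assume n: "\<not> ?thesis"
  have "lf (f X) (null_vec (phi k)) \<noteq> 0"
  proof
    assume "lf (f X) (null_vec (phi k)) = 0"
    then obtain l where "l \<in> null_dirs E" "phi l = phi k" "lf X (null_vec l) = 0"
      using phi_range_perp[OF X phi_null_dirs[OF k]] by blast
    then show False using phi_inj[of l k] k pos by simp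
  qed
  then have neg: "lf (f X) (null_vec (phi k)) < 0" using n by simp
  obtain Y where Y: "Y \<in> de_sitter E" "lf Y (null_vec k) = 0" using perp_exists[OF k k] .
  obtain t0 where t0: "0 \<le> t0" "future_le (f X) (f Y + t0 *\<^sub>R null_vec (phi k))"
    using ray_reaches[OF maps[OF X] phi_null_dirs[OF k] neg maps[OF Y(1)] phi_zero[OF k Y]] by blast
  have "ray_image k Y (phi k)" using ray_image_phi k Y by blast
  then obtain t where t: "f (Y + t *\<^sub>R null_vec k) = f Y + t0 *\<^sub>R null_vec (phi k)"
    using t0(1) by (auto simp: ray_image_def)
  have "future_le X (Y + t *\<^sub>R null_vec k)"
    using order_iff[OF X de_sitter_ray[OF subE Y(1) k Y(2)], of t] t0 t by simp
  then have "0 \<le> lf (Y + t *\<^sub>R null_vec k - X) (null_vec k)"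
    unfolding future_le_def using lf_future_cone_nonneg null_vec_future_cone by blast
  then show False using Y pos by (simp add: lf_simps)
qed

lemma phi_sgn:
  assumes "k \<in> null_dirs E" "X \<in> de_sitter E"
  shows "sgn (lf (f X) (null_vec (phi k))) = sgn (lf X (null_vec k))"
  using phi_pos[OF assms] phi_neg[OF assms] phi_zero[OF assms]
  by (cases "lf X (null_vec k)" "0 :: real" rule: linorder_cases) auto

text \<open>\<open>X\<close> and \<open>- X\<close> have the same orthogonal null directions, hence
  so have their images, which then agree up to sign. Injectivity excludes equality.\<close>

lemma f_uminus:
  assumes X: "X \<in> de_sitter E"
  shows "f (- X) = - f X"
proof -
  have X': "- X \<in> de_sitter E" using de_sitter_uminus[OF subE X] .
  have "lf (f (- X)) (null_vec k') = 0" if k': "k' \<in> null_dirs E" "lf (f X) (null_vec k') = 0" for k'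
  proof -
    obtain k where "k \<in> null_dirs E" "phi k = k'" "lf X (null_vec k) = 0" using phi_range_perp[OF X k'] .
    then show ?thesis using phi_zero[of k "- X"] X' by (simp add: lf_simps)
  qed
  then have "f (- X) = f X \<or> f (- X) = - f X"
    using null_perp_determines[OF maps[OF X] maps[OF X']] by blast
  moreover have "f (- X) \<noteq> f X"
  proof
    assume "f (- X) = f X"
    then have "- X = X" using inj X X' by (auto simp: inj_on_def)
    then have "lf X X = - lf X X" by (metis lf_minus_left)
    then show False using de_sitter_norm[OF X] by simp
  qed
  ultimately show ?thesis by blast
qed

text \<open>One of \<open>f X\<close> and \<open>f (- X)\<close> has nonpositive product with
  \<open>null_vec k'\<close>. If it is negative, a ray of direction \<open>k'\<close> enters the
  future of that image point, and a point of the ray there is an image orthogonal to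
  \<open>k'\<close>.\<close>

lemma phi_surj:
  assumes k': "k' \<in> null_dirs E"
  obtains k where "k \<in> null_dirs E" "phi k = k'"
proof -
  obtain X where X: "X \<in> de_sitter E" using perp_exists[OF k' k'] by blast
  obtain P where P: "P \<in> de_sitter E" "lf (f P) (null_vec k') \<le> 0"
  proof (cases "lf (f X) (null_vec k') \<le> 0")
    case True then show ?thesis using that X by blast
  next
    case False
    then have "lf (f (- X)) (null_vec k') \<le> 0" using f_uminus[OF X] by (simp add: lf_simps)
    then show ?thesis using that de_sitter_uminus[OF subE X] by blast
  qed
  show thesis
  proof (cases "lf (f P) (null_vec k') = 0")
    case True then show thesis using phi_range_perp[OF P(1) k'] that by blast
  next
    case False
    then have neg: "lf (f P) (null_vec k') < 0" using P by simp
    obtain Z where Z: "Z \<in> de_sitter E" "lf Z (null_vec k') = 0" using perp_exists[OF k' k'] .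
    obtain t where t: "future_le (f P) (Z + t *\<^sub>R null_vec k')"
      using ray_reaches[OF maps[OF P(1)] k' neg Z] by blast
    obtain Y where Y: "Y \<in> de_sitter E" "f Y = Z + t *\<^sub>R null_vec k'"
      using onto[OF P(1) de_sitter_ray[OF subE Z(1) k' Z(2)] t] by blast
    then have "lf (f Y) (null_vec k') = 0" using Z by (simp add: lf_simps)
    then show thesis using phi_range_perp[OF Y(1) k'] that by blast
  qed
qed

end

section \<open>From spheres to similarities\<close>

text \<open>Rectangles go to rectangles, so \<open>g\<close> is additive on orthogonal vectors.
  Products with \<open>g a\<close> and \<open>g (- a)\<close> always have opposite signs, so
  \<open>g (- a)\<close> is a negative multiple of \<open>g a\<close>; a square with its
  perpendicular diagonals forces the multiple to be \<open>- 1\<close>.\<close>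

lemma (in orth_space) right_angle_odd:
  fixes g :: "'e \<Rightarrow> 'e"
  assumes gE: "\<And>x. x \<in> E \<Longrightarrow> g x \<in> E" and surj: "\<And>y. y \<in> E \<Longrightarrow> \<exists>x\<in>E. g x = y"
    and sg: "\<And>x p q. x \<in> E \<Longrightarrow> p \<in> E \<Longrightarrow> q \<in> E \<Longrightarrow>
      sgn ((g x - g p) \<bullet> (g x - g q)) = sgn ((x - p) \<bullet> (x - q))"
    and g0: "g 0 = 0" and x: "x \<in> E"
  shows "g (- x) = - g x"
proof (cases "x = 0")
  case True then show ?thesis by (simp add: g0)
next
  case False
  have z: "0 \<in> E" using subE by (rule subspace_0)
  have sg0: "sgn (g a \<bullet> g b) = sgn (a \<bullet> b)" if "a \<in> E" "b \<in> E" for a b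
    using sg[OF z that] by (simp add: g0)
  \<comment> \<open>The rectangle with vertices \<open>0\<close>, \<open>a\<close>,
    \<open>a + b\<close> and \<open>b\<close>: the right angles at all four images give the defect
    \<open>g (a + b) - g a - g b\<close> length zero.\<close>
  have rect: "g (a + b) = g a + g b" if ab: "a \<in> E" "b \<in> E" "a \<bullet> b = 0" for a b
  proof -
    have s: "a + b \<in> E" using ab subE by (simp add: subspace_add)
    have ba: "b \<bullet> a = 0" using ab by (simp add: inner_commute)
    have sz: "u = 0" if "sgn u = sgn (0::real)" for u using that by (simp add: sgn_zero_iff)
    have "(g a - g 0) \<bullet> (g a - g (a + b)) = 0"
      by (rule sz, subst sg[OF ab(1) z s]) (use ab in \<open>simp add: inner_simps\<close>)
    then have 1: "g a \<bullet> g (a + b) = g a \<bullet> g a" by (simp add: g0 inner_simps)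
    have "(g b - g 0) \<bullet> (g b - g (a + b)) = 0"
      by (rule sz, subst sg[OF ab(2) z s]) (use ba in \<open>simp add: inner_simps\<close>)
    then have 2: "g b \<bullet> g (a + b) = g b \<bullet> g b" by (simp add: g0 inner_simps)
    have "(g (a + b) - g a) \<bullet> (g (a + b) - g b) = 0"
      by (rule sz, subst sg[OF s ab(1,2)]) (use ba in \<open>simp add: inner_simps\<close>)
    moreover have 3: "g a \<bullet> g b = 0"
      by (rule sz, subst sg0[OF ab(1,2)]) (use ab in simp)
    ultimately have "(g (a + b) - g a - g b) \<bullet> (g (a + b) - g a - g b) = 0"
      using 1 2 by (simp add: inner_simps inner_commute)
    then have "g (a + b) - g a - g b = 0" by (simp only: inner_eq_zero_iff)
    then show ?thesis by (simp add: algebra_simps)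
  qed
  have opp: "\<exists>c>0. g (- a) = - (c *\<^sub>R g a)" if a: "a \<in> E" "a \<noteq> 0" for a
  proof -
    have a': "- a \<in> E" using a subE by (simp add: subspace_neg)
    define A where "A = g a"
    define B where "B = g (- a)"
    have AA: "0 < A \<bullet> A"
      using sg0[OF a(1) a(1)] a unfolding A_def by (metis inner_gt_zero_iff sgn_greater)
    have AE: "A \<in> E" "B \<in> E" using gE a a' by (auto simp: A_def B_def)
    have key: "sgn (w \<bullet> A) = - sgn (w \<bullet> B)" if w: "w \<in> E" for w
    proof -
      obtain v where "v \<in> E" "g v = w" using surj[OF w] by blast
      then show ?thesis using sg0[of v a] sg0[of v "- a"] a a' by (auto simp: A_def B_def sgn_minus)
    qed
    define w where "w = B - (B \<bullet> A / (A \<bullet> A)) *\<^sub>R A"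
    have w: "w \<in> E" "w \<bullet> A = 0"
      using AE subE AA by (auto simp: w_def subspace_diff subspace_scale inner_simps)
    then have "w \<bullet> B = 0" using key[of w] by (simp add: sgn_zero_iff)
    then have "w \<bullet> w = 0" using w(2) by (subst (2) w_def) (simp add: inner_simps)
    then have B: "B = (B \<bullet> A / (A \<bullet> A)) *\<^sub>R A" by (simp add: w_def)
    have "sgn (A \<bullet> B) = - 1" using key[OF AE(1)] AA by simp
    then have "B \<bullet> A < 0" by (simp add: sgn_if inner_commute split: if_splits)
    then have "0 < - (B \<bullet> A / (A \<bullet> A))" using AA by (simp add: divide_neg_pos)
    then show ?thesis using B unfolding A_def B_def
      by (intro exI[of _ "- (g (- a) \<bullet> g a / (g a \<bullet> g a))"]) simp
  qed
  obtain m where m: "m \<in> E" "m \<bullet> m = 1" "m \<bullet> x = 0" using unit_orth[OF x] .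
  \<comment> \<open>\<open>x\<close> and \<open>y\<close> have equal length, so \<open>x + y\<close>
    is orthogonal to \<open>x - y\<close> and to \<open>- x + y\<close>, and \<open>- x - y\<close>
    to \<open>x - y\<close>. The images of these relations determine the factors \<open>a\<close>
    and \<open>c\<close>.\<close>
  define y where "y = norm x *\<^sub>R m"
  have y: "y \<in> E" "y \<bullet> x = 0" "x \<bullet> y = 0" "y \<bullet> y = x \<bullet> x"
    using m subE by (auto simp: y_def subspace_scale inner_commute dot_square_norm power2_eq_square)
  have "y \<noteq> 0" using y(4) False by auto
  define A where "A = g x"
  define C where "C = g y"
  obtain a where a: "0 < a" "g (- x) = - (a *\<^sub>R A)" using opp[OF x False] by (auto simp: A_def)
  obtain c where c: "0 < c" "g (- y) = - (c *\<^sub>R C)" using opp[OF y(1) \<open>y \<noteq> 0\<close>] by (auto simp: C_def)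
  have mE: "- x \<in> E" "- y \<in> E" using x y subE by (auto simp: subspace_neg)
  have sz: "u = 0" if "sgn u = sgn (0::real)" for u using that by (simp add: sgn_zero_iff)
  have AC: "A \<bullet> C = 0" "C \<bullet> A = 0"
    using sg0[OF x y(1)] y by (auto simp: A_def C_def sgn_zero_iff inner_commute)
  have r: "g (x + y) = A + C" "g (x + - y) = A + - (c *\<^sub>R C)" "g (- x + y) = - (a *\<^sub>R A) + C"
    "g (- x + - y) = - (a *\<^sub>R A) + - (c *\<^sub>R C)"
    using rect[OF x y(1,3)] rect[OF x mE(2)] rect[OF mE(1) y(1)] rect[OF mE] y a c
    by (auto simp: A_def C_def)
  have sE: "x + y \<in> E" "x + - y \<in> E" "- x + y \<in> E" "- x + - y \<in> E"
    using x y mE subE by (simp_all only: subspace_add)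
  have 1: "g (x + y) \<bullet> g (x + - y) = 0"
    by (rule sz, subst sg0[OF sE(1,2)]) (simp add: inner_simps y)
  have 2: "g (x + y) \<bullet> g (- x + y) = 0"
    by (rule sz, subst sg0[OF sE(1,3)]) (simp add: inner_simps y)
  have 3: "g (- x + - y) \<bullet> g (x + - y) = 0"
    by (rule sz, subst sg0[OF sE(4,2)]) (simp add: inner_simps y)
  have e1: "A \<bullet> A = c * (C \<bullet> C)" using 1 unfolding r by (simp add: inner_simps AC)
  have e2: "C \<bullet> C = a * (A \<bullet> A)" using 2 unfolding r by (simp add: inner_simps AC)
  have e3: "c * (c * (C \<bullet> C)) = a * (A \<bullet> A)" using 3 unfolding r by (simp add: inner_simps AC)
  have "0 < A \<bullet> A"
    using sg0[OF x x] False unfolding A_def by (metis inner_gt_zero_iff sgn_greater)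
  then have CC: "0 < C \<bullet> C" using e2 a by simp
  have "(c * c - 1) * (C \<bullet> C) = 0" using e2 e3 by (simp add: algebra_simps)
  then have "c * c = 1" using CC by simp
  then have "c = 1" using c by (simp add: square_eq_1_iff)
  then have "(a - 1) * (A \<bullet> A) = 0" using e1 e2 by (simp add: algebra_simps)
  then have "a = 1" using \<open>0 < A \<bullet> A\<close> by simp
  then show ?thesis using a by (simp add: A_def)
qed

text \<open>Central symmetry at every point means that midpoints are preserved, which gives
  additivity. Real homogeneity follows because \<open>h - h 0\<close> is monotone in the norm, which
  excludes the irregular solutions of Cauchy's equation.\<close>

lemma (in orth_space) right_angle_similarity:
  fixes h :: "'e \<Rightarrow> 'e"
  assumes hE: "\<And>x. x \<in> E \<Longrightarrow> h x \<in> E" and surj: "\<And>y. y \<in> E \<Longrightarrow> \<exists>x\<in>E. h x = y"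
    and sg: "\<And>x p q. x \<in> E \<Longrightarrow> p \<in> E \<Longrightarrow> q \<in> E \<Longrightarrow>
      sgn ((h x - h p) \<bullet> (h x - h q)) = sgn ((x - p) \<bullet> (x - q))"
  obtains c where "0 < c" "\<And>x y. x \<in> E \<Longrightarrow> y \<in> E \<Longrightarrow> h (x + y) - h 0 = (h x - h 0) + (h y - h 0)"
    "\<And>x r. x \<in> E \<Longrightarrow> h (r *\<^sub>R x) - h 0 = r *\<^sub>R (h x - h 0)"
    "\<And>x. x \<in> E \<Longrightarrow> norm (h x - h 0) = c * norm x"
proof -
  have z0: "0 \<in> E" using subE by (rule subspace_0)
  have odd: "h (z - x) = 2 *\<^sub>R h z - h (z + x)" if z: "z \<in> E" and x: "x \<in> E" for z x
  proof -
    define g where "g x = h (z + x) - h z" for x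
    have "g (- x) = - g x"
    proof (rule right_angle_odd[of g])
      show "g y \<in> E" if "y \<in> E" for y
        using that z hE subE by (simp add: g_def subspace_add subspace_diff)
      show "\<exists>x\<in>E. g x = y" if "y \<in> E" for y
      proof -
        have "y + h z \<in> E" using that z hE subE by (simp add: subspace_add)
        then obtain u where u: "u \<in> E" "h u = y + h z" using surj by blast
        have "u - z \<in> E" using u z subE by (simp add: subspace_diff)
        moreover have "g (u - z) = y" using u by (simp add: g_def)
        ultimately show ?thesis by blast
      qed
      show "sgn ((g x - g p) \<bullet> (g x - g q)) = sgn ((x - p) \<bullet> (x - q))"
        if "x \<in> E" "p \<in> E" "q \<in> E" for x p q
        using sg[of "z + x" "z + p" "z + q"] that z subE by (simp add: g_def subspace_add)
      show "g 0 = 0" by (simp add: g_def)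
    qed (rule x)
    then show ?thesis by (simp add: g_def scaleR_2 algebra_simps)
  qed
  define g where "g x = h x - h 0" for x
  have gE: "g x \<in> E" if "x \<in> E" for x using that z0 hE subE by (simp add: g_def subspace_diff)
  have add: "g (x + y) = g x + g y" if xy: "x \<in> E" "y \<in> E" for x y
  proof -
    define w where "w = (1 / 2) *\<^sub>R (x + y)"
    define d where "d = (1 / 2) *\<^sub>R (x - y)"
    have w: "w \<in> E" "d \<in> E" using xy subE by (auto simp: w_def d_def subspace_scale subspace_add subspace_diff)
    have e: "w - d = y" "w + d = x" "w + w = x + y"
      by (auto simp: w_def d_def algebra_simps) (simp_all add: scaleR_add_left[symmetric] del: scaleR_half_double)
    have "h y = 2 *\<^sub>R h w - h x" using odd[OF w] by (simp add: e)
    moreover have "h 0 = 2 *\<^sub>R h w - h (x + y)" using odd[OF w(1,1)] by (simp add: e)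
    ultimately show ?thesis by (simp add: g_def)
  qed
  have g0: "g 0 = 0" by (simp add: g_def)
  have neg: "g (- x) = - g x" if "x \<in> E" for x
    using odd[OF z0 that] by (simp add: g_def scaleR_2)
  have nat: "g (real n *\<^sub>R x) = real n *\<^sub>R g x" if x: "x \<in> E" for n x
  proof (induction n)
    case 0 then show ?case by (simp add: g0)
  next
    case (Suc n)
    have "real n *\<^sub>R x \<in> E" using x subE by (simp add: subspace_scale)
    then show ?case using add[OF x, of "real n *\<^sub>R x"] Suc by (simp add: scaleR_add_left)
  qed
  have int: "g (of_int k *\<^sub>R x) = of_int k *\<^sub>R g x" if x: "x \<in> E" for k x
  proof (cases k)
    case (nonneg n) then show ?thesis using nat[OF x] by simp
  next
    case (neg n)
    have "real (Suc n) *\<^sub>R x \<in> E" using x subE by (simp add: subspace_scale)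
    then have "g (- (real (Suc n) *\<^sub>R x)) = - (real (Suc n) *\<^sub>R g x)"
      using \<open>\<And>x. x \<in> E \<Longrightarrow> g (- x) = - g x\<close> nat[OF x] by metis
    then show ?thesis using neg by (simp only: of_int_minus of_int_of_nat_eq scaleR_minus_left)
  qed
  \<comment> \<open>Thales for the segment from \<open>- x\<close> to \<open>x\<close>: the sign of
    \<open>(y - x) \<bullet> (y + x)\<close> compares the lengths of \<open>y\<close> and
    \<open>x\<close>.\<close>
  have nrm: "sgn (g y \<bullet> g y - g x \<bullet> g x) = sgn (y \<bullet> y - x \<bullet> x)" if "x \<in> E" "y \<in> E" for x y
  proof -
    have "- x \<in> E" using that subE by (simp add: subspace_neg)
    then have "sgn ((h y - h x) \<bullet> (h y - h (- x))) = sgn ((y - x) \<bullet> (y - - x))"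
      using sg that by blast
    moreover have "h y - h x = g y - g x" "h y - h (- x) = g y + g x"
      using neg[of x] that by (auto simp: g_def algebra_simps)
    ultimately show ?thesis by (simp add: inner_simps inner_commute)
  qed
  have le: "norm (g y) \<le> norm (g x)" if "x \<in> E" "y \<in> E" "norm y \<le> norm x" for x y
  proof -
    have "y \<bullet> y \<le> x \<bullet> x" using that(3) by (simp add: norm_le)
    then have "sgn (y \<bullet> y - x \<bullet> x) \<le> 0" by (simp add: sgn_if)
    then have "sgn (g y \<bullet> g y - g x \<bullet> g x) \<le> 0" using nrm[OF that(1,2)] by simp
    then have "g y \<bullet> g y \<le> g x \<bullet> g x" by (simp add: sgn_if split: if_splits)
    then show ?thesis by (simp add: norm_le)
  qed
  \<comment> \<open>By additivity, \<open>N\<close> times the defect of homogeneity at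
    \<open>r\<close> is the defect at the fractional part \<open>d\<close> of \<open>N * r\<close>,
    which is at most \<open>2 * norm (g x)\<close>. A large \<open>N\<close> gives a
    contradiction.\<close>
  have scale: "g (r *\<^sub>R x) = r *\<^sub>R g x" if x: "x \<in> E" for r x
  proof (rule ccontr)
    assume "\<not> ?thesis"
    then have pos: "0 < norm (g (r *\<^sub>R x) - r *\<^sub>R g x)" by simp
    obtain N :: nat where N: "2 * norm (g x) < real N * norm (g (r *\<^sub>R x) - r *\<^sub>R g x)"
      using reals_Archimedean3[OF pos] by blast
    define k where "k = \<lfloor>real N * r\<rfloor>"
    define d where "d = real N * r - of_int k"
    have d: "0 \<le> d" "d \<le> 1" by (auto simp: d_def k_def) linarith
    have sE: "c *\<^sub>R x \<in> E" for c using x subE by (simp add: subspace_scale)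
    have "real N *\<^sub>R g (r *\<^sub>R x) = g (d *\<^sub>R x + of_int k *\<^sub>R x)"
      using nat[OF sE[of r], of N] by (simp add: d_def scaleR_add_left[symmetric])
    also have "\<dots> = g (d *\<^sub>R x) + of_int k *\<^sub>R g x" using add[OF sE sE] int[OF x] by simp
    finally have "real N *\<^sub>R (g (r *\<^sub>R x) - r *\<^sub>R g x) = g (d *\<^sub>R x) - d *\<^sub>R g x"
      by (simp add: d_def algebra_simps)
    then have "real N * norm (g (r *\<^sub>R x) - r *\<^sub>R g x) = norm (g (d *\<^sub>R x) - d *\<^sub>R g x)"
      by (metis abs_of_nat norm_scaleR)
    also have "\<dots> \<le> norm (g (d *\<^sub>R x)) + norm (d *\<^sub>R g x)" by (rule norm_triangle_ineq4)
    also have "\<dots> \<le> norm (g x) + norm (g x)"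
    proof (rule add_mono)
      have "norm (d *\<^sub>R x) \<le> norm x" using d by (simp add: mult_left_le_one_le)
      then show "norm (g (d *\<^sub>R x)) \<le> norm (g x)" using le[OF x sE] by blast
      show "norm (d *\<^sub>R g x) \<le> norm (g x)" using d by (simp add: mult_left_le_one_le)
    qed
    finally show False using N by simp
  qed
  obtain m where m: "m \<in> E" "m \<bullet> m = 1" using unit_orth[OF z0] by blast
  have m1: "norm m = 1" using m by (simp add: norm_eq_1)
  define c where "c = norm (g m)"
  have "0 < c"
  proof -
    have "sgn (g m \<bullet> g m - g 0 \<bullet> g 0) = sgn (m \<bullet> m - 0 \<bullet> (0::'e))" by (rule nrm[OF z0 m(1)])
    then have "sgn (g m \<bullet> g m) = 1" using m by (simp add: g0)
    then show ?thesis by (auto simp: c_def)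
  qed
  moreover have "norm (g x) = c * norm x" if x: "x \<in> E" for x
  proof (cases "x = 0")
    case True then show ?thesis by (simp add: g0)
  next
    case False
    define e where "e = (1 / norm x) *\<^sub>R x"
    have e: "e \<in> E" "norm e = 1" "x = norm x *\<^sub>R e" using x subE False by (auto simp: e_def subspace_scale)
    have "norm (g e) = c" unfolding c_def using le[OF e(1) m(1)] le[OF m(1) e(1)] e m1 by (intro antisym) auto
    moreover have "g x = norm x *\<^sub>R g e" using scale[OF e(1), of "norm x"] e(3) by simp
    ultimately show ?thesis by simp
  qed
  ultimately show thesis using that[of c] add scale by (simp add: g_def)
qed

text \<open>In the ball with centre \<open>(1 / s) *\<^sub>R v\<close> and radius
  \<open>1 / s\<close>, the point \<open>(1 / s) *\<^sub>R (v + m)\<close> is farthest in direction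
  \<open>m\<close>. As the half-space contains \<open>p\<close>, it contains that point too, which
  is then \<open>p\<close> by uniqueness.\<close>

lemma (in orth_space) sphere_touching:
  assumes P: "(s, v, u) \<in> de_sitter E" "0 < s" and H: "m \<in> E" "m \<bullet> m = 1"
    and p: "lf (s, v, u) (null_vec (Some p)) = 0" "lf (0, m, a) (null_vec (Some p)) = 0"
    and uniq: "\<And>x. x \<in> E \<Longrightarrow> lf (s, v, u) (null_vec (Some x)) \<le> 0 \<Longrightarrow> lf (0, m, a) (null_vec (Some x)) \<le> 0 \<Longrightarrow> x = p"
  shows "p = (1 / s) *\<^sub>R (v + m)"
proof -
  have a: "v \<in> E" "v \<bullet> v = 1 + s * u" using P by (auto simp: de_sitter_def)
  have sph: "s * lf (s, v, u) (null_vec (Some x)) = (s *\<^sub>R x - v) \<bullet> (s *\<^sub>R x - v) - 1" for x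
    using a(2) by (simp add: inner_simps inner_commute algebra_simps)
  define y where "y = (1 / s) *\<^sub>R (v + m)"
  have y: "s *\<^sub>R y = v + m" using P by (simp add: y_def)
  have "y \<in> E" using a H subE by (simp add: y_def subspace_scale subspace_add)
  moreover have "lf (s, v, u) (null_vec (Some y)) = 0"
    using sph[of y] P(2) H by (simp add: y)
  moreover have "lf (0, m, a) (null_vec (Some y)) \<le> 0"
  proof -
    have "(s *\<^sub>R p - v) \<bullet> (s *\<^sub>R p - v) = 1" using sph[of p] p by simp
    then have n: "norm (s *\<^sub>R p - v) = 1" by (simp add: norm_eq_1)
    have "m \<bullet> (s *\<^sub>R p - v) \<le> norm m * norm (s *\<^sub>R p - v)" by (rule norm_cauchy_schwarz)
    also have "\<dots> = 1" using n H by (simp add: norm_eq_1[symmetric])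
    finally have "s * (m \<bullet> p) \<le> m \<bullet> v + 1" by (simp add: inner_simps)
    also have "\<dots> = m \<bullet> (s *\<^sub>R y)" using H by (simp add: y inner_simps)
    also have "\<dots> = s * (m \<bullet> y)" by simp
    finally have "m \<bullet> p \<le> m \<bullet> y" using P(2) by simp
    then show ?thesis using p by simp
  qed
  ultimately have "y = p" using uniq by simp
  then show ?thesis by (simp add: y_def)
qed

lemma (in orth_space) de_sitter_nonzero_null:
  assumes "X \<in> de_sitter E"
  obtains k where "k \<in> null_dirs E" "lf X (null_vec k) \<noteq> 0"
proof -
  obtain s v u where X: "X = (s, v, u)" by (cases X)
  have a: "v \<in> E" "v \<bullet> v = 1 + s * u" using assms by (auto simp: X de_sitter_def)
  show thesis
  proof (cases "s = 0")
    case False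
    then show thesis using that[of None] by (simp add: X null_dirs_def)
  next
    case True
    have "lf X (null_vec (Some (((u + 1) / 2) *\<^sub>R v))) = - 1"
      using a True by (simp add: X field_simps)
    moreover have "Some (((u + 1) / 2) *\<^sub>R v) \<in> null_dirs E" using a subE by (simp add: null_dirs_def subspace_scale)
    ultimately show thesis using that by force
  qed
qed

section \<open>Conal maps that fix the null direction at infinity\<close>

context de_sitter_conal
begin

text \<open>The formula comes from the linear map that sends \<open>null_vec (Some p)\<close> to a
  multiple of \<open>null_vec (Some (g p + b))\<close>; the factor \<open>1 / c\<close> makes it
  preserve \<open>lf\<close>. It is forced once \<open>phi\<close> is known to be the similarity
  \<open>p \<mapsto> g p + b\<close> on finite directions.\<close>

lemma fixing_infinity:
  assumes fixinf: "phi None = None"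
  obtains c b g where "0 < c" "b \<in> E" "\<And>x. x \<in> E \<Longrightarrow> g x \<in> E"
    "\<And>x y. x \<in> E \<Longrightarrow> y \<in> E \<Longrightarrow> g (x + y) = g x + g y"
    "\<And>x r. x \<in> E \<Longrightarrow> g (r *\<^sub>R x) = r *\<^sub>R g x"
    "\<And>x. x \<in> E \<Longrightarrow> norm (g x) = c * norm x"
    "\<And>s v u. (s, v, u) \<in> de_sitter E \<Longrightarrow>
       f (s, v, u) = (1 / c) *\<^sub>R (s, g v + s *\<^sub>R b, c\<^sup>2 * u + 2 * (g v \<bullet> b) + s * (b \<bullet> b))"
proof -
  have N: "None \<in> null_dirs E" by (simp add: null_dirs_def)
  have S: "Some p \<in> null_dirs E \<longleftrightarrow> p \<in> E" for p by (auto simp: null_dirs_def)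
  define h where "h p = the (phi (Some p))" for p
  have h: "phi (Some p) = Some (h p)" "h p \<in> E" if "p \<in> E" for p
  proof -
    have pn: "Some p \<in> null_dirs E" using that by (simp add: null_dirs_def)
    have "phi (Some p) \<noteq> None" using phi_inj[OF pn N] fixinf by auto
    then show 1: "phi (Some p) = Some (h p)" by (auto simp: h_def)
    show "h p \<in> E" using phi_null_dirs[OF pn] S[of "h p"] 1 by simp
  qed
  have hsurj: "\<exists>x\<in>E. h x = y" if y: "y \<in> E" for y
  proof -
    have "Some y \<in> null_dirs E" using y by (simp add: null_dirs_def)
    then obtain k where k: "k \<in> null_dirs E" "phi k = Some y" by (rule phi_surj)
    then obtain x where "k = Some x" "x \<in> E" using fixinf by (auto simp: null_dirs_def)
    then show ?thesis using h[of x] k by auto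
  qed
  have hs: "sgn (lf (f X) (null_vec (Some (h x)))) = sgn (lf X (null_vec (Some x)))" if "X \<in> de_sitter E" "x \<in> E" for X x
    using phi_sgn[of "Some x" X] h[OF that(2)] that S[of x] by simp
  have hinj: "x = y" if "x \<in> E" "y \<in> E" "h x = h y" for x y
    using phi_inj[of "Some x" "Some y"] h[OF that(1)] h[OF that(2)] that S[of x] S[of y] by simp
  have le: "u \<le> 0 \<longleftrightarrow> w \<le> 0" if "sgn u = sgn w" for u w :: real
    using that by (auto simp: sgn_if split: if_splits)
  have sg: "sgn ((h x - h p) \<bullet> (h x - h q)) = sgn ((x - p) \<bullet> (x - q))"
    if x: "x \<in> E" and p: "p \<in> E" and q: "q \<in> E" for x p q
  proof (cases "p = q")
    case True
    show ?thesis
    proof (cases "x = p")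
      case True with \<open>p = q\<close> show ?thesis by simp
    next
      case False
      then have "h x - h p \<noteq> 0" "x - p \<noteq> 0" using hinj x p by auto
      then have "0 < (h x - h p) \<bullet> (h x - h p)" "0 < (x - p) \<bullet> (x - p)"
        using inner_gt_zero_iff by blast+
      then show ?thesis unfolding \<open>p = q\<close>[symmetric] by simp
    qed
  next
    case False
    define rho where "rho = norm (p - q) / 2"
    have rho: "0 < rho" using False by (simp add: rho_def)
    \<comment> \<open>Scaled such that its form at \<open>y\<close> is \<open>1 / rho\<close> times
      \<open>(y - p) \<bullet> (y - q)\<close>: the sign of the form tells whether the angle at
      \<open>y\<close> over the segment is acute, right or obtuse.\<close>
    define X where "X = ((1 / rho), (1 / rho) *\<^sub>R ((1 / 2) *\<^sub>R (p + q)), (1 / rho) * (p \<bullet> q))"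
    have Xe: "X = (1 / rho) *\<^sub>R (1, (1/2) *\<^sub>R (p + q), p \<bullet> q)" by (simp add: X_def)
    have rr: "rho * rho = ((p - q) \<bullet> (p - q)) / 4"
      by (simp add: rho_def dot_square_norm power2_eq_square)
    have X: "X \<in> de_sitter E"
    proof -
      have "rho * rho * lf X X = 2 * (p \<bullet> q) - 2 * (((1/2) *\<^sub>R (p + q)) \<bullet> ((1/2) *\<^sub>R (p + q)))"
        unfolding Xe using rho by (simp only: lf_scale_left lf_scale_right) simp
      also have "\<dots> = - 2 * (rho * rho)" unfolding rr
        by (simp add: inner_simps inner_commute field_simps)
      finally have "rho * rho * lf X X = rho * rho * (- 2)" by simp
      then have "lf X X = - 2" using rho by (metis mult_cancel_left mult_eq_0_iff order_less_irrefl)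
      then show ?thesis using p q subE by (simp add: de_sitter_def X_def subspace_scale subspace_add)
    qed
    have lX: "lf X (null_vec (Some y)) = (1 / rho) * ((y - p) \<bullet> (y - q))" for y
    proof -
      have "lf (1, (1/2) *\<^sub>R (p + q), p \<bullet> q) (null_vec (Some y)) = (y - p) \<bullet> (y - q)"
        by (simp add: inner_simps inner_commute field_simps)
      then show ?thesis unfolding Xe lf_scale_left by simp
    qed
    define m where "m = (1 / (2 * rho)) *\<^sub>R (p - q)"
    have m: "m \<in> E" "m \<bullet> m = 1" "p - q = (2 * rho) *\<^sub>R m"
    proof -
      show "m \<in> E" "p - q = (2 * rho) *\<^sub>R m" using p q subE rho by (auto simp: m_def subspace_scale subspace_diff)
      have "m \<bullet> m = (1 / (2 * rho)) * ((1 / (2 * rho)) * ((p - q) \<bullet> (p - q)))"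
        by (simp only: m_def inner_scaleR_left inner_scaleR_right)
      also have "(p - q) \<bullet> (p - q) = 4 * (rho * rho)" using rr by simp
      finally show "m \<bullet> m = 1" using rho by simp
    qed
    txt \<open>
      \<open>X\<close> is the ball with diameter \<open>[p, q]\<close>, and \<open>Hp\<close>, \<open>Hq\<close> are the outer half-spaces tangent to it at \<open>p\<close> and \<open>q\<close>.
      The half-spaces are disjoint, and each meets the ball in one point. Both properties pass to the
      images, so the images of \<open>p\<close> and \<open>q\<close> are antipodal.
    \<close>
    define Hp where "Hp = (0::real, m, 2 * (m \<bullet> p))"
    define Hq where "Hq = (0::real, - m, - 2 * (m \<bullet> q))"
    have Hp: "Hp \<in> de_sitter E" and Hq: "Hq \<in> de_sitter E" using m subE by (auto simp: Hp_def Hq_def de_sitter_def subspace_neg)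
    have lHp: "lf Hp (null_vec (Some y)) = 2 * (m \<bullet> p - m \<bullet> y)"
      and lHq: "lf Hq (null_vec (Some y)) = 2 * (m \<bullet> y - m \<bullet> q)" for y
      by (auto simp: Hp_def Hq_def)
    obtain s v u where fX: "f X = (s, v, u)" by (cases "f X")
    have s: "0 < s"
    proof -
      have "0 < lf X (null_vec None)" using rho by (simp add: X_def)
      then have "0 < lf (f X) (null_vec None)" using phi_pos[OF N X] fixinf by simp
      then show ?thesis by (simp add: fX)
    qed
    have dX: "(s, v, u) \<in> de_sitter E" using maps[OF X] fX by simp
    obtain s1 m1 a1 where fHp0: "f Hp = (s1, m1, a1)" by (cases "f Hp")
    obtain s2 m2 a2 where fHq0: "f Hq = (s2, m2, a2)" by (cases "f Hq")
    have "lf Hp (null_vec None) = 0" by (simp add: Hp_def)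
    then have "lf (f Hp) (null_vec None) = 0" using phi_zero[OF N Hp] fixinf by simp
    then have "s1 = 0" by (simp add: fHp0)
    then have fHp: "f Hp = (0, m1, a1)" using fHp0 by simp
    have "lf Hq (null_vec None) = 0" by (simp add: Hq_def)
    then have "lf (f Hq) (null_vec None) = 0" using phi_zero[OF N Hq] fixinf by simp
    then have "s2 = 0" by (simp add: fHq0)
    then have fHq: "f Hq = (0, m2, a2)" using fHq0 by simp
    have m12: "m1 \<in> E" "m1 \<bullet> m1 = 1" "m2 \<in> E" "m2 \<bullet> m2 = 1"
      using maps[OF Hp] maps[OF Hq] by (auto simp: fHp fHq de_sitter_def)
    have mpq: "m \<bullet> p - m \<bullet> q = 2 * rho" using m(2) by (simp add: m(3) flip: inner_diff_right)
    have uniq_p: "y = h p" if y: "y \<in> E" "lf (s, v, u) (null_vec (Some y)) \<le> 0" "lf (0, m1, a1) (null_vec (Some y)) \<le> 0" for y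
    proof -
      obtain x where x: "x \<in> E" "h x = y" using hsurj y by blast
      have "lf X (null_vec (Some x)) \<le> 0" using le[OF hs[OF X x(1)]] y x by (simp add: fX)
      then have 1: "(x - p) \<bullet> (x - q) \<le> 0" using rho by (simp del: null_vec_simps add: lX divide_le_0_iff)
      have "lf Hp (null_vec (Some x)) \<le> 0" using le[OF hs[OF Hp x(1)]] y x by (simp add: fHp)
      then have "0 \<le> m \<bullet> (x - p)" by (simp del: null_vec_simps add: lHp inner_simps)
      then have "0 \<le> (2 * rho) * (m \<bullet> (x - p))" using rho by simp
      then have "0 \<le> (p - q) \<bullet> (x - p)" using m(3) by simp
      then have "(x - p) \<bullet> (x - p) \<le> 0" using 1 by (simp add: inner_simps inner_commute)
      then have "x = p" using inner_self_le_0[of "x - p"] by simp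
      then show ?thesis using x by simp
    qed
    have uniq_q: "y = h q" if y: "y \<in> E" "lf (s, v, u) (null_vec (Some y)) \<le> 0" "lf (0, m2, a2) (null_vec (Some y)) \<le> 0" for y
    proof -
      obtain x where x: "x \<in> E" "h x = y" using hsurj y by blast
      have "lf X (null_vec (Some x)) \<le> 0" using le[OF hs[OF X x(1)]] y x by (simp add: fX)
      then have 1: "(x - p) \<bullet> (x - q) \<le> 0" using rho by (simp del: null_vec_simps add: lX divide_le_0_iff)
      have "lf Hq (null_vec (Some x)) \<le> 0" using le[OF hs[OF Hq x(1)]] y x by (simp add: fHq)
      then have "m \<bullet> (x - q) \<le> 0" by (simp del: null_vec_simps add: lHq inner_simps)
      then have "(2 * rho) * (m \<bullet> (x - q)) \<le> 0" using rho by (simp add: mult_nonneg_nonpos)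
      then have "(p - q) \<bullet> (x - q) \<le> 0" using m(3) by simp
      then have "(x - q) \<bullet> (x - q) \<le> 0" using 1 by (simp add: inner_simps inner_commute)
      then have "x = q" using inner_self_le_0[of "x - q"] by simp
      then show ?thesis using x by simp
    qed
    have opp: "m2 = - m1"
    proof (rule ccontr)
      assume "m2 \<noteq> - m1"
      then have "0 < (m1 + m2) \<bullet> (m1 + m2)" by (simp add: add_eq_0_iff)
      then have mm: "0 < 1 + m1 \<bullet> m2" using m12 by (simp add: inner_simps inner_commute)
      \<comment> \<open>If the normals were not opposite, the image half-spaces would meet at a
        multiple of \<open>m1 + m2\<close>; this \<open>t\<close> is large enough for both. The
        preimage would lie in \<open>Hp\<close> and in \<open>Hq\<close>, which are separated by
        \<open>2 * rho\<close>.\<close>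
      define t where "t = (\<bar>a1\<bar> + \<bar>a2\<bar>) / (1 + m1 \<bullet> m2)"
      have t: "t * (1 + m1 \<bullet> m2) = \<bar>a1\<bar> + \<bar>a2\<bar>" using mm by (simp add: t_def)
      define y where "y = t *\<^sub>R (m1 + m2)"
      have yE: "y \<in> E" using m12 subE by (simp add: y_def subspace_scale subspace_add)
      then obtain x where x: "x \<in> E" "h x = y" using hsurj by blast
      have "lf (f Hp) (null_vec (Some y)) = a1 - 2 * (t * (1 + m1 \<bullet> m2))"
        "lf (f Hq) (null_vec (Some y)) = a2 - 2 * (t * (1 + m1 \<bullet> m2))"
        using m12 by (auto simp: fHp fHq y_def inner_simps inner_commute)
      then have e: "lf (f Hp) (null_vec (Some y)) = a1 - 2 * (\<bar>a1\<bar> + \<bar>a2\<bar>)"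
        "lf (f Hq) (null_vec (Some y)) = a2 - 2 * (\<bar>a1\<bar> + \<bar>a2\<bar>)" unfolding t .
      have "lf (f Hp) (null_vec (Some y)) \<le> 0" "lf (f Hq) (null_vec (Some y)) \<le> 0"
        unfolding e by (auto simp: abs_if)
      then have "lf Hp (null_vec (Some x)) \<le> 0" "lf Hq (null_vec (Some x)) \<le> 0"
        using le[OF hs[OF Hp x(1)]] le[OF hs[OF Hq x(1)]] x by auto
      then show False using mpq rho by (simp del: null_vec_simps add: lHp lHq)
    qed
    have zp: "lf (s, v, u) (null_vec (Some (h p))) = 0" "lf (0, m1, a1) (null_vec (Some (h p))) = 0"
      using hs[OF X p] hs[OF Hp p] unfolding fX fHp lX lHp by (auto simp: sgn_zero_iff)
    have zq: "lf (s, v, u) (null_vec (Some (h q))) = 0" "lf (0, m2, a2) (null_vec (Some (h q))) = 0"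
      using hs[OF X q] hs[OF Hq q] unfolding fX fHq lX lHq by (auto simp: sgn_zero_iff)
    have hp: "h p = (1 / s) *\<^sub>R (v + m1)" by (rule sphere_touching[OF dX s m12(1,2) zp uniq_p])
    have hq: "h q = (1 / s) *\<^sub>R (v + m2)" by (rule sphere_touching[OF dX s m12(3,4) zq uniq_q])
    have vv: "v \<bullet> v = 1 + s * u" using dX by (simp add: de_sitter_def)
    define y where "y = h x"
    \<comment> \<open>With antipodal contact points the image ball has the segment from
      \<open>h p\<close> to \<open>h q\<close> as a diameter, so its form again gives the sign of
      the angle.\<close>
    have "(s * s) * ((y - h p) \<bullet> (y - h q)) = (s *\<^sub>R (y - h p)) \<bullet> (s *\<^sub>R (y - h q))" by simp
    also have "s *\<^sub>R (y - h p) = s *\<^sub>R y - (v + m1)" using s by (simp add: hp algebra_simps)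
    also have "s *\<^sub>R (y - h q) = s *\<^sub>R y - (v + m2)" using s by (simp add: hq algebra_simps)
    also have "(s *\<^sub>R y - (v + m1)) \<bullet> (s *\<^sub>R y - (v + m2)) = s * s * (y \<bullet> y) + v \<bullet> v - 1 - 2 * s * (v \<bullet> y)"
      using m12 by (simp add: opp inner_simps inner_commute algebra_simps)
    also have "\<dots> = s * lf (s, v, u) (null_vec (Some y))" by (simp add: vv algebra_simps)
    finally have "(s * s) * ((y - h p) \<bullet> (y - h q)) = s * lf (f X) (null_vec (Some (h x)))"
      by (simp add: fX y_def)
    then have "sgn ((y - h p) \<bullet> (y - h q)) = sgn (lf (f X) (null_vec (Some (h x))))"
      using s by (metis mult_pos_pos mult_1 sgn_mult sgn_pos)
    also have "\<dots> = sgn ((1 / rho) * ((x - p) \<bullet> (x - q)))" unfolding hs[OF X x] lX ..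
    also have "\<dots> = sgn ((x - p) \<bullet> (x - q))" using rho by (simp add: sgn_mult)
    finally show ?thesis by (simp add: y_def)
  qed
  obtain c where c: "0 < c" "\<And>x y. x \<in> E \<Longrightarrow> y \<in> E \<Longrightarrow> h (x + y) - h 0 = (h x - h 0) + (h y - h 0)"
    "\<And>x r. x \<in> E \<Longrightarrow> h (r *\<^sub>R x) - h 0 = r *\<^sub>R (h x - h 0)"
    "\<And>x. x \<in> E \<Longrightarrow> norm (h x - h 0) = c * norm x"
    using right_angle_similarity[of h] h(2) hsurj sg by blast
  define g where "g x = h x - h 0" for x
  define b where "b = h 0"
  have z0: "0 \<in> E" using subE by (rule subspace_0)
  have bE: "b \<in> E" using h z0 by (simp add: b_def)
  have gE: "g x \<in> E" if "x \<in> E" for x using that z0 h subE by (simp add: g_def subspace_diff)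
  have gadd: "g (x + y) = g x + g y" if "x \<in> E" "y \<in> E" for x y using c(2) that by (simp add: g_def)
  have gsc: "g (r *\<^sub>R x) = r *\<^sub>R g x" if "x \<in> E" for r x using c(3) that by (simp add: g_def)
  have gn: "norm (g x) = c * norm x" if "x \<in> E" for x using c(4) that by (simp add: g_def)
  have gg: "g x \<bullet> g x = c * c * (x \<bullet> x)" if "x \<in> E" for x
    using gn[OF that] by (simp add: dot_square_norm power2_eq_square)
  have gi: "g x \<bullet> g y = c * c * (x \<bullet> y)" if "x \<in> E" "y \<in> E" for x y
  proof -
    have "g (x + y) \<bullet> g (x + y) = c * c * ((x + y) \<bullet> (x + y))" using gg that subE by (simp add: subspace_add)
    then show ?thesis using gg[OF that(1)] gg[OF that(2)]
      by (simp add: gadd[OF that] inner_simps inner_commute algebra_simps)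
  qed
  have "f (s, v, u) = (1 / c) *\<^sub>R (s, g v + s *\<^sub>R b, c\<^sup>2 * u + 2 * (g v \<bullet> b) + s * (b \<bullet> b))"
    if X: "(s, v, u) \<in> de_sitter E" for s v u
  proof -
    define Y where "Y = (1 / c) *\<^sub>R (s, g v + s *\<^sub>R b, c\<^sup>2 * u + 2 * (g v \<bullet> b) + s * (b \<bullet> b))"
    have v: "v \<in> E" "v \<bullet> v = 1 + s * u" using X by (auto simp: de_sitter_def)
    have lN: "lf Y (null_vec None) = (1 / c) * lf (s, v, u) (null_vec None)" by (simp add: Y_def)
    have lS: "lf Y (null_vec (Some (h p))) = c * lf (s, v, u) (null_vec (Some p))" if p: "p \<in> E" for p
    proof -
      have hp: "h p = b + g p" by (simp add: g_def b_def)
      have "c * lf Y (null_vec (Some (h p))) =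
          s * (h p \<bullet> h p) + (c * c * u + 2 * (g v \<bullet> b) + s * (b \<bullet> b)) - 2 * ((g v + s *\<^sub>R b) \<bullet> h p)"
        unfolding Y_def lf_scale_left using c(1) by (simp add: power2_eq_square)
      also have "\<dots> = s * (g p \<bullet> g p) + c * c * u - 2 * (g v \<bullet> g p)"
        unfolding hp by (simp add: inner_simps inner_commute algebra_simps)
      also have "\<dots> = c * (c * lf (s, v, u) (null_vec (Some p)))"
        using gi[OF v(1) p] gg[OF p] by (simp add: algebra_simps)
      finally show ?thesis using c(1) by simp
    qed
    have YE: "Y \<in> de_sitter E"
    proof -
      have "c * c * lf Y Y = 2 * (s * (c * c * u + 2 * (g v \<bullet> b) + s * (b \<bullet> b)) - (g v + s *\<^sub>R b) \<bullet> (g v + s *\<^sub>R b))"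
        unfolding Y_def lf_scale_left lf_scale_right using c(1) by (simp add: power2_eq_square)
      also have "\<dots> = 2 * (c * c * (s * u) - g v \<bullet> g v)" by (simp add: inner_simps inner_commute algebra_simps)
      also have "\<dots> = c * c * (- 2)" using gg[OF v(1)] v by (simp add: algebra_simps)
      finally have "lf Y Y = - 2" using c(1) by (metis mult_cancel_left mult_eq_0_iff order_less_irrefl)
      then show ?thesis using gE bE v subE by (simp add: de_sitter_def Y_def subspace_scale subspace_add)
    qed
    \<comment> \<open>\<open>Y\<close> has the signs that \<open>phi_sgn\<close> gives for
      \<open>f (s, v, u)\<close>. Equal zero sets yield equality up to sign, and a null direction
      with nonzero value then fixes the sign.\<close>
    have sgk: "sgn (lf Y (null_vec (phi k))) = sgn (lf (s, v, u) (null_vec k))" if k: "k \<in> null_dirs E" for k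
    proof (cases k)
      case None then show ?thesis using lN c(1) fixinf by (simp add: sgn_mult)
    next
      case (Some p)
      then have "p \<in> E" using k S by simp
      then show ?thesis using lS h c(1) by (simp add: Some sgn_mult)
    qed
    have "f (s, v, u) = Y \<or> f (s, v, u) = - Y"
    proof (rule null_perp_determines[OF YE maps[OF X]])
      fix k' assume k': "k' \<in> null_dirs E" "lf Y (null_vec k') = 0"
      obtain k where k: "k \<in> null_dirs E" "phi k = k'" using phi_surj[OF k'(1)] .
      then have "lf (s, v, u) (null_vec k) = 0" using sgk[OF k(1)] k' by (simp add: sgn_zero_iff)
      then show "lf (f (s, v, u)) (null_vec k') = 0" using phi_zero[OF k(1) X] k by simp
    qed
    moreover have "f (s, v, u) \<noteq> - Y"
    proof
      assume e: "f (s, v, u) = - Y"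
      obtain k where k: "k \<in> null_dirs E" "lf (s, v, u) (null_vec k) \<noteq> 0" using de_sitter_nonzero_null[OF X] .
      have "sgn (lf (- Y) (null_vec (phi k))) = sgn (lf Y (null_vec (phi k)))"
        using sgk[OF k(1)] phi_sgn[OF k(1) X] e by simp
      then have "lf Y (null_vec (phi k)) = 0" by (simp add: lf_simps sgn_minus sgn_zero_iff)
      then show False using sgk[OF k(1)] k by (simp add: sgn_zero_iff)
    qed
    ultimately show ?thesis by (simp add: Y_def)
  qed
  then show thesis using that[of c b g] c(1) bE gE gadd gsc gn by blast
qed

end

section \<open>Inversions and the general case\<close>

text \<open>
  On null directions \<open>swp p\<close> is the inversion \<open>x \<mapsto> (p - x) / (norm (x - p))\<^sup>2\<close>, which sends \<open>p\<close> to infinity.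
\<close>

definition swp :: "'e::real_inner \<Rightarrow> real \<times> 'e \<times> real \<Rightarrow> real \<times> 'e \<times> real" where
  "swp p X = (snd (snd X) - 2 * (fst (snd X) \<bullet> p) + fst X * (p \<bullet> p), fst X *\<^sub>R p - fst (snd X), fst X)"

definition swpi :: "'e::real_inner \<Rightarrow> real \<times> 'e \<times> real \<Rightarrow> real \<times> 'e \<times> real" where
  "swpi p X = (snd (snd X), snd (snd X) *\<^sub>R p - fst (snd X), fst X - 2 * (fst (snd X) \<bullet> p) + snd (snd X) * (p \<bullet> p))"

lemma swp_swpi [simp]: "swp p (swpi p X) = X" and swpi_swp [simp]: "swpi p (swp p X) = X"
  by (auto simp: swp_def swpi_def inner_simps prod_eq_iff algebra_simps)

lemma swp_lf: "lf (swp p X) (swp p Y) = lf X Y"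
  by (simp add: swp_def lf_def inner_simps inner_commute algebra_simps)

lemma swp_linear: "swp p (X + Y) = swp p X + swp p Y" "swp p (X - Y) = swp p X - swp p Y"
  "swp p (c *\<^sub>R X) = c *\<^sub>R swp p X"
  by (auto simp: swp_def inner_simps prod_eq_iff algebra_simps)

lemma swp_de_sitter:
  assumes "subspace E" "p \<in> E"
  shows "swp p X \<in> de_sitter E \<longleftrightarrow> X \<in> de_sitter E"
proof -
  have "fst X *\<^sub>R p - fst (snd X) \<in> E \<longleftrightarrow> fst (snd X) \<in> E"
  proof
    assume "fst X *\<^sub>R p - fst (snd X) \<in> E"
    then have "fst X *\<^sub>R p - (fst X *\<^sub>R p - fst (snd X)) \<in> E"
      by (rule subspace_diff[OF assms(1) subspace_scale[OF assms]])
    then show "fst (snd X) \<in> E" by simp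
  qed (use assms in \<open>simp add: subspace_diff subspace_scale\<close>)
  then show ?thesis unfolding de_sitter_def mem_Collect_eq swp_lf by (simp add: swp_def)
qed

text \<open>\<open>swp p\<close> preserves \<open>lf\<close>, so only the choice of the half-cone is
  at stake. It is decided by the first coordinate of the image, which is the product with
  \<open>null_vec (Some p)\<close>, and by the last, which is the old first one.\<close>

lemma swp_future_cone: "swp p X \<in> future_cone \<longleftrightarrow> X \<in> future_cone"
proof -
  have a: "swp p X \<in> future_cone" if X: "X \<in> future_cone" for X and p :: 'a
  proof -
    have "0 \<le> lf X (null_vec (Some p))" using lf_future_cone_nonneg[OF X null_vec_future_cone] .
    then have "0 \<le> fst (swp p X)" by (simp add: swp_def lf_def algebra_simps)
    moreover have "0 \<le> snd (snd (swp p X))" using X by (simp add: swp_def future_cone_def split_beta)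
    moreover have "0 \<le> lf (swp p X) (swp p X)" using lf_self_nonneg[OF X] by (simp add: swp_lf)
    ultimately show ?thesis by (simp add: future_cone_def split_beta lf_def)
  qed
  have b: "X \<in> future_cone" if X: "swp p X \<in> future_cone"
  proof -
    have "0 \<le> lf X X" using lf_self_nonneg[OF X] by (simp add: swp_lf)
    then consider "X \<in> future_cone" | "- X \<in> future_cone" using future_cone_cases by blast
    then show ?thesis
    proof cases
      case 2
      then have "swp p (- X) \<in> future_cone" by (rule a)
      then have "- swp p X \<in> future_cone" using swp_linear(3)[of p "-1" X] by simp
      then have "swp p X = 0" using future_cone_antisym X by blast
      then have "X = swpi p 0" by (metis swpi_swp)
      then show ?thesis by (simp add: swpi_def zero_prod_def)
    qed
  qed
  show ?thesis using a b by blast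
qed

lemma swp_future_le: "future_le (swp p X) (swp p Y) \<longleftrightarrow> future_le X Y"
  by (simp add: future_le_def swp_future_cone flip: swp_linear)

lemma (in de_sitter_conal) swp_conal:
  assumes p: "p \<in> E"
  shows "de_sitter_conal E (swp p \<circ> f)"
proof unfold_locales
  fix X assume X: "X \<in> de_sitter E"
  show "(swp p \<circ> f) X \<in> de_sitter E" using swp_de_sitter[OF subE p] maps[OF X] by simp
  show "(swp p \<circ> f) ` {Y \<in> de_sitter E. future_le X Y} = {Y \<in> de_sitter E. future_le ((swp p \<circ> f) X) Y}"
  proof -
    have "(swp p \<circ> f) ` {Y \<in> de_sitter E. future_le X Y} = swp p ` {Y \<in> de_sitter E. future_le (f X) Y}"
      unfolding fut[OF X, symmetric] image_comp ..
    also have "\<dots> = {Y \<in> de_sitter E. future_le (swp p (f X)) Y}"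
    proof (intro equalityI subsetI)
      fix Y assume Y: "Y \<in> {Y \<in> de_sitter E. future_le (swp p (f X)) Y}"
      then have "swpi p Y \<in> {Y \<in> de_sitter E. future_le (f X) Y}"
        using swp_de_sitter[OF subE p, of "swpi p Y"] swp_future_le[of p "f X" "swpi p Y"] by simp
      then have "swp p (swpi p Y) \<in> swp p ` {Y \<in> de_sitter E. future_le (f X) Y}" by (rule imageI)
      then show "Y \<in> swp p ` {Y \<in> de_sitter E. future_le (f X) Y}" by simp
    qed (auto simp: swp_de_sitter[OF subE p] swp_future_le)
    finally show ?thesis by simp
  qed
next
  show "inj_on (swp p \<circ> f) (de_sitter E)"
    by (rule comp_inj_on[OF inj]) (metis inj_on_inverseI swpi_swp)
qed

text \<open>If \<open>phi\<close> moves infinity to a finite \<open>p\<close>, the composition with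
  \<open>swp p\<close> sends infinity to itself, and the previous formula applies to the
  composition.\<close>

lemma (in de_sitter_conal) classification:
  obtains c b g where "0 < c" "b \<in> E" "\<And>x. x \<in> E \<Longrightarrow> g x \<in> E"
    "\<And>x y. x \<in> E \<Longrightarrow> y \<in> E \<Longrightarrow> g (x + y) = g x + g y"
    "\<And>x r. x \<in> E \<Longrightarrow> g (r *\<^sub>R x) = r *\<^sub>R g x"
    "\<And>x. x \<in> E \<Longrightarrow> norm (g x) = c * norm x"
    "(\<forall>(s, v, u)\<in>de_sitter E.
       f (s, v, u) = (1 / c) *\<^sub>R (s, g v + s *\<^sub>R b, c\<^sup>2 * u + 2 * (g v \<bullet> b) + s * (b \<bullet> b))) \<or>
     (\<exists>p\<in>E. \<forall>(s, v, u)\<in>de_sitter E.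
       swp p (f (s, v, u)) = (1 / c) *\<^sub>R (s, g v + s *\<^sub>R b, c\<^sup>2 * u + 2 * (g v \<bullet> b) + s * (b \<bullet> b)))"
proof (cases "phi None")
  case None
  obtain c b g where *: "0 < c" "b \<in> E" "\<And>x. x \<in> E \<Longrightarrow> g x \<in> E"
    "\<And>x y. x \<in> E \<Longrightarrow> y \<in> E \<Longrightarrow> g (x + y) = g x + g y"
    "\<And>x r. x \<in> E \<Longrightarrow> g (r *\<^sub>R x) = r *\<^sub>R g x"
    "\<And>x. x \<in> E \<Longrightarrow> norm (g x) = c * norm x"
    "\<And>s v u. (s, v, u) \<in> de_sitter E \<Longrightarrow>
       f (s, v, u) = (1 / c) *\<^sub>R (s, g v + s *\<^sub>R b, c\<^sup>2 * u + 2 * (g v \<bullet> b) + s * (b \<bullet> b))"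
    using fixing_infinity[OF None] by blast
  show thesis by (rule that[of c b g, OF *(1-6)]) (use *(7) in auto)
next
  case (Some p)
  have N: "None \<in> null_dirs E" by (simp add: null_dirs_def)
  have p: "p \<in> E" using phi_null_dirs[OF N] Some by (auto simp: null_dirs_def)
  interpret c: de_sitter_conal E "swp p \<circ> f" using swp_conal[OF p] .
  obtain X where X: "X \<in> de_sitter E" "lf X (null_vec None) = 0" using perp_exists[OF N N] .
  have r: "ray_image None X (Some p)" using ray_image_phi[OF N X] Some by simp
  obtain t where t: "0 \<le> t" "f (X + t *\<^sub>R null_vec None) = f X + 1 *\<^sub>R null_vec (Some p)"
    using r zero_le_one unfolding ray_image_def by blast
  have sk: "swp p (null_vec (Some p)) = null_vec None" by (simp add: swp_def)
  \<comment> \<open>The direction map of \<open>swp p \<circ> f\<close> is accessible only through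
    rays, so one ray of direction \<open>None\<close> is followed; its image has direction
    \<open>None\<close> again.\<close>
  have e: "(swp p \<circ> f) (X + t *\<^sub>R null_vec None) = (swp p \<circ> f) X + 1 *\<^sub>R null_vec None"
    by (simp add: t(2) swp_linear sk del: null_vec_simps)
  obtain t' where t': "0 \<le> t'" "(swp p \<circ> f) (X + t *\<^sub>R null_vec None) = (swp p \<circ> f) X + t' *\<^sub>R null_vec (c.phi None)"
    using c.ray_image_phi[OF N X] t(1) unfolding c.ray_image_def by blast
  have "t' \<noteq> 0"
  proof
    assume "t' = 0"
    then have "1 *\<^sub>R null_vec None = (0 :: real \<times> 'e \<times> real)" using e t' by (simp del: null_vec_simps)
    then show False by (simp add: zero_prod_def)
  qed
  then have "c.phi None = None"
    using null_comparable[of t' 1 "(swp p \<circ> f) X" "c.phi None" None] t' e by (metis less_le future_le_refl zero_less_one)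
  then obtain c b g where *: "0 < c" "b \<in> E" "\<And>x. x \<in> E \<Longrightarrow> g x \<in> E"
    "\<And>x y. x \<in> E \<Longrightarrow> y \<in> E \<Longrightarrow> g (x + y) = g x + g y"
    "\<And>x r. x \<in> E \<Longrightarrow> g (r *\<^sub>R x) = r *\<^sub>R g x"
    "\<And>x. x \<in> E \<Longrightarrow> norm (g x) = c * norm x"
    "\<And>s v u. (s, v, u) \<in> de_sitter E \<Longrightarrow>
       (swp p \<circ> f) (s, v, u) = (1 / c) *\<^sub>R (s, g v + s *\<^sub>R b, c\<^sup>2 * u + 2 * (g v \<bullet> b) + s * (b \<bullet> b))"
    using c.fixing_infinity by blast
  have "\<forall>(s, v, u)\<in>de_sitter E.
       swp p (f (s, v, u)) = (1 / c) *\<^sub>R (s, g v + s *\<^sub>R b, c\<^sup>2 * u + 2 * (g v \<bullet> b) + s * (b \<bullet> b))"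
    using *(7) by (auto simp: o_def)
  then show thesis using that[of c b g, OF *(1-6)] p by blast
qed

section \<open>Rational maps\<close>

abbreviation finv :: "('a \<Rightarrow> 'a) \<Rightarrow> 'a \<Rightarrow> 'a" where
  "finv \<equiv> inv_into UNIV"

section \<open>Polynomials and equality of rational maps\<close>

text \<open>On the line from \<open>x\<close> to \<open>a\<close> the polynomial is univariate and
  nonzero at parameter 1. It has finitely many zeros there, so points with nonzero value come
  arbitrarily close to \<open>x\<close>.\<close>

lemma real_polynomial_nonzero_dense:
  fixes q :: "'a::real_normed_vector \<Rightarrow> real"
  assumes q: "real_polynomial_function q" and a: "q a \<noteq> 0"
  shows "closure {x. q x \<noteq> 0} = UNIV"
proof -
  have "x \<in> closure {x. q x \<noteq> 0}" for x
  proof (cases "a = x")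
    case True
    then show ?thesis using a closure_subset[of "{x. q x \<noteq> 0}"] by auto
  next
    case False
    define g where "g t = q (x + t *\<^sub>R (a - x))" for t
    have "polynomial_function (\<lambda>t::real. x + t *\<^sub>R (a - x))"
      by (intro polynomial_function_add polynomial_function_const polynomial_function_mult polynomial_function_id)
    then have "real_polynomial_function (q \<circ> (\<lambda>t. x + t *\<^sub>R (a - x)))"
      using q by (rule real_polynomial_function_compose)
    then have "real_polynomial_function g" by (simp add: g_def[abs_def] o_def)
    then obtain c and n :: nat where cn: "g = (\<lambda>t. \<Sum>i\<le>n. c i * t ^ i)"
      using real_polynomial_function_imp_sum by blast
    have "g 1 \<noteq> 0" using a by (simp add: g_def)
    have "\<exists>i\<le>n. c i \<noteq> 0"
    proof (rule ccontr)
      assume "\<not> ?thesis"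
      then have "g 1 = 0" by (simp add: cn)
      then show False using \<open>g 1 \<noteq> 0\<close> by simp
    qed
    then have fin: "finite {t. g t = 0}" using polyfun_finite_roots[of c n] by (simp add: cn)
    show ?thesis unfolding closure_approachable
    proof (intro allI impI)
      fix e :: real assume e: "0 < e"
      have "infinite {0<..<e / norm (a - x)}" using e False by simp
      then have "infinite ({0<..<e / norm (a - x)} - {t. g t = 0})" using fin by (rule Diff_infinite_finite[rotated])
      then have "{0<..<e / norm (a - x)} - {t. g t = 0} \<noteq> {}" by (metis finite.emptyI)
      then obtain t where "t \<in> {0<..<e / norm (a - x)} - {t. g t = 0}" by blast
      then have t: "0 < t" "t < e / norm (a - x)" "g t \<noteq> 0" by auto
      have "dist (x + t *\<^sub>R (a - x)) x = t * norm (a - x)" using t by (simp add: dist_norm)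
      then have "dist (x + t *\<^sub>R (a - x)) x < e" using t False by (simp add: pos_less_divide_eq)
      then show "\<exists>y\<in>{x. q x \<noteq> 0}. dist y x < e" using t(3) by (auto simp: g_def)
    qed
  qed
  then show ?thesis by blast
qed

lemma real_polynomial_nonzero_open:
  fixes q :: "'a::euclidean_space \<Rightarrow> real"
  assumes "real_polynomial_function q"
  shows "open {x. q x \<noteq> 0}"
proof -
  have "continuous_on UNIV q" using assms by (simp add: real_polynomial_function_eq continuous_on_polymonial_function)
  then show ?thesis
    by (intro open_Collect_neq) (auto intro: continuous_intros)
qed

lemma real_polynomial_common_nonzero:
  fixes p q :: "'a::euclidean_space \<Rightarrow> real"
  assumes "real_polynomial_function p" "real_polynomial_function q" "p a \<noteq> 0" "q b \<noteq> 0"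
  obtains x where "p x \<noteq> 0" "q x \<noteq> 0"
proof -
  have "a \<in> closure {x. q x \<noteq> 0}" using real_polynomial_nonzero_dense assms by blast
  then have "{x. p x \<noteq> 0} \<inter> {x. q x \<noteq> 0} \<noteq> {}"
    using real_polynomial_nonzero_open[OF assms(1)] assms(3)
    by (metis (mono_tags, lifting) open_Int_closure_eq_empty disjoint_iff mem_Collect_eq)
  then show thesis using that by blast
qed

lemma rat_eqI:
  assumes "real_polynomial_function q" "q a \<noteq> 0" "\<And>x. q x \<noteq> 0 \<Longrightarrow> f x = g x"
  shows "rat_eq f g"
  using assms by (auto simp: rat_eq_def)

lemma rat_eq_refl [simp]: "rat_eq f f"
  by (rule rat_eqI[of "\<lambda>_. 1"]) (auto intro: real_polynomial_function.intros(2))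

lemma rat_eq_sym: "rat_eq f g \<Longrightarrow> rat_eq g f"
  by (auto simp: rat_eq_def)

text \<open>The nonvanishing sets of the two exceptional polynomials are open and dense, hence meet,
  and the product is again a nonzero polynomial.\<close>

lemma rat_eq_trans [trans]:
  assumes "rat_eq f g" "rat_eq g h"
  shows "rat_eq f h"
proof -
  obtain p a where p: "real_polynomial_function p" "p a \<noteq> 0" "\<And>x. p x \<noteq> 0 \<Longrightarrow> f x = g x"
    using assms(1) by (auto simp: rat_eq_def)
  obtain q b where q: "real_polynomial_function q" "q b \<noteq> 0" "\<And>x. q x \<noteq> 0 \<Longrightarrow> g x = h x"
    using assms(2) by (auto simp: rat_eq_def)
  obtain x where "p x \<noteq> 0" "q x \<noteq> 0" using real_polynomial_common_nonzero[OF p(1) q(1) p(2) q(2)] .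
  then show ?thesis using p q
    by (intro rat_eqI[of "\<lambda>x. p x * q x" x]) (auto intro: real_polynomial_function.intros(4))
qed

lemma rat_eq_comp_left: "rat_eq f g \<Longrightarrow> rat_eq (h \<circ> f) (h \<circ> g)"
  by (auto simp: rat_eq_def)

lemma ratcls_eq_iff: "ratcls f = ratcls g \<longleftrightarrow> rat_eq f g"
proof
  assume "ratcls f = ratcls g"
  moreover have "f \<in> ratcls f" by (simp add: ratcls_def)
  ultimately show "rat_eq f g" by (simp add: ratcls_def)
next
  assume fg: "rat_eq f g"
  have "rat_eq h f \<longleftrightarrow> rat_eq h g" for h
    using rat_eq_trans[of h f g] rat_eq_trans[of h g f] fg rat_eq_sym by blast
  then show "ratcls f = ratcls g" by (simp add: ratcls_def)
qed

text \<open>Clears denominators: a high enough power of \<open>d\<close> turns the composite of a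
  polynomial with a rational map into a polynomial. Exceptional sets pulled back along rational maps
  thus remain zero sets of polynomials.\<close>

lemma homogenize:
  fixes q :: "'a::real_normed_vector \<Rightarrow> real" and P :: "'b::real_normed_vector \<Rightarrow> 'a"
  assumes q: "real_polynomial_function q" and P: "polynomial_function P" and d: "real_polynomial_function d"
  shows "\<exists>N r. real_polynomial_function r \<and> (\<forall>v. d v \<noteq> 0 \<longrightarrow> r v = d v ^ N * q ((1 / d v) *\<^sub>R P v))"
  using q
proof induction
  case (linear f)
  then have "real_polynomial_function (f \<circ> P)"
    using P by (intro real_polynomial_function_compose real_polynomial_function.intros(1))
  then show ?case using linear
    by (intro exI[of _ 1] exI[of _ "f \<circ> P"]) (auto simp: o_def linear_cmul bounded_linear.linear)
next
  case (const c)
  show ?case by (intro exI[of _ 0] exI[of _ "\<lambda>_. c"]) (auto intro: real_polynomial_function.intros(2))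
next
  case (add f g)
  then obtain N r M s where *: "real_polynomial_function r" "\<And>v. d v \<noteq> 0 \<Longrightarrow> r v = d v ^ N * f ((1 / d v) *\<^sub>R P v)"
    "real_polynomial_function s" "\<And>v. d v \<noteq> 0 \<Longrightarrow> s v = d v ^ M * g ((1 / d v) *\<^sub>R P v)" by blast
  show ?case
    by (intro exI[of _ "N + M"] exI[of _ "\<lambda>v. r v * d v ^ M + s v * d v ^ N"])
       (use * d in \<open>auto simp: power_add algebra_simps intro!: real_polynomial_function.intros(3) real_polynomial_function.intros(4)\<close>)
next
  case (mult f g)
  then obtain N r M s where *: "real_polynomial_function r" "\<And>v. d v \<noteq> 0 \<Longrightarrow> r v = d v ^ N * f ((1 / d v) *\<^sub>R P v)"
    "real_polynomial_function s" "\<And>v. d v \<noteq> 0 \<Longrightarrow> s v = d v ^ M * g ((1 / d v) *\<^sub>R P v)" by blast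
  show ?case
    by (intro exI[of _ "N + M"] exI[of _ "\<lambda>v. r v * s v"])
       (use * in \<open>auto simp: power_add intro!: real_polynomial_function.intros(4)\<close>)
qed

section \<open>The linear model of the conformal group\<close>

definition jb :: "'n::{finite,zero} V \<Rightarrow> 'n V \<Rightarrow> real" where
  "jb x y = 2 * (x $ 0) * (y $ 0) - x \<bullet> y"

lemma jdet_eq: "jdet x = 2 * (x $ 0)\<^sup>2 - x \<bullet> x"
  unfolding jdet_def inner_vec_def by (subst (2) sum.remove[of _ 0]) (auto simp: power2_eq_square)

lemma jdet_jb: "jdet x = jb x x"
  by (simp add: jdet_eq jb_def power2_eq_square)

lemma jb_commute: "jb x y = jb y x"
  by (simp add: jb_def inner_commute)

lemma jb_simps: "jb (x + y) z = jb x z + jb y z" "jb z (x + y) = jb z x + jb z y"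
  "jb (x - y) z = jb x z - jb y z" "jb z (x - y) = jb z x - jb z y"
  "jb (c *\<^sub>R x) z = c * jb x z" "jb z (c *\<^sub>R x) = c * jb z x"
  "jb (- x) z = - jb x z" "jb z (- x) = - jb z x" "jb 0 z = 0" "jb z 0 = 0"
  by (auto simp: jb_def inner_simps algebra_simps)

lemma jdet_add: "jdet (x + y) = jdet x + 2 * jb x y + jdet y"
  using jb_commute[of y x] by (simp add: jdet_jb jb_simps)

lemma jdet_scale [simp]: "jdet (c *\<^sub>R x) = c\<^sup>2 * jdet x"
  by (simp add: jdet_jb jb_simps power2_eq_square)

lemma jdet_minus [simp]: "jdet (- x) = jdet x"
  by (simp add: jdet_jb jb_simps)

lemma jdet_0 [simp]: "jdet 0 = 0"
  by (simp add: jdet_jb jb_simps)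

lemma junit_nth [simp]: "junit $ i = (if i = 0 then 1 else 0)"
  by (simp add: junit_def)

lemma junit_inner [simp]: "junit \<bullet> x = x $ 0" "x \<bullet> junit = x $ 0"
proof -
  show "junit \<bullet> x = x $ 0"
    unfolding inner_vec_def by (subst sum.remove[of _ 0]) (auto intro!: sum.neutral)
  then show "x \<bullet> junit = x $ 0" by (simp add: inner_commute)
qed

lemma jdet_junit [simp]: "jdet junit = 1"
  by (simp add: jdet_eq)

lemma alpha_nth [simp]: "alpha x $ i = (if i = 0 then x $ 0 else - x $ i)"
  by (simp add: alpha_def)

lemma alpha_eq: "alpha x = (2 * (x $ 0)) *\<^sub>R junit - x"
  by (simp add: vec_eq_iff)

lemma alpha_alpha [simp]: "alpha (alpha x) = x"
  by (simp add: vec_eq_iff)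

lemma alpha_linear: "alpha (x + y) = alpha x + alpha y" "alpha (c *\<^sub>R x) = c *\<^sub>R alpha x"
  "alpha (x - y) = alpha x - alpha y" "alpha (- x) = - alpha x" "alpha 0 = 0"
  by (auto simp: vec_eq_iff)

lemma linear_alpha: "linear alpha"
  by (rule linearI) (auto simp: alpha_linear)

lemma jb_alpha: "jb (alpha x) (alpha y) = jb x y"
  by (simp add: jb_def alpha_eq inner_simps)

lemma jdet_alpha [simp]: "jdet (alpha x) = jdet x"
  by (simp add: jdet_jb jb_alpha)

lemma jb_alpha_self: "jb x (alpha x) = x \<bullet> x"
  by (simp add: jb_def alpha_eq inner_simps)

definition hq :: "real \<times> 'n::{finite,zero} V \<times> real \<Rightarrow> real" where
  "hq X = jdet (fst (snd X)) - fst X * snd (snd X)"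

text \<open>Polarised without the factor one half, so that it is the mixed term of
  \<open>hq (X + Y)\<close> and \<open>hb X X = 2 * hq X\<close>. The form \<open>hq\<close> has
  signature (2, n).\<close>

definition hb :: "real \<times> 'n::{finite,zero} V \<times> real \<Rightarrow> real \<times> 'n V \<times> real \<Rightarrow> real" where
  "hb X Y = 2 * jb (fst (snd X)) (fst (snd Y)) - fst X * snd (snd Y) - snd (snd X) * fst Y"

definition kap :: "'n::{finite,zero} V \<Rightarrow> real \<times> 'n V \<times> real" where
  "kap v = (1, v, jdet v)"

text \<open>Similitudes rather than isometries, since a conformal linear map of the Jordan algebra
  lifts with its own factor. Nonzero scalars belong to the group and act trivially as rational
  maps.\<close>

definition Gam :: "(real \<times> 'n::{finite,zero} V \<times> real \<Rightarrow> real \<times> 'n V \<times> real) set" where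
  "Gam = {T. linear T \<and> bij T \<and> (\<exists>c. c \<noteq> 0 \<and> (\<forall>X. hq (T X) = c * hq X))}"

text \<open>
  \<open>mob T\<close> is the action of \<open>T\<close> on null lines in the chart \<^term>\<open>kap\<close>; it is \<open>0\<close> where \<open>T\<close> leaves the chart.
\<close>

definition mob :: "(real \<times> 'n::{finite,zero} V \<times> real \<Rightarrow> real \<times> 'n V \<times> real) \<Rightarrow> 'n V \<Rightarrow> 'n V" where
  "mob T v = (1 / fst (T (kap v))) *\<^sub>R fst (snd (T (kap v)))"

definition MT :: "(real \<times> 'n::{finite,zero} V \<times> real \<Rightarrow> real \<times> 'n V \<times> real) \<Rightarrow> 'n ratmap" where
  "MT T = ratcls (mob T)"

lemma hq_Pair [simp]: "hq (s, x, r) = jdet x - s * r"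
  by (simp add: hq_def)

lemma hb_Pair [simp]: "hb (s, x, r) (s', x', r') = 2 * jb x x' - s * r' - r * s'"
  by (simp add: hb_def)

lemma fst_kap [simp]: "fst (kap v) = 1" "fst (snd (kap v)) = v" "snd (snd (kap v)) = jdet v"
  by (simp_all add: kap_def)

lemma hq_kap [simp]: "hq (kap v) = 0"
  by (simp add: kap_def)

lemma kap_nonzero [simp]: "kap v \<noteq> 0"
  by (simp add: kap_def zero_prod_def)

lemma hq_add: "hq (X + Y) = hq X + hb X Y + hq Y"
  by (simp add: hq_def hb_def jdet_add algebra_simps)

lemma hq_scale [simp]: "hq (c *\<^sub>R X) = c\<^sup>2 * hq X"
  by (simp add: hq_def algebra_simps power2_eq_square)

lemma hb_self: "hb X X = 2 * hq X"
  by (simp add: hq_def hb_def jdet_jb)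

lemma hb_commute: "hb X Y = hb Y X"
  using jb_commute[of "fst (snd X)" "fst (snd Y)"] by (simp add: hb_def)

lemma hb_simps: "hb (x + y) z = hb x z + hb y z" "hb z (x + y) = hb z x + hb z y"
  "hb (x - y) z = hb x z - hb y z" "hb z (x - y) = hb z x - hb z y"
  "hb (c *\<^sub>R x) z = c * hb x z" "hb z (c *\<^sub>R x) = c * hb z x"
  "hb (- x) z = - hb x z" "hb z (- x) = - hb z x" "hb 0 z = 0" "hb z 0 = 0"
  by (auto simp: hb_def jb_simps algebra_simps)

lemma null_eq_kap:
  assumes "hq X = 0" "fst X \<noteq> 0"
  shows "X = fst X *\<^sub>R kap ((1 / fst X) *\<^sub>R fst (snd X))"
  using assms by (cases X) (auto simp: kap_def power2_eq_square field_simps)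

lemma GamI:
  assumes "linear T" "\<And>X. hq (T X) = c * hq X" "c \<noteq> 0" "\<And>X. T (S X) = X" "\<And>X. S (T X) = X"
  shows "T \<in> Gam"
proof -
  have "bij T" by (rule bij_betw_byWitness[of _ S]) (use assms in auto)
  then show ?thesis using assms unfolding Gam_def by blast
qed

lemma Gam_linear: "T \<in> Gam \<Longrightarrow> linear T" and Gam_bij: "T \<in> Gam \<Longrightarrow> bij T"
  by (auto simp: Gam_def)

lemma Gam_hq: "T \<in> Gam \<Longrightarrow> \<exists>c. c \<noteq> 0 \<and> (\<forall>X. hq (T X) = c * hq X)"
  by (simp only: Gam_def mem_Collect_eq)

lemma Gam_null:
  assumes "T \<in> Gam"
  shows "hq (T X) = 0 \<longleftrightarrow> hq X = 0"
proof -
  obtain c where "c \<noteq> 0" "\<And>X. hq (T X) = c * hq X" using Gam_hq[OF assms] by blast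
  then show ?thesis by simp
qed

lemma Gam_hb:
  assumes "T \<in> Gam" "\<And>X. hq (T X) = c * hq X"
  shows "hb (T X) (T Y) = c * hb X Y"
proof -
  have "hq (T X + T Y) = c * hq (X + Y)" using assms Gam_linear[OF assms(1)] by (metis linear_add)
  then show ?thesis using assms(2)[of X] assms(2)[of Y] by (simp add: hq_add algebra_simps)
qed

lemma Gam_zero_iff: "T \<in> Gam \<Longrightarrow> T X = 0 \<longleftrightarrow> X = 0"
  using linear_0[OF Gam_linear, of T] bij_is_inj[OF Gam_bij, of T] by (metis injD)

lemma Gam_scale: "T \<in> Gam \<Longrightarrow> T (c *\<^sub>R X) = c *\<^sub>R T X"
  using linear_cmul[OF Gam_linear] .

lemma Gam_id: "id \<in> Gam"
  by (rule GamI[of id 1 id]) (auto simp: linear_id)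

lemma Gam_comp: assumes "T \<in> Gam" "S \<in> Gam" shows "T \<circ> S \<in> Gam"
proof -
  obtain c where c: "c \<noteq> 0" "\<And>X. hq (T X) = c * hq X" using Gam_hq[OF assms(1)] by blast
  obtain d where d: "d \<noteq> 0" "\<And>X. hq (S X) = d * hq X" using Gam_hq[OF assms(2)] by blast
  have "linear (T \<circ> S)" using assms by (simp add: Gam_linear linear_compose)
  moreover have "bij (T \<circ> S)" using assms by (simp add: Gam_bij bij_comp)
  moreover have "c * d \<noteq> 0 \<and> (\<forall>X. hq ((T \<circ> S) X) = (c * d) * hq X)" using c d by simp
  ultimately show ?thesis unfolding Gam_def by blast
qed

lemma Gam_inv: assumes T: "T \<in> Gam" shows "finv T \<in> Gam" "\<And>X. T (finv T X) = X" "\<And>X. finv T (T X) = X"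
proof -
  obtain c where c: "c \<noteq> 0" "\<And>X. hq (T X) = c * hq X" using Gam_hq[OF T] by blast
  have b: "bij T" using Gam_bij[OF T] .
  show 1: "\<And>X. T (finv T X) = X" using b by (simp add: bij_is_surj surj_f_inv_f)
  show 2: "\<And>X. finv T (T X) = X" using b by (simp add: bij_is_inj)
  have "linear (finv T)"
  proof (rule linearI)
    show "finv T (X + Y) = finv T X + finv T Y" for X Y
      using 1 2 linear_add[OF Gam_linear[OF T], of "finv T X" "finv T Y"] by metis
    show "finv T (a *\<^sub>R X) = a *\<^sub>R finv T X" for a X
      using 1 2 linear_cmul[OF Gam_linear[OF T], of a "finv T X"] by metis
  qed
  then show "finv T \<in> Gam"
  proof (rule GamI[of _ "1 / c" T])
    show "hq (finv T X) = 1 / c * hq X" for X using c(1) c(2)[of "finv T X"] by (simp add: 1)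
  qed (use c(1) 1 2 in simp_all)
qed

lemma Gam_scaled: assumes "T \<in> Gam" "c \<noteq> 0" shows "(\<lambda>X. c *\<^sub>R T X) \<in> Gam"
proof -
  obtain d where d: "d \<noteq> 0" "\<And>X. hq (T X) = d * hq X" using Gam_hq[OF assms(1)] by blast
  show ?thesis
  proof (rule GamI[of _ "c\<^sup>2 * d" "\<lambda>X. finv T ((1 / c) *\<^sub>R X)"])
    show "linear (\<lambda>X. c *\<^sub>R T X)" using Gam_linear[OF assms(1)] by (rule linear_compose_scale_right)
  qed (use assms(2) d Gam_inv(2,3)[OF assms(1)] in simp_all)
qed

lemma mob_kap:
  assumes "T \<in> Gam" "fst (T (kap v)) \<noteq> 0"
  shows "T (kap v) = fst (T (kap v)) *\<^sub>R kap (mob T v)"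
  unfolding mob_def using assms by (intro null_eq_kap) (auto simp: Gam_null)

lemma jdet_poly: "real_polynomial_function jdet"
proof -
  have "real_polynomial_function (\<lambda>x::'a V. x $ i)" for i
    by (intro real_polynomial_function.intros(1) bounded_linear_vec_nth)
  then show ?thesis unfolding jdet_def[abs_def]
    by (intro real_polynomial_function_diff real_polynomial_function_power real_polynomial_function_sum) auto
qed

lemma kap_poly: "polynomial_function (kap :: 'n::{finite,zero} V \<Rightarrow> _)"
proof -
  have e: "(kap :: 'n V \<Rightarrow> _) = (\<lambda>v. (1, 0, 0) + (0, v, 0) + jdet v *\<^sub>R (0, 0, 1))"
    by (auto simp: kap_def)
  have a: "polynomial_function (\<lambda>v::'n V. (0::real, v, 0::real))"
    by (intro polynomial_function_bounded_linear) (auto simp flip: linear_conv_bounded_linear intro!: linearI)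
  have b: "polynomial_function (\<lambda>v::'n V. jdet v *\<^sub>R ((0::real), (0::'n V), (1::real)))"
    by (rule polynomial_function_mult) (simp_all add: jdet_poly flip: real_polynomial_function_eq)
  show ?thesis unfolding e by (intro polynomial_function_add polynomial_function_const a b)
qed

lemma linear_kap_poly:
  fixes T :: "real \<times> 'n::{finite,zero} V \<times> real \<Rightarrow> real \<times> 'n V \<times> real"
  assumes "linear T"
  shows "real_polynomial_function (\<lambda>v. fst (T (kap v)))" "polynomial_function (\<lambda>v. fst (snd (T (kap v))))"
    "polynomial_function (\<lambda>v. T (kap v))"
proof -
  have T: "bounded_linear T" using assms by (simp add: linear_conv_bounded_linear)
  then show 3: "polynomial_function (\<lambda>v. T (kap v))"
    using polynomial_function_compose[OF kap_poly polynomial_function_bounded_linear] by (simp add: o_def)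
  have "real_polynomial_function (fst \<circ> (\<lambda>v. T (kap v)))"
    by (intro real_polynomial_function_compose[OF 3] real_polynomial_function.intros(1) bounded_linear_fst)
  then show "real_polynomial_function (\<lambda>v. fst (T (kap v)))" by (simp add: o_def)
  have "polynomial_function ((\<lambda>X. fst (snd X)) \<circ> (\<lambda>v. T (kap v)))"
    by (intro polynomial_function_compose[OF 3] polynomial_function_bounded_linear bounded_linear_fst_comp bounded_linear_snd)
  then show "polynomial_function (\<lambda>v. fst (snd (T (kap v))))" by (simp add: o_def)
qed

text \<open>The vectors \<open>kap v\<close> span the whole space: the even and odd parts of
  \<open>v \<mapsto> kap v\<close> produce the three summands.\<close>

lemma linear_eq_on_kap:
  fixes L M :: "real \<times> 'n::{finite,zero} V \<times> real \<Rightarrow> 'b::real_vector"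
  assumes "linear L" "linear M" and eq: "\<And>v. L (kap v) = M (kap v)"
  shows "L = M"
proof -
  define D where "D X = L X - M X" for X
  have D: "linear D" using assms unfolding D_def by (intro linear_compose_sub)
  have z: "D (kap v) = 0" for v using eq by (simp add: D_def)
  have z0: "D (1, 0, 0) = 0" using z[of 0] by (simp add: kap_def)
  have e: "kap v + kap (- v) = 2 *\<^sub>R (1, 0, 0) + (2 * jdet v) *\<^sub>R (0, 0, 1)"
    "kap v - kap (- v) = 2 *\<^sub>R (0, v, 0)" for v :: "'n V"
    by (auto simp: kap_def scaleR_2)
  have zr: "D (0, 0, 1) = 0"
  proof -
    have "D (kap junit + kap (- junit)) = 0" using z D by (simp add: linear_add)
    then show ?thesis unfolding e(1) linear_add[OF D] linear_cmul[OF D] z0 by simp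
  qed
  have zv: "D (0, v, 0) = 0" for v
  proof -
    have "D (kap v - kap (- v)) = 0" using z D by (simp add: linear_diff)
    then show ?thesis unfolding e(2) linear_cmul[OF D] by simp
  qed
  have "D X = 0" for X
  proof -
    obtain s v r where X: "X = (s, v, r)" by (cases X)
    have e: "X = s *\<^sub>R (1, 0, 0) + (0, v, 0) + r *\<^sub>R (0, 0, 1)" by (simp add: X)
    show ?thesis unfolding e linear_add[OF D] linear_cmul[OF D] z0 zr zv by simp
  qed
  then show ?thesis by (auto simp: D_def)
qed

text \<open>Otherwise \<open>fst \<circ> T\<close> would vanish on the spanning vectors
  \<open>kap v\<close>, contrary to surjectivity. It provides a nonzero denominator for
  \<open>mob T\<close>.\<close>

lemma Gam_fst_nonzero:
  fixes T :: "real \<times> 'n::{finite,zero} V \<times> real \<Rightarrow> real \<times> 'n V \<times> real"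
  assumes "T \<in> Gam"
  obtains v where "fst (T (kap v)) \<noteq> 0"
proof (rule ccontr)
  assume "\<not> thesis"
  then have z: "fst (T (kap v)) = 0" for v using that by blast
  have "linear (\<lambda>X. fst (T X))"
    using linear_compose[OF Gam_linear[OF assms] linear_fst] by (simp add: o_def)
  then have "(\<lambda>X. fst (T X)) = (\<lambda>X. 0)"
    by (intro linear_eq_on_kap) (auto simp: z linear_zero)
  moreover have "fst (T (finv T (1, 0, 0))) = 1" using Gam_inv(2)[OF assms, of "(1, 0, 0)"] by simp
  ultimately show False by (metis zero_neq_one)
qed

section \<open>Similitudes as birational maps\<close>

lemma mob_rational:
  assumes "T \<in> Gam"
  shows "rational_fun (mob T)"
proof -
  obtain v where "fst (T (kap v)) \<noteq> 0" using Gam_fst_nonzero[OF assms] .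
  then show ?thesis unfolding rational_fun_def
    by (intro exI[of _ "\<lambda>v. fst (snd (T (kap v)))"] exI[of _ "\<lambda>v. fst (T (kap v))"])
       (auto simp: mob_def linear_kap_poly[OF Gam_linear[OF assms]])
qed

text \<open>Off the zero set of the denominator of \<open>mob S\<close>, the vector
  \<open>S (kap v)\<close> is a multiple of \<open>kap (mob S v)\<close>, and scalars cancel in
  \<open>mob T\<close>. Where the outer denominator vanishes, both sides are 0.\<close>

lemma mob_comp:
  assumes "T \<in> Gam" "S \<in> Gam"
  shows "rat_eq (mob T \<circ> mob S) (mob (T \<circ> S))"
proof -
  obtain a where a: "fst (S (kap a)) \<noteq> 0" using Gam_fst_nonzero[OF assms(2)] .
  show ?thesis
  proof (rule rat_eqI[OF linear_kap_poly(1)[OF Gam_linear[OF assms(2)]] a])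
    fix v assume v: "fst (S (kap v)) \<noteq> 0"
    define l where "l = fst (S (kap v))"
    have S: "S (kap v) = l *\<^sub>R kap (mob S v)" using mob_kap[OF assms(2) v] by (simp add: l_def)
    have "(T \<circ> S) (kap v) = l *\<^sub>R T (kap (mob S v))" using S Gam_scale[OF assms(1)] by simp
    then show "(mob T \<circ> mob S) v = mob (T \<circ> S) v" using v
      unfolding mob_def[of "T \<circ> S"] by (simp add: mob_def[of T] l_def)
  qed
qed

lemma mob_id: "mob id = id"
  by (auto simp: mob_def)

lemma mob_inverse:
  assumes "T \<in> Gam"
  shows "rat_eq (mob T \<circ> mob (finv T)) id" "rat_eq (mob (finv T) \<circ> mob T) id"
proof -
  have e: "T \<circ> finv T = id" "finv T \<circ> T = id"
    using Gam_inv(2,3)[OF assms] by (simp_all add: fun_eq_iff)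
  show "rat_eq (mob T \<circ> mob (finv T)) id"
    using mob_comp[OF assms Gam_inv(1)[OF assms]] unfolding e mob_id .
  show "rat_eq (mob (finv T) \<circ> mob T) id"
    using mob_comp[OF Gam_inv(1)[OF assms] assms] unfolding e mob_id .
qed

lemma mob_birational: "T \<in> Gam \<Longrightarrow> birational_fun (mob T)"
  unfolding birational_fun_def
  by (intro conjI exI[of _ "mob (finv T)"] mob_rational mob_inverse Gam_inv(1))

text \<open>The exceptional set of \<open>f\<close> must not swallow the image of
  \<open>mob S\<close>. A point \<open>w\<close> outside it is moved back by \<open>finv S\<close>,
  which exhibits a point where the cleared polynomial \<open>r\<close> does not vanish.\<close>

lemma rat_eq_comp_mob:
  assumes "rat_eq f g" and S: "S \<in> Gam"
  shows "rat_eq (f \<circ> mob S) (g \<circ> mob S)"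
proof -
  obtain q a where q: "real_polynomial_function q" "q a \<noteq> 0" "\<And>x. q x \<noteq> 0 \<Longrightarrow> f x = g x"
    using assms(1) by (auto simp: rat_eq_def)
  define d where "d v = fst (S (kap v))" for v
  define P where "P v = fst (snd (S (kap v)))" for v
  have dP: "real_polynomial_function d" "polynomial_function P"
    using linear_kap_poly[OF Gam_linear[OF S]] by (auto simp: d_def[abs_def] P_def[abs_def])
  have mS: "mob S v = (1 / d v) *\<^sub>R P v" for v by (simp add: mob_def d_def P_def)
  obtain N r where r: "real_polynomial_function r" "\<And>v. d v \<noteq> 0 \<Longrightarrow> r v = d v ^ N * q (mob S v)"
    unfolding mS using homogenize[OF q(1) dP(2,1)] by blast
  obtain b where b: "fst (finv S (kap b)) \<noteq> 0" using Gam_fst_nonzero[OF Gam_inv(1)[OF S]] .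
  obtain w where w: "q w \<noteq> 0" "fst (finv S (kap w)) \<noteq> 0"
    using real_polynomial_common_nonzero[OF q(1) linear_kap_poly(1)[OF Gam_linear[OF Gam_inv(1)[OF S]]] q(2) b] .
  define v where "v = mob (finv S) w"
  define l where "l = fst (finv S (kap w))"
  have "finv S (kap w) = l *\<^sub>R kap v" using mob_kap[OF Gam_inv(1)[OF S] w(2)] by (simp add: v_def l_def)
  then have "S (finv S (kap w)) = l *\<^sub>R S (kap v)" using Gam_scale[OF S] by simp
  then have kw: "kap w = l *\<^sub>R S (kap v)" by (simp only: Gam_inv(2)[OF S])
  have "1 = l * d v" using arg_cong[OF kw, of fst] by (simp add: d_def)
  then have dv: "d v \<noteq> 0" "l \<noteq> 0" by auto
  have "w = l *\<^sub>R P v" using arg_cong[OF kw, of "\<lambda>X. fst (snd X)"] by (simp add: P_def)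
  also have "\<dots> = mob S v" using \<open>1 = l * d v\<close> dv by (simp add: mS field_simps)
  finally have "q (mob S v) \<noteq> 0" using w by simp
  then have "r v * d v \<noteq> 0" using r(2)[OF dv(1)] dv by simp
  then show ?thesis
    by (intro rat_eqI[of "\<lambda>v. r v * d v" v]) (use r q dP in \<open>auto intro!: real_polynomial_function.intros(4)\<close>)
qed

lemma Bir_simps: "carrier Bir = {ratcls f |f. birational_fun f}" "\<one>\<^bsub>Bir\<^esub> = ratcls id"
  "A \<otimes>\<^bsub>Bir\<^esub> B = {h. \<exists>f\<in>A. \<exists>g\<in>B. rat_eq h (f \<circ> g)}"
  by (simp_all add: Bir_def)

lemma ratcls_mult_mob:
  assumes "S \<in> Gam"
  shows "ratcls f \<otimes>\<^bsub>Bir\<^esub> MT S = ratcls (f \<circ> mob S)"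
proof -
  have *: "rat_eq (f' \<circ> g) (f \<circ> mob S)" if "rat_eq f' f" "rat_eq g (mob S)" for f' g
    using rat_eq_comp_left[OF that(2), of f'] rat_eq_comp_mob[OF that(1) assms] by (rule rat_eq_trans)
  show ?thesis
    unfolding Bir_simps MT_def ratcls_def
  proof (intro Collect_cong iffI)
    fix h
    show "rat_eq h (f \<circ> mob S)" if ex: "\<exists>f'\<in>{h. rat_eq h f}. \<exists>g\<in>{h. rat_eq h (mob S)}. rat_eq h (f' \<circ> g)"
    proof -
      obtain f' g where fg: "rat_eq f' f" "rat_eq g (mob S)" "rat_eq h (f' \<circ> g)" using ex by auto
      show ?thesis using rat_eq_trans[OF fg(3) *[OF fg(1,2)]] .
    qed
    show "\<exists>f'\<in>{h. rat_eq h f}. \<exists>g\<in>{h. rat_eq h (mob S)}. rat_eq h (f' \<circ> g)" if "rat_eq h (f \<circ> mob S)"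
      using that by (intro bexI[of _ f] bexI[of _ "mob S"]) simp_all
  qed
qed

lemma MT_mult:
  assumes "T \<in> Gam" "S \<in> Gam"
  shows "MT T \<otimes>\<^bsub>Bir\<^esub> MT S = MT (T \<circ> S)"
  using ratcls_mult_mob[OF assms(2), of "mob T"] mob_comp[OF assms] by (simp add: MT_def ratcls_eq_iff)

lemma MT_carrier: "T \<in> Gam \<Longrightarrow> MT T \<in> carrier Bir"
  using mob_birational by (auto simp: Bir_simps MT_def)

lemma MT_id: "MT id = \<one>\<^bsub>Bir\<^esub>"
  by (simp add: MT_def mob_id Bir_simps)

text \<open>\<open>m_inv\<close> is a definite description, so uniqueness is checked against the
  class of an arbitrary birational \<open>f\<close>; composing with \<open>mob (finv T)\<close> on
  the right does it.\<close>

lemma MT_inv: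
  assumes T: "T \<in> Gam"
  shows "inv\<^bsub>Bir\<^esub> (MT T) = MT (finv T)"
proof -
  note T' = Gam_inv(1)[OF T]
  have e: "T \<circ> finv T = id" "finv T \<circ> T = id"
    using Gam_inv(2,3)[OF T] by (simp_all add: fun_eq_iff)
  show ?thesis unfolding m_inv_def
  proof (rule the_equality)
    show "MT (finv T) \<in> carrier Bir \<and> MT T \<otimes>\<^bsub>Bir\<^esub> MT (finv T) = \<one>\<^bsub>Bir\<^esub> \<and> MT (finv T) \<otimes>\<^bsub>Bir\<^esub> MT T = \<one>\<^bsub>Bir\<^esub>"
      using MT_mult[OF T T'] MT_mult[OF T' T] MT_carrier[OF T'] e MT_id by simp
    fix y assume y: "y \<in> carrier Bir \<and> MT T \<otimes>\<^bsub>Bir\<^esub> y = \<one>\<^bsub>Bir\<^esub> \<and> y \<otimes>\<^bsub>Bir\<^esub> MT T = \<one>\<^bsub>Bir\<^esub>"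
    then obtain f where f: "y = ratcls f" by (auto simp: Bir_simps)
    then have "rat_eq (f \<circ> mob T) id"
      using y ratcls_mult_mob[OF T, of f] by (simp add: Bir_simps(2) ratcls_eq_iff)
    then have "rat_eq ((f \<circ> mob T) \<circ> mob (finv T)) (id \<circ> mob (finv T))" by (rule rat_eq_comp_mob[OF _ T'])
    moreover have "rat_eq (f \<circ> (mob T \<circ> mob (finv T))) (f \<circ> id)"
      by (rule rat_eq_comp_left[OF mob_inverse(1)[OF T]])
    ultimately have "rat_eq f (mob (finv T))" by (metis comp_assoc comp_id id_comp rat_eq_sym rat_eq_trans)
    then show "y = MT (finv T)" by (simp add: f MT_def ratcls_eq_iff)
  qed
qed

section \<open>Scalars as the kernel of \<open>MT\<close>\<close>

text \<open>By density and continuity every \<open>kap v\<close> is an eigenvector of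
  \<open>U\<close>. Comparing powers of \<open>t\<close> along \<open>t *\<^sub>R v\<close> shows
  that the eigenvalue \<open>l v\<close> is constant.\<close>

lemma MT_eq_id:
  fixes U :: "real \<times> 'n::{finite,zero} V \<times> real \<Rightarrow> real \<times> 'n V \<times> real"
  assumes U: "U \<in> Gam" and id: "MT U = MT id"
  obtains c where "c \<noteq> 0" "\<And>X. U X = c *\<^sub>R X"
proof -
  have lin: "linear U" using Gam_linear[OF U] .
  define l where "l v = fst (U (kap v))" for v
  have lpoly: "real_polynomial_function l" using linear_kap_poly(1)[OF lin] by (simp add: l_def[abs_def])
  have "rat_eq (mob U) id" using id by (simp add: MT_def ratcls_eq_iff mob_id)
  then obtain q a where q: "real_polynomial_function q" "q a \<noteq> 0" "\<And>x. q x \<noteq> 0 \<Longrightarrow> mob U x = x"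
    by (auto simp: rat_eq_def)
  obtain b where b: "l b \<noteq> 0" using Gam_fst_nonzero[OF U] by (auto simp: l_def)
  obtain x0 where x0: "q x0 \<noteq> 0" "l x0 \<noteq> 0" using real_polynomial_common_nonzero[OF q(1) lpoly q(2) b] .
  have cont: "continuous_on UNIV (\<lambda>v. U (kap v))" "continuous_on UNIV (\<lambda>v. l v *\<^sub>R kap v)"
    using linear_kap_poly(3)[OF lin] polynomial_function_mult[OF _ kap_poly, of l] lpoly
    by (auto simp: real_polynomial_function_eq intro!: continuous_on_polymonial_function)
  have "closed {v. U (kap v) = l v *\<^sub>R kap v}" using cont by (intro closed_Collect_eq)
  moreover have "{v. q v * l v \<noteq> 0} \<subseteq> {v. U (kap v) = l v *\<^sub>R kap v}"
  proof
    fix v assume "v \<in> {v. q v * l v \<noteq> 0}"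
    then have v: "mob U v = v" "l v \<noteq> 0" using q(3)[of v] by auto
    then have "U (kap v) = l v *\<^sub>R kap (mob U v)" using mob_kap[OF U, of v] by (simp add: l_def)
    then show "v \<in> {v. U (kap v) = l v *\<^sub>R kap v}" unfolding v(1) by simp
  qed
  ultimately have "closure {v. q v * l v \<noteq> 0} \<subseteq> {v. U (kap v) = l v *\<^sub>R kap v}" by (rule closure_minimal[rotated])
  moreover have "closure {v. q v * l v \<noteq> 0} = UNIV"
    by (rule real_polynomial_nonzero_dense[of _ x0]) (use x0 q lpoly in \<open>auto intro: real_polynomial_function.intros(4)\<close>)
  ultimately have Uk: "U (kap v) = l v *\<^sub>R kap v" for v by auto
  define U0 where "U0 = U (1, 0, 0)"
  define U1 where "U1 = U (0, 0, 1)"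
  define W where "W v = U (0, v, 0)" for v
  have kt: "kap (t *\<^sub>R v) = (1, 0, 0) + t *\<^sub>R (0, v, 0) + (t\<^sup>2 * jdet v) *\<^sub>R (0, 0, 1)" for t and v :: "'n V"
    by (simp add: kap_def)
  have Ut: "U (kap (t *\<^sub>R v)) = U0 + t *\<^sub>R W v + (t\<^sup>2 * jdet v) *\<^sub>R U1" for t v
    unfolding kt linear_add[OF lin] linear_cmul[OF lin] U0_def U1_def W_def ..
  have lt: "l (t *\<^sub>R v) = fst U0 + t * fst (W v) + t\<^sup>2 * jdet v * fst U1" for t v
    by (simp add: l_def Ut)
  have U0: "U0 = fst U0 *\<^sub>R (1, 0, 0)" using Uk[of 0] lt[of 0 0] Ut[of 0 0] by (simp add: kap_def)
  have U0': "snd (snd U0) = 0" "fst (snd U0) = 0" using arg_cong[OF U0, of "\<lambda>X. snd (snd X)"] arg_cong[OF U0, of "\<lambda>X. fst (snd X)"] by auto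
  have c2: "t *\<^sub>R fst (snd (W v)) + (t\<^sup>2 * jdet v) *\<^sub>R fst (snd U1)
      = ((fst U0 + t * fst (W v) + t\<^sup>2 * jdet v * fst U1) * t) *\<^sub>R v" for t v
    using arg_cong[OF Uk[of "t *\<^sub>R v"], of "\<lambda>X. fst (snd X)"] Ut[of t v] lt[of t v] U0' by simp
  have c3: "t * snd (snd (W v)) + t\<^sup>2 * jdet v * snd (snd U1)
      = (fst U0 + t * fst (W v) + t\<^sup>2 * jdet v * fst U1) * (t\<^sup>2 * jdet v)" for t v
    using arg_cong[OF Uk[of "t *\<^sub>R v"], of "\<lambda>X. snd (snd X)"] Ut[of t v] lt[of t v] U0' by simp
  have f1: "fst U1 = 0"
  proof -
    define x where "x = fst (snd (W (junit :: 'n V))) $ 0"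
    define y where "y = fst (snd U1) $ 0"
    have "t * x + t\<^sup>2 * y = (fst U0 + t * fst (W junit) + t\<^sup>2 * fst U1) * t" for t
      using arg_cong[OF c2[of t junit], of "\<lambda>v. v $ 0"] by (simp add: x_def y_def)
    \<comment> \<open>A polynomial identity of degree 3 without constant term: the values at 1, -1
      and 2 isolate the cubic coefficient.\<close>
    from this[of 1] this[of "-1"] this[of 2] show ?thesis by simp
  qed
  have fW: "fst (W v) = 0" if "jdet v \<noteq> 0" for v
  proof -
    define d where "d = jdet v"
    have "t * snd (snd (W v)) + t\<^sup>2 * d * snd (snd U1) = (fst U0 + t * fst (W v)) * (t\<^sup>2 * d)" for t
      using c3[of t v] f1 by (simp add: d_def)
    note q0 = this
    have q: "t * snd (snd (W v)) + t\<^sup>2 * (d * snd (snd U1)) = t\<^sup>2 * (fst U0 * d) + t ^ 3 * (fst (W v) * d)" for t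
      using q0[of t] by algebra
    have "snd (snd (W v)) + d * snd (snd U1) = fst U0 * d + fst (W v) * d"
      "- snd (snd (W v)) + d * snd (snd U1) = fst U0 * d - fst (W v) * d"
      "2 * snd (snd (W v)) + 4 * (d * snd (snd U1)) = 4 * (fst U0 * d) + 8 * (fst (W v) * d)"
      using q[of 1] q[of "-1"] q[of 2] by simp_all
    then have "fst (W v) * d = 0" by linarith
    then show ?thesis using that by (simp add: d_def)
  qed
  have linW: "W (v + w) = W v + W w" for v w
  proof -
    have "(0::real, v + w, 0::real) = (0, v, 0) + (0, w, 0)" by simp
    then show ?thesis using lin by (metis W_def linear_add)
  qed
  have fW': "fst (W v) = 0" for v
  proof (cases "jdet v = 0")
    case False then show ?thesis by (rule fW)
  next
    case True
    \<comment> \<open>Null vectors are reached through additivity of \<open>W\<close>: a suitable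
      multiple of the unit is not null and moves \<open>v\<close> off the null cone.\<close>
    have "\<exists>t. t \<noteq> 0 \<and> jdet (v + t *\<^sub>R junit) \<noteq> 0"
    proof (cases "v $ 0 = 0")
      case True with \<open>jdet v = 0\<close> show ?thesis
        by (intro exI[of _ 1]) (simp add: jdet_add jb_def)
    next
      case False with \<open>jdet v = 0\<close> show ?thesis
        by (intro exI[of _ "v $ 0"]) (simp add: jdet_add jb_def power2_eq_square)
    qed
    then obtain t where t: "t \<noteq> 0" "jdet (v + t *\<^sub>R junit) \<noteq> 0" by blast
    have "jdet (t *\<^sub>R junit :: 'n V) \<noteq> 0" using t by simp
    then have "fst (W (t *\<^sub>R junit)) = 0" by (rule fW)
    then show ?thesis using fW[OF t(2)] linW[of v "t *\<^sub>R junit"] by simp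
  qed
  have lc: "l v = fst U0" for v using lt[of 1 v] f1 fW' by simp
  have "U = (\<lambda>X. fst U0 *\<^sub>R X)"
    by (rule linear_eq_on_kap[OF lin]) (auto simp: Uk lc intro: linear_scale_self)
  moreover have "fst U0 \<noteq> 0" using b lc by simp
  ultimately show thesis using that by metis
qed

lemma MT_eq_iff:
  assumes T: "T \<in> Gam" and S: "S \<in> Gam" and eq: "MT T = MT S"
  obtains c where "c \<noteq> 0" "\<And>X. T X = c *\<^sub>R S X"
proof -
  note S' = Gam_inv(1)[OF S]
  have "MT (finv S \<circ> T) = MT (finv S \<circ> S)" using MT_mult[OF S' T] MT_mult[OF S' S] eq by simp
  also have "finv S \<circ> S = id" using Gam_inv(3)[OF S] by (simp add: fun_eq_iff)
  finally obtain c where c: "c \<noteq> 0" "\<And>X. (finv S \<circ> T) X = c *\<^sub>R X" using MT_eq_id[OF Gam_comp[OF S' T]] by blast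
  have "T X = c *\<^sub>R S X" for X
  proof -
    have "S (finv S (T X)) = S (c *\<^sub>R X)" using c(2)[of X] by simp
    then show ?thesis using Gam_inv(2)[OF S] Gam_scale[OF S] by simp
  qed
  then show thesis using that c by blast
qed

lemma MT_scaled: "c \<noteq> 0 \<Longrightarrow> MT (\<lambda>X. c *\<^sub>R T X) = MT T"
  unfolding MT_def by (rule arg_cong[of _ _ ratcls]) (auto simp: mob_def)

section \<open>Generators and the compactification\<close>

text \<open>Linear lift of the translation by \<open>w\<close>: it sends \<open>kap v\<close> to
  \<open>kap (v + w)\<close>. Likewise \<open>Jm\<close>, \<open>Nm\<close> and
  \<open>Lg g c\<close> lift Jordan inversion, its negative, and a linear conformal map
  \<open>g\<close> with factor \<open>c\<close>.\<close>

definition tau :: "'n::{finite,zero} V \<Rightarrow> real \<times> 'n V \<times> real \<Rightarrow> real \<times> 'n V \<times> real" where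
  "tau w X = (fst X, fst (snd X) + fst X *\<^sub>R w, snd (snd X) + 2 * jb (fst (snd X)) w + fst X * jdet w)"

definition Jm :: "real \<times> 'n::{finite,zero} V \<times> real \<Rightarrow> real \<times> 'n V \<times> real" where
  "Jm X = (snd (snd X), alpha (fst (snd X)), fst X)"

definition Nm :: "real \<times> 'n::{finite,zero} V \<times> real \<Rightarrow> real \<times> 'n V \<times> real" where
  "Nm X = (snd (snd X), - alpha (fst (snd X)), fst X)"

definition Lg :: "('n::{finite,zero} V \<Rightarrow> 'n V) \<Rightarrow> real \<Rightarrow> real \<times> 'n V \<times> real \<Rightarrow> real \<times> 'n V \<times> real" where
  "Lg g c X = (fst X, g (fst (snd X)), c * snd (snd X))"

lemma tau_Pair [simp]: "tau w (s, x, r) = (s, x + s *\<^sub>R w, r + 2 * jb x w + s * jdet w)"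
  by (simp add: tau_def)

lemma Jm_Pair [simp]: "Jm (s, x, r) = (r, alpha x, s)"
  by (simp add: Jm_def)

lemma Nm_Pair [simp]: "Nm (s, x, r) = (r, - alpha x, s)"
  by (simp add: Nm_def)

lemma Lg_Pair [simp]: "Lg g c (s, x, r) = (s, g x, c * r)"
  by (simp add: Lg_def)

lemma tau_tau: "tau v (tau w X) = tau (v + w) X"
  using jb_commute[of w v]
  by (cases X) (simp add: jb_simps jdet_add algebra_simps)

lemma tau_0: "tau 0 X = X"
  by (cases X) (simp add: jb_simps)

lemma Jm_Jm [simp]: "Jm (Jm X) = X" and Nm_Nm [simp]: "Nm (Nm X) = X"
  by (cases X; simp add: alpha_linear)+

lemma linear_tau: "linear (tau w)"
  by (rule linearI) (auto simp: tau_def jb_simps algebra_simps)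

lemma linear_Jm: "linear Jm" and linear_Nm: "linear Nm"
  by (auto intro!: linearI simp: Jm_def Nm_def alpha_linear)

lemma tau_Gam: "tau w \<in> Gam"
proof (rule GamI[of _ 1 "tau (- w)"])
  show "hq (tau w X) = 1 * hq X" for X
    by (cases X) (simp add: jdet_add jb_simps power2_eq_square algebra_simps)
qed (simp_all add: linear_tau tau_tau tau_0)

lemma Jm_Gam: "Jm \<in> Gam" and Nm_Gam: "Nm \<in> Gam"
proof -
  show "Jm \<in> Gam"
  proof (rule GamI[of _ 1 Jm])
    show "hq (Jm X) = 1 * hq X" for X by (cases X) (simp add: mult.commute)
  qed (simp_all add: linear_Jm)
  show "Nm \<in> Gam"
  proof (rule GamI[of _ 1 Nm])
    show "hq (Nm X) = 1 * hq X" for X by (cases X) (simp add: mult.commute)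
  qed (simp_all add: linear_Nm)
qed

lemma GL_linear: "g \<in> GL \<Longrightarrow> linear g" and GL_bij: "g \<in> GL \<Longrightarrow> bij g"
  by (auto simp: GL_def)

lemma linear_Lg: "linear g \<Longrightarrow> linear (Lg g c)"
  by (rule linearI) (auto simp: Lg_def linear_add linear_cmul algebra_simps)

lemma conformal_factor_nonzero:
  fixes g :: "'n::{finite,zero} V \<Rightarrow> 'n V"
  assumes "g \<in> GL" "\<And>x. jdet (g x) = c * jdet x"
  shows "c \<noteq> 0"
proof -
  obtain y where "g y = junit" using GL_bij[OF assms(1)] by (metis bij_pointE)
  then have "1 = c * jdet y" using assms(2)[of y] by simp
  then show ?thesis by auto
qed

lemma Lg_Gam:
  fixes g :: "'n::{finite,zero} V \<Rightarrow> 'n V"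
  assumes g: "g \<in> GL" and c: "\<And>x. jdet (g x) = c * jdet x"
  shows "Lg g c \<in> Gam"
proof (rule GamI[of _ c "Lg (inv_into UNIV g) (1 / c)"])
  show "c \<noteq> 0" using conformal_factor_nonzero[OF assms] .
  show "hq (Lg g c X) = c * hq X" for X by (cases X) (simp add: c algebra_simps)
  have "g (inv_into UNIV g x) = x" "inv_into UNIV g (g x) = x" for x
    using GL_bij[OF g] by (simp_all add: bij_is_surj bij_is_inj surj_f_inv_f)
  then show "Lg g c (Lg (inv_into UNIV g) (1 / c) X) = X" "Lg (inv_into UNIV g) (1 / c) (Lg g c X) = X" for X
    using \<open>c \<noteq> 0\<close> by (cases X; simp)+
qed (rule linear_Lg[OF GL_linear[OF g]])

lemma MT_tau: "MT (tau w) = transl w"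
  unfolding MT_def transl_def by (rule arg_cong[of _ _ ratcls]) (auto simp: mob_def kap_def)

lemma mob_Jm: "mob Jm = jinv"
  by (auto simp: mob_def kap_def jinv_def)

lemma MT_Jm: "MT Jm = Jinv"
  by (simp add: MT_def Jinv_def mob_Jm)

lemma MT_Nm: "MT Nm = ratcls (\<lambda>x. - jinv x)"
  unfolding MT_def by (rule arg_cong[of _ _ ratcls]) (auto simp: mob_def kap_def jinv_def)

lemma mob_Lg: "mob (Lg g c) = g"
  by (auto simp: mob_def kap_def)

lemma MT_Lg: "MT (Lg g c) = ratcls g"
  by (simp add: MT_def mob_Lg)

section \<open>The structure group and the generators\<close>

text \<open>Split \<open>x\<close> into a multiple of the unit and a spatial part \<open>u\<close>
  of length \<open>N\<close>. The images of the two null vectors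
  \<open>u + N *\<^sub>R junit\<close> and \<open>u - N *\<^sub>R junit\<close> give two equations,
  which determine \<open>jdet (g u)\<close> and kill the mixed term.\<close>

lemma null_cone_conformal:
  fixes g :: "'n::{finite,zero} V \<Rightarrow> 'n V"
  assumes g: "linear g" and null: "\<And>x. jdet x = 0 \<Longrightarrow> jdet (g x) = 0"
  shows "jdet (g x) = jdet (g junit) * jdet x"
proof -
  define t where "t = x $ 0"
  define u where "u = x - t *\<^sub>R junit"
  define N where "N = norm u"
  have u0: "u $ 0 = 0" by (simp add: u_def t_def)
  have ju: "jdet u = - N\<^sup>2" using u0 by (simp add: jdet_eq N_def dot_square_norm)
  have je: "jb junit u = 0" "jb u junit = 0" using u0 by (auto simp: jb_def)
  have x: "x = t *\<^sub>R junit + u" by (simp add: u_def)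
  have jx: "jdet x = t\<^sup>2 - N\<^sup>2" unfolding x jdet_add by (simp add: jb_simps je ju)
  define q where "q = jdet (g junit)"
  define b where "b = jb (g junit) (g u)"
  have gx: "jdet (g (a *\<^sub>R junit + u)) = a\<^sup>2 * q + 2 * a * b + jdet (g u)" for a
    unfolding linear_add[OF g] linear_cmul[OF g] jdet_add by (simp add: jb_simps q_def b_def)
  have z: "jdet (g (a *\<^sub>R junit + u)) = 0" if "a\<^sup>2 = N\<^sup>2" for a
    by (rule null) (simp add: jdet_add jb_simps je ju that)
  have 1: "N\<^sup>2 * q + 2 * N * b + jdet (g u) = 0" using z[of N] gx[of N] by simp
  have 2: "N\<^sup>2 * q - 2 * N * b + jdet (g u) = 0" using z[of "- N"] gx[of "- N"] by simp
  have gu: "jdet (g u) = - N\<^sup>2 * q" using 1 2 by simp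
  have "2 * N * b = 0" using 1 2 by linarith
  moreover have "u = 0" if "N = 0" using that by (simp add: N_def)
  then have "b = 0" if "N = 0" using that by (simp add: b_def linear_0[OF g] jb_simps)
  ultimately have "b = 0" by auto
  moreover have "jdet (g x) = t\<^sup>2 * q + 2 * t * b + jdet (g u)" using gx[of t] unfolding x[symmetric] .
  ultimately show ?thesis unfolding gu jx q_def[symmetric] by (simp add: algebra_simps)
qed

text \<open>Cleared of denominators, the rational identity reads
  \<open>jdet (G v) *\<^sub>R h v = jdet v *\<^sub>R alpha (G v)\<close>, on a dense set and hence
  everywhere. For null \<open>v \<noteq> 0\<close> the right side vanishes and \<open>h v\<close>
  does not, so null vectors go to null vectors.\<close>

lemma Str_conformal:
  fixes g h :: "'n::{finite,zero} V \<Rightarrow> 'n V"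
  assumes g: "g \<in> GL" and h: "h \<in> GL" and e: "rat_eq (jinv \<circ> g \<circ> jinv) h"
  shows "jdet (g x) = jdet (g junit) * jdet x"
proof (rule null_cone_conformal[OF GL_linear[OF g]])
  note lg = GL_linear[OF g]
  define G where "G v = g (alpha v)" for v
  have lG: "linear G" unfolding G_def using linear_compose[OF linear_alpha lg] by (simp add: o_def)
  have pG: "polynomial_function G"
    using lG by (intro polynomial_function_bounded_linear) (simp add: linear_conv_bounded_linear)
  obtain q a where q: "real_polynomial_function q" "q a \<noteq> 0" "\<And>x. q x \<noteq> 0 \<Longrightarrow> (jinv \<circ> g \<circ> jinv) x = h x"
    using e by (auto simp: rat_eq_def)
  have jG: "real_polynomial_function (\<lambda>v. jdet (G v))"
    using real_polynomial_function_compose[OF pG jdet_poly] by (simp add: o_def)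
  obtain y where "g y = junit" using GL_bij[OF g] by (metis bij_pointE)
  then have "jdet (G (alpha y)) \<noteq> 0" by (simp add: G_def)
  then obtain b where b: "jdet b \<noteq> 0" "jdet (G b) \<noteq> 0"
    using real_polynomial_common_nonzero[OF jdet_poly jG, of junit] by auto
  have p2: "real_polynomial_function (\<lambda>v. jdet v * jdet (G v))" by (intro real_polynomial_function.intros(4) jdet_poly jG)
  obtain d where d: "q d \<noteq> 0" "jdet d * jdet (G d) \<noteq> 0"
    by (rule real_polynomial_common_nonzero[OF q(1) p2 q(2), of b]) (use b in auto)
  have key: "jdet (G v) *\<^sub>R h v = jdet v *\<^sub>R alpha (G v)"
    if v: "q v \<noteq> 0" "jdet v \<noteq> 0" "jdet (G v) \<noteq> 0" for v
  proof -
    have "g (jinv v) = (1 / jdet v) *\<^sub>R G v" unfolding jinv_def G_def by (rule linear_cmul[OF lg])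
    then have "(jinv \<circ> g \<circ> jinv) v = (1 / ((1 / jdet v)\<^sup>2 * jdet (G v))) *\<^sub>R alpha ((1 / jdet v) *\<^sub>R G v)"
      by (simp add: jinv_def[of "(1 / jdet v) *\<^sub>R G v"])
    also have "\<dots> = (jdet v / jdet (G v)) *\<^sub>R alpha (G v)"
      using v by (simp add: alpha_linear power2_eq_square)
    finally have "h v = (jdet v / jdet (G v)) *\<^sub>R alpha (G v)" using q(3)[OF v(1)] by simp
    then show ?thesis using v by simp
  qed
  have cl: "closed {v. jdet (G v) *\<^sub>R h v = jdet v *\<^sub>R alpha (G v)}"
  proof (rule closed_Collect_eq)
    have c: "continuous_on UNIV G" using lG by (simp add: linear_continuous_on linear_conv_bounded_linear)
    have ch: "continuous_on UNIV h" using GL_linear[OF h] by (simp add: linear_continuous_on linear_conv_bounded_linear)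
    have cj: "continuous_on UNIV (jdet :: 'n V \<Rightarrow> real)" "continuous_on UNIV (\<lambda>v. jdet (G v))"
      using jdet_poly jG by (auto simp: real_polynomial_function_eq intro: continuous_on_polymonial_function)
    have ca: "continuous_on UNIV (\<lambda>v. alpha (G v))"
      using linear_compose[OF lG linear_alpha] by (simp add: linear_continuous_on linear_conv_bounded_linear o_def)
    show "continuous_on UNIV (\<lambda>v. jdet (G v) *\<^sub>R h v)" "continuous_on UNIV (\<lambda>v. jdet v *\<^sub>R alpha (G v))"
      using cj ch ca by (auto intro: continuous_on_scaleR)
  qed
  have "{v. q v * (jdet v * jdet (G v)) \<noteq> 0} \<subseteq> {v. jdet (G v) *\<^sub>R h v = jdet v *\<^sub>R alpha (G v)}"
    using key by auto
  then have "closure {v. q v * (jdet v * jdet (G v)) \<noteq> 0} \<subseteq> {v. jdet (G v) *\<^sub>R h v = jdet v *\<^sub>R alpha (G v)}"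
    using cl by (rule closure_minimal)
  moreover have "closure {v. q v * (jdet v * jdet (G v)) \<noteq> 0} = UNIV"
    by (rule real_polynomial_nonzero_dense[of _ d])
      (use d q p2 in \<open>auto intro: real_polynomial_function.intros(4)\<close>)
  ultimately have all: "jdet (G v) *\<^sub>R h v = jdet v *\<^sub>R alpha (G v)" for v by auto
  fix x :: "'n V" assume x: "jdet x = 0"
  have "jdet (g x) *\<^sub>R h (alpha x) = 0" using all[of "alpha x"] x by (simp add: G_def)
  then have "jdet (g x) = 0 \<or> h (alpha x) = 0" by simp
  then show "jdet (g x) = 0"
  proof
    assume "h (alpha x) = 0"
    then have "alpha x = 0" using linear_0[OF GL_linear[OF h]] bij_is_inj[OF GL_bij[OF h]] by (metis injD)
    then have "x = 0" by (metis alpha_alpha alpha_linear(5))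
    then show ?thesis by (simp add: linear_0[OF lg])
  qed
qed

text \<open>Conjugation by Jordan inversion keeps linear conformal maps linear. The scalar
  \<open>c\<close> in the last identity disappears under \<open>MT\<close>.\<close>

lemma alpha_conjugate:
  fixes g :: "'n::{finite,zero} V \<Rightarrow> 'n V"
  assumes g: "g \<in> GL" "\<And>x. jdet (g x) = c * jdet x"
  defines "h \<equiv> \<lambda>v. (1 / c) *\<^sub>R alpha (g (alpha v))"
  shows "h \<in> GL" "\<And>x. jdet (h x) = (1 / c) * jdet x" "\<And>X. Jm (Lg g c (Jm X)) = c *\<^sub>R Lg h (1 / c) X"
proof -
  have c: "c \<noteq> 0" using conformal_factor_nonzero[OF g] .
  have lh: "linear h"
    unfolding h_def using linear_compose_scale_right[OF linear_compose[OF linear_compose[OF linear_alpha GL_linear[OF g(1)]] linear_alpha]]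
    by (simp add: o_def)
  have 1: "g (inv_into UNIV g x) = x" "inv_into UNIV g (g x) = x" for x
    using GL_bij[OF g(1)] by (simp_all add: bij_is_surj bij_is_inj surj_f_inv_f)
  have "bij h"
    by (rule bij_betw_byWitness[of _ "\<lambda>v. alpha (inv_into UNIV g (alpha (c *\<^sub>R v)))"])
      (use c in \<open>auto simp: h_def 1 alpha_linear(2)\<close>)
  then show "h \<in> GL" using lh by (simp add: GL_def)
  show "jdet (h x) = (1 / c) * jdet x" for x
    using c by (simp add: h_def g(2) power2_eq_square)
  show "Jm (Lg g c (Jm X)) = c *\<^sub>R Lg h (1 / c) X" for X
    using c by (cases X) (simp add: h_def)
qed

lemma Str_eq:
  "Str = {MT (Lg g c) |g c. g \<in> GL \<and> (\<forall>x. jdet (g x) = c * jdet (x :: 'n::{finite,zero} V))}"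
proof (intro equalityI subsetI)
  fix A :: "'n ratmap" assume "A \<in> Str"
  then obtain g h where "A = ratcls g" "g \<in> GL" "h \<in> GL" "rat_eq (jinv \<circ> g \<circ> jinv) h"
    by (auto simp: Str_def)
  then show "A \<in> {MT (Lg g c) |g c. g \<in> GL \<and> (\<forall>x. jdet (g x) = c * jdet x)}"
    using Str_conformal MT_Lg by blast
next
  fix A :: "'n ratmap" assume "A \<in> {MT (Lg g c) |g c. g \<in> GL \<and> (\<forall>x. jdet (g x) = c * jdet x)}"
  then obtain g c where A: "A = MT (Lg g c)" "g \<in> GL" "\<And>x. jdet (g x) = c * jdet x" by blast
  have c: "c \<noteq> 0" using conformal_factor_nonzero[OF A(2,3)] .
  define h where "h v = (1 / c) *\<^sub>R alpha (g (alpha v))" for v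
  note h = alpha_conjugate[OF A(2,3), folded h_def]
  have LG: "Lg g c \<in> Gam" by (rule Lg_Gam[OF A(2,3)])
  have "rat_eq (jinv \<circ> g \<circ> jinv) (mob (Jm \<circ> (Lg g c \<circ> Jm)))"
  proof -
    have "rat_eq (mob (Lg g c) \<circ> mob Jm) (mob (Lg g c \<circ> Jm))" by (rule mob_comp[OF LG Jm_Gam])
    then have "rat_eq (mob Jm \<circ> (mob (Lg g c) \<circ> mob Jm)) (mob Jm \<circ> mob (Lg g c \<circ> Jm))"
      by (rule rat_eq_comp_left)
    also have "rat_eq (mob Jm \<circ> mob (Lg g c \<circ> Jm)) (mob (Jm \<circ> (Lg g c \<circ> Jm)))"
      by (rule mob_comp[OF Jm_Gam Gam_comp[OF LG Jm_Gam]])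
    finally show ?thesis by (simp add: mob_Jm mob_Lg comp_assoc)
  qed
  also have "mob (Jm \<circ> (Lg g c \<circ> Jm)) = h"
    using c by (auto simp: mob_def kap_def h_def)
  finally have "rat_eq (jinv \<circ> g \<circ> jinv) h" .
  then show "A \<in> Str" using A h(1) by (auto simp: Str_def MT_Lg)
qed

lemma generate_Bir_subset:
  assumes "S \<subseteq> MT ` Gam"
  shows "generate Bir S \<subseteq> MT ` Gam"
proof
  fix A assume "A \<in> generate Bir S"
  then show "A \<in> MT ` Gam"
  proof induction
    case one then show ?case using MT_id Gam_id by (metis image_eqI)
  next
    case (incl h) then show ?case using assms by blast
  next
    case (inv h)
    then obtain T where "T \<in> Gam" "h = MT T" using assms by blast
    then show ?case using MT_inv Gam_inv(1) by blast
  next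
    case (eng h1 h2)
    then obtain T S where "T \<in> Gam" "h1 = MT T" "S \<in> Gam" "h2 = MT S" by blast
    then show ?case using MT_mult Gam_comp by blast
  qed
qed

lemma generators_MT: "Nplus \<union> Str \<union> {Jinv} \<subseteq> MT ` (Gam :: (real \<times> 'n::{finite,zero} V \<times> real \<Rightarrow> _) set)"
proof -
  have "Nplus \<subseteq> MT ` Gam" using MT_tau tau_Gam by (metis Nplus_def image_subsetI range_subsetD image_eqI rangeI)
  moreover have "Str \<subseteq> MT ` Gam" unfolding Str_eq using Lg_Gam by blast
  moreover have "Jinv \<in> MT ` Gam" using MT_Jm Jm_Gam by (metis image_eqI)
  ultimately show ?thesis by blast
qed

lemma MT_image_carrier: "MT ` Gam \<subseteq> carrier Bir"
  using MT_carrier by blast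

lemma carrier_Co_eq: "carrier Co = generate Bir (Nplus \<union> Str \<union> {Jinv})"
proof -
  have e: "carrier Bir \<inter> (Nplus \<union> Str \<union> {Jinv}) = Nplus \<union> Str \<union> {Jinv}"
    using generators_MT MT_image_carrier by blast
  show ?thesis unfolding Co_def carrier_subgroup_generated e ..
qed

lemma Co_simps: "A \<otimes>\<^bsub>Co\<^esub> B = A \<otimes>\<^bsub>Bir\<^esub> B" "\<one>\<^bsub>Co\<^esub> = \<one>\<^bsub>Bir\<^esub>"
  by (simp_all add: Co_def subgroup_generated_def)

lemma generate_comp:
  assumes "T \<in> Gam" "S \<in> Gam" "MT T \<in> generate Bir A" "MT S \<in> generate Bir A"
  shows "MT (T \<circ> S) \<in> generate Bir A"
  using MT_mult[OF assms(1,2)] generate.eng[OF assms(3,4)] by simp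

lemma omega_closure: "closure Omega = {x :: 'n::{finite,zero} V. 0 \<le> jdet x \<and> 0 \<le> x $ 0}"
proof
  have c: "continuous_on UNIV (jdet :: 'n V \<Rightarrow> real)"
    using jdet_poly by (auto simp: real_polynomial_function_eq intro: continuous_on_polymonial_function)
  have "closed {x :: 'n V. 0 \<le> jdet x}" by (intro closed_Collect_le continuous_on_const c)
  moreover have "closed {x :: 'n V. 0 \<le> x $ 0}" by (intro closed_Collect_le continuous_on_const continuous_on_component continuous_on_id)
  ultimately have "closed {x :: 'n V. 0 \<le> jdet x \<and> 0 \<le> x $ 0}" by (rule closed_Collect_conj)
  then show "closure Omega \<subseteq> {x :: 'n V. 0 \<le> jdet x \<and> 0 \<le> x $ 0}"
    by (rule closure_minimal[rotated]) (auto simp: Omega_def)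
  show "{x :: 'n V. 0 \<le> jdet x \<and> 0 \<le> x $ 0} \<subseteq> closure Omega"
  proof
    fix x :: "'n V" assume x: "x \<in> {x. 0 \<le> jdet x \<and> 0 \<le> x $ 0}"
    have nj: "norm (junit :: 'n V) = 1" by (simp add: norm_eq_1)
    show "x \<in> closure Omega" unfolding closure_approachable
    proof (intro allI impI)
      fix e :: real assume e: "0 < e"
      define y where "y = x + (e / 2) *\<^sub>R junit"
      have "jdet y = jdet x + e * x $ 0 + (e / 2)\<^sup>2"
        by (simp add: y_def jdet_add jb_simps) (simp add: jb_def)
      moreover have "0 < (e / 2)\<^sup>2" "0 \<le> e * x $ 0" using e x by auto
      ultimately have "0 < jdet y" using x by (simp only: mem_Collect_eq) linarith
      moreover have "0 < y $ 0" using x e by (simp add: y_def)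
      moreover have "dist y x < e" using e nj by (simp add: y_def dist_norm)
      ultimately show "\<exists>y\<in>Omega. dist y x < e" by (auto simp: Omega_def)
    qed
  qed
qed

text \<open>\<open>g\<close> maps \<open>Omega\<close> onto itself and its closure into itself,
  hence boundary points to boundary points; together with their negatives these form the null
  cone.\<close>

lemma GOmega_conformal:
  fixes g :: "'n::{finite,zero} V \<Rightarrow> 'n V"
  assumes g: "g \<in> GL" and O: "g ` Omega = Omega"
  obtains c where "0 < c" "\<And>x. jdet (g x) = c * jdet x"
proof -
  have l: "linear g" using GL_linear[OF g] .
  have cont: "continuous_on (closure Omega) g"
    using l by (simp add: linear_continuous_on linear_conv_bounded_linear)
  have "g ` closure Omega \<subseteq> closure Omega"
    by (rule image_closure_subset[OF cont]) (use O closure_subset in auto)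
  then have cl: "g x \<in> closure Omega" if "x \<in> closure Omega" for x using that by blast
  have n: "jdet (g x) = 0" if x: "jdet x = 0" "0 \<le> x $ 0" for x
  proof (rule ccontr)
    assume ne: "jdet (g x) \<noteq> 0"
    have gx: "0 \<le> jdet (g x)" "0 \<le> g x $ 0" using cl[of x] x by (auto simp: omega_closure)
    moreover have "g x $ 0 \<noteq> 0"
    proof
      assume "g x $ 0 = 0"
      then have "jdet (g x) \<le> 0" by (simp add: jdet_eq)
      then show False using gx ne by simp
    qed
    ultimately have "g x \<in> Omega" using ne by (simp add: Omega_def)
    then have "g x \<in> g ` Omega" using O by simp
    then have "x \<in> Omega" using bij_is_inj[OF GL_bij[OF g]] by (auto simp: inj_image_mem_iff)
    then show False using x by (simp add: Omega_def)
  qed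
  have "jdet (g x) = 0" if x: "jdet x = 0" for x
  proof (cases "0 \<le> x $ 0")
    case True then show ?thesis using n x by blast
  next
    case False
    then have "jdet (g (- x)) = 0" using x by (intro n) auto
    then show ?thesis using linear_neg[OF l, of x] by simp
  qed
  then have "jdet (g x) = jdet (g junit) * jdet x" for x by (rule null_cone_conformal[OF l])
  moreover have "0 < jdet (g junit)"
  proof -
    have "junit \<in> Omega" by (simp add: Omega_def)
    then have "g junit \<in> Omega" using O by blast
    then show ?thesis by (simp add: Omega_def)
  qed
  ultimately show thesis using that by blast
qed

text \<open>Linear representatives of causal transformations; composing them replaces computing
  products of classes in \<open>Bir\<close>.\<close>

definition CGam :: "(real \<times> 'n::{finite,zero} V \<times> real \<Rightarrow> real \<times> 'n V \<times> real) set" where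
  "CGam = {T \<in> Gam. MT T \<in> CoG}"

lemma CGam_Gam: "T \<in> CGam \<Longrightarrow> T \<in> Gam"
  by (simp add: CGam_def)

lemma CGam_comp: "T \<in> CGam \<Longrightarrow> S \<in> CGam \<Longrightarrow> T \<circ> S \<in> CGam"
  using generate_comp Gam_comp by (auto simp: CGam_def CoG_def)

lemma tau_CGam: "tau w \<in> CGam"
  using tau_Gam by (auto simp: CGam_def CoG_def MT_tau Nplus_def intro: generate.incl)

lemma Nm_CGam: "Nm \<in> CGam"
  using Nm_Gam by (auto simp: CGam_def CoG_def MT_Nm intro: generate.incl)

lemma Lg_CGam:
  assumes "g \<in> GL" "g ` Omega = Omega" "\<And>x. jdet (g x) = c * jdet x"
  shows "Lg g c \<in> CGam"
  using Lg_Gam[OF assms(1,3)] assms(1,2) by (auto simp: CGam_def CoG_def MT_Lg GOmega_def intro: generate.incl)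

lemma CoG_subset_MT: "CoG \<subseteq> MT ` (Gam :: (real \<times> 'n::{finite,zero} V \<times> real \<Rightarrow> _) set)"
  unfolding CoG_def
proof (rule generate_Bir_subset)
  have a: "(Nplus :: 'n ratmap set) \<subseteq> MT ` Gam" using generators_MT by blast
  have b: "(GOmega :: 'n ratmap set) \<subseteq> MT ` Gam"
  proof
    fix A :: "'n ratmap" assume "A \<in> GOmega"
    then obtain g where g: "A = ratcls g" "g \<in> GL" "g ` Omega = Omega" by (auto simp: GOmega_def)
    obtain c where "\<And>x. jdet (g x) = c * jdet x" using GOmega_conformal[OF g(2,3)] by blast
    then have "Lg g c \<in> Gam" using Lg_Gam g by blast
    then show "A \<in> MT ` Gam" using g MT_Lg by blast
  qed
  have c: "ratcls (\<lambda>x. - jinv x) \<in> MT ` (Gam :: (real \<times> 'n V \<times> real \<Rightarrow> _) set)"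
    unfolding MT_Nm[symmetric] by (rule imageI[OF Nm_Gam])
  show "Nplus \<union> GOmega \<union> {ratcls (\<lambda>x. - jinv x)} \<subseteq> MT ` (Gam :: (real \<times> 'n V \<times> real \<Rightarrow> _) set)"
    using a b c by (simp only: Un_subset_iff insert_subset empty_subsetI simp_thms)
qed

lemma minus_GL: "uminus \<in> GL"
  by (auto simp: GL_def linear_uminus bij_uminus)

lemma Nm_eq: "Nm = Lg uminus 1 \<circ> Jm"
  by (rule ext) (simp add: Lg_def Jm_def Nm_def)

lemma Lg_minus_Gam: "Lg uminus 1 \<in> Gam"
  by (rule Lg_Gam[OF minus_GL]) simp

section \<open>Transitivity on null lines and the stabilizer of the origin\<close>

text \<open>\<open>P\<close> is kept abstract to serve both the conformal and the causal group. A
  line with \<open>fst X \<noteq> 0\<close> is reached by a translation, one with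
  \<open>fst X = 0\<close> and nonzero last coordinate after exchanging the ends by
  \<open>Nm\<close>. If both vanish, translating by \<open>alpha x\<close> makes the last coordinate
  \<open>2 * (x \<bullet> x)\<close>.\<close>

lemma null_transitive:
  fixes P :: "(real \<times> 'n::{finite,zero} V \<times> real \<Rightarrow> real \<times> 'n V \<times> real) set"
  assumes X: "hq X = 0" "X \<noteq> 0"
    and P: "\<And>w. tau w \<in> P" "Nm \<in> P" "\<And>T S. T \<in> P \<Longrightarrow> S \<in> P \<Longrightarrow> T \<circ> S \<in> P"
  obtains T c where "T \<in> P" "c \<noteq> 0" "T (kap 0) = c *\<^sub>R X"
proof -
  have 1: "\<exists>T\<in>P. \<exists>c. c \<noteq> 0 \<and> T (kap 0) = c *\<^sub>R X" if X: "hq X = 0" "fst X \<noteq> 0" for X :: "real \<times> 'n V \<times> real"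
  proof -
    have "tau ((1 / fst X) *\<^sub>R fst (snd X)) (kap 0) = (1 / fst X) *\<^sub>R X"
      using X by (cases X) (auto simp: kap_def jb_simps power2_eq_square field_simps)
    then show ?thesis using P(1) X(2) by (metis divide_eq_0_iff zero_neq_one)
  qed
  have 2: "\<exists>T\<in>P. \<exists>c. c \<noteq> 0 \<and> T (kap 0) = c *\<^sub>R X"
    if X: "hq X = 0" "fst X \<noteq> 0 \<or> snd (snd X) \<noteq> 0" for X :: "real \<times> 'n V \<times> real"
  proof (cases "fst X = 0")
    case False then show ?thesis using 1 X by blast
  next
    case True
    then have "hq (Nm X) = 0" "fst (Nm X) \<noteq> 0" using X Gam_null[OF Nm_Gam, of X] by (auto simp: Nm_def)
    then obtain T c where T: "T \<in> P" "c \<noteq> 0" "T (kap 0) = c *\<^sub>R Nm X" using 1 by blast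
    have "(Nm \<circ> T) (kap 0) = c *\<^sub>R X" using T(3) by (simp add: Gam_scale[OF Nm_Gam])
    then show ?thesis using T P(3)[OF P(2) T(1)] by blast
  qed
  have "\<exists>T\<in>P. \<exists>c. c \<noteq> 0 \<and> T (kap 0) = c *\<^sub>R X"
  proof (cases "fst X \<noteq> 0 \<or> snd (snd X) \<noteq> 0")
    case True then show ?thesis using 2 X by blast
  next
    case False
    obtain x where Xe: "X = (0, x, 0)" using False by (cases X) auto
    have x: "x \<noteq> 0" using X Xe by (auto simp: zero_prod_def)
    define w where "w = alpha x"
    have "snd (snd (tau w X)) \<noteq> 0" using x by (simp add: Xe w_def jb_alpha_self)
    moreover have "hq (tau w X) = 0" using X Gam_null[OF tau_Gam] by blast
    ultimately obtain T c where T: "T \<in> P" "c \<noteq> 0" "T (kap 0) = c *\<^sub>R tau w X" using 2 by blast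
    have "(tau (- w) \<circ> T) (kap 0) = c *\<^sub>R X"
      using T(3) by (simp add: Gam_scale[OF tau_Gam] tau_tau tau_0)
    then show ?thesis using T P(3)[OF P(1) T(1)] by blast
  qed
  then show thesis using that by blast
qed

text \<open>Conjugation by \<open>Jm\<close> turns the stabilizer of the origin into that of
  infinity. After a translation the origin is fixed as well, and a similitude fixing both null lines
  preserves their common orthogonal complement, where it is a conformal linear map.\<close>

lemma stabilizer_decomposition:
  fixes R :: "real \<times> 'n::{finite,zero} V \<times> real \<Rightarrow> real \<times> 'n V \<times> real"
  assumes R: "R \<in> Gam" and Ro: "R (kap 0) = c *\<^sub>R kap 0"
  obtains g k w where "g \<in> GL" "\<And>x. jdet (g x) = k * jdet x" "MT R = MT (Lg g k \<circ> (Jm \<circ> tau w \<circ> Jm))"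
proof -
  define i :: "real \<times> 'n V \<times> real" where "i = (0, 0, 1)"
  define T where "T = Jm \<circ> R \<circ> Jm"
  have T: "T \<in> Gam" unfolding T_def by (intro Gam_comp Jm_Gam R)
  have Ji: "Jm i = kap 0" "Jm (kap 0) = i" by (auto simp: i_def kap_def alpha_linear)
  have Ti: "T i = c *\<^sub>R i" by (simp add: T_def Ji Ro Gam_scale[OF Jm_Gam])
  have c: "c \<noteq> 0" using Ro Gam_zero_iff[OF R, of "kap 0"] by auto
  \<comment> \<open>\<open>T\<close> sends \<open>X\<close> to the origin. The product of
    \<open>X\<close> with \<open>i\<close> is nonzero, so \<open>X\<close> lies in the chart and is
    a multiple of some \<open>kap w\<close>; precomposing with \<open>tau w\<close> makes the origin
    fixed.\<close>
  define X where "X = finv T (kap 0)"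
  have TX: "T X = kap 0" by (simp add: X_def Gam_inv(2)[OF T])
  obtain d where d: "d \<noteq> 0" "\<And>X. hq (T X) = d * hq X" using Gam_hq[OF T] by blast
  have X0: "hq X = 0" using Gam_null[OF T, of X] by (simp add: TX)
  have "d * hb X i = c * hb (kap 0) i" using Gam_hb[OF T d(2), of X i] by (simp add: TX Ti hb_simps)
  then have s0: "fst X \<noteq> 0" using c by (cases X) (auto simp: i_def kap_def jb_simps)
  define s where "s = fst X"
  define w where "w = (1 / s) *\<^sub>R fst (snd X)"
  have Xk: "X = s *\<^sub>R kap w" using null_eq_kap[OF X0 s0] by (simp add: s_def w_def)
  define U where "U Y = s *\<^sub>R T (tau w Y)" for Y
  have U: "U \<in> Gam" unfolding U_def using Gam_scaled[OF Gam_comp[OF T tau_Gam], of s w] s0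
    by (simp add: s_def o_def)
  have Uo: "U (kap 0) = kap 0"
  proof -
    have "tau w (kap 0) = kap w" by (simp add: kap_def jb_simps)
    then have "U (kap 0) = T X" by (simp add: U_def Xk Gam_scale[OF T])
    then show ?thesis by (simp add: TX)
  qed
  define k where "k = s * c"
  have Ui: "U i = k *\<^sub>R i"
  proof -
    have "tau w i = i" by (simp add: i_def jb_simps)
    then show ?thesis by (simp add: U_def Ti k_def)
  qed
  have k: "k \<noteq> 0" using c s0 by (simp add: k_def s_def)
  obtain e where e: "e \<noteq> 0" "\<And>X. hq (U X) = e * hq X" using Gam_hq[OF U] by blast
  have ek: "e = k"
    using Gam_hb[OF U e(2), of "kap 0" i] by (simp add: Uo Ui hb_simps) (simp add: kap_def i_def jb_simps)
  define g where "g v = fst (snd (U (0, v, 0)))" for v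
  have Uv: "U (0, v, 0) = (0, g v, 0)" for v
  proof -
    have "hb (U (0, v, 0)) (U (kap 0)) = 0" "hb (U (0, v, 0)) (U i) = 0"
      unfolding Gam_hb[OF U e(2)] by (auto simp: kap_def i_def jb_simps)
    then show ?thesis using k unfolding Uo Ui
      by (cases "U (0, v, 0)") (auto simp: kap_def i_def jb_simps g_def)
  qed
  have UL: "U (a, v, b) = Lg g k (a, v, b)" for a v b
  proof -
    have e1: "(a, v, b) = a *\<^sub>R kap 0 + (0, v, 0) + b *\<^sub>R i" by (simp add: kap_def i_def)
    show ?thesis unfolding e1 linear_add[OF Gam_linear[OF U]] linear_cmul[OF Gam_linear[OF U]] Uo Ui Uv
      by (simp add: kap_def i_def)
  qed
  have gl: "linear g"
  proof (rule linearI)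
    fix v v' :: "'n V" and r :: real
    have "(0::real, v + v', 0::real) = (0, v, 0) + (0, v', 0)" by simp
    then have "U (0, v + v', 0) = U (0, v, 0) + U (0, v', 0)" by (metis linear_add[OF Gam_linear[OF U]])
    then show "g (v + v') = g v + g v'" by (simp add: Uv)
    have "(0::real, r *\<^sub>R v, 0::real) = r *\<^sub>R (0, v, 0)" by simp
    then have "U (0, r *\<^sub>R v, 0) = r *\<^sub>R U (0, v, 0)" by (metis linear_cmul[OF Gam_linear[OF U]])
    then show "g (r *\<^sub>R v) = r *\<^sub>R g v" by (simp add: Uv)
  qed
  have "inj g"
  proof (rule injI)
    fix v v' assume "g v = g v'"
    then have "U (0, v, 0) = U (0, v', 0)" by (simp add: Uv)
    then have "(0::real, v, 0::real) = (0, v', 0)" using bij_is_inj[OF Gam_bij[OF U]] by (metis injD)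
    then show "v = v'" by simp
  qed
  moreover have "surj g"
    using linear_injective_imp_surjective[OF gl \<open>inj g\<close>] by simp
  ultimately have gGL: "g \<in> GL" using gl by (simp add: GL_def bij_def)
  have gj: "jdet (g x) = k * jdet x" for x
    using e(2)[of "(0, x, 0)"] by (simp add: Uv ek)
  define h where "h v = (1 / k) *\<^sub>R alpha (g (alpha v))" for v
  note ac = alpha_conjugate[OF gGL gj, folded h_def]
  have "R Y = (k / s) *\<^sub>R (Lg h (1 / k) \<circ> (Jm \<circ> tau (- w) \<circ> Jm)) Y" for Y
  proof -
    define Z where "Z = tau (- w) (Jm Y)"
    have JY: "Jm Y = tau w Z" by (simp add: Z_def tau_tau tau_0)
    have "U Z = s *\<^sub>R Jm (R Y)" unfolding U_def by (simp add: JY[symmetric] T_def)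
    then have "s *\<^sub>R Jm (R Y) = Lg g k Z" using UL by (metis prod_cases3)
    then have "Jm (s *\<^sub>R Jm (R Y)) = Jm (Lg g k (Jm (Jm Z)))" by simp
    then have "s *\<^sub>R R Y = k *\<^sub>R Lg h (1 / k) (Jm Z)" unfolding ac(3) by (simp add: Gam_scale[OF Jm_Gam])
    then have "(1 / s) *\<^sub>R (s *\<^sub>R R Y) = (1 / s) *\<^sub>R (k *\<^sub>R Lg h (1 / k) (Jm Z))" by simp
    then show ?thesis using s0 by (simp add: Z_def s_def)
  qed
  then have "R = (\<lambda>Y. (k / s) *\<^sub>R (Lg h (1 / k) \<circ> (Jm \<circ> tau (- w) \<circ> Jm)) Y)" by (rule ext)
  then have "MT R = MT (Lg h (1 / k) \<circ> (Jm \<circ> tau (- w) \<circ> Jm))"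
    using MT_scaled[of "k / s" "Lg h (1 / k) \<circ> (Jm \<circ> tau (- w) \<circ> Jm)"] k s0 by (simp add: s_def)
  then show thesis using that[OF ac(1,2)] by blast
qed

lemma tau_Co: "MT (tau w) \<in> carrier Co" and Jm_Co: "MT Jm \<in> carrier Co"
  and Lg_Co: "g \<in> GL \<Longrightarrow> (\<And>x. jdet (g x) = c * jdet x) \<Longrightarrow> MT (Lg g c) \<in> carrier Co"
proof -
  show "MT (tau w) \<in> carrier Co" unfolding carrier_Co_eq by (rule generate.incl) (simp add: MT_tau Nplus_def)
  show "MT Jm \<in> carrier Co" unfolding carrier_Co_eq by (rule generate.incl) (simp add: MT_Jm)
  show "MT (Lg g c) \<in> carrier Co" if "g \<in> GL" "\<And>x. jdet (g x) = c * jdet x"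
    unfolding carrier_Co_eq by (rule generate.incl) (use that Str_eq in blast)
qed

lemma Co_comp: "T \<in> Gam \<Longrightarrow> S \<in> Gam \<Longrightarrow> MT T \<in> carrier Co \<Longrightarrow> MT S \<in> carrier Co \<Longrightarrow> MT (T \<circ> S) \<in> carrier Co"
  unfolding carrier_Co_eq by (rule generate_comp)

text \<open>The conformal group acts transitively on null lines and contains every class of a
  similitude that fixes the line of the origin, by the decomposition of the stabilizer; so it
  contains the class of every similitude.\<close>

lemma carrier_Co: "carrier Co = MT ` (Gam :: (real \<times> 'n::{finite,zero} V \<times> real \<Rightarrow> _) set)"
proof
  show "carrier Co \<subseteq> MT ` (Gam :: (real \<times> 'n V \<times> real \<Rightarrow> _) set)"
    unfolding carrier_Co_eq by (rule generate_Bir_subset[OF generators_MT])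
  show "MT ` Gam \<subseteq> carrier (Co :: 'n ratmap monoid)"
  proof
    fix A :: "'n ratmap" assume "A \<in> MT ` Gam"
    then obtain T :: "real \<times> 'n V \<times> real \<Rightarrow> _" where T: "T \<in> Gam" "A = MT T" by blast
    define P where "P = {S :: real \<times> 'n V \<times> real \<Rightarrow> _. S \<in> Gam \<and> MT S \<in> carrier Co}"
    have n: "hq (T (kap 0)) = 0" "T (kap 0) \<noteq> 0" using T by (simp_all add: Gam_null Gam_zero_iff)
    have p1: "tau w \<in> P" for w by (simp add: P_def tau_Gam tau_Co)
    have p2: "Nm \<in> P"
      unfolding Nm_eq P_def using Gam_comp[OF Lg_minus_Gam Jm_Gam]
        Co_comp[OF Lg_minus_Gam Jm_Gam Lg_Co[OF minus_GL] Jm_Co] by simp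
    have p3: "S \<circ> S' \<in> P" if "S \<in> P" "S' \<in> P" for S S' using that by (simp add: P_def Gam_comp Co_comp)
    obtain S c where S: "S \<in> P" "c \<noteq> 0" "S (kap 0) = c *\<^sub>R T (kap 0)"
      using null_transitive[OF n, of P] p1 p2 p3 by blast
    have SG: "S \<in> Gam" "MT S \<in> carrier Co" using S(1) by (auto simp: P_def)
    define R where "R = finv S \<circ> T"
    have RG: "R \<in> Gam" unfolding R_def by (intro Gam_comp Gam_inv(1) SG T)
    have "T (kap 0) = (1 / c) *\<^sub>R S (kap 0)" using S by simp
    then have "R (kap 0) = (1 / c) *\<^sub>R kap 0"
      by (simp add: R_def Gam_scale[OF Gam_inv(1)[OF SG(1)]] Gam_inv(3)[OF SG(1)])
    then obtain g k w where g: "g \<in> GL" "\<And>x. jdet (g x) = k * jdet x"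
      "MT R = MT (Lg g k \<circ> (Jm \<circ> tau w \<circ> Jm))"
      using stabilizer_decomposition[OF RG] by blast
    have "MT R \<in> carrier Co" unfolding g(3)
      by (intro Co_comp Gam_comp Lg_Gam[OF g(1,2)] Jm_Gam tau_Gam Lg_Co[OF g(1,2)] Jm_Co tau_Co)
    then have "MT (S \<circ> R) \<in> carrier Co" by (intro Co_comp SG RG)
    moreover have "S \<circ> R = T" by (rule ext) (simp add: R_def Gam_inv(2)[OF SG(1)])
    ultimately show "A \<in> carrier Co" using T by simp
  qed
qed

text \<open>Makes the product of \<open>Str\<close> and \<open>Nminus\<close> the full stabilizer of
  the null line of the origin, which lets cosets be read as null lines.\<close>

lemma base_eq: "base = {MT R |R. R \<in> (Gam :: (real \<times> 'n::{finite,zero} V \<times> real \<Rightarrow> _) set) \<and> (\<exists>c. R (kap 0) = c *\<^sub>R kap 0)}"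
proof (intro equalityI subsetI)
  fix A :: "'n ratmap" assume "A \<in> base"
  then obtain B C where A: "A = B \<otimes>\<^bsub>Bir\<^esub> C" "B \<in> Str" "C \<in> Nminus"
    unfolding base_def set_mult_def by blast
  obtain g c where g: "B = MT (Lg g c)" "g \<in> GL" "\<And>x. jdet (g x) = c * jdet x" using A(2) unfolding Str_eq by blast
  obtain w where w: "C = MT Jm \<otimes>\<^bsub>Bir\<^esub> MT (tau w) \<otimes>\<^bsub>Bir\<^esub> MT Jm"
    using A(3) by (auto simp: Nminus_def Nplus_def MT_Jm MT_tau)
  have C: "C = MT (Jm \<circ> tau w \<circ> Jm)"
    unfolding w by (simp add: MT_mult Jm_Gam tau_Gam Gam_comp)
  have R: "Lg g c \<circ> (Jm \<circ> tau w \<circ> Jm) \<in> Gam" by (intro Gam_comp Lg_Gam[OF g(2,3)] Jm_Gam tau_Gam)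
  have "A = MT (Lg g c \<circ> (Jm \<circ> tau w \<circ> Jm))"
    unfolding A g C by (rule MT_mult) (intro Gam_comp Lg_Gam[OF g(2,3)] Jm_Gam tau_Gam)+
  moreover have "(Lg g c \<circ> (Jm \<circ> tau w \<circ> Jm)) (kap 0) = 1 *\<^sub>R kap 0"
    by (simp add: kap_def alpha_linear jb_simps linear_0[OF GL_linear[OF g(2)]])
  ultimately show "A \<in> {MT R |R. R \<in> Gam \<and> (\<exists>c. R (kap 0) = c *\<^sub>R kap 0)}" using R by blast
next
  fix A :: "'n ratmap" assume "A \<in> {MT R |R. R \<in> Gam \<and> (\<exists>c. R (kap 0) = c *\<^sub>R kap 0)}"
  then obtain R c where R: "A = MT R" "R \<in> Gam" "R (kap 0) = c *\<^sub>R kap 0" by blast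
  obtain g k w where g: "g \<in> GL" "\<And>x. jdet (g x) = k * jdet x"
    "MT R = MT (Lg g k \<circ> (Jm \<circ> tau w \<circ> Jm))"
    using stabilizer_decomposition[OF R(2,3)] by blast
  have "A = MT (Lg g k) \<otimes>\<^bsub>Bir\<^esub> MT (Jm \<circ> tau w \<circ> Jm)"
    unfolding R(1) g(3) by (rule MT_mult[symmetric]) (intro Gam_comp Lg_Gam[OF g(1,2)] Jm_Gam tau_Gam)+
  also have "MT (Jm \<circ> tau w \<circ> Jm) = Jinv \<otimes>\<^bsub>Bir\<^esub> transl w \<otimes>\<^bsub>Bir\<^esub> Jinv"
    unfolding MT_Jm[symmetric] MT_tau[symmetric] by (simp add: MT_mult Jm_Gam tau_Gam Gam_comp)
  finally have "A = MT (Lg g k) \<otimes>\<^bsub>Bir\<^esub> (Jinv \<otimes>\<^bsub>Bir\<^esub> transl w \<otimes>\<^bsub>Bir\<^esub> Jinv)" .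
  moreover have "MT (Lg g k) \<in> Str" unfolding Str_eq using g by blast
  moreover have "Jinv \<otimes>\<^bsub>Bir\<^esub> transl w \<otimes>\<^bsub>Bir\<^esub> Jinv \<in> Nminus" by (auto simp: Nminus_def Nplus_def)
  ultimately show "A \<in> base" unfolding base_def set_mult_def by blast
qed

lemma CoG_subset_Co: "CoG \<subseteq> carrier Co"
  unfolding carrier_Co by (rule CoG_subset_MT)

lemma CGam_transitive:
  fixes X :: "real \<times> 'n::{finite,zero} V \<times> real"
  assumes "hq X = 0" "X \<noteq> 0"
  obtains T c where "T \<in> CGam" "c \<noteq> 0" "T (kap 0) = c *\<^sub>R X"
  using null_transitive[OF assms, of CGam] tau_CGam Nm_CGam CGam_comp by blast

text \<open>The coset of the birational maps that send the null line of the origin to the line of \<open>X\<close>.\<close>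

definition pt :: "real \<times> 'n::{finite,zero} V \<times> real \<Rightarrow> 'n vcpoint" where
  "pt X = {MT R |R. R \<in> Gam \<and> (\<exists>c. R (kap 0) = c *\<^sub>R X)}"

lemma act_pt:
  assumes T: "T \<in> Gam"
  shows "act (MT T) (pt X) = pt (T X)"
proof (intro equalityI subsetI)
  fix A assume "A \<in> act (MT T) (pt X)"
  then obtain R c where R: "A = MT T \<otimes>\<^bsub>Bir\<^esub> MT R" "R \<in> Gam" "R (kap 0) = c *\<^sub>R X"
    by (auto simp: act_def l_coset_def Co_simps pt_def)
  have "A = MT (T \<circ> R)" using R MT_mult[OF T] by simp
  moreover have "(T \<circ> R) (kap 0) = c *\<^sub>R T X" using R by (simp add: Gam_scale[OF T])
  ultimately show "A \<in> pt (T X)" using Gam_comp[OF T R(2)] unfolding pt_def by blast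
next
  fix A assume "A \<in> pt (T X)"
  then obtain R c where R: "A = MT R" "R \<in> Gam" "R (kap 0) = c *\<^sub>R T X" by (auto simp: pt_def)
  define S where "S = finv T \<circ> R"
  have S: "S \<in> Gam" unfolding S_def by (intro Gam_comp Gam_inv(1) T R)
  have "S (kap 0) = c *\<^sub>R X" by (simp add: S_def R Gam_scale[OF Gam_inv(1)[OF T]] Gam_inv(3)[OF T])
  then have "MT S \<in> pt X" using S unfolding pt_def by blast
  moreover have "T \<circ> S = R" by (rule ext) (simp add: S_def Gam_inv(2)[OF T])
  then have "A = MT T \<otimes>\<^bsub>Bir\<^esub> MT S" using R MT_mult[OF T S] by simp
  ultimately show "A \<in> act (MT T) (pt X)" by (auto simp: act_def l_coset_def Co_simps)
qed

lemma base_pt: "base = pt (kap 0)"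
  unfolding base_eq pt_def ..

lemma Vc_eq: "Vc = {pt X |X. hq X = 0 \<and> X \<noteq> (0 :: real \<times> 'n::{finite,zero} V \<times> real)}"
proof -
  have "Vc = {act A base |A. A \<in> carrier (Co :: 'n ratmap monoid)}"
    unfolding Vc_def LCOSETS_def act_def by auto
  also have "\<dots> = {pt (T (kap 0)) |T. T \<in> (Gam :: (real \<times> 'n V \<times> real \<Rightarrow> _) set)}"
    unfolding carrier_Co base_pt using act_pt by (auto, blast+)
  also have "\<dots> = {pt X |X. hq X = 0 \<and> X \<noteq> (0 :: real \<times> 'n V \<times> real)}"
  proof (intro equalityI subsetI)
    fix p assume "p \<in> {pt (T (kap 0)) |T. T \<in> (Gam :: (real \<times> 'n V \<times> real \<Rightarrow> _) set)}"
    then show "p \<in> {pt X |X. hq X = 0 \<and> X \<noteq> (0 :: real \<times> 'n V \<times> real)}"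
      using Gam_null Gam_zero_iff hq_kap kap_nonzero by (smt (verit) mem_Collect_eq)
  next
    fix p assume "p \<in> {pt X |X. hq X = 0 \<and> X \<noteq> (0 :: real \<times> 'n V \<times> real)}"
    then obtain X :: "real \<times> 'n V \<times> real" where X: "p = pt X" "hq X = 0" "X \<noteq> 0" by blast
    obtain T c where T: "T \<in> CGam" "c \<noteq> 0" "T (kap 0) = c *\<^sub>R X" using CGam_transitive[OF X(2,3)] .
    define S where "S = (\<lambda>X. (1 / c) *\<^sub>R T X)"
    have "S \<in> Gam" unfolding S_def by (rule Gam_scaled) (use T CGam_Gam in auto)
    moreover have "S (kap 0) = X" using T by (simp add: S_def)
    ultimately show "p \<in> {pt (T (kap 0)) |T. T \<in> (Gam :: (real \<times> 'n V \<times> real \<Rightarrow> _) set)}" using X by blast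
  qed
  finally show ?thesis .
qed

lemma pt_scale: "c \<noteq> 0 \<Longrightarrow> pt (c *\<^sub>R X) = pt X"
proof -
  assume c: "c \<noteq> 0"
  have e: "(\<exists>d. R (kap 0) = d *\<^sub>R c *\<^sub>R X) \<longleftrightarrow> (\<exists>d. R (kap 0) = d *\<^sub>R X)" for R
  proof
    assume "\<exists>d. R (kap 0) = d *\<^sub>R X"
    then obtain d where "R (kap 0) = d *\<^sub>R X" ..
    then have "R (kap 0) = (d / c) *\<^sub>R c *\<^sub>R X" using c by simp
    then show "\<exists>d. R (kap 0) = d *\<^sub>R c *\<^sub>R X" ..
  qed auto
  show ?thesis unfolding pt_def e ..
qed

text \<open>\<open>pt X\<close> contains the class of a similitude that moves the origin to the line
  of \<open>X\<close>. The same class lies in \<open>pt Y\<close>, and representatives are unique up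
  to scalars, so the two lines agree.\<close>

lemma pt_eqD:
  assumes eq: "pt X = pt Y" and X: "hq X = 0" "X \<noteq> 0" and Y: "Y \<noteq> 0"
  obtains c where "c \<noteq> 0" "X = c *\<^sub>R Y"
proof -
  obtain T c where T: "T \<in> CGam" "c \<noteq> 0" "T (kap 0) = c *\<^sub>R X" using CGam_transitive[OF X] .
  have TG: "T \<in> Gam" using T CGam_Gam by blast
  have "MT T \<in> pt Y" using T TG eq unfolding pt_def by blast
  then obtain R d where R: "MT T = MT R" "R \<in> Gam" "R (kap 0) = d *\<^sub>R Y" by (auto simp: pt_def)
  obtain e where e: "e \<noteq> 0" "\<And>X. T X = e *\<^sub>R R X" using MT_eq_iff[OF TG R(2,1)] by blast
  have "c *\<^sub>R X = (e * d) *\<^sub>R Y" using T(3) e(2)[of "kap 0"] R(3) by simp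
  then have "(1 / c) *\<^sub>R c *\<^sub>R X = (1 / c) *\<^sub>R (e * d) *\<^sub>R Y" by simp
  then have Xe: "X = (e * d / c) *\<^sub>R Y" using T(2) by simp
  then have "e * d / c \<noteq> 0" using X(2) by (metis scaleR_zero_left)
  then show thesis using that Xe by blast
qed

lemma emb_eq: "emb v = pt (kap v)"
proof -
  have "emb v = pt (tau v (kap 0))" unfolding emb_def base_pt MT_tau[symmetric] by (rule act_pt[OF tau_Gam])
  then show ?thesis by (simp add: kap_def jb_simps)
qed

lemma vcpar_eq: "T \<in> Gam \<Longrightarrow> vcpar (MT T) v = pt (T (kap v))"
  unfolding vcpar_def emb_eq by (rule act_pt)

lemma vcpar_inj:
  assumes "T \<in> Gam"
  shows "inj (vcpar (MT T))"
proof (rule injI)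
  fix v w assume "vcpar (MT T) v = vcpar (MT T) w"
  then have "pt (T (kap v)) = pt (T (kap w))" by (simp add: vcpar_eq[OF assms])
  then obtain c where c: "c \<noteq> 0" "T (kap v) = c *\<^sub>R T (kap w)"
    by (rule pt_eqD) (use assms in \<open>simp_all add: Gam_null Gam_zero_iff\<close>)
  then have "T (kap v) = T (c *\<^sub>R kap w)" by (simp add: Gam_scale[OF assms])
  then have "kap v = c *\<^sub>R kap w" using bij_is_inj[OF Gam_bij[OF assms]] by (metis injD)
  then show "v = w" by (simp add: kap_def)
qed

lemma vcchart_vcpar: "T \<in> Gam \<Longrightarrow> vcchart (MT T) (vcpar (MT T) v) = v"
  by (simp add: vcchart_def vcpar_inj)

lemma vcpar_vcchart: "p \<in> range (vcpar g) \<Longrightarrow> vcpar g (vcchart g p) = p"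
  by (simp add: vcchart_def f_inv_into_f)

section \<open>\<open>Vc_top\<close> as a quotient topology of the null cone\<close>

definition Nc :: "(real \<times> 'n::{finite,zero} V \<times> real) set" where
  "Nc = {X. hq X = 0 \<and> X \<noteq> 0}"

lemma Nc_Gam: "T \<in> Gam \<Longrightarrow> T X \<in> Nc \<longleftrightarrow> X \<in> Nc"
  by (simp add: Nc_def Gam_null Gam_zero_iff)

lemma kap_Nc [simp]: "kap v \<in> Nc"
  by (simp add: Nc_def)

lemma Vc_Nc: "Vc = pt ` Nc"
  unfolding Vc_eq Nc_def by blast

lemma continuous_on_kap: "continuous_on A (kap :: 'n::{finite,zero} V \<Rightarrow> _)"
  using continuous_on_polymonial_function[OF kap_poly] continuous_on_subset by blast

lemma continuous_on_linear: "linear (T :: 'a::euclidean_space \<Rightarrow> 'b::real_normed_vector) \<Longrightarrow> continuous_on A T"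
  by (simp add: linear_continuous_on linear_conv_bounded_linear)

text \<open>In a chart the preimage is a union over all scalars \<open>c \<noteq> 0\<close> of open
  sets, because \<open>pt\<close> sees only lines.\<close>

lemma openin_pt_image:
  fixes B :: "(real \<times> 'n::{finite,zero} V \<times> real) set"
  assumes B: "open B"
  shows "openin Vc_top (pt ` (B \<inter> Nc))"
  unfolding openin_Vc_top
proof (intro conjI ballI)
  show "pt ` (B \<inter> Nc) \<subseteq> Vc" by (auto simp: Vc_Nc)
  fix A :: "'n ratmap" assume "A \<in> carrier Co"
  then obtain T :: "real \<times> 'n V \<times> real \<Rightarrow> _" where T: "T \<in> Gam" "A = MT T" unfolding carrier_Co by blast
  have "vcpar A -` (pt ` (B \<inter> Nc)) = (\<Union>c\<in>-{0}. (\<lambda>v. c *\<^sub>R T (kap v)) -` B)"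
  proof (intro equalityI subsetI)
    fix v assume "v \<in> vcpar A -` (pt ` (B \<inter> Nc))"
    then obtain X where X: "X \<in> B" "X \<in> Nc" "pt (T (kap v)) = pt X"
      by (auto simp: T(2) vcpar_eq[OF T(1)])
    obtain c where c: "c \<noteq> 0" "X = c *\<^sub>R T (kap v)"
      using pt_eqD[OF X(3)[symmetric]] X(2) T(1) by (metis (mono_tags, lifting) Gam_zero_iff Nc_def kap_nonzero mem_Collect_eq)
    then show "v \<in> (\<Union>c\<in>-{0}. (\<lambda>v. c *\<^sub>R T (kap v)) -` B)" using X by auto
  next
    fix v assume "v \<in> (\<Union>c\<in>-{0}. (\<lambda>v. c *\<^sub>R T (kap v)) -` B)"
    then obtain c where c: "c \<noteq> 0" "c *\<^sub>R T (kap v) \<in> B" by auto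
    have "T (kap v) \<in> Nc" using T by (simp add: Nc_Gam)
    then have "c *\<^sub>R T (kap v) \<in> Nc" using c by (simp add: Nc_def)
    moreover have "vcpar A v = pt (c *\<^sub>R T (kap v))" by (simp add: T(2) vcpar_eq[OF T(1)] pt_scale[OF c(1)])
    ultimately show "v \<in> vcpar A -` (pt ` (B \<inter> Nc))" using c by blast
  qed
  moreover have "open ((\<lambda>v. c *\<^sub>R T (kap v)) -` B)" for c
  proof (rule open_vimage[OF B])
    have "continuous_on UNIV (T \<circ> kap)"
      by (intro continuous_on_compose continuous_on_kap continuous_on_linear Gam_linear[OF T(1)])
    then show "continuous_on UNIV (\<lambda>v. c *\<^sub>R T (kap v))" by (intro continuous_on_scaleR continuous_on_const) (simp add: o_def)
  qed
  ultimately show "open (vcpar A -` (pt ` (B \<inter> Nc)))" by auto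
qed

text \<open>Charts of the causal group already cover \<open>Vc\<close>; this matters because the
  cone field is given in these charts.\<close>

lemma chart_at:
  assumes X: "X \<in> Nc"
  obtains T where "T \<in> CGam" "fst (finv T X) \<noteq> 0"
proof -
  have n: "hq X = 0" "X \<noteq> 0" using X by (simp_all add: Nc_def)
  obtain T c where T: "T \<in> CGam" "c \<noteq> 0" "T (kap 0) = c *\<^sub>R X"
    using CGam_transitive[OF n] .
  note TG = CGam_Gam[OF T(1)]
  have "c *\<^sub>R finv T X = kap 0" using T(3) by (metis Gam_inv(1,3)[OF TG] Gam_scale)
  then have "c * fst (finv T X) = 1" by (metis fst_kap(1) fst_scaleR real_scaleR_def)
  then have "fst (finv T X) \<noteq> 0" by auto
  then show thesis using that T by blast
qed

lemma pt_in_chart: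
  assumes T: "T \<in> Gam" and X: "X \<in> Nc" "fst (finv T X) \<noteq> 0"
  shows "pt X = vcpar (MT T) ((1 / fst (finv T X)) *\<^sub>R fst (snd (finv T X)))"
proof -
  define S where "S = finv T X"
  have "hq S = 0" using X Gam_null[OF Gam_inv(1)[OF T]] by (simp add: S_def Nc_def)
  then have "S = fst S *\<^sub>R kap ((1 / fst S) *\<^sub>R fst (snd S))" using X by (intro null_eq_kap) (auto simp: S_def)
  then have "T S = fst S *\<^sub>R T (kap ((1 / fst S) *\<^sub>R fst (snd S)))" using Gam_scale[OF T] by metis
  moreover have "T S = X" by (simp add: S_def Gam_inv(2)[OF T])
  moreover have "pt (fst S *\<^sub>R T (kap ((1 / fst S) *\<^sub>R fst (snd S)))) = pt (T (kap ((1 / fst S) *\<^sub>R fst (snd S))))"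
    by (rule pt_scale) (use X in \<open>simp add: S_def\<close>)
  ultimately have "pt X = pt (T (kap ((1 / fst S) *\<^sub>R fst (snd S))))" by (simp only:)
  then show ?thesis by (simp add: vcpar_eq[OF T] S_def)
qed

text \<open>Near a point, \<open>B\<close> is the preimage under the chart coordinate
  \<open>r\<close>, which extends continuously to an open set of the ambient space.\<close>

lemma openin_pt_vimage:
  fixes U :: "'n::{finite,zero} vcpoint set"
  assumes U: "openin Vc_top U"
  obtains B where "open B" "\<And>X. X \<in> Nc \<Longrightarrow> X \<in> B \<longleftrightarrow> pt X \<in> U"
proof -
  have loc: "\<exists>B. open B \<and> X \<in> B \<and> (\<forall>Y\<in>B \<inter> Nc. pt Y \<in> U)" if X: "X \<in> Nc" "pt X \<in> U" for X
  proof -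
    obtain T where T: "T \<in> CGam" "fst (finv T X) \<noteq> 0" using chart_at[OF X(1)] .
    note TG = CGam_Gam[OF T(1)]
    note lin = Gam_linear[OF Gam_inv(1)[OF TG]]
    define r where "r Y = (1 / fst (finv T Y)) *\<^sub>R fst (snd (finv T Y))" for Y
    define A where "A = {Y. fst (finv T Y) \<noteq> 0}"
    have c: "continuous_on S (\<lambda>Y. fst (finv T Y))" "continuous_on S (\<lambda>Y. fst (snd (finv T Y)))" for S
      using continuous_on_linear[OF lin] by (auto intro!: continuous_on_fst continuous_on_snd)
    have oA: "open A" unfolding A_def by (intro open_Collect_neq c continuous_on_const)
    have "continuous_on A r" unfolding r_def by (intro continuous_intros c) (simp add: A_def)
    moreover have "open (vcpar (MT T) -` U)"
      using U TG unfolding openin_Vc_top carrier_Co by blast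
    ultimately have "open (r -` (vcpar (MT T) -` U) \<inter> A)" using oA
      by (metis Int_commute continuous_on_open_vimage)
    moreover have "X \<in> r -` (vcpar (MT T) -` U) \<inter> A"
      using pt_in_chart[OF TG X(1) T(2)] X T by (simp add: r_def A_def)
    moreover have "pt Y \<in> U" if "Y \<in> (r -` (vcpar (MT T) -` U) \<inter> A) \<inter> Nc" for Y
      using pt_in_chart[OF TG, of Y] that by (simp add: r_def A_def)
    ultimately show ?thesis by blast
  qed
  define B where "B = \<Union>{B. open B \<and> (\<forall>Y\<in>B \<inter> Nc. pt Y \<in> U)}"
  have "open B" unfolding B_def by auto
  moreover have "X \<in> B \<longleftrightarrow> pt X \<in> U" if "X \<in> Nc" for X
    using loc[OF that] that unfolding B_def by blast
  ultimately show thesis using that by blast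
qed

section \<open>The open orbit as de Sitter space\<close>

definition E0 :: "('n::{finite,zero} V) set" where
  "E0 = {v. v $ 0 = 0}"

lemma subspace_E0: "subspace E0"
  by (auto simp: E0_def subspace_def)

lemma E0_orth_space:
  assumes "CARD('n::{finite,zero}) \<ge> 3"
  shows "orth_space (E0 :: ('n V) set)"
proof
  show "subspace (E0 :: ('n V) set)" by (rule subspace_E0)
  have nz: "\<exists>j. j \<notin> {0 :: 'n, i}" for i
  proof (rule ccontr)
    assume "\<not> ?thesis"
    then have "UNIV = {0 :: 'n, i}" by blast
    then have "CARD('n) = card {0 :: 'n, i}" by simp
    also have "\<dots> \<le> 2" by (simp add: card_insert_if)
    finally show False using assms by simp
  qed
  obtain i :: 'n where i: "i \<notin> {0, 0}" using nz by blast
  obtain j :: 'n where j: "j \<notin> {0, i}" using nz by blast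
  have ij: "i \<noteq> 0" "j \<noteq> 0" "j \<noteq> i" using i j by auto
  have "axis i 1 \<in> (E0 :: ('n V) set)" "axis j 1 \<in> (E0 :: ('n V) set)" using ij by (auto simp: E0_def axis_def)
  moreover have "axis i (1::real) \<noteq> 0" "axis j (1::real) \<noteq> 0" by (simp_all add: axis_eq_0_iff)
  moreover have "axis i (1::real) \<bullet> axis j 1 = 0" using ij by (simp add: inner_axis_axis)
  ultimately show "\<exists>a\<in>E0 :: ('n V) set. \<exists>b\<in>E0. a \<noteq> 0 \<and> b \<noteq> 0 \<and> a \<bullet> b = 0" by blast
qed

text \<open>Places de Sitter space in the slice of the null cone where the time coordinate is 1.
  With the sign of the last entry, \<open>hq (lift X) = 1 + lf X X / 2\<close> holds for spatial
  part in \<open>E0\<close>.\<close>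

definition lift :: "real \<times> 'n::{finite,zero} V \<times> real \<Rightarrow> real \<times> 'n V \<times> real" where
  "lift X = (fst X, junit + fst (snd X), - snd (snd X))"

lemma lift_Pair [simp]: "lift (s, v, u) = (s, junit + v, - u)"
  by (simp add: lift_def)

lemma E0_jb: "v \<in> E0 \<Longrightarrow> w \<in> E0 \<Longrightarrow> jb v w = - (v \<bullet> w)" "v \<in> E0 \<Longrightarrow> jb junit v = 0" "v \<in> E0 \<Longrightarrow> jb v junit = 0"
  "v \<in> E0 \<Longrightarrow> jdet v = - (v \<bullet> v)" "v \<in> E0 \<Longrightarrow> jdet (junit + v) = 1 - v \<bullet> v" "v \<in> E0 \<Longrightarrow> alpha v = - v"
proof -
  show 1: "v \<in> E0 \<Longrightarrow> w \<in> E0 \<Longrightarrow> jb v w = - (v \<bullet> w)" for v w :: "'a V" by (simp add: jb_def E0_def)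
  show 2: "v \<in> E0 \<Longrightarrow> jb junit v = 0" for v :: "'a V" by (simp add: jb_def E0_def)
  show "v \<in> E0 \<Longrightarrow> jb v junit = 0" for v :: "'a V" by (simp add: jb_def E0_def)
  show 4: "v \<in> E0 \<Longrightarrow> jdet v = - (v \<bullet> v)" for v :: "'a V" by (simp add: jdet_eq E0_def)
  show "v \<in> E0 \<Longrightarrow> jdet (junit + v) = 1 - v \<bullet> v" for v :: "'a V" by (simp add: jdet_add 2 4)
  show "v \<in> E0 \<Longrightarrow> alpha v = - v" for v :: "'a V" by (simp add: alpha_eq E0_def)
qed

lemma lift_null_iff: "fst (snd X) \<in> E0 \<Longrightarrow> hq (lift X) = 0 \<longleftrightarrow> lf X X = - 2"
  by (cases X) (auto simp: E0_jb)

lemma lift_nonzero [simp]: "fst (snd X) \<in> E0 \<Longrightarrow> lift X \<noteq> 0"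
  by (cases X) (auto simp: zero_prod_def vec_eq_iff E0_def intro!: exI[of _ 0])

lemma lift_Nc: "X \<in> de_sitter E0 \<Longrightarrow> lift X \<in> Nc"
  by (simp add: Nc_def de_sitter_def lift_null_iff)

lemma lift_of_Nc:
  assumes "X \<in> Nc" "fst (snd X) $ 0 \<noteq> 0"
  obtains Y where "Y \<in> de_sitter E0" "lift Y = (1 / fst (snd X) $ 0) *\<^sub>R X"
proof -
  define a where "a = fst (snd X) $ 0"
  define Y where "Y = (fst X / a, (1 / a) *\<^sub>R fst (snd X) - junit, - (snd (snd X) / a))"
  have l: "lift Y = (1 / a) *\<^sub>R X" by (simp add: Y_def prod_eq_iff)
  have E: "fst (snd Y) \<in> E0" using assms by (simp add: Y_def E0_def a_def)
  have "hq (lift Y) = 0" using assms by (simp add: l Nc_def)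
  then have "Y \<in> de_sitter E0" using E lift_null_iff[OF E] by (simp add: de_sitter_def)
  then show thesis using that l by (simp add: a_def)
qed

lemma pt_lift_inj: "inj_on (\<lambda>X. pt (lift X)) (de_sitter E0)"
proof (rule inj_onI)
  fix X Y :: "real \<times> 'a V \<times> real" assume X: "X \<in> de_sitter E0" and Y: "Y \<in> de_sitter E0" and eq: "pt (lift X) = pt (lift Y)"
  obtain c where c: "lift X = c *\<^sub>R lift Y"
    using pt_eqD[OF eq] lift_Nc[OF X] lift_Nc[OF Y] by (metis (mono_tags, lifting) Nc_def mem_Collect_eq)
  have "fst (snd X) $ 0 = 0" "fst (snd Y) $ 0 = 0" using X Y by (auto simp: de_sitter_def E0_def)
  then have "c = 1" using arg_cong[OF c, of "\<lambda>X. fst (snd X) $ 0"] by (simp add: lift_def)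
  then show "X = Y" using c by (simp add: lift_def prod_eq_iff)
qed

section \<open>Fixed points of the involution and the orbit of the unit\<close>

text \<open>Lift of \<open>- alpha\<close>: the reflection that negates the unit and fixes
  \<open>E0\<close> and both ends.\<close>

definition NA :: "real \<times> 'n::{finite,zero} V \<times> real \<Rightarrow> real \<times> 'n V \<times> real" where
  "NA X = (fst X, - alpha (fst (snd X)), snd (snd X))"

lemma NA_Pair [simp]: "NA (s, x, r) = (s, - alpha x, r)"
  by (simp add: NA_def)

lemma NA_NA [simp]: "NA (NA X) = X"
  by (cases X) (simp add: alpha_linear)

lemma NA_Lg: "NA = Lg (\<lambda>x. - alpha x) 1"
  by (rule ext) (simp add: NA_def Lg_def)

lemma neg_alpha_GL: "(\<lambda>x. - alpha x) \<in> GL"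
proof -
  have "linear (\<lambda>x :: 'a V. - alpha x)" by (rule linearI) (auto simp: alpha_linear)
  moreover have "bij (\<lambda>x :: 'a V. - alpha x)"
    by (rule bij_betw_byWitness[of _ "\<lambda>x. - alpha x"]) (auto simp: alpha_linear)
  ultimately show ?thesis by (simp add: GL_def)
qed

lemma NA_Gam: "NA \<in> Gam"
  unfolding NA_Lg by (rule Lg_Gam[OF neg_alpha_GL]) simp

lemma MT_NA: "MT NA = ratcls (\<lambda>x. - alpha x)"
  unfolding NA_Lg MT_Lg ..

lemma neg_alpha_fixed_MT:
  assumes "T \<in> Gam"
  shows "MT T \<in> neg_alpha_fixed L \<longleftrightarrow> MT T \<in> L \<and> MT (NA \<circ> T \<circ> NA) = MT T"
  using assms by (simp add: neg_alpha_fixed_def MT_NA[symmetric] MT_mult NA_Gam Gam_comp)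

lemma neg_alpha_fixed_commute:
  assumes "T \<in> Gam" "MT T \<in> L" "\<And>X. NA (T X) = T (NA X)"
  shows "MT T \<in> neg_alpha_fixed L"
proof -
  have "NA \<circ> T \<circ> NA = T" by (rule ext) (simp add: assms(3))
  then show ?thesis using assms by (simp add: neg_alpha_fixed_MT)
qed

text \<open>Elements of \<open>Ggrp\<close> commute with \<open>NA\<close> up to a scalar
  \<open>c\<close>. If the image of \<open>kap junit\<close> had time coordinate 0, it would be
  fixed by \<open>NA\<close>, hence \<open>kap junit = c *\<^sub>R NA (kap junit)\<close>; the first
  coordinate requires \<open>c = 1\<close>, the time coordinate \<open>c = - 1\<close>.\<close>

lemma MM_subset: "MM \<subseteq> (\<lambda>X. pt (lift X)) ` (de_sitter E0 :: (real \<times> 'n::{finite,zero} V \<times> real) set)"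
proof
  fix p :: "'n vcpoint" assume "p \<in> MM"
  then obtain A where A: "A \<in> Ggrp" "p = act A (emb junit)" by (auto simp: MM_def)
  have "Ggrp \<subseteq> topspace (subtopology Co_top (neg_alpha_fixed (carrier (Co :: 'n ratmap monoid))))"
    unfolding Ggrp_def by (rule connected_component_of_subset_topspace)
  then have A': "A \<in> neg_alpha_fixed (carrier Co)" using A by auto
  then obtain T :: "real \<times> 'n V \<times> real \<Rightarrow> _" where T: "T \<in> Gam" "A = MT T"
    unfolding neg_alpha_fixed_def carrier_Co by blast
  define X where "X = T (kap junit)"
  have pX: "p = pt X" by (simp add: A(2) T(2) emb_eq act_pt[OF T(1)] X_def)
  have XN: "X \<in> Nc" by (simp add: X_def Nc_Gam[OF T(1)])
  have "MT (NA \<circ> T \<circ> NA) = MT T" using A' T neg_alpha_fixed_MT by blast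
  then obtain c where c: "c \<noteq> 0" "\<And>X. (NA \<circ> T \<circ> NA) X = c *\<^sub>R T X"
    using MT_eq_iff[of "NA \<circ> T \<circ> NA" T] Gam_comp[OF Gam_comp[OF NA_Gam T(1)] NA_Gam] T(1) by blast
  have "fst (snd X) $ 0 \<noteq> 0"
  proof
    assume z: "fst (snd X) $ 0 = 0"
    have "alpha (fst (snd X)) = - fst (snd X)" using z by (simp add: alpha_eq)
    then have "NA X = X" by (simp add: NA_def)
    then have "T (kap junit) = T (c *\<^sub>R NA (kap junit))"
      using c(2)[of "NA (kap junit)"] by (simp add: X_def Gam_scale[OF T(1)])
    then have e: "kap junit = c *\<^sub>R NA (kap (junit :: 'n V))" using bij_is_inj[OF Gam_bij[OF T(1)]] by (metis injD)
    have "1 = c" using arg_cong[OF e, of fst] by (simp add: kap_def)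
    moreover have "1 = - c" using arg_cong[OF e, of "\<lambda>X. fst (snd X) $ 0"] by (simp add: kap_def)
    ultimately show False by simp
  qed
  then obtain Y where Y: "Y \<in> de_sitter E0" "lift Y = (1 / fst (snd X) $ 0) *\<^sub>R X" using lift_of_Nc[OF XN] by blast
  have "pt (lift Y) = p" unfolding Y(2) pX using \<open>fst (snd X) $ 0 \<noteq> 0\<close> by (intro pt_scale) simp
  then show "p \<in> (\<lambda>X. pt (lift X)) ` de_sitter E0" using Y by blast
qed

text \<open>Orthogonal projection onto \<open>E0\<close>. Through it the family \<open>Psi\<close>
  is parametrised by a whole vector space, which is connected.\<close>

definition prj :: "'n::{finite,zero} V \<Rightarrow> 'n V" where
  "prj v = v - (v $ 0) *\<^sub>R junit"

lemma prj_E0 [simp]: "prj v \<in> E0" and prj_id: "v \<in> E0 \<Longrightarrow> prj v = v"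
  by (auto simp: prj_def E0_def)

text \<open>
  A continuous family through the identity; it stays in the identity component, and its orbit of the
  unit covers de Sitter space (\<open>Psi_0\<close>, \<open>MM_eq\<close>).
\<close>

definition Psi :: "'n::{finite,zero} V \<times> 'n V \<times> real \<Rightarrow> real \<times> 'n V \<times> real \<Rightarrow> real \<times> 'n V \<times> real" where
  "Psi z X = tau (prj (fst z)) (Jm (tau (prj (fst (snd z))) (Jm (Lg (scaleR (exp (snd (snd z)))) (exp (2 * snd (snd z))) X))))"

lemma scale_GL: "c \<noteq> 0 \<Longrightarrow> scaleR c \<in> GL"
  unfolding GL_def mem_Collect_eq
  by (intro conjI linear_scaleR bij_betw_byWitness[of _ "scaleR (1 / c)"]) auto

lemma exp_scale_conformal: "jdet (exp t *\<^sub>R x) = exp (2 * t) * jdet x"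
  by (simp add: power2_eq_square exp_add[symmetric])

lemma Psi_Gam: "Psi z \<in> Gam"
proof -
  have "Lg (scaleR (exp (snd (snd z)))) (exp (2 * snd (snd z))) \<in> Gam"
    by (rule Lg_Gam[OF scale_GL exp_scale_conformal]) simp
  moreover have "Psi z = tau (prj (fst z)) \<circ> (Jm \<circ> (tau (prj (fst (snd z))) \<circ> (Jm \<circ>
    Lg (scaleR (exp (snd (snd z)))) (exp (2 * snd (snd z))))))"
    by (rule ext) (simp add: Psi_def)
  ultimately show ?thesis by (auto intro!: Gam_comp tau_Gam Jm_Gam)
qed

lemma NA_tau: "w \<in> E0 \<Longrightarrow> NA (tau w X) = tau w (NA X)"
proof -
  assume w: "w \<in> E0"
  have a: "alpha w = - w" using w by (rule E0_jb)
  have "jb (- alpha x) w = jb x w" for x using w by (simp add: jb_def alpha_eq E0_def inner_simps)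
  then show ?thesis by (cases X) (simp add: alpha_linear a)
qed

lemma NA_Jm: "NA (Jm X) = Jm (NA X)"
  by (cases X) (simp add: alpha_linear)

lemma Psi_neg_alpha: "MT (Psi z) \<in> neg_alpha_fixed (carrier Co)"
proof (rule neg_alpha_fixed_commute[OF Psi_Gam])
  show "MT (Psi z) \<in> carrier Co" using Psi_Gam carrier_Co by blast
  show "NA (Psi z X) = Psi z (NA X)" for X
    unfolding Psi_def NA_tau[OF prj_E0] NA_Jm by (cases X) (simp add: alpha_linear)
qed

lemma Psi_0: "Psi 0 = id"
  by (rule ext) (simp add: Psi_def prj_def tau_0 split_beta Lg_def)

lemma Psi_continuous: "continuous_on UNIV (\<lambda>zX. Psi (fst zX) (snd zX) :: real \<times> 'n::{finite,zero} V \<times> real)"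
proof -
  have tc: "continuous_on UNIV (\<lambda>y. tau (prj (f y)) (F y) :: real \<times> 'n V \<times> real)"
    if "continuous_on UNIV f" "continuous_on UNIV F" for f :: "'z::topological_space \<Rightarrow> 'n V" and F
    unfolding tau_def jb_def jdet_eq prj_def using that by (intro continuous_intros)
  have jc: "continuous_on UNIV (\<lambda>y. Jm (F y) :: real \<times> 'n V \<times> real)"
    if "continuous_on UNIV F" for F :: "'z::topological_space \<Rightarrow> _"
    unfolding Jm_def alpha_eq using that by (intro continuous_intros)
  have lc: "continuous_on UNIV (\<lambda>zX. Lg (scaleR (exp (snd (snd (fst zX))))) (exp (2 * snd (snd (fst zX)))) (snd zX)
     :: real \<times> 'n V \<times> real)"
    unfolding Lg_def by (intro continuous_intros)
  show ?thesis unfolding Psi_def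
    by (intro tc jc lc continuous_intros)
qed

text \<open>A tube argument: around \<open>z0\<close> and each point of the compact \<open>K\<close>
  there are neighbourhoods on which the jointly continuous map \<open>Psi\<close> stays in the open
  set \<open>B\<close> over \<open>U\<close>. Finitely many cover \<open>K\<close>, and the
  corresponding neighbourhoods of \<open>z0\<close> are intersected.\<close>

lemma Psi_Co_top_continuous:
  "continuous_map euclidean Co_top (\<lambda>z :: 'n::{finite,zero} V \<times> 'n V \<times> real. MT (Psi z))"
  unfolding Co_top_def continuous_on_generated_topo_iff
proof (intro conjI allI impI)
  have inCo: "MT (Psi z) \<in> carrier (Co :: 'n ratmap monoid)" for z :: "'n V \<times> 'n V \<times> real" using Psi_Gam carrier_Co by blast
  have "carrier Co \<in> {{g \<in> carrier (Co :: 'n ratmap monoid). act g ` K \<subseteq> U} |K U. compactin Vc_top K \<and> openin Vc_top U}"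
    by (rule CollectI, rule exI[of _ "{}"], rule exI[of _ "{}"]) simp
  then show "(\<lambda>z :: 'n V \<times> 'n V \<times> real. MT (Psi z)) ` topspace euclidean \<subseteq>
      \<Union> {{g \<in> carrier Co. act g ` K \<subseteq> U} |K U. compactin Vc_top K \<and> openin Vc_top U}"
    using inCo by blast
  fix S :: "'n ratmap set" assume "S \<in> {{g \<in> carrier Co. act g ` K \<subseteq> U} |K U. compactin Vc_top K \<and> openin Vc_top U}"
  then obtain K U where KU: "S = {g \<in> carrier Co. act g ` K \<subseteq> U}" "compactin Vc_top K" "openin Vc_top U" by blast
  obtain B where B: "open B" "\<And>X. X \<in> Nc \<Longrightarrow> X \<in> B \<longleftrightarrow> pt X \<in> U" using openin_pt_vimage[OF KU(3)] by blast
  have KV: "K \<subseteq> Vc"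
  proof -
    have "topspace Vc_top \<subseteq> (Vc :: 'n vcpoint set)" using openin_Vc_top openin_topspace by blast
    then show ?thesis using compactin_subset_topspace[OF KU(2)] by blast
  qed
  have eq: "(\<lambda>z. MT (Psi z)) -` S = {z. act (MT (Psi z)) ` K \<subseteq> U}" using inCo by (auto simp: KU(1))
  have "open {z. act (MT (Psi z)) ` K \<subseteq> U}"
    unfolding open_subopen[of "{z. act (MT (Psi z)) ` K \<subseteq> U}"]
  proof
    fix z0 :: "'n V \<times> 'n V \<times> real" assume "z0 \<in> {z. act (MT (Psi z)) ` K \<subseteq> U}"
    then have z0: "act (MT (Psi z0)) p \<in> U" if "p \<in> K" for p using that by auto
    have "\<exists>A C. open A \<and> z0 \<in> A \<and> open C \<and> p \<in> pt ` (C \<inter> Nc) \<and> (\<forall>z\<in>A. \<forall>X\<in>C. Psi z X \<in> B)" if p: "p \<in> K" for p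
    proof -
      obtain X where X: "X \<in> Nc" "p = pt X" using p KV by (auto simp: Vc_Nc)
      have "pt (Psi z0 X) \<in> U" using z0[OF p] act_pt[OF Psi_Gam, of z0 X] X by simp
      then have "Psi z0 X \<in> B" using B(2) X by (simp add: Nc_Gam[OF Psi_Gam])
      then have m: "(z0, X) \<in> (\<lambda>zX. Psi (fst zX) (snd zX)) -` B" by simp
      have o: "open ((\<lambda>zX. Psi (fst zX) (snd zX)) -` B)" by (rule open_vimage[OF B(1) Psi_continuous])
      obtain A C where AC: "open A" "open C" "(z0, X) \<in> A \<times> C"
          "A \<times> C \<subseteq> (\<lambda>zX. Psi (fst zX) (snd zX)) -` B"
        using open_prod_elim[OF o m] .
      have "z0 \<in> A" "p \<in> pt ` (C \<inter> Nc)" using X AC(3) by auto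
      moreover have "\<forall>z\<in>A. \<forall>Y\<in>C. Psi z Y \<in> B"
      proof (intro ballI)
        fix z Y assume "z \<in> A" "Y \<in> C"
        then have "(z, Y) \<in> (\<lambda>zX. Psi (fst zX) (snd zX)) -` B" using AC(4) by blast
        then show "Psi z Y \<in> B" by simp
      qed
      ultimately show ?thesis using AC(1,2) by blast
    qed
    then have "\<forall>p\<in>K. \<exists>AC. open (fst AC) \<and> z0 \<in> fst AC \<and> open (snd AC) \<and> p \<in> pt ` (snd AC \<inter> Nc) \<and> (\<forall>z\<in>fst AC. \<forall>X\<in>snd AC. Psi z X \<in> B)"
      by simp
    then obtain G where G: "\<forall>p\<in>K. open (fst (G p)) \<and> z0 \<in> fst (G p) \<and> open (snd (G p)) \<and> p \<in> pt ` (snd (G p) \<inter> Nc) \<and> (\<forall>z\<in>fst (G p). \<forall>X\<in>snd (G p). Psi z X \<in> B)"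
      by (rule bchoice[THEN exE])
    define A where "A p = fst (G p)" for p
    define C where "C p = snd (G p)" for p
    have AC: "open (A p) \<and> z0 \<in> A p \<and> open (C p) \<and> p \<in> pt ` (C p \<inter> Nc) \<and> (\<forall>z\<in>A p. \<forall>X\<in>C p. Psi z X \<in> B)"
      if "p \<in> K" for p using G that unfolding A_def C_def by (rule bspec)
    have 1: "\<forall>V\<in>(\<lambda>p. pt ` (C p \<inter> Nc)) ` K. openin Vc_top V"
    proof
      fix V assume "V \<in> (\<lambda>p. pt ` (C p \<inter> Nc)) ` K"
      then obtain p where "p \<in> K" "V = pt ` (C p \<inter> Nc)" by blast
      then show "openin Vc_top V" using openin_pt_image[of "C p"] AC[of p] by simp
    qed
    have 2: "K \<subseteq> \<Union>((\<lambda>p. pt ` (C p \<inter> Nc)) ` K)"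
    proof
      fix p assume p: "p \<in> K"
      then have "p \<in> pt ` (C p \<inter> Nc)" using AC by blast
      then show "p \<in> \<Union>((\<lambda>p. pt ` (C p \<inter> Nc)) ` K)" using p by (rule UN_I[rotated])
    qed
    have "\<exists>F. finite F \<and> F \<subseteq> (\<lambda>p. pt ` (C p \<inter> Nc)) ` K \<and> K \<subseteq> \<Union>F"
      by (rule KU(2)[unfolded compactin_def, THEN conjunct2, rule_format, OF conjI[OF 1 2]])
    then obtain F where F: "finite F" "F \<subseteq> (\<lambda>p. pt ` (C p \<inter> Nc)) ` K" "K \<subseteq> \<Union>F" by blast
    then obtain K0 where K0: "K0 \<subseteq> K" "finite K0" "F = (\<lambda>p. pt ` (C p \<inter> Nc)) ` K0"
      by (meson finite_subset_image)
    have "open (\<Inter>p\<in>K0. A p)"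
      by (rule open_INT[OF K0(2)]) (use K0(1) AC in blast)
    moreover have "z0 \<in> (\<Inter>p\<in>K0. A p)"
      by (rule INT_I) (use K0(1) AC in blast)
    moreover have "(\<Inter>p\<in>K0. A p) \<subseteq> {z. act (MT (Psi z)) ` K \<subseteq> U}"
    proof clarify
      fix z p assume z: "z \<in> (\<Inter>p\<in>K0. A p)" and p: "p \<in> K"
      have "p \<in> (\<Union>q\<in>K0. pt ` (C q \<inter> Nc))" using F(3) K0(3) p by blast
      then obtain q X where q: "q \<in> K0" "X \<in> C q" "X \<in> Nc" "p = pt X" by blast
      have "q \<in> K" "z \<in> A q" using q(1) K0(1) z by auto
      then have "Psi z X \<in> B" using AC[of q] q(2) by blast
      then have "pt (Psi z X) \<in> U" using B(2) q by (simp add: Nc_Gam[OF Psi_Gam])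
      then show "act (MT (Psi z)) p \<in> U" by (simp add: q act_pt[OF Psi_Gam])
    qed
    ultimately show "\<exists>T. open T \<and> z0 \<in> T \<and> T \<subseteq> {z. act (MT (Psi z)) ` K \<subseteq> U}" by blast
  qed
  then show "openin euclidean ((\<lambda>z. MT (Psi z)) -` S \<inter> topspace euclidean)" by (simp add: eq)
qed

lemma Psi_Ggrp: "MT (Psi z) \<in> Ggrp"
proof -
  have "connectedin Co_top ((\<lambda>z. MT (Psi z)) ` UNIV)"
    by (rule connectedin_continuous_map_image[OF Psi_Co_top_continuous]) (simp add: connected_UNIV)
  then have "connectedin (subtopology Co_top (neg_alpha_fixed (carrier Co))) (range (\<lambda>z. MT (Psi z)))"
    using Psi_neg_alpha by (auto simp: connectedin_subtopology)
  moreover have "\<one>\<^bsub>Co\<^esub> \<in> range (\<lambda>z. MT (Psi z))" using Psi_0 MT_id by (metis Co_simps(2) rangeI)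
  ultimately show ?thesis unfolding Ggrp_def connected_component_of_def by blast
qed

text \<open>The normalised orbit of the unit under \<open>Psi\<close> has first coordinate
  \<open>exp (- t) - exp t * (c \<bullet> c)\<close>, which takes every real value. For
  \<open>s \<noteq> 0\<close> the vector \<open>b\<close> is then solved from the middle entry, and
  the last entry is right because both points are null.\<close>

lemma MM_eq:
  assumes "orth_space (E0 :: ('n::{finite,zero} V) set)"
  shows "MM = (\<lambda>X. pt (lift X)) ` (de_sitter E0 :: (real \<times> 'n V \<times> real) set)"
proof (rule equalityI[OF MM_subset])
  interpret orth_space "E0 :: ('n V) set" by (rule assms)
  show "(\<lambda>X. pt (lift X)) ` (de_sitter E0 :: (real \<times> 'n V \<times> real) set) \<subseteq> MM"
  proof clarify
    fix s u :: real and v :: "'n V" assume Y: "(s, v, u) \<in> de_sitter E0"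
    have v: "v \<in> E0" "v \<bullet> v = 1 + s * u" using Y by (auto simp: de_sitter_def)
    have "\<exists>b\<in>E0. \<exists>c\<in>E0. \<exists>t. Psi (b, c, t) (kap junit) = exp t *\<^sub>R lift (s, v, u)"
    proof -
      have comp: "Psi (b, c, t) (kap junit) =
        exp t *\<^sub>R lift (exp (- t) - exp t * (c \<bullet> c), (exp (- t) - exp t * (c \<bullet> c)) *\<^sub>R b - exp t *\<^sub>R c,
          - (exp t + 2 * exp t * (c \<bullet> b) - (exp (- t) - exp t * (c \<bullet> c)) * (b \<bullet> b)))"
        if bc: "b \<in> E0" "c \<in> E0" for b c :: "'n V" and t
      proof -
        have ee: "exp t * exp (- t) = 1" "exp (2 * t) = exp t * exp t" by (simp_all add: exp_add[symmetric])
        have ej: "alpha junit = (junit :: 'n V)" by (simp add: alpha_eq scaleR_2)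
        have ac: "alpha c = - c" using bc by (simp add: E0_jb)
        have "Jm (tau c (Jm (Lg (scaleR (exp t)) (exp (2 * t)) (kap junit)))) =
           (1 - exp t * exp t * (c \<bullet> c), exp t *\<^sub>R junit - (exp t * exp t) *\<^sub>R c, exp t * exp t)"
          using bc by (simp add: kap_def alpha_linear ej ac jb_simps E0_jb ee)
        then have "Psi (b, c, t) (kap junit) = tau b (1 - exp t * exp t * (c \<bullet> c), exp t *\<^sub>R junit - (exp t * exp t) *\<^sub>R c, exp t * exp t)"
          by (simp add: Psi_def prj_id bc)
        also have "\<dots> = exp t *\<^sub>R lift (exp (- t) - exp t * (c \<bullet> c), (exp (- t) - exp t * (c \<bullet> c)) *\<^sub>R b - exp t *\<^sub>R c,
          - (exp t + 2 * exp t * (c \<bullet> b) - (exp (- t) - exp t * (c \<bullet> c)) * (b \<bullet> b)))"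
          using bc ee by (simp add: jb_simps E0_jb algebra_simps)
        finally show ?thesis .
      qed
      show ?thesis
      proof (cases "s = 0")
        case True
        \<comment> \<open>For \<open>s = 0\<close> the middle entry does not contain
          \<open>b\<close>; \<open>c = - v\<close> and \<open>t = 0\<close> produce it, and
          \<open>b\<close> adjusts the last entry through
          \<open>v \<bullet> b = (1 + u) / 2\<close>.\<close>
        define b where "b = ((1 + u) / 2) *\<^sub>R v"
        have b: "b \<in> E0" "- v \<in> E0" using v subE by (auto simp: b_def subspace_scale subspace_neg)
        have "Psi (b, - v, 0) (kap junit) = exp 0 *\<^sub>R lift (s, v, u)"
          unfolding comp[OF b] using v True by (simp add: b_def field_simps)
        then show ?thesis using b by blast
      next
        case False
        obtain c :: "'n V" and t where c: "c \<in> E0" "s = exp (- t) - exp t * (c \<bullet> c)"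
        proof (cases "0 < s")
          case True
          show ?thesis by (rule that[of 0 "- ln s"]) (use True in \<open>auto simp: subspace_0[OF subE]\<close>)
        next
          case f: False
          obtain m :: "'n V" where m: "m \<in> E0" "m \<bullet> m = 1" "m \<bullet> 0 = 0"
            using unit_orth[OF subspace_0[OF subE]] .
          have "(sqrt (1 - s) *\<^sub>R m) \<bullet> (sqrt (1 - s) *\<^sub>R m) = sqrt (1 - s) * sqrt (1 - s)" by (simp add: m(2))
          also have "\<dots> = 1 - s" using f by simp
          finally have "s = exp (- 0) - exp 0 * ((sqrt (1 - s) *\<^sub>R m) \<bullet> (sqrt (1 - s) *\<^sub>R m))" by simp
          then show ?thesis by (rule that[of "sqrt (1 - s) *\<^sub>R m" 0, rotated]) (rule subspace_scale[OF subE m(1)])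
        qed
        define b where "b = (1 / s) *\<^sub>R (v + exp t *\<^sub>R c)"
        have b: "b \<in> E0" using v c subE by (simp add: b_def subspace_scale subspace_add)
        have sb: "s *\<^sub>R b = v + exp t *\<^sub>R c" using False by (simp add: b_def)
        define u' where "u' = - (exp t + 2 * exp t * (c \<bullet> b) - s * (b \<bullet> b))"
        have P: "Psi (b, c, t) (kap junit) = exp t *\<^sub>R lift (s, v, u')"
          unfolding comp[OF b c(1)] c(2)[symmetric] sb u'_def by simp
        have "hq (Psi (b, c, t) (kap junit)) = 0" by (simp add: Gam_null[OF Psi_Gam])
        then have "hq (lift (s, v, u')) = 0" unfolding P hq_scale by (simp del: lift_Pair)
        then have "v \<bullet> v = 1 + s * u'" using v(1) by (simp add: E0_jb)
        then have "u' = u" using v False by simp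
        then show ?thesis using P b c by blast
      qed
    qed
    then obtain z t where z: "Psi z (kap junit) = exp t *\<^sub>R lift (s, v, u)" by blast
    have "act (MT (Psi z)) (emb junit) = pt (lift (s, v, u))"
      unfolding emb_eq act_pt[OF Psi_Gam] z by (rule pt_scale) simp
    then show "pt (lift (s, v, u)) \<in> MM" unfolding MM_def by (rule image_eqI[OF sym Psi_Ggrp])
  qed
qed

section \<open>Time orientation\<close>

definition ta :: "real \<times> 'n::{finite,zero} V \<times> real \<Rightarrow> real" where
  "ta X = fst X - snd (snd X)"

definition tz :: "real \<times> 'n::{finite,zero} V \<times> real \<Rightarrow> real" where
  "tz X = fst (snd X) $ 0"

text \<open>
  \<open>ta / 2\<close> and \<open>tz\<close> are coordinates on a maximal positive definite plane of \<^const>\<open>hq\<close>. The sign of \<open>om\<close> orients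
  the positive semidefinite pairs and thereby separates future from past tangent vectors.
\<close>

definition om :: "real \<times> 'n::{finite,zero} V \<times> real \<Rightarrow> real \<times> 'n V \<times> real \<Rightarrow> real" where
  "om X Z = ta X * tz Z - tz X * ta Z"

text \<open>The case of interest is a null vector together with an orthogonal causal tangent vector;
  see \<open>semidefinite_pairI\<close>.\<close>

definition semidefinite_pair :: "real \<times> 'n::{finite,zero} V \<times> real \<Rightarrow> real \<times> 'n V \<times> real \<Rightarrow> bool" where
  "semidefinite_pair X Z \<longleftrightarrow> (\<forall>a b. 0 \<le> hq (a *\<^sub>R X + b *\<^sub>R Z))"

text \<open>Rebuilds \<open>X\<close> with unchanged \<open>ta\<close> and \<open>tz\<close> and
  with the negative definite coordinates \<open>fst X + snd (snd X)\<close> and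
  \<open>prj (fst (snd X))\<close> multiplied by \<open>d\<close>.\<close>

definition shrink :: "real \<Rightarrow> real \<times> 'n::{finite,zero} V \<times> real \<Rightarrow> real \<times> 'n V \<times> real" where
  "shrink d X = ((ta X + d * (fst X + snd (snd X))) / 2, tz X *\<^sub>R junit + d *\<^sub>R prj (fst (snd X)),
     (d * (fst X + snd (snd X)) - ta X) / 2)"

lemma ta_tz_linear: "ta (X + Y) = ta X + ta Y" "tz (X + Y) = tz X + tz Y"
  "ta (c *\<^sub>R X) = c * ta X" "tz (c *\<^sub>R X) = c * tz X"
  by (auto simp: ta_def tz_def algebra_simps)

lemma om_simps: "om (X + Y) Z = om X Z + om Y Z" "om Z (X + Y) = om Z X + om Z Y"
  "om (c *\<^sub>R X) Z = c * om X Z" "om Z (c *\<^sub>R X) = c * om Z X" "om X X = 0"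
  by (auto simp: om_def ta_tz_linear algebra_simps)

lemma om_commute: "om X Z = - om Z X"
  by (simp add: om_def)

lemma jdet_prj: "jdet x = (x $ 0)\<^sup>2 - prj x \<bullet> prj x"
proof -
  have "x = (x $ 0) *\<^sub>R junit + prj x" by (simp add: prj_def)
  then have "jdet x = jdet ((x $ 0) *\<^sub>R junit + prj x)" by simp
  also have "\<dots> = (x $ 0)\<^sup>2 - prj x \<bullet> prj x" by (simp add: jdet_add jb_simps E0_jb)
  finally show ?thesis .
qed

lemma hq_decomp: "hq X = (ta X / 2)\<^sup>2 + (tz X)\<^sup>2 - (((fst X + snd (snd X)) / 2)\<^sup>2 + prj (fst (snd X)) \<bullet> prj (fst (snd X)))"
  unfolding hq_def jdet_prj by (simp add: ta_def tz_def power2_eq_square field_simps)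

lemma prj_linear: "prj (x + y) = prj x + prj y" "prj (c *\<^sub>R x) = c *\<^sub>R prj x" "prj junit = 0"
  by (auto simp: prj_def algebra_simps)

lemma shrink_linear: "shrink d (X + Y) = shrink d X + shrink d Y" "shrink d (c *\<^sub>R X) = c *\<^sub>R shrink d X"
  by (auto simp: shrink_def ta_tz_linear prj_linear prod_eq_iff field_simps)

lemma shrink_ta_tz: "ta (shrink d X) = ta X" "tz (shrink d X) = tz X"
  by (auto simp: shrink_def ta_def tz_def prj_def field_simps)

lemma shrink_1: "shrink 1 X = X"
  by (cases X) (auto simp: shrink_def ta_def tz_def prj_def)

lemma shrink_0: "shrink 0 X = (ta X / 2) *\<^sub>R (1, 0, - 1) + tz X *\<^sub>R (0, junit, 0)"
  by (auto simp: shrink_def)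

lemma hq_shrink:
  assumes "0 \<le> d" "d \<le> 1"
  shows "hq X \<le> hq (shrink d X)"
proof -
  have p: "prj (fst (snd (shrink d X))) = d *\<^sub>R prj (fst (snd X))"
    by (simp add: shrink_def prj_linear) (simp add: prj_def)
  have s: "fst (shrink d X) + snd (snd (shrink d X)) = d * (fst X + snd (snd X))"
    by (simp add: shrink_def field_simps)
  have d2: "d * d \<le> 1" using assms by (simp add: mult_le_one)
  define A where "A = ((fst X + snd (snd X)) / 2)\<^sup>2 + prj (fst (snd X)) \<bullet> prj (fst (snd X))"
  have "0 \<le> A" by (simp add: A_def)
  then have "(d * d) * A \<le> 1 * A" using d2 by (intro mult_right_mono)
  moreover have "hq (shrink d X) = (ta X / 2)\<^sup>2 + (tz X)\<^sup>2 - (d * d) * A"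
    unfolding hq_decomp[of "shrink d X"] p s shrink_ta_tz A_def by (simp add: power2_eq_square field_simps)
  ultimately show ?thesis unfolding hq_decomp[of X] A_def by simp
qed

lemma semidefinite_pair_shrink:
  assumes "0 \<le> d" "d \<le> 1" "semidefinite_pair X Z"
  shows "semidefinite_pair (shrink d X) (shrink d Z)"
  unfolding semidefinite_pair_def
proof (intro allI)
  fix a b
  have "0 \<le> hq (a *\<^sub>R X + b *\<^sub>R Z)" using assms by (simp add: semidefinite_pair_def)
  also have "\<dots> \<le> hq (shrink d (a *\<^sub>R X + b *\<^sub>R Z))" by (rule hq_shrink[OF assms(1,2)])
  finally show "0 \<le> hq (a *\<^sub>R shrink d X + b *\<^sub>R shrink d Z)" by (simp add: shrink_linear)
qed

text \<open>Vanishing \<open>om\<close> gives a nontrivial combination with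
  \<open>ta = tz = 0\<close>. It lies in the negative definite part and has nonnegative square, so
  it is zero.\<close>

lemma om_zero_dependent:
  assumes "semidefinite_pair X Z" "om X Z = 0"
  obtains a b where "a \<noteq> 0 \<or> b \<noteq> 0" "a *\<^sub>R X + b *\<^sub>R Z = 0"
proof -
  have zero: "W = 0" if W: "0 \<le> hq W" "ta W = 0" "tz W = 0" for W :: "real \<times> 'a V \<times> real"
  proof -
    have "((fst W + snd (snd W)) / 2)\<^sup>2 + prj (fst (snd W)) \<bullet> prj (fst (snd W)) \<le> 0"
      using W unfolding hq_decomp[of W] by simp
    moreover have "0 \<le> ((fst W + snd (snd W)) / 2)\<^sup>2" "0 \<le> prj (fst (snd W)) \<bullet> prj (fst (snd W))" by simp_all
    ultimately have "((fst W + snd (snd W)) / 2)\<^sup>2 = 0" "prj (fst (snd W)) \<bullet> prj (fst (snd W)) = 0" by linarith+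
    then have "fst W + snd (snd W) = 0" "prj (fst (snd W)) = 0" by simp_all
    then show ?thesis using W by (cases W) (auto simp: ta_def tz_def prj_def zero_prod_def)
  qed
  have "\<exists>a b. (a \<noteq> 0 \<or> b \<noteq> 0) \<and> a * ta X + b * ta Z = 0 \<and> a * tz X + b * tz Z = 0"
  proof (cases "ta X = 0 \<and> ta Z = 0")
    case True
    show ?thesis
    proof (cases "tz X = 0 \<and> tz Z = 0")
      case True with \<open>ta X = 0 \<and> ta Z = 0\<close> show ?thesis by (intro exI[of _ 1]) auto
    next
      case False with \<open>ta X = 0 \<and> ta Z = 0\<close> show ?thesis
        by (intro exI[of _ "tz Z"] exI[of _ "- tz X"]) auto
    qed
  next
    case False
    then show ?thesis using assms(2)
      by (intro exI[of _ "ta Z"] exI[of _ "- ta X"]) (auto simp: om_def algebra_simps)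
  qed
  then obtain a b where ab: "a \<noteq> 0 \<or> b \<noteq> 0" "a * ta X + b * ta Z = 0" "a * tz X + b * tz Z = 0" by blast
  have "a *\<^sub>R X + b *\<^sub>R Z = 0"
    by (rule zero) (use assms(1) ab in \<open>auto simp: semidefinite_pair_def ta_tz_linear\<close>)
  then show thesis using that ab by blast
qed

lemma dependent_om_zero:
  assumes "a \<noteq> 0 \<or> b \<noteq> 0" "a *\<^sub>R X + b *\<^sub>R Z = 0"
  shows "om X Z = 0"
proof -
  have "om (a *\<^sub>R X + b *\<^sub>R Z) Z = 0" "om X (a *\<^sub>R X + b *\<^sub>R Z) = 0"
    unfolding assms(2) by (simp_all add: om_def ta_def tz_def)
  then have "a * om X Z = 0" "b * om X Z = 0" by (simp_all add: om_simps)
  then show ?thesis using assms(1) by auto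
qed

text \<open>One basis of the positive plane is enough, since \<open>om_sgn\<close> spreads the sign
  to all semidefinite pairs. The condition is the same for \<open>T\<close> and \<open>- T\<close>,
  as a projective notion requires.\<close>

definition time_oriented :: "(real \<times> 'n::{finite,zero} V \<times> real \<Rightarrow> real \<times> 'n V \<times> real) \<Rightarrow> bool" where
  "time_oriented T \<longleftrightarrow> T \<in> Gam \<and> (\<exists>c>0. \<forall>X. hq (T X) = c * hq X) \<and> 0 < om (T (1, 0, - 1)) (T (0, junit, 0))"

lemma semidefinite_pair_Gam:
  assumes T: "T \<in> Gam" and c: "0 < c" "\<And>X. hq (T X) = c * hq X" and X: "semidefinite_pair X Z"
  shows "semidefinite_pair (T X) (T Z)"
  unfolding semidefinite_pair_def
proof (intro allI)
  fix a b
  have "a *\<^sub>R T X + b *\<^sub>R T Z = T (a *\<^sub>R X + b *\<^sub>R Z)"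
    by (simp add: linear_add[OF Gam_linear[OF T]] Gam_scale[OF T])
  moreover have "0 \<le> c * hq (a *\<^sub>R X + b *\<^sub>R Z)" using X c(1) by (simp add: semidefinite_pair_def)
  ultimately show "0 \<le> hq (a *\<^sub>R T X + b *\<^sub>R T Z)" using c(2) by metis
qed

lemma om_Gam_nonzero:
  assumes T: "T \<in> Gam" and c: "0 < c" "\<And>X. hq (T X) = c * hq X" and X: "semidefinite_pair X Z"
  shows "om (T X) (T Z) = 0 \<longleftrightarrow> om X Z = 0"
proof
  assume "om (T X) (T Z) = 0"
  then obtain a b where ab: "a \<noteq> 0 \<or> b \<noteq> 0" "a *\<^sub>R T X + b *\<^sub>R T Z = 0"
    using om_zero_dependent[OF semidefinite_pair_Gam[OF assms]] by blast
  then have "T (a *\<^sub>R X + b *\<^sub>R Z) = 0"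
    by (simp add: linear_add[OF Gam_linear[OF T]] Gam_scale[OF T])
  then show "om X Z = 0" using Gam_zero_iff[OF T] dependent_om_zero[OF ab(1)] by blast
next
  assume "om X Z = 0"
  then obtain a b where ab: "a \<noteq> 0 \<or> b \<noteq> 0" "a *\<^sub>R X + b *\<^sub>R Z = 0" using om_zero_dependent[OF X] by blast
  then have "T (a *\<^sub>R X + b *\<^sub>R Z) = 0" by (simp add: Gam_zero_iff[OF T])
  then have "a *\<^sub>R T X + b *\<^sub>R T Z = 0"
    by (simp add: linear_add[OF Gam_linear[OF T]] Gam_scale[OF T])
  then show "om (T X) (T Z) = 0" by (rule dependent_om_zero[OF ab(1)])
qed

text \<open>
  Scaling the negative definite part of a semidefinite pair to zero deforms it, through pairs with the
  same nonzero \<open>om\<close>, into the positive definite plane spanned by \<open>(1, 0, -1)\<close> and \<open>(0, junit, 0)\<close>.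
\<close>

lemma om_sgn:
  assumes T: "time_oriented T" and X: "semidefinite_pair X Z"
  shows "sgn (om (T X) (T Z)) = sgn (om X Z)"
proof (cases "om X Z = 0")
  case True
  obtain c where "T \<in> Gam" "0 < c" "\<And>X. hq (T X) = c * hq X" using T by (auto simp: time_oriented_def)
  then have "om (T X) (T Z) = 0" using om_Gam_nonzero X True by blast
  then show ?thesis using True by simp
next
  case False
  obtain c where c: "0 < c" "\<And>X. hq (T X) = c * hq X" using T unfolding time_oriented_def by blast
  have TG: "T \<in> Gam" using T by (simp add: time_oriented_def)
  define f where "f d = om (T (shrink d X)) (T (shrink d Z))" for d
  have nz: "f d \<noteq> 0" if "d \<in> {0..1}" for d
  proof -
    have "om (shrink d X) (shrink d Z) = om X Z" by (simp add: om_def shrink_ta_tz)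
    then show ?thesis unfolding f_def using om_Gam_nonzero[OF TG c semidefinite_pair_shrink[OF _ _ X, of d]] that False by simp
  qed
  have cs: "continuous_on {0..1} (\<lambda>d. T (shrink d W))" for W
  proof -
    have "continuous_on {0..1} (\<lambda>d. shrink d W)" unfolding shrink_def by (intro continuous_intros) auto
    then have "continuous_on {0..1} (T \<circ> (\<lambda>d. shrink d W))"
      by (rule continuous_on_compose) (rule continuous_on_linear[OF Gam_linear[OF TG]])
    then show ?thesis by (simp add: o_def)
  qed
  have cf: "continuous_on {0..1} f"
    unfolding f_def om_def ta_def tz_def by (intro continuous_intros cs)
  have f1: "f 1 = om (T X) (T Z)" by (simp add: f_def shrink_1)
  have f0: "f 0 = om X Z / 2 * om (T (1, 0, - 1)) (T (0, junit, 0))"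
  proof -
    have "T (shrink 0 W) = (ta W / 2) *\<^sub>R T (1, 0, - 1) + tz W *\<^sub>R T (0, junit, 0)" for W
      unfolding shrink_0 linear_add[OF Gam_linear[OF TG]] Gam_scale[OF TG] ..
    then have "f 0 = (ta X / 2 * tz Z - tz X * (ta Z / 2)) * om (T (1, 0, - 1)) (T (0, junit, 0))"
      unfolding f_def using om_commute[of "T (0, junit, 0)" "T (1, 0, - 1)"]
      by (simp add: om_simps algebra_simps)
    then show ?thesis unfolding om_def[of X Z] by (simp add: field_simps)
  qed
  have pos: "0 < om (T (1, 0, - 1)) (T (0, junit, 0))" using T by (simp add: time_oriented_def)
  have "sgn (f 1) = sgn (f 0)"
  proof (rule ccontr)
    assume ne: "sgn (f 1) \<noteq> sgn (f 0)"
    have "f 0 \<noteq> 0" "f 1 \<noteq> 0" using nz by auto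
    then have "(f 0 < 0 \<and> 0 < f 1) \<or> (0 < f 0 \<and> f 1 < 0)" using ne by (auto simp: sgn_if split: if_splits)
    then have "\<exists>d\<in>{0..1}. f d = 0"
    proof
      assume "f 0 < 0 \<and> 0 < f 1"
      then show ?thesis using IVT'[of f 0 0 1] cf by force
    next
      assume "0 < f 0 \<and> f 1 < 0"
      then show ?thesis using IVT2'[of f 1 0 0] cf by force
    qed
    then show False using nz by blast
  qed
  also have "sgn (f 0) = sgn (om X Z)" unfolding f0 using pos by (simp add: sgn_mult)
  finally show ?thesis by (simp add: f1)
qed

lemma semidefinite_pair_basis: "semidefinite_pair (1, 0, - 1) (0, junit, 0)"
  by (auto simp: semidefinite_pair_def power2_eq_square)

lemma om_basis: "om (1, 0, - 1) (0, junit, 0) = 2"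
  by (simp add: om_def ta_def tz_def)

lemma time_oriented_comp:
  assumes T: "time_oriented T" and S: "time_oriented S"
  shows "time_oriented (T \<circ> S)"
proof -
  obtain c where c: "0 < c" "\<And>X. hq (T X) = c * hq X" using T unfolding time_oriented_def by blast
  obtain d where d: "0 < d" "\<And>X. hq (S X) = d * hq X" using S unfolding time_oriented_def by blast
  have G: "T \<in> Gam" "S \<in> Gam" using T S by (auto simp: time_oriented_def)
  have "semidefinite_pair (S (1, 0, - 1)) (S (0, junit, 0))" by (rule semidefinite_pair_Gam[OF G(2) d semidefinite_pair_basis])
  then have "sgn (om (T (S (1, 0, - 1))) (T (S (0, junit, 0)))) = sgn (om (S (1, 0, - 1)) (S (0, junit, 0)))"
    by (rule om_sgn[OF T])
  moreover have "0 < om (S (1, 0, - 1)) (S (0, junit, 0))" using S by (simp add: time_oriented_def)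
  ultimately have "0 < om ((T \<circ> S) (1, 0, - 1)) ((T \<circ> S) (0, junit, 0))"
    by (simp add: sgn_1_pos)
  moreover have "0 < c * d \<and> (\<forall>X. hq ((T \<circ> S) X) = (c * d) * hq X)" using c d by simp
  ultimately show ?thesis unfolding time_oriented_def using Gam_comp[OF G] by blast
qed

lemma time_oriented_inv:
  assumes T: "time_oriented T"
  shows "time_oriented (finv T)"
proof -
  obtain c where c: "0 < c" "\<And>X. hq (T X) = c * hq X" using T unfolding time_oriented_def by blast
  have G: "T \<in> Gam" using T by (auto simp: time_oriented_def)
  have i: "hq (finv T X) = (1 / c) * hq X" for X using c(1) c(2)[of "finv T X"] by (simp add: Gam_inv(2)[OF G])
  have "semidefinite_pair (finv T (1, 0, - 1)) (finv T (0, junit, 0))"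
    by (rule semidefinite_pair_Gam[OF Gam_inv(1)[OF G] _ i semidefinite_pair_basis]) (use c in simp)
  from om_sgn[OF T this] have "sgn (om (finv T (1, 0, - 1)) (finv T (0, junit, 0))) = 1"
    by (simp add: Gam_inv(2)[OF G] om_basis)
  then have "0 < om (finv T (1, 0, - 1)) (finv T (0, junit, 0))" by (simp add: sgn_1_pos)
  moreover have "0 < 1 / c \<and> (\<forall>X. hq (finv T X) = (1 / c) * hq X)" using c i by simp
  ultimately show ?thesis unfolding time_oriented_def using Gam_inv(1)[OF G] by blast
qed

lemma time_oriented_tau: "time_oriented (tau w)"
proof -
  have "hq (tau w X) = 1 * hq X" for X
    by (cases X) (simp add: jdet_add jb_simps power2_eq_square algebra_simps)
  moreover have "0 < om (tau w (1, 0, - 1)) (tau w (0, junit, 0))"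
  proof -
    have "om (tau w (1, 0, - 1)) (tau w (0, junit, 0)) = 2 - jdet w + 2 * (w $ 0) * (w $ 0)"
      by (simp add: om_def ta_def tz_def jb_simps) (simp add: jb_def)
    also have "\<dots> = 2 + (w $ 0)\<^sup>2 + prj w \<bullet> prj w" by (simp add: jdet_prj power2_eq_square)
    finally show ?thesis by (simp add: add_pos_nonneg)
  qed
  ultimately show ?thesis unfolding time_oriented_def using tau_Gam zero_less_one by blast
qed

lemma time_oriented_Nm: "time_oriented Nm"
proof -
  have "hq (Nm X) = 1 * hq X" for X by (cases X) (simp add: mult.commute)
  moreover have "0 < om (Nm (1, 0, - 1)) (Nm (0, junit, 0))"
    by (simp add: om_def ta_def tz_def)
  ultimately show ?thesis unfolding time_oriented_def using Nm_Gam zero_less_one by blast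
qed

lemma time_oriented_Lg:
  assumes g: "g \<in> GL" and c: "0 < c" "\<And>x. jdet (g x) = c * jdet x" and pos: "0 < g junit $ 0"
  shows "time_oriented (Lg g c)"
proof -
  have "hq (Lg g c X) = c * hq X" for X by (cases X) (simp add: c algebra_simps)
  moreover have "0 < om (Lg g c (1, 0, - 1)) (Lg g c (0, junit, 0))"
    using c(1) pos linear_0[OF GL_linear[OF g]] by (simp add: om_def ta_def tz_def)
  ultimately show ?thesis unfolding time_oriented_def using Lg_Gam[OF g c(2)] c(1) by blast
qed

lemma time_oriented_id: "time_oriented id"
  unfolding time_oriented_def using Gam_id by (auto intro!: exI[of _ 1] simp: om_basis)

text \<open>This is what makes the cone field consistent: a change between causal charts has a
  time-oriented lift, so future tangent vectors stay future.\<close>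

lemma CoG_time_oriented:
  fixes A :: "'n::{finite,zero} ratmap"
  assumes "A \<in> CoG"
  obtains T where "time_oriented T" "A = MT T"
proof -
  have gen: "\<exists>T. time_oriented T \<and> B = MT T" if B: "B \<in> Nplus \<union> GOmega \<union> {ratcls (\<lambda>x. - jinv x)}" for B :: "'n ratmap"
  proof -
    consider w where "B = MT (tau w)" | "B \<in> GOmega" | "B = MT Nm"
      using B by (auto simp: Nplus_def MT_tau MT_Nm)
    then show ?thesis
    proof cases
      case 1 then show ?thesis using time_oriented_tau by blast
    next
      case 2
      then obtain g where g: "B = ratcls g" "g \<in> GL" "g ` Omega = Omega" by (auto simp: GOmega_def)
      obtain c where c: "0 < c" "\<And>x. jdet (g x) = c * jdet x" using GOmega_conformal[OF g(2,3)] by blast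
      have "junit \<in> Omega" by (simp add: Omega_def)
      then have "g junit \<in> Omega" using g(3) by blast
      then have "time_oriented (Lg g c)" by (intro time_oriented_Lg g c) (simp add: Omega_def)
      then show ?thesis using g MT_Lg by blast
    next
      case 3 then show ?thesis using time_oriented_Nm by blast
    qed
  qed
  have "\<exists>T. time_oriented T \<and> A = MT T"
    using assms unfolding CoG_def
  proof induction
    case one
    show ?case by (rule exI[of _ id]) (intro conjI time_oriented_id MT_id[symmetric])
  next
    case (incl h) then show ?case by (rule gen)
  next
    case (inv h)
    then obtain T where T: "time_oriented T" "h = MT T" using gen by blast
    have "T \<in> Gam" using T by (simp add: time_oriented_def)
    then show ?case using T time_oriented_inv MT_inv by blast
  next
    case (eng h1 h2)
    then obtain T S where T: "time_oriented T" "h1 = MT T" "time_oriented S" "h2 = MT S" by blast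
    have "T \<in> Gam" "S \<in> Gam" using T by (auto simp: time_oriented_def)
    then show ?case using T time_oriented_comp MT_mult by blast
  qed
  then show thesis using that by blast
qed

lemma semidefinite_pairI:
  assumes "hq X = 0" "hb X Z = 0" "0 \<le> hq Z"
  shows "semidefinite_pair X Z"
  using assms by (simp add: semidefinite_pair_def hq_add hb_simps)

text \<open>Moving \<open>v\<close> to the origin by \<open>tau (- v)\<close> preserves the sign and
  leaves exactly \<open>w $ 0\<close>. In a chart \<open>om\<close> thus reads off the time
  component of a tangent vector.\<close>

lemma om_chart:
  assumes "semidefinite_pair (kap v) (0, w, r)"
  shows "sgn (om (kap v) (0, w, r)) = sgn (w $ 0)"
proof -
  have "sgn (om (tau (- v) (kap v)) (tau (- v) (0, w, r))) = sgn (om (kap v) (0, w, r))"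
    by (rule om_sgn[OF time_oriented_tau assms])
  moreover have "om (tau (- v) (kap v)) (tau (- v) (0, w, r)) = w $ 0"
    using jb_commute by (simp add: kap_def om_def ta_def tz_def jb_simps jdet_jb)
  ultimately show ?thesis by simp
qed

section \<open>Causal curves and the order\<close>

text \<open>The linear part of the affine map \<open>lift\<close>, hence its differential.\<close>

definition dlift :: "real \<times> 'n::{finite,zero} V \<times> real \<Rightarrow> real \<times> 'n V \<times> real" where
  "dlift D = (fst D, fst (snd D), - snd (snd D))"

lemma dlift_Pair [simp]: "dlift (s, v, u) = (s, v, - u)"
  by (simp add: dlift_def)

lemma dlift_dlift [simp]: "dlift (dlift D) = D"
  by (simp add: dlift_def)

lemma linear_dlift: "linear dlift"
  by (rule linearI) (auto simp: dlift_def)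

lemma lift_dlift: "lift X = (0, junit, 0) + dlift X"
  by (simp add: lift_def dlift_def)

lemma hb_lift: "fst (snd X) \<in> E0 \<Longrightarrow> fst (snd D) \<in> E0 \<Longrightarrow> hb (lift X) (dlift D) = lf X D"
  by (cases X; cases D) (simp add: jb_simps E0_jb)

lemma hq_dlift: "fst (snd D) \<in> E0 \<Longrightarrow> hq (dlift D) = lf D D / 2"
  by (cases D) (simp add: E0_jb)

lemma om_lift: "fst (snd X) \<in> E0 \<Longrightarrow> fst (snd D) \<in> E0 \<Longrightarrow> om (lift X) (dlift D) = - (fst D + snd (snd D))"
  by (simp add: om_def ta_def tz_def lift_def dlift_def E0_def)

text \<open>For \<open>D = (s, v, u)\<close> the value \<open>om (lift X) (dlift D)\<close> is
  \<open>- (s + u)\<close>, so the future corresponds to nonpositive \<open>om\<close>, in agreement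
  with the cone \<open>- closure Omega\<close> in the charts.\<close>

lemma future_cone_iff_om:
  assumes "fst (snd X) \<in> E0" "fst (snd D) \<in> E0"
  shows "D \<in> future_cone \<longleftrightarrow> 0 \<le> hq (dlift D) \<and> om (lift X) (dlift D) \<le> 0"
proof -
  obtain s v u where D: "D = (s, v, u)" by (cases D)
  have "v \<bullet> v \<le> s * u \<and> 0 \<le> s + u \<longleftrightarrow> 0 \<le> s \<and> 0 \<le> u \<and> v \<bullet> v \<le> s * u"
  proof
    assume a: "v \<bullet> v \<le> s * u \<and> 0 \<le> s + u"
    then have "0 \<le> s * u" using inner_ge_zero[of v] by linarith
    then have "(0 \<le> s \<and> 0 \<le> u) \<or> (s \<le> 0 \<and> u \<le> 0)" by (simp add: zero_le_mult_iff)
    then show "0 \<le> s \<and> 0 \<le> u \<and> v \<bullet> v \<le> s * u" using a by auto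
  qed auto
  then show ?thesis unfolding om_lift[OF assms] hq_dlift[OF assms(2)] by (auto simp: D)
qed

text \<open>The cone is self-dual and its extreme rays suffice as test vectors; for
  \<open>s \<noteq> 0\<close> the decisive one is at \<open>p = (1 / s) *\<^sub>R v\<close>.\<close>

lemma future_cone_dual:
  assumes "\<And>k. 0 \<le> lf D (null_vec k)"
  shows "D \<in> future_cone"
proof -
  obtain s v u where D: "D = (s, v, u)" by (cases D)
  have s: "0 \<le> s" using assms[of None] by (simp add: D)
  have p: "0 \<le> s * (p \<bullet> p) + u - 2 * (v \<bullet> p)" for p using assms[of "Some p"] by (simp add: D)
  have u: "0 \<le> u" using p[of 0] by simp
  have "v \<bullet> v \<le> s * u"
  proof (cases "s = 0")
    case True
    have "v = 0"
    proof (rule ccontr)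
      assume v: "v \<noteq> 0"
      have "0 \<le> u - 2 * ((u + 1) / (v \<bullet> v) * (v \<bullet> v))" using p[of "((u + 1) / (v \<bullet> v)) *\<^sub>R v"] True by simp
      then show False using v u by simp
    qed
    then show ?thesis using True by simp
  next
    case False
    have "0 \<le> s * (s * (((1 / s) *\<^sub>R v) \<bullet> ((1 / s) *\<^sub>R v)) + u - 2 * (v \<bullet> ((1 / s) *\<^sub>R v)))"
      by (rule mult_nonneg_nonneg[OF s p])
    also have "\<dots> = s * u - v \<bullet> v" using False by (simp add: algebra_simps)
    finally show ?thesis by simp
  qed
  then show ?thesis using s u by (simp add: D)
qed

section \<open>Causal curves ascend in the order\<close>

text \<open>Only right derivatives at interior points are available. The last point at which
  \<open>h\<close> stays above a line of slope \<open>- e\<close> through the graph at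
  \<open>c\<close> cannot lie before \<open>b\<close>. Then \<open>e\<close> tends to 0, and
  continuity reaches the left end point.\<close>

lemma right_deriv_nonneg_mono:
  fixes h :: "real \<Rightarrow> real"
  assumes ab: "a < b" and cont: "continuous_on {a..b} h"
    and der: "\<And>t. t \<in> {a<..<b} \<Longrightarrow> \<exists>d\<ge>0. (h has_vector_derivative d) (at_right t)"
  shows "h a \<le> h b"
proof -
  have step: "h c - e * (b - c) \<le> h b" if c: "a < c" "c < b" and e: "0 < e" for c e
  proof -
    define S where "S = {c..b} \<inter> {t. h c - e * (t - c) \<le> h t}"
    have contc: "continuous_on {c..b} h" using cont by (rule continuous_on_subset) (use c in auto)
    have "closed S"
    proof -
      have "closed {t \<in> {c..b}. h c - e * (t - c) \<le> h t}"
        by (intro continuous_on_closed_Collect_le contc continuous_intros closed_atLeastAtMost)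
      moreover have "{t \<in> {c..b}. h c - e * (t - c) \<le> h t} = S" by (auto simp: S_def)
      ultimately show ?thesis by simp
    qed
    moreover have "bounded S" by (rule bounded_subset[of "{c..b}"]) (auto simp: S_def)
    ultimately have cS: "compact S" by (simp add: compact_eq_bounded_closed)
    have "c \<in> S" using c by (simp add: S_def)
    then obtain m where m: "m \<in> S" "\<And>t. t \<in> S \<Longrightarrow> t \<le> m" using compact_attains_sup[OF cS] by blast
    have mb: "c \<le> m" "m \<le> b" "h c - e * (m - c) \<le> h m" using m(1) by (auto simp: S_def)
    have "m = b"
    proof (rule ccontr)
      assume "m \<noteq> b"
      then have m2: "m < b" "a < m" using mb c by auto
      then obtain d where d: "0 \<le> d" "(h has_vector_derivative d) (at_right m)" using der[of m] by auto
      have "(h has_real_derivative d) (at_right m)" using d(2) by (simp add: has_real_derivative_iff_has_vector_derivative)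
      then have "((\<lambda>t. (h t - h m) / (t - m)) \<longlongrightarrow> d) (at_right m)" by (simp add: has_field_derivative_iff)
      then have "\<forall>\<^sub>F t in at_right m. - e < (h t - h m) / (t - m)"
        by (rule order_tendstoD(1)) (use d e in simp)
      moreover have "\<forall>\<^sub>F t in at_right m. t \<in> {m<..<b}" by (rule eventually_at_right_real[OF m2(1)])
      ultimately have ev: "\<forall>\<^sub>F t in at_right m. - e < (h t - h m) / (t - m) \<and> t \<in> {m<..<b}" by (rule eventually_conj)
      obtain t where t: "- e < (h t - h m) / (t - m)" "m < t" "t < b"
        using eventually_happens'[OF trivial_limit_at_right_real ev] by auto
      have "- e * (t - m) < h t - h m" using t by (simp add: pos_less_divide_eq)
      then have "h c - e * (t - c) \<le> h t" using mb(3) by (simp add: algebra_simps)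
      then have "t \<in> S" using t mb by (simp add: S_def)
      then show False using m(2) t by fastforce
    qed
    then show ?thesis using mb by simp
  qed
  have "h c \<le> h b" if c: "a < c" "c < b" for c
  proof (rule field_le_epsilon)
    fix e :: real assume e: "0 < e"
    have "h c - e / (b - c) * (b - c) \<le> h b" using step[OF c, of "e / (b - c)"] e c by simp
    then show "h c \<le> h b + e" using c by simp
  qed
  then have ev: "\<forall>\<^sub>F c in at_right a. h c \<le> h b"
    using eventually_at_right_real[OF ab] by (auto elim: eventually_mono)
  have "(h \<longlongrightarrow> h a) (at a within {a..b})" using cont ab by (simp add: continuous_on_def)
  then have "(h \<longlongrightarrow> h a) (at_right a)"
    using ab by (simp add: at_within_Icc_at_right)
  then show ?thesis
    using ev by (rule tendsto_upperbound) (simp add: trivial_limit_at_right_real)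
qed

text \<open>By duality the cone is tested with the functionals \<open>lf _ (null_vec k)\<close>,
  which are nondecreasing along the curve.\<close>

lemma right_deriv_future_cone_future_le:
  fixes Y :: "real \<Rightarrow> real \<times> 'e::euclidean_space \<times> real"
  assumes ab: "a < b" and cont: "continuous_on {a..b} Y"
    and der: "\<And>t. t \<in> {a<..<b} \<Longrightarrow> \<exists>D\<in>future_cone. (Y has_vector_derivative D) (at_right t)"
  shows "future_le (Y a) (Y b)"
  unfolding future_le_def
proof (rule future_cone_dual)
  fix k :: "'e option"
  have lin: "bounded_linear (\<lambda>X. lf X (null_vec k))"
    unfolding linear_conv_bounded_linear[symmetric]
    by (rule linearI) (simp_all only: lf_simps real_scaleR_def)
  have "lf (Y a) (null_vec k) \<le> lf (Y b) (null_vec k)"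
  proof (rule right_deriv_nonneg_mono[OF ab, of "\<lambda>t. lf (Y t) (null_vec k)"])
    show "continuous_on {a..b} (\<lambda>t. lf (Y t) (null_vec k))"
      using bounded_linear.continuous_on[OF lin cont] .
    fix t assume "t \<in> {a<..<b}"
    then obtain D where D: "D \<in> future_cone" "(Y has_vector_derivative D) (at_right t)" using der by blast
    have "((\<lambda>t. lf (Y t) (null_vec k)) has_vector_derivative lf D (null_vec k)) (at_right t)"
      by (rule bounded_linear.has_vector_derivative[OF lin D(2)])
    then show "\<exists>d\<ge>0. ((\<lambda>t. lf (Y t) (null_vec k)) has_vector_derivative d) (at_right t)"
      using lf_future_cone_nonneg[OF D(1) null_vec_future_cone] by blast
  qed
  then show "0 \<le> lf (Y b - Y a) (null_vec k)" by (simp add: lf_simps)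
qed

text \<open>Inverts \<open>lift\<close> on representatives of any scale: the vector is first
  rescaled to time coordinate 1.\<close>

definition unlift :: "real \<times> 'n::{finite,zero} V \<times> real \<Rightarrow> real \<times> 'n V \<times> real" where
  "unlift X = dlift ((1 / tz X) *\<^sub>R X - (0, junit, 0))"

lemma unlift_lift: "X \<in> de_sitter E0 \<Longrightarrow> c \<noteq> 0 \<Longrightarrow> unlift (c *\<^sub>R lift X) = X"
  by (cases X) (auto simp: unlift_def tz_def de_sitter_def E0_def)

lemma unlift_deriv:
  assumes X: "(X has_vector_derivative Z) (at t within S)" and nz: "tz (X t) \<noteq> 0"
  shows "((\<lambda>s. unlift (X s)) has_vector_derivative
    dlift ((1 / tz (X t)) *\<^sub>R Z - (tz Z / (tz (X t))\<^sup>2) *\<^sub>R X t)) (at t within S)"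
proof -
  have bl: "bounded_linear (tz :: real \<times> 'a V \<times> real \<Rightarrow> real)"
    unfolding linear_conv_bounded_linear[symmetric]
    by (rule linearI) (simp_all only: ta_tz_linear real_scaleR_def)
  have "((\<lambda>s. tz (X s)) has_vector_derivative tz Z) (at t within S)"
    by (rule bounded_linear.has_vector_derivative[OF bl X])
  then have d: "((\<lambda>s. tz (X s)) has_field_derivative tz Z) (at t within S)"
    by (simp add: has_real_derivative_iff_has_vector_derivative)
  have "((\<lambda>s. 1 / tz (X s)) has_field_derivative - (tz Z / (tz (X t))\<^sup>2)) (at t within S)"
    using DERIV_inverse_fun[OF d nz] nz by (simp add: field_simps power2_eq_square)
  from has_vector_derivative_scaleR[OF this X]
  have "((\<lambda>s. (1 / tz (X s)) *\<^sub>R X s) has_vector_derivative (1 / tz (X t)) *\<^sub>R Z - (tz Z / (tz (X t))\<^sup>2) *\<^sub>R X t) (at t within S)"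
    by simp
  then have "((\<lambda>s. (1 / tz (X s)) *\<^sub>R X s - (0, junit, 0)) has_vector_derivative (1 / tz (X t)) *\<^sub>R Z - (tz Z / (tz (X t))\<^sup>2) *\<^sub>R X t) (at t within S)"
    by (simp add: has_vector_derivative_diff_const)
  then show ?thesis unfolding unlift_def
    by (rule bounded_linear.has_vector_derivative[rotated]) (simp add: linear_dlift flip: linear_conv_bounded_linear)
qed

abbreviation hp :: "real \<times> 'n::{finite,zero} V \<times> real \<Rightarrow> 'n vcpoint" where
  "hp X \<equiv> pt (lift X)"

lemma hq_minus [simp]: "hq (- X) = hq X"
  by (simp add: hq_def)

lemma om_diff: "om (X - Y) Z = om X Z - om Y Z" "om Z (X - Y) = om Z X - om Z Y"
  and tz_diff: "tz (X - Y) = tz X - tz Y"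
  by (auto simp: om_def ta_def tz_def algebra_simps)

lemma unlift_of_hp:
  assumes X: "X \<in> de_sitter E0" and W: "W \<in> Nc" and eq: "pt W = hp X"
  shows "tz W \<noteq> 0" "W = tz W *\<^sub>R lift X" "unlift W = X"
proof -
  obtain c where c: "c \<noteq> 0" "W = c *\<^sub>R lift X"
    by (rule pt_eqD[OF eq]) (use W lift_Nc[OF X] in \<open>auto simp: Nc_def\<close>)
  have "tz (lift X) = 1" using X by (simp add: tz_def lift_def de_sitter_def E0_def)
  then have "tz W = c" using c by (simp add: ta_tz_linear)
  then show "tz W \<noteq> 0" "W = tz W *\<^sub>R lift X" using c by auto
  show "unlift W = X" unfolding c(2) by (rule unlift_lift[OF X c(1)])
qed

lemma bounded_bilinear_jb: "bounded_bilinear (jb :: 'n::{finite,zero} V \<Rightarrow> _)"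
  unfolding bilinear_conv_bounded_bilinear[symmetric] bilinear_def
  by (intro conjI allI linearI) (simp_all add: jb_simps)

lemma kap_deriv:
  assumes v: "(v has_vector_derivative w) (at t within S)"
  shows "((\<lambda>s. kap (v s)) has_vector_derivative (0, w, 2 * jb (v t) w)) (at t within S)"
proof -
  have "((\<lambda>s. jb (v s) (v s)) has_vector_derivative jb (v t) w + jb w (v t)) (at t within S)"
    by (rule bounded_bilinear.has_vector_derivative[OF bounded_bilinear_jb v v])
  then have j: "((\<lambda>s. jdet (v s)) has_vector_derivative 2 * jb (v t) w) (at t within S)"
    using jb_commute[of w "v t"] by (simp add: jdet_jb)
  have b1: "bounded_linear (\<lambda>x::'a V. (0::real, x, 0::real))"
    unfolding linear_conv_bounded_linear[symmetric] by (rule linearI) simp_all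
  have b2: "bounded_linear (\<lambda>r::real. (0::real, 0::'a V, r))"
    unfolding linear_conv_bounded_linear[symmetric] by (rule linearI) simp_all
  have "((\<lambda>s. (1::real, 0, 0) + ((0, v s, 0) + (0, 0, jdet (v s)))) has_vector_derivative 0 + ((0, w, 0) + (0, 0, 2 * jb (v t) w))) (at t within S)"
    by (rule has_vector_derivative_add[OF has_vector_derivative_const
        has_vector_derivative_add[OF bounded_linear.has_vector_derivative[OF b1 v]
          bounded_linear.has_vector_derivative[OF b2 j]]])
  then show ?thesis by (simp add: kap_def)
qed

lemma continuous_on_unlift: "continuous_on {X. tz X \<noteq> 0} unlift"
  unfolding unlift_def dlift_def tz_def by (intro continuous_intros) auto

lemma topspace_Vc: "topspace Vc_top = (Vc :: 'n::{finite,zero} vcpoint set)"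
proof
  show "topspace Vc_top \<subseteq> (Vc :: 'n vcpoint set)" using openin_Vc_top openin_topspace by blast
  have "openin Vc_top (pt ` (UNIV \<inter> Nc) :: 'n vcpoint set)" by (rule openin_pt_image) simp
  then show "(Vc :: 'n vcpoint set) \<subseteq> topspace Vc_top" using openin_subset by (auto simp: Vc_Nc)
qed

lemma range_vcpar:
  assumes T: "T \<in> Gam"
  shows "range (vcpar (MT T)) = pt ` ({X. fst (finv T X) \<noteq> 0} \<inter> Nc)"
proof (intro equalityI subsetI)
  fix p assume "p \<in> range (vcpar (MT T))"
  then obtain v where "p = pt (T (kap v))" by (auto simp: vcpar_eq[OF T])
  moreover have "T (kap v) \<in> {X. fst (finv T X) \<noteq> 0} \<inter> Nc" by (simp add: Gam_inv(3)[OF T] Nc_Gam[OF T])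
  ultimately show "p \<in> pt ` ({X. fst (finv T X) \<noteq> 0} \<inter> Nc)" by blast
next
  fix p assume "p \<in> pt ` ({X. fst (finv T X) \<noteq> 0} \<inter> Nc)"
  then obtain X where "X \<in> Nc" "fst (finv T X) \<noteq> 0" "p = pt X" by blast
  then show "p \<in> range (vcpar (MT T))" using pt_in_chart[OF T] by blast
qed

lemma openin_range_vcpar: "T \<in> Gam \<Longrightarrow> openin Vc_top (range (vcpar (MT T)))"
proof -
  assume T: "T \<in> Gam"
  have "continuous_on UNIV (\<lambda>X. fst (finv T X))"
    using continuous_on_linear[OF Gam_linear[OF Gam_inv(1)[OF T]]] by (intro continuous_on_fst)
  then have "open {X. fst (finv T X) \<noteq> 0}" by (intro open_Collect_neq continuous_on_const)
  then show ?thesis unfolding range_vcpar[OF T] by (rule openin_pt_image)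
qed

text \<open>The curve is lifted to a curve \<open>Y\<close> in the ambient vector space of de Sitter
  space. Right derivatives in a causal chart are carried over by \<open>unlift\<close>, and the sign
  of \<open>om\<close> shows that they lie in the future cone.\<close>

lemma causal_imp_future_le:
  fixes X Z :: "real \<times> 'n::{finite,zero} V \<times> real"
  assumes os: "orth_space (E0 :: ('n V) set)" and X: "X \<in> de_sitter E0" and Z: "Z \<in> de_sitter E0"
    and le: "causal_le (hp X) (hp Z)"
  shows "future_le X Z"
proof -
  obtain \<gamma> a b where g: "causal_curve \<gamma> a b" "\<gamma> a = hp X" "\<gamma> b = hp Z" using le by (auto simp: causal_le_def)
  have ab: "a < b" and img: "\<gamma> ` {a..b} \<subseteq> MM" and cont: "continuous_map (top_of_set {a..b}) Vc_top \<gamma>"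
    and rd: "\<And>t. t \<in> {a<..<b} \<Longrightarrow> right_deriv_in_cone \<gamma> t"
    using g(1) by (auto simp: causal_curve_def)
  define Y where "Y s = inv_into (de_sitter E0) hp (\<gamma> s)" for s
  have Y: "Y s \<in> de_sitter E0" "hp (Y s) = \<gamma> s" if "s \<in> {a..b}" for s
  proof -
    have "\<gamma> s \<in> hp ` de_sitter E0" using img that MM_eq[OF os] by auto
    then show "Y s \<in> de_sitter E0" "hp (Y s) = \<gamma> s" unfolding Y_def by (rule inv_into_into, rule f_inv_into_f)
  qed
  have Yab: "Y a = X" "Y b = Z"
    unfolding Y_def g(2,3) by (rule inv_into_f_f[OF pt_lift_inj X], rule inv_into_f_f[OF pt_lift_inj Z])
  have op: "\<exists>W. open W \<and> {s \<in> {a..b}. \<gamma> s \<in> U} = {a..b} \<inter> W" if "openin Vc_top U" for U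
  proof -
    have "openin (top_of_set {a..b}) {s \<in> topspace (top_of_set {a..b}). \<gamma> s \<in> U}"
      by (rule openin_continuous_map_preimage[OF cont that])
    then show ?thesis by (auto simp: openin_open)
  qed
  \<comment> \<open>The preimage of an open set under \<open>unlift\<close> is open in the ambient
    space, so its image under \<open>pt\<close> is open in \<open>Vc_top\<close>, where
    \<open>\<gamma>\<close> is known to be continuous.\<close>
  have contY: "continuous_on {a..b} Y"
    unfolding continuous_openin_preimage_eq
  proof (intro allI impI)
    fix W :: "(real \<times> 'n V \<times> real) set" assume W: "open W"
    have bl: "continuous_on UNIV (tz :: real \<times> 'n V \<times> real \<Rightarrow> real)" unfolding tz_def by (intro continuous_intros)
    have o1: "open {X :: real \<times> 'n V \<times> real. tz X \<noteq> 0}" by (intro open_Collect_neq continuous_on_const bl)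
    define B where "B = unlift -` W \<inter> {X. tz X \<noteq> 0}"
    have "open B" unfolding B_def using continuous_on_open_vimage[OF o1] continuous_on_unlift W by blast
    then obtain V where V: "open V" "{s \<in> {a..b}. \<gamma> s \<in> pt ` (B \<inter> Nc)} = {a..b} \<inter> V" using op[OF openin_pt_image] by blast
    have "{a..b} \<inter> Y -` W = {s \<in> {a..b}. \<gamma> s \<in> pt ` (B \<inter> Nc)}"
    proof (intro equalityI subsetI)
      fix s assume s: "s \<in> {a..b} \<inter> Y -` W"
      then have Ys: "Y s \<in> de_sitter E0" "hp (Y s) = \<gamma> s" using Y by auto
      have "lift (Y s) \<in> B"
        using unlift_of_hp[OF Ys(1) lift_Nc[OF Ys(1)] refl] s by (simp add: B_def)
      then have "\<gamma> s \<in> pt ` (B \<inter> Nc)" using lift_Nc[OF Ys(1)] Ys(2) by (metis IntI imageI)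
      then show "s \<in> {s \<in> {a..b}. \<gamma> s \<in> pt ` (B \<inter> Nc)}" using s by simp
    next
      fix s assume "s \<in> {s \<in> {a..b}. \<gamma> s \<in> pt ` (B \<inter> Nc)}"
      then obtain P where P: "s \<in> {a..b}" "P \<in> B" "P \<in> Nc" "\<gamma> s = pt P" by auto
      have "unlift P = Y s" by (rule unlift_of_hp(3)) (use P Y in auto)
      then show "s \<in> {a..b} \<inter> Y -` W" using P by (auto simp: B_def)
    qed
    then show "openin (top_of_set {a..b}) ({a..b} \<inter> Y -` W)" unfolding V(2) using V(1) by (auto simp: openin_open)
  qed
  have "future_le (Y a) (Y b)"
  proof (rule right_deriv_future_cone_future_le[OF ab contY])
    fix t assume t: "t \<in> {a<..<b}"
    then have tI: "t \<in> {a..b}" by simp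
    obtain A w where A: "A \<in> CoG" "\<gamma> t \<in> range (vcpar A)" "w \<in> uminus ` closure Omega"
      "((\<lambda>s. vcchart A (\<gamma> s)) has_vector_derivative w) (at_right t)"
      using rd[OF t] by (auto simp: right_deriv_in_cone_def)
    obtain T where T: "time_oriented T" "A = MT T" using CoG_time_oriented[OF A(1)] .
    have TG: "T \<in> Gam" using T by (simp add: time_oriented_def)
    define v where "v s = vcchart A (\<gamma> s)" for s
    have YT: "Y s = unlift (T (kap (v s)))" "tz (T (kap (v s))) \<noteq> 0" "T (kap (v s)) = tz (T (kap (v s))) *\<^sub>R lift (Y s)"
      if s: "s \<in> {a..b}" "\<gamma> s \<in> range (vcpar A)" for s
    proof -
      have "\<gamma> s = vcpar A (v s)" using vcpar_vcchart[OF s(2)] by (simp add: v_def)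
      then have "pt (T (kap (v s))) = hp (Y s)" using Y(2)[OF s(1)] by (simp add: T(2) vcpar_eq[OF TG])
      from unlift_of_hp[OF Y(1)[OF s(1)] _ this]
      show "Y s = unlift (T (kap (v s)))" "tz (T (kap (v s))) \<noteq> 0" "T (kap (v s)) = tz (T (kap (v s))) *\<^sub>R lift (Y s)"
        by (simp_all add: Nc_Gam[OF TG])
    qed
    define kd where "kd = (0::real, w, 2 * jb (v t) w)"
    have dv: "(v has_vector_derivative w) (at_right t)" using A(4) by (simp add: v_def[abs_def])
    have bT: "bounded_linear T" using Gam_linear[OF TG] by (simp add: linear_conv_bounded_linear)
    have dT: "((\<lambda>s. T (kap (v s))) has_vector_derivative T kd) (at_right t)"
      unfolding kd_def by (rule bounded_linear.has_vector_derivative[OF bT kap_deriv[OF dv]])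
    define l where "l = tz (T (kap (v t)))"
    note Yt = YT[OF tI A(2)]
    have l: "l \<noteq> 0" using Yt by (simp add: l_def)
    \<comment> \<open>Quotient rule for the normalised curve. The subtracted multiple of
      \<open>T (kap (v t))\<close> changes neither the square nor the sign of \<open>om\<close>,
      since that vector is null and orthogonal to \<open>T kd\<close>.\<close>
    define D where "D = (1 / l) *\<^sub>R T kd - (tz (T kd) / l\<^sup>2) *\<^sub>R T (kap (v t))"
    have "((\<lambda>s. unlift (T (kap (v s)))) has_vector_derivative dlift D) (at_right t)"
      unfolding D_def l_def by (rule unlift_deriv[OF dT Yt(2)])
    moreover have "\<forall>\<^sub>F s in nhds t. s \<in> {t<..} \<longrightarrow> unlift (T (kap (v s))) = Y s"
    proof -
      obtain W where W: "open W" "{s \<in> {a..b}. \<gamma> s \<in> range (vcpar A)} = {a..b} \<inter> W"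
        using op[OF openin_range_vcpar[OF TG]] T(2) by blast
      have "t \<in> W \<inter> {a<..<b}" using A(2) t W(2) by auto
      moreover have "open (W \<inter> {a<..<b})" using W by auto
      ultimately have "\<forall>\<^sub>F s in nhds t. s \<in> W \<inter> {a<..<b}" by (rule eventually_nhds_in_open[rotated])
      then show ?thesis
      proof (rule eventually_mono)
        fix s assume s: "s \<in> W \<inter> {a<..<b}"
        then have "s \<in> {a..b}" by simp
        moreover have "s \<in> {a..b} \<inter> W" using s by auto
        then have "\<gamma> s \<in> range (vcpar A)" unfolding W(2)[symmetric] by blast
        ultimately show "s \<in> {t<..} \<longrightarrow> unlift (T (kap (v s))) = Y s" using YT(1) by simp
      qed
    qed
    ultimately have dY: "(Y has_vector_derivative dlift D) (at_right t)"
      using has_vector_derivative_cong_ev[of "{t<..}" "\<lambda>s. unlift (T (kap (v s)))" Y t] Yt(1) by simp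
    obtain c where c: "0 < c" "\<And>X. hq (T X) = c * hq X" using T(1) unfolding time_oriented_def by blast
    have wc: "0 \<le> jdet w" "w $ 0 \<le> 0" using A(3) by (auto simp: omega_closure)
    have kk: "hb (kap (v t)) kd = 0" by (simp add: kap_def kd_def)
    have hkd: "hq kd = jdet w" by (simp add: kd_def)
    have pk: "semidefinite_pair (kap (v t)) kd" using kk hkd wc by (intro semidefinite_pairI) auto
    have E: "fst (snd (dlift D)) \<in> E0"
    proof -
      have "tz D = 0" using l unfolding D_def
        by (simp add: tz_diff ta_tz_linear l_def power2_eq_square)
      then show ?thesis by (simp add: dlift_def E0_def tz_def)
    qed
    have h0: "hb (T kd) (T (kap (v t))) = 0"
      using Gam_hb[OF TG c(2), of kd "kap (v t)"] kk hb_commute[of kd] by simp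
    have DD: "D = (1 / l) *\<^sub>R T kd + (- (tz (T kd) / l\<^sup>2)) *\<^sub>R T (kap (v t))" by (simp add: D_def)
    have "hq D = (1 / l)\<^sup>2 * (c * jdet w)"
      unfolding DD hq_add by (simp add: hb_simps h0 c(2) hkd)
    then have 1: "0 \<le> hq D" using c(1) wc by simp
    have "l *\<^sub>R lift (Y t) = T (kap (v t))" using Yt(3) by (simp add: l_def)
    then have "om (l *\<^sub>R lift (Y t)) D = (1 / l) * om (T (kap (v t))) (T kd)" unfolding DD by (simp add: om_simps om_diff)
    \<comment> \<open>The scale \<open>l\<close> enters as a square, so its unknown sign does no
      harm.\<close>
    then have "l * l * om (lift (Y t)) D = om (T (kap (v t))) (T kd)" using l by (simp add: om_simps field_simps)
    moreover have "sgn (om (T (kap (v t))) (T kd)) = sgn (w $ 0)"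
      using om_sgn[OF T(1) pk] om_chart[of "v t" w "2 * jb (v t) w"] pk by (simp add: kd_def)
    then have "om (T (kap (v t))) (T kd) \<le> 0" using wc(2) by (auto simp: sgn_if split: if_splits)
    ultimately have 2: "om (lift (Y t)) D \<le> 0" using l
      by (metis linorder_not_less mult_pos_pos not_real_square_gt_zero)
    have "fst (snd (Y t)) \<in> E0" using Y(1)[OF tI] by (simp add: de_sitter_def)
    then have "dlift D \<in> future_cone" using future_cone_iff_om[OF _ E, of "Y t"] 1 2 by simp
    then show "\<exists>D\<in>future_cone. (Y has_vector_derivative D) (at_right t)" using dY by blast
  qed
  then show ?thesis by (simp add: Yab)
qed

lemma chart_at_time_oriented:
  assumes X: "X \<in> Nc"
  obtains T where "time_oriented T" "MT T \<in> CoG" "fst (finv T X) \<noteq> 0"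
proof -
  obtain S where S: "S \<in> CGam" "fst (finv S X) \<noteq> 0" using chart_at[OF X] .
  have SG: "S \<in> Gam" "MT S \<in> CoG" using S(1) by (auto simp: CGam_def)
  obtain T where T: "time_oriented T" "MT S = MT T" using CoG_time_oriented[OF SG(2)] .
  have TG: "T \<in> Gam" using T by (simp add: time_oriented_def)
  obtain e where e: "e \<noteq> 0" "\<And>X. S X = e *\<^sub>R T X" using MT_eq_iff[OF SG(1) TG T(2)] by blast
  have "X = e *\<^sub>R T (finv S X)" using e(2)[of "finv S X"] by (simp add: Gam_inv(2)[OF SG(1)])
  then have "finv T X = finv T (e *\<^sub>R T (finv S X))" by simp
  also have "\<dots> = e *\<^sub>R finv S X" by (simp add: Gam_scale[OF Gam_inv(1)[OF TG]] Gam_inv(3)[OF TG])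
  finally have "fst (finv T X) \<noteq> 0" using e S(2) by simp
  then show thesis using that T SG by simp
qed

section \<open>Curves that realise the order\<close>

text \<open>Around each point the curve is read in a causal chart by the inverse \<open>S\<close> of
  a time-oriented lift. \<open>S\<close> preserves the sign of \<open>om\<close>, so future tangent
  vectors become vectors of \<open>- closure Omega\<close>.\<close>

lemma smooth_causal:
  fixes Y Yd :: "real \<Rightarrow> real \<times> 'n::{finite,zero} V \<times> real"
  assumes os: "orth_space (E0 :: ('n V) set)" and ab: "a < b"
    and Y: "\<And>t. t \<in> {a..b} \<Longrightarrow> Y t \<in> de_sitter E0"
    and dY: "\<And>t. t \<in> {a..b} \<Longrightarrow> (Y has_vector_derivative Yd t) (at t)"
    and fc: "\<And>t. t \<in> {a..b} \<Longrightarrow> Yd t \<in> future_cone"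
    and E: "\<And>t. t \<in> {a..b} \<Longrightarrow> fst (snd (Yd t)) \<in> E0"
    and orth: "\<And>t. t \<in> {a..b} \<Longrightarrow> lf (Y t) (Yd t) = 0"
  shows "causal_le (hp (Y a)) (hp (Y b))"
proof -
  define \<gamma> where "\<gamma> s = hp (Y s)" for s
  have contY: "continuous_on {a..b} Y"
    by (rule continuous_at_imp_continuous_on) (use dY has_vector_derivative_continuous in blast)
  have contL: "continuous_on {a..b} (\<lambda>s. lift (Y s))"
    unfolding lift_def using contY by (intro continuous_intros)
  \<comment> \<open>\<open>r\<close> is differentiable from both sides but agrees with the chart of
    \<open>\<gamma>\<close> only within \<open>{a..b}\<close>, where \<open>Y\<close> is controlled.
    Restricting its derivative serves both the pieces and the right derivative.\<close>
  have chart: "\<exists>T r w. time_oriented T \<and> MT T \<in> CoG \<and> \<gamma> t \<in> range (vcpar (MT T)) \<and> (r has_vector_derivative w) (at t) \<and>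
      vcchart (MT T) (\<gamma> t) = r t \<and> w \<in> uminus ` closure Omega \<and>
      (\<forall>\<^sub>F s in nhds t. s \<in> {a..b} \<longrightarrow> vcchart (MT T) (\<gamma> s) = r s)" if t: "t \<in> {a..b}" for t
  proof -
    obtain T where T: "time_oriented T" "MT T \<in> CoG" "fst (finv T (lift (Y t))) \<noteq> 0"
      using chart_at_time_oriented[OF lift_Nc[OF Y[OF t]]] .
    have TG: "T \<in> Gam" using T by (simp add: time_oriented_def)
    define S where "S = finv T"
    have SG: "S \<in> Gam" and SO: "time_oriented S" using Gam_inv(1)[OF TG] time_oriented_inv[OF T(1)] by (simp_all add: S_def)
    define G where "G s = S (lift (Y s))" for s
    define r where "r s = (1 / fst (G s)) *\<^sub>R fst (snd (G s))" for s
    have bS: "bounded_linear S" using Gam_linear[OF SG] by (simp add: linear_conv_bounded_linear)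
    have bd: "bounded_linear (dlift :: real \<times> 'n V \<times> real \<Rightarrow> _)" using linear_dlift by (simp add: linear_conv_bounded_linear)
    define Z where "Z = S (dlift (Yd t))"
    have dL: "((\<lambda>s. lift (Y s)) has_vector_derivative dlift (Yd t)) (at t)"
      using has_vector_derivative_add[OF has_vector_derivative_const bounded_linear.has_vector_derivative[OF bd dY[OF t]]]
      by (simp add: lift_dlift)
    have dG: "(G has_vector_derivative Z) (at t)"
      unfolding G_def Z_def by (rule bounded_linear.has_vector_derivative[OF bS dL])
    define l where "l = fst (G t)"
    have l: "l \<noteq> 0" using T(3) by (simp add: l_def G_def S_def)
    have d1: "((\<lambda>s. fst (G s)) has_vector_derivative fst Z) (at t)"
      by (rule bounded_linear.has_vector_derivative[OF bounded_linear_fst dG])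
    have d2: "((\<lambda>s. fst (snd (G s))) has_vector_derivative fst (snd Z)) (at t)"
      by (rule bounded_linear.has_vector_derivative[OF bounded_linear_fst_comp[OF bounded_linear_snd] dG])
    have d1': "((\<lambda>s. fst (G s)) has_field_derivative fst Z) (at t)"
      using d1 by (simp add: has_real_derivative_iff_has_vector_derivative)
    have "((\<lambda>s. 1 / fst (G s)) has_field_derivative - (fst Z / l\<^sup>2)) (at t)"
      using DERIV_inverse_fun[OF d1'] l by (simp add: field_simps power2_eq_square l_def)
    from has_vector_derivative_scaleR[OF this d2]
    have dr: "(r has_vector_derivative (1 / l) *\<^sub>R fst (snd Z) - (fst Z / l\<^sup>2) *\<^sub>R fst (snd (G t))) (at t)"
      by (simp add: r_def[abs_def] l_def)
    define w where "w = (1 / l) *\<^sub>R fst (snd Z) - (fst Z / l\<^sup>2) *\<^sub>R fst (snd (G t))"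
    have vr: "vcchart (MT T) (\<gamma> s) = r s" if s: "s \<in> {a..b}" "fst (G s) \<noteq> 0" for s
      unfolding \<gamma>_def using pt_in_chart[OF TG lift_Nc[OF Y[OF s(1)]]] s(2)
      by (simp add: G_def S_def r_def vcchart_vcpar[OF TG])
    have contG: "isCont (\<lambda>s. fst (G s)) t" using has_vector_derivative_continuous[OF d1] .
    have "\<forall>\<^sub>F s in nhds t. fst (G s) \<noteq> 0"
      using contG l unfolding l_def by (metis isCont_def tendsto_at_iff_tendsto_nhds tendsto_imp_eventually_ne)
    then have ev: "\<forall>\<^sub>F s in nhds t. s \<in> {a..b} \<longrightarrow> vcchart (MT T) (\<gamma> s) = r s"
      by (rule eventually_mono) (use vr in blast)
    have ran: "\<gamma> t \<in> range (vcpar (MT T))"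
      unfolding \<gamma>_def using pt_in_chart[OF TG lift_Nc[OF Y[OF t]] T(3)] by simp
    have wcone: "w \<in> uminus ` closure Omega"
    proof -
      obtain c where c: "0 < c" "\<And>X. hq (S X) = c * hq X" using SO unfolding time_oriented_def by blast
      have Yt: "fst (snd (Y t)) \<in> E0" using Y[OF t] by (simp add: de_sitter_def)
      have L0: "hq (lift (Y t)) = 0" using lift_Nc[OF Y[OF t]] by (simp add: Nc_def)
      have LD: "hb (lift (Y t)) (dlift (Yd t)) = 0" using hb_lift[OF Yt E[OF t]] orth[OF t] by simp
      have f: "0 \<le> hq (dlift (Yd t))" "om (lift (Y t)) (dlift (Yd t)) \<le> 0"
        using future_cone_iff_om[OF Yt E[OF t]] fc[OF t] by auto
      have p1: "semidefinite_pair (lift (Y t)) (dlift (Yd t))" by (rule semidefinite_pairI[OF L0 LD f(1)])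
      have G0: "hq (G t) = 0" by (simp add: G_def c(2) L0)
      have GZ: "hb (G t) Z = 0" unfolding G_def Z_def Gam_hb[OF SG c(2)] by (simp add: LD)
      have Gk: "G t = l *\<^sub>R kap (r t)" using null_eq_kap[OF G0] l by (simp add: l_def r_def)
      \<comment> \<open>\<open>K\<close> is the velocity of the curve normalised to first coordinate
        1, so its first entry is 0 and its middle entry is \<open>w\<close>.\<close>
      define K where "K = (1 / l) *\<^sub>R Z + (- (fst Z / l\<^sup>2)) *\<^sub>R G t"
      have Kw: "K = (0, w, snd (snd K))"
        using l by (simp add: K_def w_def prod_eq_iff l_def power2_eq_square)
      have hK: "hq K = (1 / l)\<^sup>2 * (c * hq (dlift (Yd t)))"
        unfolding K_def hq_add using GZ hb_commute[of Z "G t"] by (simp add: hb_simps G0) (simp add: Z_def c(2))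
      then have hK0: "0 \<le> hq K" using c(1) f(1) by simp
      have "hq K = jdet w" by (subst Kw) simp
      then have w1: "0 \<le> jdet w" using hK0 by simp
      have kr: "kap (r t) = (1 / l) *\<^sub>R G t" using Gk l by simp
      have pK: "semidefinite_pair (kap (r t)) K"
        by (rule semidefinite_pairI) (use hK0 GZ in \<open>simp_all add: kr K_def hb_simps hb_self G0\<close>)
      have "om (kap (r t)) K = (1 / l)\<^sup>2 * om (G t) Z"
        unfolding kr K_def by (simp add: om_simps om_diff power2_eq_square)
      moreover have "sgn (om (G t) Z) = sgn (om (lift (Y t)) (dlift (Yd t)))"
        unfolding G_def Z_def by (rule om_sgn[OF SO p1])
      then have "om (G t) Z \<le> 0" using f(2) by (auto simp: sgn_if split: if_splits)
      ultimately have "om (kap (r t)) K \<le> 0" by (simp add: mult_nonneg_nonpos)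
      moreover have "sgn (om (kap (r t)) K) = sgn (w $ 0)"
        using om_chart[of "r t" w "snd (snd K)"] pK Kw by simp
      ultimately have w2: "w $ 0 \<le> 0" by (auto simp: sgn_if split: if_splits)
      have "- w \<in> closure Omega" using w1 w2 by (simp add: omega_closure)
      then show ?thesis by (metis image_eqI minus_minus)
    qed
    show ?thesis
      using T(1,2) ran dr[folded w_def] vr[OF t l[unfolded l_def]] wcone ev
      by (intro exI[of _ T] exI[of _ r] exI[of _ w] conjI)
  qed
  have "causal_curve \<gamma> a b"
    unfolding causal_curve_def
  proof (intro conjI ballI)
    show "a < b" by (rule ab)
    show "\<gamma> ` {a..b} \<subseteq> MM" using Y by (auto simp: \<gamma>_def MM_eq[OF os])
    show "continuous_map (top_of_set {a..b}) Vc_top \<gamma>"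
      unfolding continuous_map_def
    proof (intro conjI allI impI)
      show "\<gamma> \<in> topspace (top_of_set {a..b}) \<rightarrow> topspace Vc_top"
      proof (rule funcsetI)
        fix s assume "s \<in> topspace (top_of_set {a..b})"
        then have "lift (Y s) \<in> Nc" using lift_Nc[OF Y] by simp
        then show "\<gamma> s \<in> topspace Vc_top" unfolding \<gamma>_def topspace_Vc Vc_Nc by (rule imageI)
      qed
      fix U :: "'n vcpoint set" assume "openin Vc_top U"
      then obtain B where B: "open B" "\<And>X. X \<in> Nc \<Longrightarrow> X \<in> B \<longleftrightarrow> pt X \<in> U" by (rule openin_pt_vimage) blast
      have "{s \<in> topspace (top_of_set {a..b}). \<gamma> s \<in> U} = {a..b} \<inter> (\<lambda>s. lift (Y s)) -` B"
      proof -
        have "\<gamma> s \<in> U \<longleftrightarrow> lift (Y s) \<in> B" if "s \<in> {a..b}" for s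
          unfolding \<gamma>_def using B(2)[OF lift_Nc[OF Y[OF that]]] by simp
        then show ?thesis by auto
      qed
      then show "openin (top_of_set {a..b}) {s \<in> topspace (top_of_set {a..b}). \<gamma> s \<in> U}"
        using continuous_openin_preimage_gen[OF contL B(1)] by simp
    qed
    show "piecewise_diff_curve \<gamma> a b"
      unfolding piecewise_diff_curve_def
    proof (intro exI[of _ "{}"] conjI allI impI ballI)
      fix c d t assume cd: "a \<le> c \<and> c < d \<and> d \<le> b \<and> {} \<inter> {c<..<d} = {}" and t: "t \<in> {c..d}"
      then have tI: "t \<in> {a..b}" and sub: "{c..d} \<subseteq> {a..b}" by auto
      obtain T r w where T: "MT T \<in> CoG" "\<gamma> t \<in> range (vcpar (MT T))" "(r has_vector_derivative w) (at t)"
        "vcchart (MT T) (\<gamma> t) = r t" "\<forall>\<^sub>F s in nhds t. s \<in> {a..b} \<longrightarrow> vcchart (MT T) (\<gamma> s) = r s"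
        using chart[OF tI] by blast
      have "\<forall>\<^sub>F s in nhds t. s \<in> {c..d} \<longrightarrow> r s = vcchart (MT T) (\<gamma> s)"
        using T(5) by (rule eventually_mono) (use sub in auto)
      moreover have "(r has_vector_derivative w) (at t within {c..d})" using T(3) by (rule has_vector_derivative_at_within)
      ultimately have "((\<lambda>s. vcchart (MT T) (\<gamma> s)) has_vector_derivative w) (at t within {c..d})"
        using has_vector_derivative_cong_ev[of "{c..d}" r "\<lambda>s. vcchart (MT T) (\<gamma> s)" t] T(4) by simp
      then have "(\<lambda>s. vcchart (MT T) (\<gamma> s)) differentiable (at t within {c..d})" by (rule differentiableI_vector)
      then show "vc_differentiable \<gamma> t {c..d}"
        unfolding vc_differentiable_def using T(1,2) CoG_subset_Co by blast
    qed simp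
    fix t assume t: "t \<in> {a<..<b}"
    then have tI: "t \<in> {a..b}" by simp
    obtain T r w where T: "MT T \<in> CoG" "\<gamma> t \<in> range (vcpar (MT T))" "(r has_vector_derivative w) (at t)"
      "vcchart (MT T) (\<gamma> t) = r t" "w \<in> uminus ` closure Omega"
      "\<forall>\<^sub>F s in nhds t. s \<in> {a..b} \<longrightarrow> vcchart (MT T) (\<gamma> s) = r s"
      using chart[OF tI] by blast
    have "\<forall>\<^sub>F s in nhds t. s \<in> {a<..<b}" using t by (intro eventually_nhds_in_open) auto
    with T(6) have "\<forall>\<^sub>F s in nhds t. s \<in> {t<..} \<longrightarrow> r s = vcchart (MT T) (\<gamma> s)"
      by eventually_elim auto
    moreover have "(r has_vector_derivative w) (at_right t)" using T(3) by (rule has_vector_derivative_at_within)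
    ultimately have "((\<lambda>s. vcchart (MT T) (\<gamma> s)) has_vector_derivative w) (at_right t)"
      using has_vector_derivative_cong_ev[of "{t<..}" r "\<lambda>s. vcchart (MT T) (\<gamma> s)" t] T(4) by simp
    then show "right_deriv_in_cone \<gamma> t" unfolding right_deriv_in_cone_def using T by blast
  qed
  then show ?thesis unfolding causal_le_def \<gamma>_def by blast
qed

lemma future_le_imp_causal:
  fixes X Z :: "real \<times> 'n::{finite,zero} V \<times> real"
  assumes os: "orth_space (E0 :: ('n V) set)" and X: "X \<in> de_sitter E0" and Z: "Z \<in> de_sitter E0" and le: "future_le X Z"
  shows "causal_le (hp X) (hp Z)"
proof -
  define D where "D = Z - X"
  have D: "D \<in> future_cone" using le by (simp add: future_le_def D_def)
  have EX: "fst (snd X) \<in> E0" "fst (snd Z) \<in> E0" using X Z by (auto simp: de_sitter_def)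
  have ED: "fst (snd D) \<in> E0" using EX by (simp add: subspace_diff[OF subspace_E0] D_def)
  have XX: "lf X X = - 2" "lf Z Z = - 2" using X Z by (simp_all add: de_sitter_norm)
  have sy: "lf Z X = lf X Z" by (rule lf_commute)
  have DDe: "lf D D = - 4 - 2 * lf X Z" using lf_de_sitter_diff[OF X Z] by (simp add: D_def)
  show ?thesis
  proof (cases "lf D D = 0")
    case True
    have XD: "lf X D = 0" using DDe True by (simp add: D_def lf_simps XX)
    \<comment> \<open>The straight segment runs along a ruling line of the quadric; for
      \<open>X = Z\<close> it is the constant curve.\<close>
    have "causal_le (hp (X + 0 *\<^sub>R D)) (hp (X + 1 *\<^sub>R D))"
    proof (rule smooth_causal[OF os, of 0 1 "\<lambda>t. X + t *\<^sub>R D" "\<lambda>_. D"])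
      show "X + t *\<^sub>R D \<in> de_sitter E0" for t
        using EX ED
        by (simp add: subspace_add[OF subspace_E0] subspace_scale[OF subspace_E0] de_sitter_def lf_quad XX XD True)
      show "((\<lambda>t. X + t *\<^sub>R D) has_vector_derivative D) (at t)" for t
        by (auto intro!: derivative_eq_intros)
      show "lf (X + t *\<^sub>R D) D = 0" for t by (simp add: lf_simps XD True)
    qed (use D ED in auto)
    then show ?thesis by (simp add: D_def)
  next
    case False
    then have pos: "0 < lf D D" using lf_self_nonneg[OF D] by simp
    txt \<open>
      \<open>X\<close> and \<open>Z\<close> are joined by a branch of the hyperbola in which their plane meets de Sitter space. The null
      vectors \<open>N1\<close>, \<open>N2\<close> are its asymptotes.
    \<close>
    define b where "b = - lf X Z / 2"
    have XZ: "lf X Z = - 2 * b" by (simp add: b_def)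
    have b1: "1 < b" using pos DDe by (simp add: b_def)
    \<comment> \<open>\<open>m\<close> and \<open>n\<close> below are the roots of
      \<open>x * x - 2 * b * x + 1\<close>, the values of \<open>x\<close> for which
      \<open>Z - x *\<^sub>R X\<close> is null.\<close>
    define r where "r = sqrt (b\<^sup>2 - 1)"
    have b2: "1 < b\<^sup>2" using b1 by (simp add: one_less_power)
    have r0: "0 < r" "r\<^sup>2 = b\<^sup>2 - 1" using b2 by (auto simp: r_def)
    define m where "m = b + r"
    define n where "n = b - r"
    have m1: "1 < m" using b1 r0 by (simp add: m_def)
    have mn: "m * n = 1" using r0 by (simp add: m_def n_def power2_eq_square algebra_simps)
    then have n: "n = 1 / m" using m1 by (simp add: field_simps)
    have n1: "0 < n" "n < 1" using m1 by (auto simp: n)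
    have m2: "m * m = 2 * b * m - 1" and n2: "n * n = 2 * b * n - 1"
      using r0 by (auto simp: m_def n_def power2_eq_square algebra_simps)
    define N1 where "N1 = Z - n *\<^sub>R X"
    define N2 where "N2 = Z - m *\<^sub>R X"
    define d where "d = m - n"
    have d: "0 < d" using r0 by (simp add: d_def m_def n_def)
    have l11: "lf N1 N1 = 0"
      using n2 by (simp add: N1_def lf_simps XX XZ sy algebra_simps)
    have l22: "lf N2 N2 = 0"
      using m2 by (simp add: N2_def lf_simps XX XZ sy algebra_simps)
    have l12: "lf N1 N2 = d * d"
    proof -
      have "lf N1 N2 = - 2 + 2 * b * (m + n) - 2 * (m * n)"
        by (simp add: N1_def N2_def lf_simps XX XZ sy algebra_simps)
      also have "m + n = 2 * b" by (simp add: m_def n_def)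
      finally have "lf N1 N2 = 4 * (b\<^sup>2 - 1)" unfolding mn by (simp add: power2_eq_square)
      also have "\<dots> = d * d" unfolding r0(2)[symmetric] by (simp add: d_def m_def n_def power2_eq_square)
      finally show ?thesis .
    qed
    have l21: "lf N2 N1 = d * d" using l12 lf_commute[of N2 N1] by simp
    have De: "d *\<^sub>R D = (m - 1) *\<^sub>R N1 + (1 - n) *\<^sub>R N2"
    proof -
      have "(m - 1) *\<^sub>R N1 + (1 - n) *\<^sub>R N2 = (m - n) *\<^sub>R Z - ((m - 1) * n + (1 - n) * m) *\<^sub>R X"
        by (simp add: N1_def N2_def algebra_simps)
      also have "(m - 1) * n + (1 - n) * m = m - n" by (simp add: algebra_simps)
      finally show ?thesis by (simp add: D_def d_def algebra_simps)
    qed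
    have dD: "d *\<^sub>R D \<in> future_cone" using D d by (intro future_cone_scale) auto
    have "lf N1 (d *\<^sub>R D) = (1 - n) * (d * d)" unfolding De by (simp add: lf_simps(2,6) l11 l12)
    then have "0 < lf N1 (d *\<^sub>R D)" using n1 d by simp
    then have F1: "N1 \<in> future_cone" using future_cone_sign[OF _ _ dD] l11 by simp
    have "lf N2 (d *\<^sub>R D) = (m - 1) * (d * d)" unfolding De by (simp add: lf_simps(2,6) l22 l21)
    then have "0 < lf N2 (d *\<^sub>R D)" using m1 d by simp
    then have F2: "N2 \<in> future_cone" using future_cone_sign[OF _ _ dD] l22 by simp
    have EN: "fst (snd N1) \<in> E0" "fst (snd N2) \<in> E0"
      using EX by (simp_all add: subspace_diff[OF subspace_E0] subspace_scale[OF subspace_E0] N1_def N2_def)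
    \<comment> \<open>The hyperbola in light-cone coordinates, scaled so that \<open>Y 1 = X\<close>
      and \<open>Y m = Z\<close>; the latter rests on \<open>m * n = 1\<close>.\<close>
    define Y where "Y t = (1 / d) *\<^sub>R (t *\<^sub>R N1 - (1 / t) *\<^sub>R N2)" for t
    define Yd where "Yd t = (1 / d) *\<^sub>R (N1 + (1 / t\<^sup>2) *\<^sub>R N2)" for t
    have "causal_le (hp (Y 1)) (hp (Y m))"
    proof (rule smooth_causal[OF os m1, of Y Yd])
      fix t assume "t \<in> {1..m}"
      then have t: "0 < t" by simp
      have "d * d * lf (Y t) (Y t) = lf (t *\<^sub>R N1 - (1 / t) *\<^sub>R N2) (t *\<^sub>R N1 - (1 / t) *\<^sub>R N2)"
        unfolding Y_def lf_scale_left lf_scale_right using d by simp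
      also have "\<dots> = d * d * (- 2)" using t by (simp add: lf_simps l11 l22 l12 l21)
      finally have "lf (Y t) (Y t) = - 2" using d by (metis less_irrefl mult_cancel_left mult_pos_pos)
      moreover have "fst (snd (Y t)) \<in> E0"
        using EN by (simp add: subspace_diff[OF subspace_E0] subspace_scale[OF subspace_E0] Y_def)
      ultimately show "Y t \<in> de_sitter E0" by (simp add: de_sitter_def)
      have di: "((\<lambda>t. 1 / t) has_field_derivative - (1 / t\<^sup>2)) (at t)"
        using t by (auto intro!: derivative_eq_intros simp: power2_eq_square)
      have "((\<lambda>t. t *\<^sub>R N1 - (1 / t) *\<^sub>R N2) has_vector_derivative N1 - (- (1 / t\<^sup>2)) *\<^sub>R N2) (at t)"
        using has_vector_derivative_diff[OF has_vector_derivative_scaleR[OF DERIV_ident has_vector_derivative_const[of N1]]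
            has_vector_derivative_scaleR[OF di has_vector_derivative_const[of N2]]] by simp
      then have "((\<lambda>t. (1 / d) *\<^sub>R (t *\<^sub>R N1 - (1 / t) *\<^sub>R N2)) has_vector_derivative (1 / d) *\<^sub>R (N1 - (- (1 / t\<^sup>2)) *\<^sub>R N2)) (at t)"
        by (rule bounded_linear.has_vector_derivative[OF bounded_linear_scaleR_right])
      then show "(Y has_vector_derivative Yd t) (at t)" by (simp add: Y_def[abs_def] Yd_def)
      show "Yd t \<in> future_cone" unfolding Yd_def using F1 F2 d t by (intro future_cone_scale future_cone_add) auto
      show "fst (snd (Yd t)) \<in> E0"
        using EN by (simp add: subspace_add[OF subspace_E0] subspace_scale[OF subspace_E0] Yd_def)
      have "lf (Y t) (Yd t) = (1 / d) * ((1 / d) * lf (t *\<^sub>R N1 - (1 / t) *\<^sub>R N2) (N1 + (1 / t\<^sup>2) *\<^sub>R N2))"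
        unfolding Y_def Yd_def lf_scale_left lf_scale_right ..
      also have "lf (t *\<^sub>R N1 - (1 / t) *\<^sub>R N2) (N1 + (1 / t\<^sup>2) *\<^sub>R N2) = 0"
        using t by (simp add: lf_simps l11 l22 l12 l21 power2_eq_square)
      finally show "lf (Y t) (Yd t) = 0" by simp
    qed
    moreover have "Y 1 = X"
    proof -
      have "N1 - N2 = d *\<^sub>R X" by (simp add: N1_def N2_def d_def algebra_simps)
      then show ?thesis using d by (simp add: Y_def)
    qed
    moreover have "Y m = Z"
    proof -
      have "m *\<^sub>R N1 - n *\<^sub>R N2 = d *\<^sub>R Z"
        by (simp add: N1_def N2_def d_def algebra_simps mn)
      then show ?thesis using d by (simp add: Y_def n)
    qed
    ultimately show ?thesis by simp
  qed
qed

lemma causal_iff_future_le: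
  fixes X Z :: "real \<times> 'n::{finite,zero} V \<times> real"
  assumes "orth_space (E0 :: ('n V) set)" "X \<in> de_sitter E0" "Z \<in> de_sitter E0"
  shows "causal_le (hp X) (hp Z) \<longleftrightarrow> future_le X Z"
  using causal_imp_future_le[OF assms] future_le_imp_causal[OF assms] by blast

lemma future_hp:
  fixes X :: "real \<times> 'n::{finite,zero} V \<times> real"
  assumes os: "orth_space (E0 :: ('n V) set)" and X: "X \<in> de_sitter E0"
  shows "future (hp X) = hp ` {Y \<in> de_sitter E0. future_le X Y}"
  unfolding future_def MM_eq[OF os] using causal_iff_future_le[OF os X] by auto

section \<open>Extension of conal maps\<close>

lemma conal_de_sitter:
  fixes f :: "'n::{finite,zero} vcpoint \<Rightarrow> 'n vcpoint"
  assumes os: "orth_space (E0 :: ('n V) set)" and f: "conal f"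
  obtains F where "de_sitter_conal (E0 :: ('n V) set) F" "\<And>X. X \<in> de_sitter E0 \<Longrightarrow> f (hp X) = hp (F X)"
proof -
  define F where "F X = inv_into (de_sitter E0) hp (f (hp X))" for X
  have MM: "hp X \<in> MM" if "X \<in> de_sitter E0" for X :: "real \<times> 'n V \<times> real" using that by (auto simp: MM_eq[OF os])
  have F: "F X \<in> de_sitter E0" "f (hp X) = hp (F X)" if "X \<in> de_sitter E0" for X
  proof -
    have "f (hp X) \<in> hp ` de_sitter E0" using f MM[OF that] unfolding conal_def MM_eq[OF os] by blast
    then show "F X \<in> de_sitter E0" "f (hp X) = hp (F X)"
      unfolding F_def by (rule inv_into_into, rule f_inv_into_f[symmetric])
  qed
  interpret orth_space "E0 :: ('n V) set" by (rule os)
  have "de_sitter_conal (E0 :: ('n V) set) F"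
  proof unfold_locales
    show "F X \<in> de_sitter E0" if "X \<in> de_sitter E0" for X using F(1)[OF that] .
    show "inj_on F (de_sitter E0)"
    proof (rule inj_onI)
      fix X Y assume X: "X \<in> de_sitter E0" and Y: "Y \<in> de_sitter E0" and "F X = F Y"
      then have "f (hp X) = f (hp Y)" using F(2) by metis
      then have "hp X = hp Y" using f MM[OF X] MM[OF Y] unfolding conal_def by (metis inj_onD)
      then show "X = Y" using pt_lift_inj X Y by (metis inj_onD)
    qed
    show "F ` {Y \<in> de_sitter E0. future_le X Y} = {Y \<in> de_sitter E0. future_le (F X) Y}" if X: "X \<in> de_sitter E0" for X
    proof -
      have "hp ` (F ` {Y \<in> de_sitter E0. future_le X Y}) = f ` (hp ` {Y \<in> de_sitter E0. future_le X Y})"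
        unfolding image_image by (rule image_cong) (use F(2) in auto)
      also have "\<dots> = f ` future (hp X)" by (simp only: future_hp[OF os X])
      also have "\<dots> = future (f (hp X))" using f MM[OF X] unfolding conal_def by blast
      also have "\<dots> = hp ` {Y \<in> de_sitter E0. future_le (F X) Y}" by (simp only: F(2)[OF X] future_hp[OF os F(1)[OF X]])
      finally show ?thesis
        by (rule inj_on_image_eq_iff[THEN iffD1, OF pt_lift_inj, rotated 2]) (use F(1) in auto)
    qed
  qed
  then show thesis using that F(2) by blast
qed

text \<open>The time axis is stretched by the same factor \<open>c\<close> as the spatial
  hyperplane, which makes the extension conformal; positivity of \<open>c\<close> keeps
  \<open>Omega\<close>.\<close>

lemma similarity_extension:
  fixes g :: "'n::{finite,zero} V \<Rightarrow> 'n V"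
  assumes c: "0 < c" and gE: "\<And>x. x \<in> E0 \<Longrightarrow> g x \<in> E0"
    and add: "\<And>x y. x \<in> E0 \<Longrightarrow> y \<in> E0 \<Longrightarrow> g (x + y) = g x + g y"
    and scale: "\<And>x r. x \<in> E0 \<Longrightarrow> g (r *\<^sub>R x) = r *\<^sub>R g x"
    and nrm: "\<And>x. x \<in> E0 \<Longrightarrow> norm (g x) = c * norm x"
  defines "h \<equiv> \<lambda>v. (c * v $ 0) *\<^sub>R junit + g (prj v)"
  shows "h \<in> GL" "h ` Omega = Omega" "\<And>x. jdet (h x) = c\<^sup>2 * jdet x" "\<And>x. - alpha (h x) = h (- alpha x)"
proof -
  have gz: "g x $ 0 = 0" if "x \<in> E0" for x using gE[OF that] by (simp add: E0_def)
  have h0: "h v $ 0 = c * v $ 0" for v by (simp add: h_def gz)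
  have lin: "linear h"
    by (rule linearI) (simp_all add: h_def prj_linear add scale algebra_simps)
  show jd: "jdet (h x) = c\<^sup>2 * jdet x" for x
  proof -
    have "prj (h x) = g (prj x)" by (simp add: prj_def[of "h x"] h0) (simp add: h_def)
    moreover have "g (prj x) \<bullet> g (prj x) = c\<^sup>2 * (prj x \<bullet> prj x)"
      using nrm[of "prj x"] by (simp add: dot_square_norm power_mult_distrib)
    ultimately show ?thesis unfolding jdet_prj[of "h x"] jdet_prj[of x] h0
      by (simp add: power_mult_distrib algebra_simps)
  qed
  have "inj h"
  proof (rule injI)
    fix x y assume "h x = h y"
    then have "h (x - y) = 0" by (simp add: linear_diff[OF lin])
    then have z: "(x - y) $ 0 = 0" using h0[of "x - y"] c by simp
    then have "g (prj (x - y)) = 0" using \<open>h (x - y) = 0\<close> by (simp add: h_def)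
    then have "c * norm (prj (x - y)) = 0" using nrm[of "prj (x - y)"] by simp
    then have "prj (x - y) = 0" using c by simp
    then show "x = y" using z by (simp add: prj_def)
  qed
  moreover have "surj h" using linear_injective_imp_surjective[OF lin \<open>inj h\<close>] by simp
  ultimately show "h \<in> GL" using lin by (simp add: GL_def bij_def)
  show "h ` Omega = Omega"
  proof (intro equalityI subsetI)
    fix y :: "'n V" assume "y \<in> h ` Omega"
    then show "y \<in> Omega" using c by (auto simp: Omega_def jd h0)
  next
    fix y :: "'n V" assume y: "y \<in> Omega"
    obtain x where x: "y = h x" using \<open>surj h\<close> by (metis surjD)
    have "x \<in> Omega" using y c by (simp add: x Omega_def jd h0 zero_less_mult_iff)
    then show "y \<in> h ` Omega" using x by blast
  qed
  show "- alpha (h x) = h (- alpha x)" for x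
  proof -
    have "prj (- alpha x) = prj x" by (simp add: vec_eq_iff prj_def)
    moreover have "alpha (g (prj x)) = - g (prj x)" by (simp add: E0_jb gE)
    moreover have "alpha junit = (junit :: 'n V)" by (simp add: alpha_eq scaleR_2)
    ultimately show ?thesis by (simp add: h_def alpha_linear)
  qed
qed

lemma NA_Nm: "NA (Nm X) = Nm (NA X)"
  by (cases X) (simp add: alpha_linear)

text \<open>\<open>Nm \<circ> tau (- p)\<close> realises \<open>swp p\<close> on lifts up to a sign,
  which \<open>pt\<close> does not see.\<close>

lemma lift_swp: "fst (snd X) \<in> E0 \<Longrightarrow> p \<in> E0 \<Longrightarrow> Nm (tau (- p) (lift X)) = - lift (swp p X)"
proof -
  assume X: "fst (snd X) \<in> E0" and p: "p \<in> E0"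
  obtain s v u where Xe: "X = (s, v, u)" by (cases X)
  have "alpha junit = (junit :: 'a V)" by (simp add: alpha_eq scaleR_2)
  then show ?thesis using X p by (simp add: Xe swp_def jb_simps E0_jb alpha_linear)
qed

lemma conal_act:
  fixes f :: "'n::{finite,zero} vcpoint \<Rightarrow> 'n vcpoint"
  assumes os: "orth_space (E0 :: ('n V) set)" and f: "conal f"
  obtains T where "T \<in> CGam" "MT T \<in> neg_alpha_fixed CoG" "\<And>x. x \<in> MM \<Longrightarrow> f x = act (MT T) x"
proof -
  note goal = that
  obtain F where F: "de_sitter_conal (E0 :: ('n V) set) F" "\<And>X. X \<in> de_sitter E0 \<Longrightarrow> f (hp X) = hp (F X)"
    using conal_de_sitter[OF os f] by blast
  interpret de_sitter_conal "E0 :: ('n V) set" F by (rule F(1))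
  obtain c b g where c: "0 < c" and b: "b \<in> E0" and g: "\<And>x. x \<in> E0 \<Longrightarrow> g x \<in> E0"
    "\<And>x y. x \<in> E0 \<Longrightarrow> y \<in> E0 \<Longrightarrow> g (x + y) = g x + g y"
    "\<And>x r. x \<in> E0 \<Longrightarrow> g (r *\<^sub>R x) = r *\<^sub>R g x"
    "\<And>x. x \<in> E0 \<Longrightarrow> norm (g x) = c * norm x"
    and alt: "(\<forall>(s, v, u)\<in>de_sitter E0.
       F (s, v, u) = (1 / c) *\<^sub>R (s, g v + s *\<^sub>R b, c\<^sup>2 * u + 2 * (g v \<bullet> b) + s * (b \<bullet> b))) \<or>
     (\<exists>p\<in>E0. \<forall>(s, v, u)\<in>de_sitter E0.
       swp p (F (s, v, u)) = (1 / c) *\<^sub>R (s, g v + s *\<^sub>R b, c\<^sup>2 * u + 2 * (g v \<bullet> b) + s * (b \<bullet> b)))"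
    using classification by blast
  define h where "h v = (c * v $ 0) *\<^sub>R junit + g (prj v)" for v
  note hh = similarity_extension[OF c g, folded h_def]
  \<comment> \<open>Lift of the conformal map \<open>x \<mapsto> h x + b\<close>; on the slice it
    induces the formula of the classification up to the scalar \<open>c\<close>.\<close>
  define A where "A = tau b \<circ> Lg h (c\<^sup>2)"
  have LC: "Lg h (c\<^sup>2) \<in> CGam" by (rule Lg_CGam[OF hh(1,2,3)])
  have AC: "A \<in> CGam" unfolding A_def by (rule CGam_comp[OF tau_CGam LC])
  have AN: "NA (A X) = A (NA X)" for X
    unfolding A_def o_def NA_tau[OF b] by (cases X) (simp add: hh(4))
  have Al: "A (lift (s, v, u)) = c *\<^sub>R lift ((1 / c) *\<^sub>R (s, g v + s *\<^sub>R b, c\<^sup>2 * u + 2 * (g v \<bullet> b) + s * (b \<bullet> b)))"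
    if X: "(s, v, u) \<in> de_sitter E0" for s v u
  proof -
    have v: "v \<in> E0" using X by (simp add: de_sitter_def)
    have hv: "h (junit + v) = c *\<^sub>R junit + g v" using v by (simp add: h_def prj_linear prj_id E0_def)
    show ?thesis using c b v g(1)[OF v]
      by (simp add: A_def hv jb_simps E0_jb algebra_simps)
  qed
  \<comment> \<open>Common end of both cases: it remains to find \<open>T\<close> in
    \<open>CGam\<close> that commutes with \<open>NA\<close> and agrees with \<open>F\<close> on
    lifts up to a scalar, which will be \<open>c\<close> or \<open>- c\<close>.\<close>
  have fin: thesis if T: "T \<in> CGam" "\<And>X. NA (T X) = T (NA X)"
    and k: "k \<noteq> 0" "\<And>X. X \<in> de_sitter E0 \<Longrightarrow> T (lift X) = k *\<^sub>R lift (F X)" for T k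
  proof (rule goal[OF T(1)])
    have TG: "T \<in> Gam" "MT T \<in> CoG" using T by (auto simp: CGam_def)
    show "MT T \<in> neg_alpha_fixed CoG" by (rule neg_alpha_fixed_commute[OF TG T(2)])
    fix x :: "'n vcpoint" assume "x \<in> MM"
    then obtain X where X: "X \<in> de_sitter E0" "x = hp X" unfolding MM_eq[OF os] by blast
    have "act (MT T) x = pt (T (lift X))" unfolding X(2) by (rule act_pt[OF TG(1)])
    also have "\<dots> = hp (F X)" unfolding k(2)[OF X(1)] by (rule pt_scale[OF k(1)])
    finally show "f x = act (MT T) x" using F(2)[OF X(1)] X(2) by simp
  qed
  from alt show thesis
  proof
    assume a: "\<forall>(s, v, u)\<in>de_sitter E0.
       F (s, v, u) = (1 / c) *\<^sub>R (s, g v + s *\<^sub>R b, c\<^sup>2 * u + 2 * (g v \<bullet> b) + s * (b \<bullet> b))"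
    show thesis
    proof (rule fin[OF AC AN])
      show "c \<noteq> 0" using c by simp
      fix X :: "real \<times> 'n V \<times> real" assume X: "X \<in> de_sitter E0"
      obtain s v u where Xe: "X = (s, v, u)" by (cases X)
      have "F (s, v, u) = (1 / c) *\<^sub>R (s, g v + s *\<^sub>R b, c\<^sup>2 * u + 2 * (g v \<bullet> b) + s * (b \<bullet> b))"
        using a X unfolding Xe by blast
      then show "A (lift X) = c *\<^sub>R lift (F X)" using Al X unfolding Xe by metis
    qed
  next
    assume "\<exists>p\<in>E0. \<forall>(s, v, u)\<in>de_sitter E0.
       swp p (F (s, v, u)) = (1 / c) *\<^sub>R (s, g v + s *\<^sub>R b, c\<^sup>2 * u + 2 * (g v \<bullet> b) + s * (b \<bullet> b))"
    then obtain p where p: "p \<in> E0" and a: "\<forall>(s, v, u)\<in>de_sitter E0.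
       swp p (F (s, v, u)) = (1 / c) *\<^sub>R (s, g v + s *\<^sub>R b, c\<^sup>2 * u + 2 * (g v \<bullet> b) + s * (b \<bullet> b))" by blast
    \<comment> \<open>\<open>tau p \<circ> Nm\<close> undoes the lift
      \<open>Nm \<circ> tau (- p)\<close> of the inversion \<open>swp p\<close>.\<close>
    define T where "T = tau p \<circ> (Nm \<circ> A)"
    have TC: "T \<in> CGam" unfolding T_def by (intro CGam_comp tau_CGam Nm_CGam AC)
    have TN: "NA (T X) = T (NA X)" for X unfolding T_def o_def NA_tau[OF p] NA_Nm AN ..
    show thesis
    proof (rule fin[OF TC TN])
      show "- c \<noteq> 0" using c by simp
      fix X :: "real \<times> 'n V \<times> real" assume X: "X \<in> de_sitter E0"
      obtain s v u where Xe: "X = (s, v, u)" by (cases X)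
      have "swp p (F (s, v, u)) = (1 / c) *\<^sub>R (s, g v + s *\<^sub>R b, c\<^sup>2 * u + 2 * (g v \<bullet> b) + s * (b \<bullet> b))"
        using a X unfolding Xe by blast
      then have 1: "A (lift X) = c *\<^sub>R lift (swp p (F X))" using Al X unfolding Xe by metis
      have "fst (snd (F X)) \<in> E0" using maps[OF X] by (simp add: de_sitter_def)
      then have "lift (swp p (F X)) = (- 1) *\<^sub>R Nm (tau (- p) (lift (F X)))" using lift_swp[OF _ p] by simp
      then have "A (lift X) = (- c) *\<^sub>R Nm (tau (- p) (lift (F X)))" using 1 by simp
      then show "T (lift X) = (- c) *\<^sub>R lift (F X)"
        unfolding T_def o_def by (simp only: Gam_scale[OF Nm_Gam] Gam_scale[OF tau_Gam] Nm_Nm tau_tau) (simp add: tau_0)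
    qed
  qed
qed

section \<open>Birationality of the action\<close>

lemma Vc_zariski_open_Vc: "Vc_zariski_open (Vc :: 'n::{finite,zero} vcpoint set)"
  unfolding Vc_zariski_open_def
proof (intro conjI ballI)
  fix A :: "'n ratmap" assume "A \<in> carrier Co"
  then obtain T :: "real \<times> 'n V \<times> real \<Rightarrow> _" where T: "T \<in> Gam" "A = MT T" unfolding carrier_Co by blast
  have "vcpar A v \<in> Vc" for v
    unfolding T(2) vcpar_eq[OF T(1)] Vc_Nc by (rule imageI) (simp add: Nc_Gam[OF T(1)])
  then have "vcpar A -` Vc = UNIV" by blast
  then show "\<exists>Q. (\<forall>q\<in>Q. real_polynomial_function q) \<and> vcpar A -` Vc = {v. \<exists>q\<in>Q. q v \<noteq> 0}"
    by (intro exI[of _ "{\<lambda>_. 1}"]) (auto intro: real_polynomial_function.intros(2))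
qed simp

text \<open>Read in the chart of \<open>S\<close> at the source and of \<open>T \<circ> S\<close> at
  the target, the action is the identity in coordinates, hence \<open>P\<close> is the identity and
  \<open>q\<close> the constant 1.\<close>

lemma Vc_regular_act:
  fixes T :: "real \<times> 'n::{finite,zero} V \<times> real \<Rightarrow> _"
  assumes T: "T \<in> Gam"
  shows "Vc_regular_on Vc (act (MT T))"
  unfolding Vc_regular_on_def
proof
  fix p :: "'n vcpoint" assume "p \<in> Vc"
  then obtain X where X: "X \<in> Nc" "p = pt X" by (auto simp: Vc_Nc)
  obtain S where S: "S \<in> CGam" "fst (finv S X) \<noteq> 0" using chart_at[OF X(1)] .
  have SG: "S \<in> Gam" by (rule CGam_Gam[OF S(1)])
  obtain v where v: "p = vcpar (MT S) v" using pt_in_chart[OF SG X(1) S(2)] X(2) by blast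
  have TS: "T \<circ> S \<in> Gam" by (rule Gam_comp[OF T SG])
  have mem: "MT S \<in> carrier (Co :: 'n ratmap monoid)" "MT (T \<circ> S) \<in> carrier (Co :: 'n ratmap monoid)"
    using SG TS by (auto simp: carrier_Co)
  have e: "act (MT T) (vcpar (MT S) w) = vcpar (MT (T \<circ> S)) w" for w
    by (simp add: vcpar_eq[OF SG] vcpar_eq[OF TS] act_pt[OF T])
  show "\<exists>g\<in>carrier Co. \<exists>h\<in>carrier Co. \<exists>v P q.
        p = vcpar g v \<and> polynomial_function P \<and> real_polynomial_function q \<and> q v \<noteq> 0 \<and>
        (\<forall>w. q w \<noteq> 0 \<and> vcpar g w \<in> Vc \<longrightarrow> act (MT T) (vcpar g w) = vcpar h ((1 / q w) *\<^sub>R P w))"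
    using v e
    by (intro bexI[OF _ mem(1)] bexI[OF _ mem(2)] exI[of _ v] exI[of _ "\<lambda>x. x"] exI[of _ "\<lambda>_. 1"])
       (auto intro: real_polynomial_function.intros(2))
qed

text \<open>The action is biregular: \<open>U\<close>, \<open>U'\<close> and \<open>W\<close> are
  all of \<open>Vc\<close>, and the inverse is the action of \<open>MT (finv T)\<close>.\<close>

lemma Vc_birational_act:
  fixes T :: "real \<times> 'n::{finite,zero} V \<times> real \<Rightarrow> _"
  assumes T: "T \<in> Gam"
  shows "Vc_birational Vc (act (MT T))"
proof -
  have sub: "act (MT S) ` Vc \<subseteq> Vc" if "S \<in> Gam" for S :: "real \<times> 'n V \<times> real \<Rightarrow> _"
    using act_pt[OF that] Nc_Gam[OF that] by (auto simp: Vc_Nc)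
  note Ti = Gam_inv(1)[OF T]
  have inv: "act (MT (finv T)) (act (MT T) x) = x" "act (MT T) (act (MT (finv T)) x) = x" if "x \<in> Vc" for x
    using that by (auto simp: Vc_Nc act_pt[OF T] act_pt[OF Ti] Gam_inv(2,3)[OF T])
  have mem: "act (MT T) x \<in> Vc" "act (MT (finv T)) x \<in> Vc" if "x \<in> Vc" for x
    using sub[OF T] sub[OF Ti] that by blast+
  have im: "act (MT T) ` Vc = Vc" "act (MT (finv T)) ` Vc = Vc"
  proof -
    have "x \<in> act (MT T) ` Vc" "x \<in> act (MT (finv T)) ` Vc" if x: "x \<in> Vc" for x
      using imageI[OF mem(2)[OF x], of "act (MT T)"] imageI[OF mem(1)[OF x], of "act (MT (finv T))"]
      by (simp_all only: inv[OF x])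
    then show "act (MT T) ` Vc = Vc" "act (MT (finv T)) ` Vc = Vc" using sub[OF T] sub[OF Ti] by blast+
  qed
  have "emb 0 \<in> (Vc :: 'n vcpoint set)" unfolding emb_eq Vc_Nc by (rule imageI) simp
  then have ne: "(Vc :: 'n vcpoint set) \<noteq> {}" by blast
  show ?thesis unfolding Vc_birational_def
    by (intro conjI ballI bexI exI[of _ "act (MT (finv T))"] exI[of _ Vc] Vc_zariski_open_Vc Vc_regular_act T Ti im ne inv sub order_refl)
qed

theorem theorem12:
  fixes f :: "'n::{finite,zero} vcpoint \<Rightarrow> 'n vcpoint"
  assumes "CARD('n) \<ge> 3"
    and "conal f"
  shows "(\<exists>g\<in>neg_alpha_fixed CoG. \<forall>x\<in>MM. f x = act g x) \<and>
         (\<exists>U F. Vc_birational U F \<and> MM \<subseteq> U \<and> (\<forall>x\<in>MM. F x = f x))"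
proof -
  have os: "orth_space (E0 :: ('n V) set)" by (rule E0_orth_space[OF assms(1)])
  obtain T where T: "T \<in> CGam" "MT T \<in> neg_alpha_fixed CoG" "\<And>x. x \<in> MM \<Longrightarrow> f x = act (MT T) x"
    using conal_act[OF os assms(2)] by blast
  have "MM \<subseteq> hp ` (de_sitter E0 :: (real \<times> 'n V \<times> real) set)" by (rule MM_subset)
  also have "\<dots> \<subseteq> Vc" unfolding Vc_Nc by (intro image_subsetI imageI lift_Nc)
  finally have "MM \<subseteq> (Vc :: 'n vcpoint set)" .
  moreover have "\<forall>x\<in>MM. f x = act (MT T) x" "\<forall>x\<in>MM. act (MT T) x = f x" using T(3) by simp_all
  ultimately show ?thesis
    by (intro conjI bexI[OF _ T(2)] exI[of _ Vc] exI[of _ "act (MT T)"] Vc_birational_act[OF CGam_Gam[OF T(1)]])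
qed

end
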